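(* Let $\Omega\subset\mathbb{R}^2$ be an open domain, and let $\alpha<\beta$ and $a<b$ be finite real constants. Assume: (i) $k,l:\mathbb{R}^2\to\mathbb{R}$ belong to $L^\infty(\mathbb{R}^2)\cap BV(\mathbb{R}^2)$ with $\alpha\le k,l\le\beta$ a.e. in $\mathbb{R}^2$; (ii) $f,g:[\alpha,\beta]\times[a,b]\to\mathbb{R}$ are such that $u\mapsto f(\kappa,u)$ and $u\mapsto g(\lambda,u)$ belong to $C^2[a,b]$ for all $\kappa,\lambda\in[\alpha,\beta]$, and $\kappa\mapsto f(\kappa,u)$ and $\lambda\mapsto g(\lambda,u)$ belong to $C^1[\alpha,\beta]$ for all $u\in[a,b]$; (iii) the pair $(f,g)$ satisfies the nonlinearity assumption: either for all $\xi=(\xi_1,\xi_2)\in\mathbb{R}^2$ with $|\xi|=1$ and all $\kappa,\lambda\in[\alpha,\beta]$ the function $\xi_1f(\kappa,\cdot)+\xi_2g(\lambda,\cdot)$ is not affine on any nontrivial subinterval of $[a,b]$; or (the other version) for all such $\xi,\kappa,\lambda$ the set $\{u\in[a,b]:\ \xi_1f_u(\kappa,u)+\xi_2g_u(\lambda,u)=0\}$ has Lebesgue measure zero; (iv) $f(\kappa,a)=f(\kappa,b)=g(\lambda,a)=g(\lambda,b)=0$ for all $\kappa,\lambda\in[\alpha,\beta]$. Let $\{v^\rho\}_{\rho>0}$ be a sequence of measurable functions on $\Omega$ such that: (1) $a\le v^\rho(x,y)\le b$ for a.e. $(x,y)\in\Omega$, for every $\rho$; (2) with $F,G,H$ defined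 by $F_u(\kappa,u)=(f_u(\kappa,u))^2$, $G_u(\lambda,u)=(g_u(\lambda,u))^2$, $H_u(\kappa,\lambda,u)=f_u(\kappa,u)g_u(\lambda,u)$, the two sequences of distributions $$\Bigl\{F(k(x,y),v^\rho)_x+H(k(x,y),l(x,y),v^\rho)_y\Bigr\}_{\rho>0},\qquad \Bigl\{H(k(x,y),l(x,y),v^\rho)_x+G(l(x,y),v^\rho)_y\Bigr\}_{\rho>0}$$ belong to a compact subset of $W^{-1,2}_{\mathrm{loc}}(\Omega)$. Then there exists a subsequence of $\{v^\rho\}_{\rho>0}$ that converges a.e. in $\Omega$ to a function $v\in L^\infty(\Omega)$, and $a\le v(x,y)\le b$ for a.e. $(x,y)\in\Omega$.
   Context: The parameter $\rho>0$ takes its values in a sequence tending to zero. Subscript $u$ denotes the partial derivative with respect to the last variable $u$; the primitives are normalized to vanish at $u=a$, e.g. $F(\kappa,u)=\int_a^u(f_u(\kappa,\xi))^2\,d\xi$, and similarly for $G$ and $H$. Derivatives $(\cdot)_x,(\cdot)_y$ in the two sequences are distributional derivatives of the composed functions. "Belongs to a compact subset of $W^{-1,2}_{\mathrm{loc}}(\Omega)$" means that for every bounded open $\Omega'$ compactly contained in $\Omega$ the restrictions to $\Omega'$ form a relatively compact subset of $W^{-1,2}(\Omega')$, the dual of $W^{1,2}_0(\Omega')$.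
   Formalization: Added assumption: F(k(x,y),b) and G(l(x,y),b) are locally integrable on Ω. Separate regularity in (ii) alone allows unbounded f_u, g_u, for which the distributions in (2) need not be defined; it is automatic when f_u and g_u are bounded. *)

theory Defs
  imports "HOL-Analysis.Analysis"
begin

text \<open>Functions on a closed interval are total functions of which only the restriction to the
  interval matters; derivatives at the end points are one-sided.\<close>

definition deriv_Icc :: "real \<Rightarrow> real \<Rightarrow> (real \<Rightarrow> real) \<Rightarrow> real \<Rightarrow> real"
  where "deriv_Icc a b h u = vector_derivative h (at u within {a..b})"

primrec Ck_Icc :: "nat \<Rightarrow> real \<Rightarrow> real \<Rightarrow> (real \<Rightarrow> real) \<Rightarrow> bool"
  where
    "Ck_Icc 0 a b h \<longleftrightarrow> continuous_on {a..b} h"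
  | "Ck_Icc (Suc n) a b h \<longleftrightarrow> h differentiable_on {a..b} \<and> Ck_Icc n a b (deriv_Icc a b h)"

text \<open>The primitives \<open>F\<close>, \<open>G\<close> and \<open>H\<close> of \<open>f\<^sub>u\<^sup>2\<close>, \<open>g\<^sub>u\<^sup>2\<close> and \<open>f\<^sub>u g\<^sub>u\<close>, normalized to vanish at
  \<open>u = a\<close>; \<open>F\<close> and \<open>G\<close> are both instances of \<open>prim_sq\<close>.\<close>

definition prim_sq :: "real \<Rightarrow> real \<Rightarrow> (real \<Rightarrow> real \<Rightarrow> real) \<Rightarrow> real \<Rightarrow> real \<Rightarrow> real"
  where "prim_sq a b f \<kappa> u = integral {a..u} (\<lambda>s. (deriv_Icc a b (f \<kappa>) s)\<^sup>2)"

definition prim_mix ::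
    "real \<Rightarrow> real \<Rightarrow> (real \<Rightarrow> real \<Rightarrow> real) \<Rightarrow> (real \<Rightarrow> real \<Rightarrow> real) \<Rightarrow> real \<Rightarrow> real \<Rightarrow> real \<Rightarrow> real"
  where "prim_mix a b f g \<kappa> \<mu> u =
    integral {a..u} (\<lambda>s. deriv_Icc a b (f \<kappa>) s * deriv_Icc a b (g \<mu>) s)"

definition nowhere_affine_pair ::
    "real \<Rightarrow> real \<Rightarrow> real \<Rightarrow> real \<Rightarrow> (real \<Rightarrow> real \<Rightarrow> real) \<Rightarrow> (real \<Rightarrow> real \<Rightarrow> real) \<Rightarrow> bool"
  where "nowhere_affine_pair \<alpha> \<beta> a b f g \<longleftrightarrow>
    (\<forall>\<xi>::real \<times> real. norm \<xi> = 1 \<longrightarrow> (\<forall>\<kappa>\<in>{\<alpha>..\<beta>}. \<forall>\<mu>\<in>{\<alpha>..\<beta>}.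
      \<not> (\<exists>c d. a \<le> c \<and> c < d \<and> d \<le> b \<and>
           (\<exists>m q. \<forall>u\<in>{c..d}. fst \<xi> * f \<kappa> u + snd \<xi> * g \<mu> u = m * u + q))))"

definition null_critical_pair ::
    "real \<Rightarrow> real \<Rightarrow> real \<Rightarrow> real \<Rightarrow> (real \<Rightarrow> real \<Rightarrow> real) \<Rightarrow> (real \<Rightarrow> real \<Rightarrow> real) \<Rightarrow> bool"
  where "null_critical_pair \<alpha> \<beta> a b f g \<longleftrightarrow>
    (\<forall>\<xi>::real \<times> real. norm \<xi> = 1 \<longrightarrow> (\<forall>\<kappa>\<in>{\<alpha>..\<beta>}. \<forall>\<mu>\<in>{\<alpha>..\<beta>}.
      {u \<in> {a..b}. fst \<xi> * deriv_Icc a b (f \<kappa>) u + snd \<xi> * deriv_Icc a b (g \<mu>) u = 0}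
        \<in> null_sets lebesgue))"


definition Linfty :: "'a measure \<Rightarrow> ('a \<Rightarrow> real) set"
  where "Linfty M = {h \<in> borel_measurable M. \<exists>C. AE x in M. \<bar>h x\<bar> \<le> C}"

definition loc_integrable :: "(real \<times> real) set \<Rightarrow> (real \<times> real \<Rightarrow> real) \<Rightarrow> bool"
  where "loc_integrable U h \<longleftrightarrow> (\<forall>K. compact K \<longrightarrow> K \<subseteq> U \<longrightarrow> set_integrable lebesgue K h)"

definition partial :: "real \<times> real \<Rightarrow> (real \<times> real \<Rightarrow> real) \<Rightarrow> real \<times> real \<Rightarrow> real"
  where "partial e \<phi> p = frechet_derivative \<phi> (at p) e"

abbreviation partial_x :: "(real \<times> real \<Rightarrow> real) \<Rightarrow> real \<times> real \<Rightarrow> real"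
  where "partial_x \<equiv> partial (1, 0)"

abbreviation partial_y :: "(real \<times> real \<Rightarrow> real) \<Rightarrow> real \<times> real \<Rightarrow> real"
  where "partial_y \<equiv> partial (0, 1)"

primrec Ck_plane :: "nat \<Rightarrow> (real \<times> real \<Rightarrow> real) \<Rightarrow> bool"
  where
    "Ck_plane 0 \<phi> \<longleftrightarrow> continuous_on UNIV \<phi>"
  | "Ck_plane (Suc n) \<phi> \<longleftrightarrow>
      \<phi> differentiable_on UNIV \<and> Ck_plane n (partial_x \<phi>) \<and> Ck_plane n (partial_y \<phi>)"

definition compact_support_in :: "(real \<times> real) set \<Rightarrow> (real \<times> real \<Rightarrow> real) \<Rightarrow> bool"
  where "compact_support_in U \<phi> \<longleftrightarrow>
    compact (closure {p. \<phi> p \<noteq> 0}) \<and> closure {p. \<phi> p \<noteq> 0} \<subseteq> U"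

definition test_functions :: "(real \<times> real) set \<Rightarrow> (real \<times> real \<Rightarrow> real) set"
  where "test_functions U = {\<phi>. (\<forall>n. Ck_plane n \<phi>) \<and> compact_support_in U \<phi>}"

text \<open>\<open>BV\<close> on the plane is understood as finiteness of the total variation of the distributional
  gradient.  Only local, not global, integrability is required: a globally integrable function
  cannot satisfy \<open>\<alpha> \<le> k \<le> \<beta>\<close> unless \<open>\<alpha> \<le> 0 \<le> \<beta>\<close>.\<close>

definition BV_plane :: "(real \<times> real \<Rightarrow> real) set"
  where "BV_plane = {h. loc_integrable UNIV h \<and>
    (\<exists>C. \<forall>\<phi> \<psi>. Ck_plane 1 \<phi> \<and> compact_support_in UNIV \<phi> \<and>
                Ck_plane 1 \<psi> \<and> compact_support_in UNIV \<psi> \<and>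
                (\<forall>p. norm (\<phi> p, \<psi> p) \<le> 1) \<longrightarrow>
        (LINT p|lebesgue. h p * (partial_x \<phi> p + partial_y \<psi> p)) \<le> C)}"


text \<open>Distributions are functionals on test functions; \<open>distr_div U P Q\<close> is \<open>P\<^sub>x + Q\<^sub>y\<close> on \<open>U\<close>.
  It is meaningful for locally integrable \<open>P\<close> and \<open>Q\<close>.\<close>

definition distr_partial ::
    "(real \<times> real) set \<Rightarrow> real \<times> real \<Rightarrow> (real \<times> real \<Rightarrow> real) \<Rightarrow> (real \<times> real \<Rightarrow> real) \<Rightarrow> real"
  where "distr_partial U e h \<phi> = - (LINT p|lebesgue_on U. h p * partial e \<phi> p)"

definition distr_div ::
    "(real \<times> real) set \<Rightarrow> (real \<times> real \<Rightarrow> real) \<Rightarrow> (real \<times> real \<Rightarrow> real)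
      \<Rightarrow> (real \<times> real \<Rightarrow> real) \<Rightarrow> real"
  where "distr_div U P Q \<phi> = distr_partial U (1, 0) P \<phi> + distr_partial U (0, 1) Q \<phi>"

text \<open>Elements of \<open>L\<^sup>2\<close>, \<open>W\<^sup>1\<^sup>,\<^sup>2\<close> and its subspace are functions, not classes modulo null sets.\<close>

definition L2_on :: "(real \<times> real) set \<Rightarrow> (real \<times> real \<Rightarrow> real) set"
  where "L2_on U =
    {h \<in> borel_measurable (lebesgue_on U). integrable (lebesgue_on U) (\<lambda>p. (h p)\<^sup>2)}"

definition is_weak_partial ::
    "(real \<times> real) set \<Rightarrow> real \<times> real \<Rightarrow> (real \<times> real \<Rightarrow> real) \<Rightarrow> (real \<times> real \<Rightarrow> real) \<Rightarrow> bool"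
  where "is_weak_partial U e h w \<longleftrightarrow>
    (\<forall>\<phi>\<in>test_functions U. distr_partial U e h \<phi> = (LINT p|lebesgue_on U. w p * \<phi> p))"

definition W12 :: "(real \<times> real) set \<Rightarrow> (real \<times> real \<Rightarrow> real) set"
  where "W12 U = {h \<in> L2_on U. (\<exists>w\<in>L2_on U. is_weak_partial U (1, 0) h w) \<and>
                               (\<exists>w\<in>L2_on U. is_weak_partial U (0, 1) h w)}"

text \<open>Weak derivatives are unique up to null sets, so the choice does not affect the norm below.\<close>

definition weak_partial ::
    "(real \<times> real) set \<Rightarrow> real \<times> real \<Rightarrow> (real \<times> real \<Rightarrow> real) \<Rightarrow> real \<times> real \<Rightarrow> real"
  where "weak_partial U e h = (SOME w. w \<in> L2_on U \<and> is_weak_partial U e h w)"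

definition W12_norm :: "(real \<times> real) set \<Rightarrow> (real \<times> real \<Rightarrow> real) \<Rightarrow> real"
  where "W12_norm U h = sqrt
    ((LINT p|lebesgue_on U. (h p)\<^sup>2) + (LINT p|lebesgue_on U. (weak_partial U (1, 0) h p)\<^sup>2)
      + (LINT p|lebesgue_on U. (weak_partial U (0, 1) h p)\<^sup>2))"

definition W12_0 :: "(real \<times> real) set \<Rightarrow> (real \<times> real \<Rightarrow> real) set"
  where "W12_0 U = {h \<in> W12 U. \<exists>\<phi>::nat \<Rightarrow> real \<times> real \<Rightarrow> real.
    (\<forall>n. \<phi> n \<in> test_functions U) \<and> (\<lambda>n. W12_norm U (\<lambda>p. \<phi> n p - h p)) \<longlonglongrightarrow> 0}"

text \<open>The dual of \<open>W12_0 U\<close> with its operator norm.  Functionals are made extensional so that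
  functionals that agree on \<open>W12_0 U\<close> are equal.  The bound forces them to respect equality
  almost everywhere.\<close>

definition W_minus12 :: "(real \<times> real) set \<Rightarrow> ((real \<times> real \<Rightarrow> real) \<Rightarrow> real) set"
  where "W_minus12 U = {L \<in> extensional (W12_0 U).
    (\<forall>h\<in>W12_0 U. \<forall>w\<in>W12_0 U. L (\<lambda>p. h p + w p) = L h + L w) \<and>
    (\<forall>c. \<forall>h\<in>W12_0 U. L (\<lambda>p. c * h p) = c * L h) \<and>
    (\<exists>C. \<forall>h\<in>W12_0 U. \<bar>L h\<bar> \<le> C * W12_norm U h)}"

text \<open>Outside \<open>W_minus12 U\<close> the distance is set to 0: \<open>Metric_space\<close> requires a distance
  that is nonnegative everywhere.\<close>

definition W_minus12_dist ::
    "(real \<times> real) set \<Rightarrow> ((real \<times> real \<Rightarrow> real) \<Rightarrow> real) \<Rightarrow> ((real \<times> real \<Rightarrow> real) \<Rightarrow> real) \<Rightarrow> real"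
  where "W_minus12_dist U L L' =
    (if L \<in> W_minus12 U \<and> L' \<in> W_minus12 U
     then Inf {C. 0 \<le> C \<and> (\<forall>h\<in>W12_0 U. \<bar>L h - L' h\<bar> \<le> C * W12_norm U h)} else 0)"

lemma W12_norm_nonneg: "0 \<le> W12_norm U h"
  unfolding W12_norm_def by simp

lemma W_minus12_dist_bound:
  assumes "L \<in> W_minus12 U" "L' \<in> W_minus12 U"
  shows "0 \<le> W_minus12_dist U L L'"
    and "\<And>h. h \<in> W12_0 U \<Longrightarrow> \<bar>L h - L' h\<bar> \<le> W_minus12_dist U L L' * W12_norm U h"
proof -
  let ?S = "{C. 0 \<le> C \<and> (\<forall>h\<in>W12_0 U. \<bar>L h - L' h\<bar> \<le> C * W12_norm U h)}"
  have d: "W_minus12_dist U L L' = Inf ?S"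
    using assms by (simp add: W_minus12_dist_def)
  obtain C C' where C: "\<forall>h\<in>W12_0 U. \<bar>L h\<bar> \<le> C * W12_norm U h"
      "\<forall>h\<in>W12_0 U. \<bar>L' h\<bar> \<le> C' * W12_norm U h"
    using assms unfolding W_minus12_def by blast
  have "\<bar>L h - L' h\<bar> \<le> (\<bar>C\<bar> + \<bar>C'\<bar>) * W12_norm U h" if "h \<in> W12_0 U" for h
  proof -
    have "C * W12_norm U h \<le> \<bar>C\<bar> * W12_norm U h" "C' * W12_norm U h \<le> \<bar>C'\<bar> * W12_norm U h"
      by (auto intro!: mult_right_mono W12_norm_nonneg)
    moreover have "\<bar>L h\<bar> \<le> C * W12_norm U h" "\<bar>L' h\<bar> \<le> C' * W12_norm U h"
      using C that by auto
    ultimately have "\<bar>L h - L' h\<bar> \<le> \<bar>C\<bar> * W12_norm U h + \<bar>C'\<bar> * W12_norm U h"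
      by linarith
    then show ?thesis by (simp add: distrib_right)
  qed
  then have "\<bar>C\<bar> + \<bar>C'\<bar> \<in> ?S" by auto
  then have ne: "?S \<noteq> {}" by blast
  show "0 \<le> W_minus12_dist U L L'"
    unfolding d using ne by (intro cInf_greatest) auto
  fix h assume h: "h \<in> W12_0 U"
  show "\<bar>L h - L' h\<bar> \<le> W_minus12_dist U L L' * W12_norm U h"
  proof (cases "W12_norm U h = 0")
    case True
    then show ?thesis using ne h by auto
  next
    case False
    then have pos: "0 < W12_norm U h" using W12_norm_nonneg[of U h] by simp
    have "\<bar>L h - L' h\<bar> / W12_norm U h \<le> Inf ?S"
      using ne h pos by (intro cInf_greatest) (auto simp: divide_le_eq)
    then show ?thesis unfolding d using pos by (simp add: divide_le_eq)
  qed
qed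

lemma W_minus12_dist_le:
  assumes "0 \<le> C" "\<And>h. h \<in> W12_0 U \<Longrightarrow> \<bar>L h - L' h\<bar> \<le> C * W12_norm U h"
  shows "W_minus12_dist U L L' \<le> C"
proof (cases "L \<in> W_minus12 U \<and> L' \<in> W_minus12 U")
  case True
  then show ?thesis
    unfolding W_minus12_dist_def using assms by (auto intro!: cInf_lower bdd_belowI[of _ 0])
next
  case False
  then show ?thesis unfolding W_minus12_dist_def using assms(1) by auto
qed

lemma Metric_space_W_minus12: "Metric_space (W_minus12 U) (W_minus12_dist U)"
proof
  fix L L' :: "(real \<times> real \<Rightarrow> real) \<Rightarrow> real"
  show "0 \<le> W_minus12_dist U L L'"
    by (cases "L \<in> W_minus12 U \<and> L' \<in> W_minus12 U")
       (use W_minus12_dist_bound(1) in blast, auto simp: W_minus12_dist_def)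
  show "W_minus12_dist U L L' = W_minus12_dist U L' L"
    unfolding W_minus12_dist_def by (simp add: abs_minus_commute conj_commute)
next
  fix L L' assume L: "L \<in> W_minus12 U" "L' \<in> W_minus12 U"
  show "(W_minus12_dist U L L' = 0) = (L = L')"
  proof
    assume 0: "W_minus12_dist U L L' = 0"
    show "L = L'"
    proof (rule extensionalityI[of _ "W12_0 U"])
      show "L \<in> extensional (W12_0 U)" "L' \<in> extensional (W12_0 U)"
        using L unfolding W_minus12_def by auto
      show "L h = L' h" if "h \<in> W12_0 U" for h
        using W_minus12_dist_bound(2)[OF L that] 0 by simp
    qed
  next
    assume "L = L'"
    then show "W_minus12_dist U L L' = 0"
      using W_minus12_dist_le[of 0 U L L'] W_minus12_dist_bound(1)[OF L] by simp
  qed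
next
  fix L1 L2 L3 assume L: "L1 \<in> W_minus12 U" "L2 \<in> W_minus12 U" "L3 \<in> W_minus12 U"
  show "W_minus12_dist U L1 L3 \<le> W_minus12_dist U L1 L2 + W_minus12_dist U L2 L3"
  proof (rule W_minus12_dist_le)
    show "0 \<le> W_minus12_dist U L1 L2 + W_minus12_dist U L2 L3"
      using W_minus12_dist_bound(1) L by (simp add: add_nonneg_nonneg)
    show "\<bar>L1 h - L3 h\<bar> \<le> (W_minus12_dist U L1 L2 + W_minus12_dist U L2 L3) * W12_norm U h"
      if "h \<in> W12_0 U" for h
      using W_minus12_dist_bound(2)[OF L(1,2) that] W_minus12_dist_bound(2)[OF L(2,3) that]
      by (simp add: distrib_right)
  qed
qed

definition W_minus12_topology :: "(real \<times> real) set \<Rightarrow> ((real \<times> real \<Rightarrow> real) \<Rightarrow> real) topology"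
  where "W_minus12_topology U = Metric_space.mtopology (W_minus12 U) (W_minus12_dist U)"

text \<open>A distribution belongs to \<open>W_minus12 U\<close> if its restriction to \<open>U\<close> extends from test
  functions to a bounded functional on \<open>W12_0 U\<close>; this extension is unique by density.\<close>

definition extends_distr ::
    "(real \<times> real) set \<Rightarrow> ((real \<times> real \<Rightarrow> real) \<Rightarrow> real) \<Rightarrow> ((real \<times> real \<Rightarrow> real) \<Rightarrow> real) \<Rightarrow> bool"
  where "extends_distr U T L \<longleftrightarrow> L \<in> W_minus12 U \<and> (\<forall>\<phi>\<in>test_functions U. L \<phi> = T \<phi>)"

definition precompact_W_minus12_loc ::
    "(real \<times> real) set \<Rightarrow> ((real \<times> real \<Rightarrow> real) \<Rightarrow> real) set \<Rightarrow> bool"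
  where "precompact_W_minus12_loc \<Omega> \<T> \<longleftrightarrow>
    (\<forall>U. open U \<and> bounded U \<and> closure U \<subseteq> \<Omega> \<longrightarrow>
      (\<forall>T\<in>\<T>. \<exists>L. extends_distr U T L) \<and>
      compactin (W_minus12_topology U)
        (W_minus12_topology U closure_of {L. \<exists>T\<in>\<T>. extends_distr U T L}))"

end

theory Submission
  imports Defs "HOL-Library.Diagonal_Subsequence" "HOL-Complex_Analysis.Great_Picard"
begin

text \<open>
  Write \<open>F\<close>, \<open>G\<close>, \<open>H\<close> for the primitives of \<open>f\<^sub>u\<^sup>2\<close>, \<open>g\<^sub>u\<^sup>2\<close> and \<open>f\<^sub>u g\<^sub>u\<close>, and for two members \<open>v\<^sub>n\<close>, \<open>v\<^sub>m\<close>
  of the sequence let \<open>p\<close>, \<open>q\<close>, \<open>r\<close> be the differences of \<open>F\<close>, \<open>H\<close>, \<open>G\<close> between them.  The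
  determinant \<open>p r - q\<^sup>2\<close> is the gap in the Cauchy--Schwarz inequality for \<open>f\<^sub>u\<close> and \<open>g\<^sub>u\<close> on the
  interval between \<open>v\<^sub>m\<close> and \<open>v\<^sub>n\<close>.  It is nonnegative, and it vanishes only if a nontrivial
  combination of \<open>f\<^sub>u\<close> and \<open>g\<^sub>u\<close> vanishes on that interval, which either form of the nonlinearity
  assumption excludes unless \<open>v\<^sub>m = v\<^sub>n\<close> (\<open>gap_pos\<close>).  So it is enough that the determinant tends
  to zero in measure as \<open>n\<close> and \<open>m\<close> tend to infinity along a subsequence: then \<open>v\<close> is Cauchy in
  measure on compact sets (\<open>gap_in_measure_AE_subseq\<close>), and a diagonal argument over a countable
  cover of \<open>\<Omega>\<close> by boxes gives convergence almost everywhere.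

  The determinant is treated by compensated compactness.  Its rows \<open>(p, q)\<close> and \<open>(q, r)\<close> have
  divergences that tend to zero in \<open>W\<^sup>-\<^sup>1\<^sup>,\<^sup>2\<close> by the compactness assumption
  (\<open>precompact_subseq\<close>), and \<open>p\<close> and \<open>q\<close> tend to zero weakly, in the sense that their
  mollifications tend to zero uniformly at every scale (\<open>all_mollified_subseq\<close>).  The entries are
  however dominated only by the one integrable function \<open>M = F(k, b) + G(l, b)\<close>, so the products
  need not be integrable, and the div-curl lemma has to be localized and truncated.

  Near a point, \<open>(p, q)\<close> is up to a small error in \<open>L\<^sup>1\<close> the rotated gradient of a stream function:
  \<open>\<psi>\<^sub>x \<approx> - q\<close> and \<open>\<psi>\<^sub>y \<approx> p\<close> (\<open>approx_stream_function\<close>).  Hence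
  \<open>p r - q\<^sup>2 \<approx> q \<psi>\<^sub>x + r \<psi>\<^sub>y\<close>, and this would be small in the mean if a cutoff multiple of \<open>\<psi>\<close> were
  an admissible test function for the second divergence.  Where all averages of \<open>\<bar>\<nabla>\<psi>\<bar>\<close> over balls
  are at most a constant \<open>K\<close>, the function \<open>\<psi>\<close> is Lipschitz, and its oscillation is small because
  the mollified gradient is small (\<open>mean_oscillation\<close>).  By the weak type bound for the maximal
  function, the exceptional set has measure of the order of the integral of \<open>max 0 (M - c)\<close>, which
  is a small part of a small ball about a point where \<open>M\<close> is well below \<open>c\<close> and
  is close on average to a continuous function.  Replacing \<open>\<psi>\<close> by a Lipschitz extension from the good set
  therefore costs little (\<open>Lipschitz_truncation_estimate\<close>, \<open>determinant_local_estimate\<close>).  All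
  points of a compact set where \<open>M\<close> is bounded, up to a set of small measure, admit such balls,
  and finitely many of them cover (\<open>determinant_small_in_measure\<close>).
\<close>

section \<open>Density of continuous functions in \<open>L\<^sup>1\<close>\<close>

text \<open>Regularity of Lebesgue measure squeezes a set between a closed and an open set of nearly
  equal measure, and a Urysohn function between the two approximates its indicator. The induction
  principle for integrable functions does the rest.\<close>

lemma L1_approx_continuous:
  fixes h :: "'a::euclidean_space \<Rightarrow> real"
  assumes "integrable lborel h" "e > 0"
  shows "\<exists>g. continuous_on UNIV g \<and> integrable lborel g \<and> (LINT x|lborel. \<bar>h x - g x\<bar>) < e"
proof -
  have "\<forall>e>0. \<exists>g. continuous_on UNIV g \<and> integrable lborel g \<and> (LINT x|lborel. \<bar>h x - g x\<bar>) < e"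
    using assms(1)
  proof (induct rule: integrable_induct)
    case (base A c)
    show ?case
    proof (intro allI impI)
      fix e :: real assume "e > 0"
      define d where "d = e / (2 * (\<bar>c\<bar> + 1))"
      have d: "d > 0" using \<open>e > 0\<close> by (simp add: d_def)
      have A: "A \<in> sets lebesgue" using base by simp
      obtain T where T: "open T" "A \<subseteq> T" "T - A \<in> lmeasurable" "measure lebesgue (T - A) < d"
        using sets_lebesgue_outer_open[OF A d] by (metis measure_def enn2real_less_iff emeasure_eq_measure2 fmeasurableD2 ennreal_less_iff measure_nonneg)
      obtain C where C: "closed C" "C \<subseteq> A" "A - C \<in> lmeasurable" "measure lebesgue (A - C) < d"
        using sets_lebesgue_inner_closed[OF A d] by (metis measure_def enn2real_less_iff emeasure_eq_measure2 fmeasurableD2 ennreal_less_iff measure_nonneg)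
      have "C \<inter> - T = {}" using T C by auto
      then obtain g :: "'a \<Rightarrow> real" where g: "continuous_on UNIV g" "\<And>x. g x \<in> closed_segment 1 0"
        "\<And>x. x \<in> C \<Longrightarrow> g x = 1" "\<And>x. x \<in> - T \<Longrightarrow> g x = 0"
        using Urysohn[of C "-T" 1 0] T C by (metis closed_Compl)
      have [measurable]: "g \<in> borel_measurable borel" using g(1) by (rule borel_measurable_continuous_onI)
      have bd: "0 \<le> g x \<and> g x \<le> 1" for x using g(2)[of x] by (auto simp: closed_segment_eq_real_ivl)
      have [measurable]: "A \<in> sets borel" "T \<in> sets borel" "C \<in> sets borel" using base T C by auto
      have le: "\<bar>indicator A x - g x\<bar> \<le> indicator (T - A) x + indicator (A - C) x" for x
        using bd[of x] g(3)[of x] g(4)[of x] T C by (auto simp: indicator_def)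
      have fin: "integrable lborel (indicator (T - A) :: 'a \<Rightarrow> real)" "integrable lborel (indicator (A - C) :: 'a \<Rightarrow> real)"
        using T(3) C(3) by (auto simp: fmeasurable_def)
      have i1: "integrable lborel (\<lambda>x. indicator A x - g x)"
        by (rule Bochner_Integration.integrable_bound[OF Bochner_Integration.integrable_add[OF fin]]) (auto intro!: AE_I2 order_trans[OF le])
      have iA: "integrable lborel (indicator A :: 'a \<Rightarrow> real)" using base by auto
      have ig: "integrable lborel g"
        using Bochner_Integration.integrable_diff[OF iA i1] by simp
      have "(LINT x|lborel. \<bar>indicator A x - g x\<bar>) \<le> (LINT x|lborel. indicator (T - A) x + indicator (A - C) x)"
        using i1 fin le by (intro integral_mono) auto
      also have "\<dots> = measure lborel (T - A) + measure lborel (A - C)"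
        using fin by simp
      also have "\<dots> < 2 * d" using T(4) C(4) by (simp add: measure_completion)
      finally have l: "(LINT x|lborel. \<bar>indicator A x - g x\<bar>) < 2 * d" .
      have "(LINT x|lborel. \<bar>indicat_real A x *\<^sub>R c - c * g x\<bar>) = \<bar>c\<bar> * (LINT x|lborel. \<bar>indicator A x - g x\<bar>)"
        by (subst integral_mult_right_zero[symmetric]) (auto intro!: Bochner_Integration.integral_cong simp: abs_mult[symmetric] algebra_simps)
      also have "\<dots> \<le> \<bar>c\<bar> * (2 * d)" using l by (intro mult_left_mono) auto
      also have "\<dots> < (\<bar>c\<bar> + 1) * (2 * d)" using d by simp
      also have "\<dots> = e" by (simp add: d_def field_simps)
      finally show "\<exists>g. continuous_on UNIV g \<and> integrable lborel g \<and> (LINT x|lborel. \<bar>indicat_real A x *\<^sub>R c - g x\<bar>) < e"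
        using ig g(1) by (intro exI[of _ "\<lambda>x. c * g x"]) (auto intro!: continuous_intros)
    qed
  next
    case (add f1 f2)
    show ?case
    proof (intro allI impI)
      fix e :: real assume "e > 0"
      then have e: "e/2 > 0" by simp
      obtain g1 where g1: "continuous_on UNIV g1" "integrable lborel g1" "(LINT x|lborel. \<bar>f1 x - g1 x\<bar>) < e/2"
        using add(2)[rule_format, OF e] by auto
      obtain g2 where g2: "continuous_on UNIV g2" "integrable lborel g2" "(LINT x|lborel. \<bar>f2 x - g2 x\<bar>) < e/2"
        using add(4)[rule_format, OF e] by auto
      have "(LINT x|lborel. \<bar>f1 x + f2 x - (g1 x + g2 x)\<bar>) \<le> (LINT x|lborel. \<bar>f1 x - g1 x\<bar> + \<bar>f2 x - g2 x\<bar>)"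
        using add g1 g2 by (intro integral_mono) auto
      also have "\<dots> < e" using add g1 g2 by simp
      finally show "\<exists>g. continuous_on UNIV g \<and> integrable lborel g \<and> (LINT x|lborel. \<bar>f1 x + f2 x - g x\<bar>) < e"
        using g1 g2 by (intro exI[of _ "\<lambda>x. g1 x + g2 x"]) (auto intro!: continuous_intros)
    qed
  next
    case (lim f s)
    show ?case
    proof (intro allI impI)
      fix e :: real assume "e > 0"
      have "(\<lambda>i. LINT x|lborel. \<bar>f x - s i x\<bar>) \<longlonglongrightarrow> (LINT x::'a|lborel. (0::real))"
      proof (rule integral_dominated_convergence[where w="\<lambda>x. 3 * \<bar>f x\<bar>" and f="\<lambda>x. 0" and s="\<lambda>i x. \<bar>f x - s i x\<bar>"])
        show "AE x in lborel. (\<lambda>i. \<bar>f x - s i x\<bar>) \<longlonglongrightarrow> 0"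
          using lim(3) by (auto intro!: AE_I2 tendsto_eq_intros)
        show "AE x in lborel. norm \<bar>f x - s i x\<bar> \<le> 3 * \<bar>f x\<bar>" for i
        proof (rule AE_I2)
          fix x show "norm \<bar>f x - s i x\<bar> \<le> 3 * \<bar>f x\<bar>" using lim(4)[of x i] by (simp add: abs_le_iff) linarith
        qed
      qed (use lim in auto)
      then have "\<forall>\<^sub>F i in sequentially. (LINT x|lborel. \<bar>f x - s i x\<bar>) < e/2"
        using \<open>e > 0\<close> by (intro order_tendstoD(2)) auto
      then obtain i where i: "(LINT x|lborel. \<bar>f x - s i x\<bar>) < e/2" by (auto simp: eventually_sequentially)
      obtain g where g: "continuous_on UNIV g" "integrable lborel g" "(LINT x|lborel. \<bar>s i x - g x\<bar>) < e/2"
        using lim(2)[of i] \<open>e > 0\<close> by (meson half_gt_zero)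
      have "(LINT x|lborel. \<bar>f x - g x\<bar>) \<le> (LINT x|lborel. \<bar>f x - s i x\<bar> + \<bar>s i x - g x\<bar>)"
        using lim g by (intro integral_mono) auto
      also have "\<dots> < e" using lim g i by simp
      finally show "\<exists>g. continuous_on UNIV g \<and> integrable lborel g \<and> (LINT x|lborel. \<bar>f x - g x\<bar>) < e"
        using g by auto
    qed
  qed
  with assms show ?thesis by blast
qed

section \<open>A smooth bump on the line\<close>

text \<open>The derivative is existentially quantified, so that products and affine substitutions
  need no formula for higher derivatives.\<close>

primrec Ck_line :: "nat \<Rightarrow> (real \<Rightarrow> real) \<Rightarrow> bool" where
  "Ck_line 0 f \<longleftrightarrow> continuous_on UNIV f"
| "Ck_line (Suc n) f \<longleftrightarrow> (\<exists>f'. (\<forall>x. (f has_real_derivative f' x) (at x)) \<and> Ck_line n f')"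

lemma Ck_line_cont: "Ck_line n f \<Longrightarrow> continuous_on UNIV f"
  by (cases n) (auto intro!: continuous_at_imp_continuous_on dest: DERIV_isCont)

lemma Ck_line_Suc: "Ck_line (Suc n) f \<Longrightarrow> Ck_line n f"
proof (induction n arbitrary: f)
  case 0 then show ?case using Ck_line_cont[of "Suc 0"] by auto
qed auto

lemma Ck_line_add: "Ck_line n f \<Longrightarrow> Ck_line n g \<Longrightarrow> Ck_line n (\<lambda>x. f x + g x)"
proof (induction n arbitrary: f g)
  case (Suc n)
  then obtain f' g' where "\<And>x. (f has_real_derivative f' x) (at x)" "Ck_line n f'"
    "\<And>x. (g has_real_derivative g' x) (at x)" "Ck_line n g'" by auto
  then show ?case using Suc.IH[of f' g'] by (auto intro!: exI[of _ "\<lambda>x. f' x + g' x"] derivative_eq_intros)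
qed (auto intro!: continuous_intros)

lemma Ck_line_mult: "Ck_line n f \<Longrightarrow> Ck_line n g \<Longrightarrow> Ck_line n (\<lambda>x. f x * g x)"
proof (induction n arbitrary: f g)
  case (Suc n)
  then obtain f' g' where *: "\<And>x. (f has_real_derivative f' x) (at x)" "Ck_line n f'"
    "\<And>x. (g has_real_derivative g' x) (at x)" "Ck_line n g'" by auto
  have "Ck_line n (\<lambda>x. f' x * g x + g' x * f x)"
    using Suc * Ck_line_Suc[of n f] Ck_line_Suc[of n g] by (intro Ck_line_add Suc.IH) auto
  then show ?case using * by (auto intro!: exI[of _ "\<lambda>x. f' x * g x + g' x * f x"] derivative_eq_intros)
qed (auto intro!: continuous_intros)

lemma Ck_line_const: "Ck_line n (\<lambda>x. c)"
  by (induction n arbitrary: c) (auto intro!: exI[of _ "\<lambda>x. 0"])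

lemma Ck_line_affine: "Ck_line n f \<Longrightarrow> Ck_line n (\<lambda>x. f (c + m * x))"
proof (induction n arbitrary: f)
  case 0 then show ?case by (auto intro!: continuous_on_compose2[of UNIV f] continuous_intros)
next
  case (Suc n)
  then obtain f' where *: "\<And>x. (f has_real_derivative f' x) (at x)" "Ck_line n f'" by auto
  have "((\<lambda>x. f (c + m * x)) has_real_derivative f' (c + m * x) * m) (at x)" for x
    by (rule DERIV_chain2[OF *(1)]) (auto intro!: derivative_eq_intros)
  then show ?case using Ck_line_mult[OF Suc.IH[OF *(2)] Ck_line_const[of n m]]
    by (auto intro!: exI[of _ "\<lambda>x. f' (c + m * x) * m"])
qed

text \<open>The classical flat function, multiplied by a polynomial in \<open>1 / x\<close>: this
  family is closed under differentiation.\<close>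

definition flat_exp :: "real poly \<Rightarrow> real \<Rightarrow> real" where
  "flat_exp p x = (if x > 0 then poly p (1/x) * exp (- (1/x)) else 0)"

lemma poly_exp_tendsto_0: "((\<lambda>x. poly p x * exp (- x)) \<longlongrightarrow> (0::real)) at_top"
proof -
  have "((\<lambda>x::real. \<Sum>i\<le>degree p. coeff p i * (x ^ i / exp x)) \<longlongrightarrow> (\<Sum>i\<le>degree p. coeff p i * 0)) at_top"
    by (intro tendsto_intros tendsto_power_div_exp_0)
  moreover have "(\<Sum>i\<le>degree p. coeff p i * (x ^ i / exp x)) = poly p x * exp (- x)" for x :: real
    unfolding poly_altdef sum_distrib_right by (intro sum.cong) (auto simp: exp_minus divide_inverse)
  ultimately show ?thesis by simp
qed

lemma flat_exp_deriv:
  "(flat_exp p has_real_derivative flat_exp ([:0,0,1:] * (p - pderiv p)) x) (at x)"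
proof -
  consider "x > 0" | "x < 0" | "x = 0" by linarith
  then show ?thesis
  proof cases
    case 1
    have "((\<lambda>x. poly p (1/x) * exp (- (1/x))) has_real_derivative
       flat_exp ([:0,0,1:] * (p - pderiv p)) x) (at x)"
      using 1 by (auto intro!: derivative_eq_intros simp: flat_exp_def field_simps power2_eq_square)
    then show ?thesis
      by (rule has_field_derivative_transform_within_open[where S="{0<..}"]) (use 1 in \<open>auto simp: flat_exp_def\<close>)
  next
    case 2
    have "((\<lambda>x. 0) has_real_derivative flat_exp ([:0,0,1:] * (p - pderiv p)) x) (at x)"
      using 2 by (auto simp: flat_exp_def)
    then show ?thesis
      by (rule has_field_derivative_transform_within_open[where S="{..<0}"]) (use 2 in \<open>auto simp: flat_exp_def\<close>)
  next
    case 3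
    have l: "((\<lambda>h. (flat_exp p (0 + h) - flat_exp p 0) / h) \<longlongrightarrow> 0) (at_left 0)"
      by (rule tendsto_eventually) (auto simp: flat_exp_def eventually_at_filter)
    have "((\<lambda>h. poly ([:0,1:] * p) (inverse h) * exp (- (inverse h))) \<longlongrightarrow> (0::real)) (at_right 0)"
      by (rule filterlim_compose[OF poly_exp_tendsto_0 filterlim_inverse_at_top_right])
    moreover have "\<forall>\<^sub>F h in at_right 0. poly ([:0,1:] * p) (inverse h) * exp (- (inverse h))
        = (flat_exp p (0 + h) - flat_exp p 0) / h"
      by (auto simp: flat_exp_def eventually_at_filter field_simps intro!: always_eventually)
    ultimately have r: "((\<lambda>h. (flat_exp p (0 + h) - flat_exp p 0) / h) \<longlongrightarrow> 0) (at_right 0)"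
      by (rule Lim_transform_eventually)
    show ?thesis using filterlim_split_at[OF l r] 3 by (simp add: DERIV_def flat_exp_def)
  qed
qed

lemma flat_exp_smooth: "Ck_line n (flat_exp p)"
proof (induction n arbitrary: p)
  case 0
  show ?case using flat_exp_deriv by (auto intro!: continuous_at_imp_continuous_on DERIV_isCont)
next
  case (Suc n) then show ?case using flat_exp_deriv by auto
qed

text \<open>A product of two flat functions is positive exactly on the open interval \<open>(-1,
  1)\<close>.\<close>

definition bump :: "real \<Rightarrow> real" where
  "bump x = flat_exp 1 (1 + x) * flat_exp 1 (1 - x)"

lemma bump_smooth: "Ck_line n bump"
  using Ck_line_mult[OF Ck_line_affine[OF flat_exp_smooth, of n 1 1 1] Ck_line_affine[OF flat_exp_smooth, of n 1 1 "-1"]]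
  unfolding bump_def by (simp add: fun_eq_iff[symmetric] bump_def[abs_def])

lemma bump_pos: "bump x > 0 \<longleftrightarrow> \<bar>x\<bar> < 1" and bump_nonneg: "bump x \<ge> 0"
  and bump_zero: "\<bar>x\<bar> \<ge> 1 \<Longrightarrow> bump x = 0" and bump_even: "bump (- x) = bump x"
  by (auto simp: bump_def flat_exp_def)

section \<open>Calculus and test functions in the plane\<close>

text \<open>Total differentiability with named partial derivatives. In contrast to
  \<^const>\<open>partial\<close> it makes an assertion about differentiability and composes by the
  usual rules.\<close>

definition has_grad :: "(real \<times> real \<Rightarrow> real) \<Rightarrow> (real \<times> real \<Rightarrow> real) \<Rightarrow> (real \<times> real \<Rightarrow> real) \<Rightarrow> bool" where
  "has_grad f f1 f2 \<longleftrightarrow> (\<forall>p. (f has_derivative (\<lambda>v. fst v * f1 p + snd v * f2 p)) (at p))"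

lemma has_gradD: "has_grad f f1 f2 \<Longrightarrow> (f has_derivative (\<lambda>v. fst v * f1 p + snd v * f2 p)) (at p within S)"
  unfolding has_grad_def by (blast intro: has_derivative_at_withinI)

lemma has_grad_partial:
  assumes "has_grad f f1 f2" shows "partial_x f = f1" "partial_y f = f2"
proof -
  have "frechet_derivative f (at p) = (\<lambda>v. fst v * f1 p + snd v * f2 p)" for p
    using frechet_derivative_at[OF has_gradD[OF assms, of p UNIV]] by simp
  then show "partial_x f = f1" "partial_y f = f2" by (simp_all add: partial_def fun_eq_iff)
qed

lemma has_grad_cont: "has_grad f f1 f2 \<Longrightarrow> continuous_on S f"
  unfolding has_grad_def by (meson has_derivative_continuous continuous_at_imp_continuous_on)

text \<open>A linear functional on the plane is determined by its values at the two unit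
  vectors.\<close>

lemma differentiable_has_grad:
  assumes "f differentiable_on UNIV" shows "has_grad f (partial_x f) (partial_y f)"
  unfolding has_grad_def
proof
  fix p
  have d: "(f has_derivative frechet_derivative f (at p)) (at p)"
    using bspec[OF assms[unfolded differentiable_on_def] UNIV_I] unfolding frechet_derivative_works .
  then interpret bounded_linear "frechet_derivative f (at p)" by (rule has_derivative_bounded_linear)
  have "frechet_derivative f (at p) v = fst v * partial_x f p + snd v * partial_y f p" for v :: "real \<times> real"
  proof -
    have "v = fst v *\<^sub>R (1, 0) + snd v *\<^sub>R (0, 1)" by (simp add: prod_eq_iff)
    then have "frechet_derivative f (at p) v = frechet_derivative f (at p) (fst v *\<^sub>R (1, 0) + snd v *\<^sub>R (0, 1))" by simp
    then show ?thesis unfolding add scaleR partial_def by simp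
  qed
  then have "frechet_derivative f (at p) = (\<lambda>v. fst v * partial_x f p + snd v * partial_y f p)" by (rule ext)
  then show "(f has_derivative (\<lambda>v. fst v * partial_x f p + snd v * partial_y f p)) (at p)"
    by (rule has_derivative_eq_rhs[OF d])
qed

lemma Ck_plane_Suc_grad: "Ck_plane (Suc n) f \<Longrightarrow> has_grad f (partial_x f) (partial_y f)"
  using differentiable_has_grad by auto

lemma Ck_plane_SucI:
  assumes "has_grad f f1 f2" "Ck_plane n f1" "Ck_plane n f2" shows "Ck_plane (Suc n) f"
  using assms has_grad_partial[OF assms(1)]
  by (auto simp: differentiable_on_def differentiable_def has_grad_def)

lemma Ck_plane_cont: "Ck_plane n f \<Longrightarrow> continuous_on S f"
  by (cases n) (auto intro: continuous_on_subset dest: differentiable_imp_continuous_on)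

lemma Ck_plane_lin: "Ck_plane n f \<Longrightarrow> Ck_plane n g \<Longrightarrow> Ck_plane n (\<lambda>p. a * f p + b * g p)"
proof (induction n arbitrary: f g)
  case (Suc n)
  have "has_grad (\<lambda>p. a * f p + b * g p) (\<lambda>p. a * partial_x f p + b * partial_x g p) (\<lambda>p. a * partial_y f p + b * partial_y g p)"
    unfolding has_grad_def using Ck_plane_Suc_grad[OF Suc.prems(1)] Ck_plane_Suc_grad[OF Suc.prems(2)]
    by (auto simp: has_grad_def algebra_simps intro!: derivative_eq_intros)
  then show ?case using Suc by (intro Ck_plane_SucI) auto
qed (auto intro!: continuous_intros)

lemma Ck_plane_tensor: "Ck_line n f \<Longrightarrow> Ck_line n g \<Longrightarrow> Ck_plane n (\<lambda>p. f (fst p) * g (snd p))"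
proof (induction n arbitrary: f g)
  case 0 then show ?case
    by (auto intro!: continuous_intros continuous_on_compose2[of UNIV f] continuous_on_compose2[of UNIV g])
next
  case (Suc n)
  then obtain f' g' where *: "\<And>x. (f has_real_derivative f' x) (at x)" "Ck_line n f'"
    "\<And>x. (g has_real_derivative g' x) (at x)" "Ck_line n g'" by auto
  have "has_grad (\<lambda>p. f (fst p) * g (snd p)) (\<lambda>p. f' (fst p) * g (snd p)) (\<lambda>p. f (fst p) * g' (snd p))"
    unfolding has_grad_def
  proof
    fix p :: "real \<times> real"
    have 1: "((\<lambda>p. f (fst p)) has_derivative (\<lambda>v. fst v * f' (fst p))) (at p)"
      using has_derivative_compose[OF has_derivative_fst[OF has_derivative_ident], of f, OF *(1)[unfolded has_field_derivative_def]]
      by (simp add: mult.commute)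
    have 2: "((\<lambda>p. g (snd p)) has_derivative (\<lambda>v. snd v * g' (snd p))) (at p)"
      using has_derivative_compose[OF has_derivative_snd[OF has_derivative_ident], of g, OF *(3)[unfolded has_field_derivative_def]]
      by (simp add: mult.commute)
    show "((\<lambda>p. f (fst p) * g (snd p)) has_derivative (\<lambda>v. fst v * (f' (fst p) * g (snd p)) + snd v * (f (fst p) * g' (snd p)))) (at p)"
      using has_derivative_mult[OF 1 2] by (simp add: algebra_simps)
  qed
  moreover have "Ck_line n f" "Ck_line n g" using Suc.prems Ck_line_Suc by blast+
  ultimately show ?case using * Suc.IH by (intro Ck_plane_SucI) auto
qed

lemma compact_support_inI:
  assumes "compact K" "K \<subseteq> U" "\<And>p. p \<notin> K \<Longrightarrow> \<phi> p = 0" shows "compact_support_in U \<phi>"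
proof -
  have "closure {p. \<phi> p \<noteq> 0} \<subseteq> K" using assms by (intro closure_minimal) (auto simp: compact_imp_closed)
  then show ?thesis unfolding compact_support_in_def using assms(1,2)
    by (meson closed_closure compact_closure bounded_subset compact_imp_bounded closure_subset order_trans)
qed

lemma test_supportE:
  assumes "\<phi> \<in> test_functions U"
  obtains K where "compact K" "K \<subseteq> U" "\<And>p. p \<notin> K \<Longrightarrow> \<phi> p = 0"
proof (rule that[of "closure {p. \<phi> p \<noteq> 0}"])
  show "\<phi> p = 0" if "p \<notin> closure {p. \<phi> p \<noteq> 0}" for p
    using that closure_subset[of "{p. \<phi> p \<noteq> 0}"] by blast
qed (use assms in \<open>auto simp: test_functions_def compact_support_in_def\<close>)

lemma has_grad_zero_outside:
  assumes "has_grad f f1 f2" "closed K" "\<And>p. p \<notin> K \<Longrightarrow> f p = 0" "p \<notin> K"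
  shows "f1 p = 0" "f2 p = 0"
proof -
  have "((\<lambda>p. 0::real) has_derivative (\<lambda>v. fst v * f1 p + snd v * f2 p)) (at p)"
    by (rule has_derivative_transform_within_open[where s="-K", OF has_gradD[OF assms(1)]]) (use assms in auto)
  from has_derivative_unique[OF this has_derivative_const]
  have *: "(\<lambda>v. fst v * f1 p + snd v * f2 p) = (\<lambda>v. 0)" .
  from fun_cong[OF *, of "(1,0)"] fun_cong[OF *, of "(0,1)"] show "f1 p = 0" "f2 p = 0" by simp_all
qed

lemma test_grad: "\<phi> \<in> test_functions U \<Longrightarrow> has_grad \<phi> (partial_x \<phi>) (partial_y \<phi>)"
  using Ck_plane_Suc_grad[of 0 \<phi>] by (simp only: test_functions_def mem_Collect_eq)

lemma test_cont: "\<phi> \<in> test_functions U \<Longrightarrow> continuous_on S \<phi>"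
  using Ck_plane_cont by (auto simp: test_functions_def)

lemma test_partial:
  assumes "\<phi> \<in> test_functions U" shows "partial_x \<phi> \<in> test_functions U" "partial_y \<phi> \<in> test_functions U"
proof -
  obtain K where K: "compact K" "K \<subseteq> U" "\<And>p. p \<notin> K \<Longrightarrow> \<phi> p = 0" using test_supportE[OF assms] by blast
  have "Ck_plane (Suc n) \<phi>" for n using assms by (auto simp: test_functions_def)
  then have "Ck_plane n (partial_x \<phi>)" "Ck_plane n (partial_y \<phi>)" for n by auto
  then show "partial_x \<phi> \<in> test_functions U" "partial_y \<phi> \<in> test_functions U"
    using has_grad_zero_outside[OF test_grad[OF assms] compact_imp_closed[OF K(1)] K(3)] K
    by (auto simp: test_functions_def intro!: compact_support_inI[of K])
qed

lemma test_lin: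
  assumes "\<phi> \<in> test_functions U" "\<psi> \<in> test_functions U"
  shows "(\<lambda>p. a * \<phi> p + b * \<psi> p) \<in> test_functions U"
proof -
  obtain K where K: "compact K" "K \<subseteq> U" "\<And>p. p \<notin> K \<Longrightarrow> \<phi> p = 0" using test_supportE[OF assms(1)] by blast
  obtain L where L: "compact L" "L \<subseteq> U" "\<And>p. p \<notin> L \<Longrightarrow> \<psi> p = 0" using test_supportE[OF assms(2)] by blast
  have "compact_support_in U (\<lambda>p. a * \<phi> p + b * \<psi> p)"
    by (rule compact_support_inI[of "K \<union> L"]) (simp_all add: K L compact_Un)
  moreover have "\<forall>n. Ck_plane n \<phi>" "\<forall>n. Ck_plane n \<psi>" using assms unfolding test_functions_def by blast+
  ultimately show ?thesis unfolding test_functions_def by (blast intro: Ck_plane_lin)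
qed

lemma test_partial_lin:
  assumes "\<phi> \<in> test_functions U" "\<psi> \<in> test_functions U"
  shows "partial_x (\<lambda>p. a * \<phi> p + b * \<psi> p) = (\<lambda>p. a * partial_x \<phi> p + b * partial_x \<psi> p)"
    "partial_y (\<lambda>p. a * \<phi> p + b * \<psi> p) = (\<lambda>p. a * partial_y \<phi> p + b * partial_y \<psi> p)"
proof -
  have "has_grad (\<lambda>p. a * \<phi> p + b * \<psi> p) (\<lambda>p. a * partial_x \<phi> p + b * partial_x \<psi> p) (\<lambda>p. a * partial_y \<phi> p + b * partial_y \<psi> p)"
    unfolding has_grad_def using test_grad[OF assms(1)] test_grad[OF assms(2)]
    by (auto simp: has_grad_def algebra_simps intro!: derivative_eq_intros)
  from has_grad_partial[OF this] show "partial_x (\<lambda>p. a * \<phi> p + b * \<psi> p) = (\<lambda>p. a * partial_x \<phi> p + b * partial_x \<psi> p)"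
    "partial_y (\<lambda>p. a * \<phi> p + b * \<psi> p) = (\<lambda>p. a * partial_y \<phi> p + b * partial_y \<psi> p)" .
qed

lemma bounded_compact_support:
  fixes f :: "real \<times> real \<Rightarrow> real"
  assumes "continuous_on UNIV f" "compact K" "\<And>p. p \<notin> K \<Longrightarrow> f p = 0"
  obtains C where "C > 0" "\<And>p. \<bar>f p\<bar> \<le> C"
proof -
  have "bounded (f ` K)" using assms by (intro compact_imp_bounded compact_continuous_image) (auto intro: continuous_on_subset)
  then obtain C where C: "C > 0" "\<And>p. p \<in> K \<Longrightarrow> \<bar>f p\<bar> \<le> C" by (force simp: bounded_pos)
  show ?thesis using C assms(3) by (intro that[of C]) (metis abs_zero less_imp_le)+
qed

lemma integrable_compact_support:
  fixes f :: "real \<times> real \<Rightarrow> real"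
  assumes "continuous_on UNIV f" "compact K" "\<And>p. p \<notin> K \<Longrightarrow> f p = 0"
  shows "integrable lborel f"
proof -
  have "set_integrable lborel K f"
    unfolding set_integrable_def using assms by (intro borel_integrable_compact) (auto intro: continuous_on_subset)
  moreover have "(\<lambda>x. indicator K x *\<^sub>R f x) = f" using assms(3) by (auto simp: indicator_def fun_eq_iff)
  ultimately show ?thesis by (simp add: set_integrable_def)
qed

lemma test_bounded:
  assumes "\<phi> \<in> test_functions U" obtains C where "C > 0" "\<And>p. \<bar>\<phi> p\<bar> \<le> C"
  using test_supportE[OF assms] bounded_compact_support[OF test_cont[OF assms]] by metis

lemma test_integrable: "\<phi> \<in> test_functions U \<Longrightarrow> integrable lborel \<phi>"
  using test_supportE[of \<phi> U] integrable_compact_support[OF test_cont] by metis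

lemma test_measurable: "\<phi> \<in> test_functions U \<Longrightarrow> \<phi> \<in> borel_measurable borel"
  using test_cont[of \<phi> U UNIV] by (rule borel_measurable_continuous_onI)

lemma test_mono: "\<phi> \<in> test_functions U \<Longrightarrow> U \<subseteq> V \<Longrightarrow> \<phi> \<in> test_functions V"
  by (auto simp: test_functions_def compact_support_in_def)

lemma grad_bound_Lipschitz:
  assumes "convex S" "\<And>p. p \<in> S \<Longrightarrow> (f has_derivative (\<lambda>v. fst v * f1 p + snd v * f2 p)) (at p within S)"
    "\<And>p. p \<in> S \<Longrightarrow> \<bar>f1 p\<bar> \<le> C" "\<And>p. p \<in> S \<Longrightarrow> \<bar>f2 p\<bar> \<le> C" "x \<in> S" "y \<in> S"
  shows "\<bar>f x - f y\<bar> \<le> 2 * C * norm (x - y)"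
proof -
  have "norm (f x - f y) \<le> 2 * C * norm (x - y)"
  proof (rule differentiable_bound[OF assms(1,2)])
    fix p assume p: "p \<in> S"
    show "onorm (\<lambda>v. fst v * f1 p + snd v * f2 p) \<le> 2 * C"
    proof (rule onorm_le)
      fix v :: "real \<times> real"
      have "\<bar>fst v * f1 p + snd v * f2 p\<bar> \<le> \<bar>fst v\<bar> * \<bar>f1 p\<bar> + \<bar>snd v\<bar> * \<bar>f2 p\<bar>"
        by (metis abs_mult abs_triangle_ineq)
      also have "\<dots> \<le> norm v * C + norm v * C"
        using assms(3,4)[OF p] norm_fst_le[of "fst v" "snd v"] norm_snd_le[of "snd v" "fst v"]
        by (intro add_mono mult_mono) auto
      finally show "norm (fst v * f1 p + snd v * f2 p) \<le> 2 * C * norm v" by (simp add: algebra_simps)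
    qed
  qed (use assms in auto)
  then show ?thesis by simp
qed

lemma integral_translation:
  fixes f :: "real \<times> real \<Rightarrow> real"
  assumes "f \<in> borel_measurable borel"
  shows "(LINT x|lborel. f (c + x)) = (LINT x|lborel. f x)"
  by (subst (2) lborel_distr_plus[of c, symmetric], subst integral_distr) (use assms in auto)

text \<open>The difference quotients in direction \<open>e\<close> have integral zero because
  Lebesgue measure is translation invariant, and they are dominated since \<open>u\<close> is
  Lipschitz with compact support. Applied to a product, this is integration by parts.\<close>

lemma integral_directional_zero:
  assumes g: "has_grad u u1 u2" and c: "continuous_on UNIV u1" "continuous_on UNIV u2"
    and K: "compact K" "\<And>p. p \<notin> K \<Longrightarrow> u p = 0"
  shows "(LINT p|lborel. fst e * u1 p + snd e * u2 p) = 0"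
proof -
  note z = has_grad_zero_outside[OF g compact_imp_closed[OF K(1)] K(2)]
  obtain C1 where C1: "C1 > 0" "\<And>p. \<bar>u1 p\<bar> \<le> C1" using bounded_compact_support[OF c(1) K(1) z(1)] by blast
  obtain C2 where C2: "C2 > 0" "\<And>p. \<bar>u2 p\<bar> \<le> C2" using bounded_compact_support[OF c(2) K(1) z(2)] by blast
  define C where "C = C1 + C2"
  have C: "\<bar>u1 p\<bar> \<le> C" "\<bar>u2 p\<bar> \<le> C" for p using C1(1) C2(1) C1(2)[of p] C2(2)[of p] by (auto simp: C_def)
  have Lip: "\<bar>u x - u y\<bar> \<le> 2 * C * norm (x - y)" for x y
    by (rule grad_bound_Lipschitz[of UNIV]) (use C has_gradD[OF g] in auto)
  define h where "h n = inverse (real (Suc n))" for n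
  have h: "h n > 0" "h n \<le> 1" for n by (auto simp: h_def inverse_le_1_iff)
  have hlim: "h \<longlonglongrightarrow> 0" unfolding h_def by (rule LIMSEQ_inverse_real_of_nat)
  define K' where "K' = K \<union> (\<lambda>p. fst p - snd p) ` (K \<times> cball 0 (norm e))"
  have K': "compact K'" unfolding K'_def using K(1)
    by (intro compact_Un compact_continuous_image compact_Times) (auto intro!: continuous_intros)
  have uc: "continuous_on UNIV u" by (rule has_grad_cont[OF g])
  have um[measurable]: "u \<in> borel_measurable borel" by (intro borel_measurable_continuous_onI uc)
  have ui: "integrable lborel u" by (rule integrable_compact_support[OF uc K])
  have uti: "integrable lborel (\<lambda>p. u (c + p))" for c
    using ui by (subst (asm) lborel_distr_plus[of c, symmetric], subst (asm) integrable_distr_eq) auto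
  define s where "s n p = (u (h n *\<^sub>R e + p) - u p) / h n" for n p
  have "(LINT p|lborel. s n p) = 0" for n
  proof -
    have "(LINT p|lborel. s n p) = ((LINT p|lborel. u (h n *\<^sub>R e + p)) - (LINT p|lborel. u p)) / h n"
      unfolding s_def using uti ui by (subst Bochner_Integration.integral_divide_zero, subst Bochner_Integration.integral_diff) auto
    then show ?thesis by (simp add: integral_translation)
  qed
  moreover have "(\<lambda>n. LINT p|lborel. s n p) \<longlonglongrightarrow> (LINT p|lborel. fst e * u1 p + snd e * u2 p)"
  proof (rule integral_dominated_convergence[where w="\<lambda>p. indicator K' p *\<^sub>R (2 * C * norm e)"])
    show "(\<lambda>p. fst e * u1 p + snd e * u2 p) \<in> borel_measurable lborel"
      using c by (auto intro!: borel_measurable_continuous_onI continuous_intros)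
    show "s n \<in> borel_measurable lborel" for n unfolding s_def[abs_def] by simp
    show "integrable lborel (\<lambda>p. indicator K' p *\<^sub>R (2 * C * norm e))"
      using borel_integrable_compact[OF K', of "\<lambda>_. 2 * C * norm e"] by (simp add: set_integrable_def)
    show "AE p in lborel. (\<lambda>n. s n p) \<longlonglongrightarrow> fst e * u1 p + snd e * u2 p"
    proof (rule AE_I2)
      fix p
      have "((\<lambda>t. u (p + t *\<^sub>R e)) has_derivative (\<lambda>t. fst (t *\<^sub>R e) * u1 (p + 0 *\<^sub>R e) + snd (t *\<^sub>R e) * u2 (p + 0 *\<^sub>R e))) (at 0)"
        by (rule has_derivative_compose[OF _ has_gradD[OF g]]) (auto intro!: derivative_eq_intros)
      then have "((\<lambda>t. u (p + t *\<^sub>R e)) has_real_derivative (fst e * u1 p + snd e * u2 p)) (at 0)"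
        unfolding has_field_derivative_def by (rule has_derivative_eq_rhs) (simp add: fun_eq_iff algebra_simps)
      then have "((\<lambda>t. (u (p + t *\<^sub>R e) - u p) / t) \<longlongrightarrow> fst e * u1 p + snd e * u2 p) (at 0)"
        by (simp add: DERIV_def)
      from filterlim_compose[OF this, of h sequentially]
      have "(\<lambda>n. (u (p + h n *\<^sub>R e) - u p) / h n) \<longlonglongrightarrow> fst e * u1 p + snd e * u2 p"
        using hlim h(1) by (fastforce simp: filterlim_at less_imp_neq[symmetric])
      then show "(\<lambda>n. s n p) \<longlonglongrightarrow> fst e * u1 p + snd e * u2 p" by (simp add: s_def add.commute)
    qed
    show "AE p in lborel. norm (s n p) \<le> indicator K' p *\<^sub>R (2 * C * norm e)" for n
    proof (rule AE_I2)
      fix p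
      show "norm (s n p) \<le> indicator K' p *\<^sub>R (2 * C * norm e)"
      proof (cases "p \<in> K'")
        case True
        then show ?thesis using Lip[of "h n *\<^sub>R e + p" p] h(1)[of n] by (simp add: s_def field_simps abs_mult)
      next
        case False
        have "h n *\<^sub>R e + p \<notin> K"
        proof
          assume "h n *\<^sub>R e + p \<in> K"
          then have "(h n *\<^sub>R e + p) - h n *\<^sub>R e \<in> K'" unfolding K'_def
            using h[of n] mult_right_mono[of "h n" 1 "norm e"] by (intro UnI2 image_eqI[of _ _ "(h n *\<^sub>R e + p, h n *\<^sub>R e)"]) auto
          with False show False by simp
        qed
        then show ?thesis using False K(2) by (auto simp: s_def K'_def)
      qed
    qed
  qed
  ultimately show ?thesis using LIMSEQ_unique[OF _ tendsto_const] by fastforce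
qed

lemma integral_partial_zero:
  assumes "has_grad u u1 u2" "continuous_on UNIV u1" "continuous_on UNIV u2"
    "compact K" "\<And>p. p \<notin> K \<Longrightarrow> u p = 0"
  shows "(LINT p|lborel. u1 p) = 0" "(LINT p|lborel. u2 p) = 0"
  using integral_directional_zero[OF assms, of "(1,0)"] integral_directional_zero[OF assms, of "(0,1)"] by simp_all

section \<open>Convolution with a test function\<close>

definition conv :: "(real \<times> real \<Rightarrow> real) \<Rightarrow> (real \<times> real \<Rightarrow> real) \<Rightarrow> real \<times> real \<Rightarrow> real" where
  "conv h z x = (LINT y|lborel. h y * z (x - y))"

lemma conv_integrable:
  fixes h z :: "real \<times> real \<Rightarrow> real"
  assumes h: "integrable lborel h" and z: "z \<in> borel_measurable borel" and C: "\<And>p. \<bar>z p\<bar> \<le> C"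
  shows "integrable lborel (\<lambda>y. h y * z (x - y))"
proof (rule Bochner_Integration.integrable_bound[where f="\<lambda>y. C * h y"])
  show "integrable lborel (\<lambda>y. C * h y)" using h by simp
  note [measurable] = z borel_measurable_integrable[OF h]
  show "(\<lambda>y. h y * z (x - y)) \<in> borel_measurable lborel" by simp
  have "C \<ge> 0" using C[of 0] by linarith
  then show "AE y in lborel. norm (h y * z (x - y)) \<le> norm (C * h y)"
    using mult_left_mono[OF C abs_ge_zero] by (intro AE_I2) (simp add: abs_mult mult.commute)
qed

text \<open>The derivative falls on the smooth factor: the difference quotients of \<open>z\<close>
  are bounded, so the integrable \<open>h\<close> dominates.\<close>

lemma has_grad_conv:
  assumes h: "integrable lborel h" and g: "has_grad z z1 z2"
    and c: "continuous_on UNIV z1" "continuous_on UNIV z2"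
    and C: "\<And>p. \<bar>z p\<bar> \<le> C" "\<And>p. \<bar>z1 p\<bar> \<le> C" "\<And>p. \<bar>z2 p\<bar> \<le> C"
  shows "has_grad (conv h z) (conv h z1) (conv h z2)"
  unfolding has_grad_def
proof
  fix x
  have [measurable]: "z \<in> borel_measurable borel" "z1 \<in> borel_measurable borel" "z2 \<in> borel_measurable borel"
    "h \<in> borel_measurable borel"
    using has_grad_cont[OF g] c h by (auto intro: borel_measurable_continuous_onI)
  have i: "integrable lborel (\<lambda>y. h y * z (p - y))" "integrable lborel (\<lambda>y. h y * z1 (p - y))"
    "integrable lborel (\<lambda>y. h y * z2 (p - y))" for p
    by (rule conv_integrable[OF h _ C(1)] conv_integrable[OF h _ C(2)] conv_integrable[OF h _ C(3)]; simp)+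
  have Lip: "\<bar>z p - z q\<bar> \<le> 2 * C * norm (p - q)" for p q
    by (rule grad_bound_Lipschitz[of UNIV]) (use C has_gradD[OF g] in auto)
  have dle: "\<bar>fst v * z1 p + snd v * z2 p\<bar> \<le> 2 * C * norm v" for v p
  proof -
    have "\<bar>fst v * z1 p + snd v * z2 p\<bar> \<le> \<bar>fst v\<bar> * \<bar>z1 p\<bar> + \<bar>snd v\<bar> * \<bar>z2 p\<bar>"
      by (metis abs_mult abs_triangle_ineq)
    also have "\<dots> \<le> norm v * C + norm v * C"
      using C(2,3)[of p] norm_fst_le[of "fst v" "snd v"] norm_snd_le[of "snd v" "fst v"]
      by (intro add_mono mult_mono) auto
    finally show ?thesis by (simp add: algebra_simps)
  qed
  \<comment> \<open>the expected derivative under the integral sign\<close>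
  define D where "D v y = fst v * z1 (x - y) + snd v * z2 (x - y)" for v y
  show "(conv h z has_derivative (\<lambda>v. fst v * conv h z1 x + snd v * conv h z2 x)) (at x)"
    unfolding has_derivative_at
  proof
    show "bounded_linear (\<lambda>v. fst v * conv h z1 x + snd v * conv h z2 x)"
      by (intro bounded_linear_add bounded_linear_mult_left bounded_linear_compose[OF bounded_linear_mult_left] bounded_linear_fst bounded_linear_snd)
    define s where "s v y = h y * ((z (x + v - y) - z (x - y) - D v y) / norm v)" for v y
    have eq: "(conv h z (x + v) - conv h z x - (fst v * conv h z1 x + snd v * conv h z2 x)) / norm v
        = (LINT y|lborel. s v y)" for v
    proof -
      have "(LINT y|lborel. s v y) = (LINT y|lborel. (h y * z (x + v - y) - h y * z (x - y)
          - (fst v * (h y * z1 (x - y)) + snd v * (h y * z2 (x - y)))) / norm v)"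
        by (intro Bochner_Integration.integral_cong refl) (simp add: s_def D_def field_simps)
      also have "\<dots> = (conv h z (x + v) - conv h z x - (fst v * conv h z1 x + snd v * conv h z2 x)) / norm v"
        using i by (simp add: conv_def)
      finally show ?thesis by simp
    qed
    have "((\<lambda>v. LINT y|lborel. s v y) \<longlongrightarrow> 0) (at 0)"
      unfolding tendsto_at_iff_sequentially comp_def
    proof (intro allI impI)
      fix X :: "nat \<Rightarrow> real \<times> real" assume X: "\<forall>i. X i \<in> UNIV - {0}" "X \<longlonglongrightarrow> 0"
      have "(\<lambda>i. LINT y|lborel. s (X i) y) \<longlonglongrightarrow> (LINT y::real\<times>real|lborel. (0::real))"
      proof (rule integral_dominated_convergence[where w="\<lambda>y. \<bar>h y\<bar> * (4 * C)"])
        show "(\<lambda>y. 0) \<in> borel_measurable lborel" by simp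
        show "s (X i) \<in> borel_measurable lborel" for i unfolding s_def[abs_def] D_def by simp
        show "integrable lborel (\<lambda>y. \<bar>h y\<bar> * (4 * C))" using h by simp
        show "AE y in lborel. (\<lambda>i. s (X i) y) \<longlonglongrightarrow> 0"
        proof (rule AE_I2)
          fix y
          have "((\<lambda>v. (z (x - y + v) - z (x - y) - D v y) / norm v) \<longlongrightarrow> 0) (at 0)"
          proof (rule tendsto_norm_zero_cancel)
            show "((\<lambda>v. norm ((z (x - y + v) - z (x - y) - D v y) / norm v)) \<longlongrightarrow> 0) (at 0)"
              using conjunct2[OF has_gradD[OF g, of "x - y" UNIV, unfolded has_derivative_at]]
              by (simp add: D_def abs_divide)
          qed
          from this[unfolded tendsto_at_iff_sequentially comp_def, THEN spec, THEN mp, OF X(1), THEN mp, OF X(2)]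
          have "(\<lambda>i. (z (x - y + X i) - z (x - y) - D (X i) y) / norm (X i)) \<longlonglongrightarrow> 0" .
          then have "(\<lambda>i. h y * ((z (x - y + X i) - z (x - y) - D (X i) y) / norm (X i))) \<longlonglongrightarrow> h y * 0"
            by (intro tendsto_intros)
          then show "(\<lambda>i. s (X i) y) \<longlonglongrightarrow> 0" by (simp add: s_def algebra_simps)
        qed
        show "AE y in lborel. norm (s (X i) y) \<le> \<bar>h y\<bar> * (4 * C)" for i
        proof (rule AE_I2)
          fix y
          have n: "norm (X i) > 0" using X(1) by simp
          have "\<bar>z (x + X i - y) - z (x - y) - D (X i) y\<bar> \<le> 2 * C * norm (X i) + 2 * C * norm (X i)"
            using Lip[of "x + X i - y" "x - y"] dle[of "X i" "x - y"] by (auto simp: D_def)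
          then have "\<bar>(z (x + X i - y) - z (x - y) - D (X i) y) / norm (X i)\<bar> \<le> 4 * C"
            using n by (simp add: field_simps)
          then show "norm (s (X i) y) \<le> \<bar>h y\<bar> * (4 * C)"
            unfolding s_def real_norm_def abs_mult by (intro mult_left_mono) auto
        qed
      qed
      then show "(\<lambda>i. LINT y|lborel. s (X i) y) \<longlonglongrightarrow> 0" by simp
    qed
    then have "((\<lambda>v. norm (LINT y|lborel. s v y)) \<longlongrightarrow> 0) (at 0)" by (rule tendsto_norm_zero)
    then show "(\<lambda>v. norm (conv h z (x + v) - conv h z x - (fst v * conv h z1 x + snd v * conv h z2 x)) / norm v) \<midarrow>0\<rightarrow> 0"
      by (simp add: eq[symmetric] abs_divide)
  qed
qed

lemma has_grad_conv_test:
  assumes "integrable lborel h" "z \<in> test_functions UNIV"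
  shows "has_grad (conv h z) (conv h (partial_x z)) (conv h (partial_y z))"
proof -
  obtain C0 where C0: "\<And>p. \<bar>z p\<bar> \<le> C0" using test_bounded[OF assms(2)] by metis
  obtain C1 where C1: "\<And>p. \<bar>partial_x z p\<bar> \<le> C1" using test_bounded[OF test_partial(1)[OF assms(2)]] by metis
  obtain C2 where C2: "\<And>p. \<bar>partial_y z p\<bar> \<le> C2" using test_bounded[OF test_partial(2)[OF assms(2)]] by metis
  show ?thesis
    by (rule has_grad_conv[OF assms(1) test_grad[OF assms(2)] test_cont[OF test_partial(1)[OF assms(2)]]
        test_cont[OF test_partial(2)[OF assms(2)]], of "max C0 (max C1 C2)"])
      (use C0 C1 C2 in \<open>auto simp: le_max_iff_disj\<close>)
qed

lemma Ck_plane_conv: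
  assumes "integrable lborel h" "z \<in> test_functions UNIV" shows "Ck_plane n (conv h z)"
  using assms(2)
proof (induction n arbitrary: z)
  case 0 then show ?case using has_grad_cont[OF has_grad_conv_test[OF assms(1)]] by simp
next
  case (Suc n)
  then show ?case using has_grad_conv_test[OF assms(1) Suc.prems] test_partial[OF Suc.prems]
    by (intro Ck_plane_SucI[OF has_grad_conv_test[OF assms(1) Suc.prems]]) auto
qed

text \<open>The support of a convolution lies in the neighbourhood of radius \<open>r\<close> of the
  support of \<open>h\<close>.\<close>

lemma conv_test:
  assumes h: "integrable lborel h" and z: "z \<in> test_functions UNIV"
    and K: "compact K" "\<And>y. y \<notin> K \<Longrightarrow> h y = 0" and r: "\<And>p. z p \<noteq> 0 \<Longrightarrow> norm p \<le> r"
    and sub: "\<And>x y. y \<in> K \<Longrightarrow> dist x y \<le> r \<Longrightarrow> x \<in> U"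
  shows "conv h z \<in> test_functions U"
proof -
  define L where "L = (\<lambda>p. fst p + snd p) ` (K \<times> cball 0 r)"
  have L: "compact L" unfolding L_def using K(1)
    by (intro compact_continuous_image compact_Times) (auto intro!: continuous_intros)
  have "conv h z x = 0" if "x \<notin> L" for x
  proof -
    have eq: "h y * z (x - y) = 0" for y
    proof (rule ccontr)
      assume "h y * z (x - y) \<noteq> 0"
      then have "y \<in> K" "norm (x - y) \<le> r" using K(2)[of y] r[of "x - y"] by auto
      then have "y + (x - y) \<in> L" unfolding L_def by (intro image_eqI[of _ _ "(y, x - y)"]) auto
      then show False using that by simp
    qed
    show ?thesis unfolding conv_def eq by simp
  qed
  moreover have "L \<subseteq> U"
  proof
    fix x assume "x \<in> L"
    then obtain q where q: "q \<in> K \<times> cball 0 r" "x = fst q + snd q" unfolding L_def by blast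
    then show "x \<in> U" using sub[of "fst q" x] by (auto simp: dist_norm mem_Times_iff)
  qed
  ultimately show ?thesis
    using Ck_plane_conv[OF h z] L unfolding test_functions_def by (auto intro: compact_support_inI)
qed

section \<open>The standard mollifier\<close>

lemma bump_cont: "continuous_on S bump"
  using Ck_line_cont[OF bump_smooth[of 0]] continuous_on_subset by blast

lemma bump_integrable: "integrable lborel bump"
proof -
  have "integrable lborel (\<lambda>x. indicator {-1..1} x *\<^sub>R bump x)"
    by (intro borel_integrable_compact bump_cont) auto
  also have "(\<lambda>x. indicator {-1..1} x *\<^sub>R bump x) = bump"
  proof
    fix x show "indicator {-1..1} x *\<^sub>R bump x = bump x"
      using bump_zero[of x] by (cases "x \<in> {-1..1}") (auto simp: abs_if)
  qed
  finally show ?thesis .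
qed

definition bump_mass :: real where "bump_mass = (LINT x|lborel. bump x)"

lemma bump_mass_pos: "bump_mass > 0"
proof -
  have "bump_mass \<noteq> 0"
  proof
    assume "bump_mass = 0"
    then have "AE x in lborel. bump x = 0"
      using bump_integrable bump_nonneg by (subst (asm) bump_mass_def, subst (asm) integral_nonneg_eq_0_iff_AE) auto
    then have "AE x in lborel. x \<notin> {-1<..<1::real}"
    proof eventually_elim
      case (elim x) then show ?case using bump_pos[of x] by (auto simp: abs_less_iff)
    qed
    then have "{-1<..<1::real} \<in> null_sets lborel" by (subst AE_iff_null_sets) auto
    then have "emeasure lborel {-1<..<1::real} = 0" by auto
    then show False by simp
  qed
  moreover have "bump_mass \<ge> 0" unfolding bump_mass_def by (intro integral_nonneg_AE AE_I2 bump_nonneg)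
  ultimately show ?thesis by simp
qed

text \<open>A product of two bumps, scaled to integral one. Its support is the square of half side
  \<open>t\<close>, for which the ball of radius \<open>2 * t\<close> is a convenient bound.\<close>

definition eta :: "real \<Rightarrow> real \<times> real \<Rightarrow> real" where
  "eta t p = bump (fst p / t) * bump (snd p / t) / (t * bump_mass)\<^sup>2"

lemma eta_nonneg: "eta t p \<ge> 0"
  by (simp add: eta_def bump_nonneg)

lemma eta_even: "eta t (- p) = eta t p"
  by (simp add: eta_def bump_even minus_divide_left[symmetric] del: minus_divide_left)

lemma eta_sym: "eta t (x - y) = eta t (y - x)"
  using eta_even[of t "x - y"] by simp

lemma eta_supp: assumes "t > 0" "eta t p \<noteq> 0" shows "norm p \<le> 2 * t"
proof -
  have "bump (fst p / t) \<noteq> 0" "bump (snd p / t) \<noteq> 0" using assms by (auto simp: eta_def)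
  then have "\<bar>fst p / t\<bar> < 1" "\<bar>snd p / t\<bar> < 1" using bump_zero by (meson not_le)+
  then have "\<bar>fst p\<bar> < t" "\<bar>snd p\<bar> < t" using assms by (auto simp: abs_divide)
  then show ?thesis using norm_Pair_le[of "fst p" "snd p"] by simp
qed

lemma eta_Ck: "Ck_plane n (\<lambda>p. eta t (x + m *\<^sub>R p))"
proof -
  have "Ck_plane n (\<lambda>p. (bump (fst x / t + (m / t) * fst p) * (1 / (t * bump_mass)\<^sup>2)) * bump (snd x / t + (m / t) * snd p))"
    by (rule Ck_plane_tensor[OF Ck_line_mult[OF Ck_line_affine[OF bump_smooth, of n "fst x / t" "m / t"] Ck_line_const]
          Ck_line_affine[OF bump_smooth, of n "snd x / t" "m / t"]])
  moreover have "(\<lambda>p. eta t (x + m *\<^sub>R p)) = (\<lambda>p. (bump (fst x / t + (m / t) * fst p) * (1 / (t * bump_mass)\<^sup>2)) * bump (snd x / t + (m / t) * snd p))"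
    by (auto simp: eta_def fun_eq_iff add_divide_distrib)
  ultimately show ?thesis by simp
qed

lemma eta_test: "t > 0 \<Longrightarrow> eta t \<in> test_functions UNIV"
proof -
  assume t: "t > 0"
  have "compact_support_in UNIV (eta t)"
  proof (rule compact_support_inI[of "cball 0 (2 * t)"])
    show "eta t p = 0" if "p \<notin> cball 0 (2 * t)" for p using eta_supp[OF t, of p] that by auto
  qed auto
  then show ?thesis using eta_Ck[of _ t 0 1] by (simp add: test_functions_def)
qed

lemma eta_shift_test:
  assumes "t > 0" "cball x (2 * t) \<subseteq> U" shows "(\<lambda>y. eta t (x - y)) \<in> test_functions U"
proof -
  have "compact_support_in U (\<lambda>y. eta t (x - y))"
  proof (rule compact_support_inI[of "cball x (2 * t)"])
    show "eta t (x - p) = 0" if "p \<notin> cball x (2 * t)" for p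
      using eta_supp[OF assms(1), of "x - p"] that by (auto simp: dist_norm)
  qed (use assms in auto)
  then show ?thesis using eta_Ck[of _ t x "-1"] by (simp add: test_functions_def)
qed

lemma eta_shift_partial:
  assumes "t > 0"
  shows "partial_x (\<lambda>y. eta t (x - y)) = (\<lambda>y. - partial_x (eta t) (x - y))"
    "partial_y (\<lambda>y. eta t (x - y)) = (\<lambda>y. - partial_y (eta t) (x - y))"
proof -
  have "has_grad (\<lambda>y. eta t (x - y)) (\<lambda>y. - partial_x (eta t) (x - y)) (\<lambda>y. - partial_y (eta t) (x - y))"
    unfolding has_grad_def
  proof
    fix y
    have "((\<lambda>y. x - y) has_derivative (\<lambda>v. - v)) (at y)" by (auto intro!: derivative_eq_intros)
    from has_derivative_compose[OF this has_gradD[OF test_grad[OF eta_test[OF assms]]]]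
    show "((\<lambda>y. eta t (x - y)) has_derivative (\<lambda>v. fst v * - partial_x (eta t) (x - y) + snd v * - partial_y (eta t) (x - y))) (at y)"
      by simp
  qed
  from has_grad_partial[OF this] show "partial_x (\<lambda>y. eta t (x - y)) = (\<lambda>y. - partial_x (eta t) (x - y))"
    "partial_y (\<lambda>y. eta t (x - y)) = (\<lambda>y. - partial_y (eta t) (x - y))" .
qed

lemma eta_measurable[measurable]: "eta t \<in> borel_measurable borel"
  using Ck_plane_cont[OF eta_Ck[of 0 t 0 1], of UNIV] by (intro borel_measurable_continuous_onI) simp

lemma eta_integral:
  assumes "t > 0" shows "(LINT p|lborel. eta t p) = 1"
proof -
  have m[measurable]: "bump \<in> borel_measurable borel" using bump_cont by (rule borel_measurable_continuous_onI)
  have i: "integrable lborel (\<lambda>x. bump (x / t))"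
    using lborel_integrable_real_affine[OF bump_integrable, of "1/t" 0] assms by simp
  have I: "(LINT x|lborel. bump (x / t)) = t * bump_mass"
    unfolding bump_mass_def using lborel_integral_real_affine[of "1/t" bump 0] assms by (simp add: field_simps)
  have int: "integrable lborel (eta t)" using test_integrable[OF eta_test[OF assms]] .
  have "(LINT p|lborel. eta t p) = (LINT p|(lborel \<Otimes>\<^sub>M lborel). eta t p)" by (simp add: lborel_prod)
  also have "\<dots> = (LINT x|lborel. LINT y|lborel. eta t (x, y))"
    using lborel_pair.integral_fst'[of "eta t"] int by (simp add: lborel_prod)
  also have "\<dots> = (LINT x|lborel. bump (x / t) * (t * bump_mass) / (t * bump_mass)\<^sup>2)"
    by (simp add: eta_def I)
  also have "\<dots> = (t * bump_mass) * (t * bump_mass) / (t * bump_mass)\<^sup>2" by (simp add: I)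
  also have "\<dots> = 1" using assms bump_mass_pos by (simp add: power2_eq_square)
  finally show ?thesis .
qed

lemma eta_scale: assumes "t > 0" shows "eta t p = eta 1 ((1 / t) *\<^sub>R p) / t\<^sup>2"
  by (simp add: eta_def power_mult_distrib)

text \<open>The kernel at scale \<open>2 * t\<close> is bounded below on the support of the kernel
  at scale \<open>t\<close>. Hence an error estimate for mollified gradients is again a
  mollification, which converges almost everywhere.\<close>

lemma eta_grad_bound:
  obtains C where "C > 0" "\<And>t p. t > 0 \<Longrightarrow> \<bar>partial_x (eta t) p\<bar> \<le> C / t * eta (2 * t) p"
    "\<And>t p. t > 0 \<Longrightarrow> \<bar>partial_y (eta t) p\<bar> \<le> C / t * eta (2 * t) p"
proof -
  have t1: "eta 1 \<in> test_functions UNIV" by (rule eta_test) simp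
  obtain C1 where C1: "C1 > 0" "\<And>p. \<bar>partial_x (eta 1) p\<bar> \<le> C1" using test_bounded[OF test_partial(1)[OF t1]] by metis
  obtain C2 where C2: "C2 > 0" "\<And>p. \<bar>partial_y (eta 1) p\<bar> \<le> C2" using test_bounded[OF test_partial(2)[OF t1]] by metis
  have "continuous_on (cbox (-1,-1) (1::real,1::real)) (eta 2)" by (rule test_cont[OF eta_test]) simp
  moreover have "(0,0) \<in> cbox (-1,-1) (1::real,1::real)" by (simp add: cbox_Pair_iff)
  ultimately have "\<exists>x\<in>cbox (-1,-1) (1::real,1::real). \<forall>y\<in>cbox (-1,-1) (1::real,1::real). eta 2 x \<le> eta 2 y"
    using continuous_attains_inf[of "cbox (-1,-1) (1::real,1::real)" "eta 2"] compact_cbox by (metis empty_iff)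
  then obtain p0 where p0: "p0 \<in> cbox (-1,-1) (1::real,1::real)" "\<And>p. p \<in> cbox (-1,-1) (1,1) \<Longrightarrow> eta 2 p0 \<le> eta 2 p"
    by metis
  define m where "m = eta 2 p0"
  have "\<bar>fst p0\<bar> \<le> 1" "\<bar>snd p0\<bar> \<le> 1" using p0(1) by (cases p0; auto simp: cbox_Pair_iff)+
  then have m: "m > 0" unfolding m_def eta_def using bump_mass_pos by (intro divide_pos_pos mult_pos_pos) (auto simp: bump_pos)
  define C where "C = (C1 + C2) / m"
  have C: "C > 0" using C1 C2 m by (simp add: C_def)
  have z: "eta 1 p = 0" if "p \<notin> cbox (-1,-1) (1,1)" for p
  proof (rule ccontr)
    assume "eta 1 p \<noteq> 0"
    then have "\<bar>fst p\<bar> < 1" "\<bar>snd p\<bar> < 1" using bump_zero[of "fst p"] bump_zero[of "snd p"] by (auto simp: eta_def not_le[symmetric])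
    then show False using that by (cases p) (auto simp: cbox_Pair_iff)
  qed
  have z': "partial_x (eta 1) p = 0" "partial_y (eta 1) p = 0" if "p \<notin> cbox (-1,-1) (1,1)" for p
    by (rule has_grad_zero_outside[OF test_grad[OF t1] closed_cbox z that]; assumption)+
  have B: "\<bar>partial_x (eta 1) p\<bar> \<le> C * eta 2 p" "\<bar>partial_y (eta 1) p\<bar> \<le> C * eta 2 p" for p
  proof -
    have *: "C1 + C2 \<le> C * eta 2 p" if "p \<in> cbox (-1,-1) (1,1)"
    proof -
      have "(C1 + C2) / m * m \<le> C * eta 2 p" unfolding C_def m_def
        by (intro mult_left_mono p0(2)[OF that]) (use m C1(1) C2(1) in \<open>auto simp: m_def\<close>)
      then show ?thesis using m by simp
    qed
    have "0 \<le> C * eta 2 p" using C eta_nonneg by simp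
    then show "\<bar>partial_x (eta 1) p\<bar> \<le> C * eta 2 p" "\<bar>partial_y (eta 1) p\<bar> \<le> C * eta 2 p"
      using * C1(1) C2(1) C1(2)[of p] C2(2)[of p] z'[of p] by (cases "p \<in> cbox (-1,-1) (1,1)"; linarith)+
  qed
  have S: "partial_x (eta t) p = partial_x (eta 1) ((1/t) *\<^sub>R p) / t^3" "partial_y (eta t) p = partial_y (eta 1) ((1/t) *\<^sub>R p) / t^3"
    if t: "t > 0" for t p
  proof -
    have "has_grad (eta t) (\<lambda>p. partial_x (eta 1) ((1/t) *\<^sub>R p) / t^3) (\<lambda>p. partial_y (eta 1) ((1/t) *\<^sub>R p) / t^3)"
      unfolding has_grad_def
    proof
      fix p :: "real \<times> real"
      have "((\<lambda>p. (1/t) *\<^sub>R p) has_derivative (\<lambda>v. (1/t) *\<^sub>R v)) (at p)" by (auto intro!: derivative_eq_intros)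
      from has_derivative_compose[OF this has_gradD[OF test_grad[OF t1]]]
      have "((\<lambda>p. eta 1 ((1/t) *\<^sub>R p) / t\<^sup>2) has_derivative (\<lambda>v. (fst ((1/t) *\<^sub>R v) * partial_x (eta 1) ((1/t) *\<^sub>R p) + snd ((1/t) *\<^sub>R v) * partial_y (eta 1) ((1/t) *\<^sub>R p)) / t\<^sup>2)) (at p)"
        by (rule bounded_linear.has_derivative[OF bounded_linear_divide])
      moreover have e: "(\<lambda>p. eta 1 ((1/t) *\<^sub>R p) / t\<^sup>2) = eta t" using eta_scale[OF t] by (intro ext) simp
      ultimately have "(eta t has_derivative (\<lambda>v. (fst ((1/t) *\<^sub>R v) * partial_x (eta 1) ((1/t) *\<^sub>R p) + snd ((1/t) *\<^sub>R v) * partial_y (eta 1) ((1/t) *\<^sub>R p)) / t\<^sup>2)) (at p)"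
        by (simp only: e)
      then show "(eta t has_derivative (\<lambda>v. fst v * (partial_x (eta 1) ((1/t) *\<^sub>R p) / t^3) + snd v * (partial_y (eta 1) ((1/t) *\<^sub>R p) / t^3))) (at p)"
        by (rule has_derivative_eq_rhs) (simp add: fun_eq_iff power2_eq_square power3_eq_cube add_divide_distrib mult_ac)
    qed
    from has_grad_partial[OF this] show "partial_x (eta t) p = partial_x (eta 1) ((1/t) *\<^sub>R p) / t^3" "partial_y (eta t) p = partial_y (eta 1) ((1/t) *\<^sub>R p) / t^3" by simp_all
  qed
  have E: "C * eta 2 ((1/t) *\<^sub>R p) / t^3 = C / t * eta (2 * t) p" if "t > 0" for t p
    using that by (simp add: eta_def field_simps power2_eq_square power3_eq_cube)
  show ?thesis
  proof (rule that[OF C])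
    fix t :: real and p assume t: "t > 0"
    show "\<bar>partial_x (eta t) p\<bar> \<le> C / t * eta (2 * t) p"
      unfolding E[OF t, symmetric] S[OF t] using B(1)[of "(1/t) *\<^sub>R p"] t by (simp add: divide_right_mono)
    show "\<bar>partial_y (eta t) p\<bar> \<le> C / t * eta (2 * t) p"
      unfolding E[OF t, symmetric] S[OF t] using B(2)[of "(1/t) *\<^sub>R p"] t by (simp add: divide_right_mono)
  qed
qed

section \<open>Mollification in \<open>L\<^sup>1\<close>\<close>

lemma eta_integrable: "t > 0 \<Longrightarrow> integrable lborel (eta t)"
  by (rule test_integrable[OF eta_test])

lemma eta_bounded: assumes "t > 0" obtains C where "C > 0" "\<And>p. \<bar>eta t p\<bar> \<le> C"
  using test_bounded[OF eta_test[OF assms]] by metis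

lemma integrable_translation:
  fixes f :: "real \<times> real \<Rightarrow> real"
  assumes "integrable lborel f" shows "integrable lborel (\<lambda>p. f (c + p))"
  using assms by (subst (asm) lborel_distr_plus[of c, symmetric], subst (asm) integrable_distr_eq) auto

lemma eta_shift_integral:
  assumes "t > 0"
  shows "(LINT x|lborel. eta t (x - y)) = 1" "integrable lborel (\<lambda>x. eta t (x - y))"
    "(LINT y|lborel. eta t (x - y)) = 1" "integrable lborel (\<lambda>y. eta t (x - y))"
proof -
  have *: "eta t (x - y) = eta t (- y + x)" for x y by simp
  show 1: "(LINT x|lborel. eta t (x - y)) = 1" for y
    unfolding * using integral_translation[of "eta t" "- y"] eta_integral[OF assms] by simp
  show 2: "integrable lborel (\<lambda>x. eta t (x - y))" for y
    unfolding * by (rule integrable_translation[OF eta_integrable[OF assms]])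
  show "(LINT y|lborel. eta t (x - y)) = 1" "integrable lborel (\<lambda>y. eta t (x - y))"
    using 1[of x] 2[of x] by (simp_all add: eta_sym[of t x])
qed

lemma conv_eta_integrable:
  assumes "integrable lborel h" "t > 0" shows "integrable lborel (\<lambda>y. h y * eta t (x - y))"
  using conv_integrable[OF assms(1) eta_measurable] eta_bounded[OF assms(2)] by metis

lemma conv_eta_L1:
  assumes h: "integrable lborel h" and t: "t > 0"
  shows "integrable lborel (conv h (eta t))" "(LINT x|lborel. \<bar>conv h (eta t) x\<bar>) \<le> (LINT x|lborel. \<bar>h x\<bar>)"
proof -
  have [measurable]: "h \<in> borel_measurable borel" using h by auto
  have i: "integrable (lborel \<Otimes>\<^sub>M lborel) (\<lambda>(y, x). f y * eta t (x - y))"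
    if f: "integrable lborel f" for f :: "real \<times> real \<Rightarrow> real"
  proof (rule lborel_pair.Fubini_integrable)
    have [measurable]: "f \<in> borel_measurable borel" using f by auto
    show "(\<lambda>(y, x). f y * eta t (x - y)) \<in> borel_measurable (lborel \<Otimes>\<^sub>M lborel)" by measurable
    have "(LINT x|lborel. norm (case (y, x) of (y, x) \<Rightarrow> f y * eta t (x - y))) = \<bar>f y\<bar>" for y
      using eta_shift_integral(1)[OF t, of y] by (simp add: abs_mult eta_nonneg)
    then show "integrable lborel (\<lambda>y. LINT x|lborel. norm (case (y, x) of (y, x) \<Rightarrow> f y * eta t (x - y)))"
      using f by simp
    show "AE y in lborel. integrable lborel (\<lambda>x. case (y, x) of (y, x) \<Rightarrow> f y * eta t (x - y))"
      using eta_shift_integral(2)[OF t] by (intro AE_I2) simp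
  qed
  show ci: "integrable lborel (conv h (eta t))"
    using lborel_pair.integrable_snd[OF i[OF h]] by (simp add: conv_def[abs_def])
  have ha: "integrable lborel (\<lambda>y. \<bar>h y\<bar>)" using h by simp
  have "(LINT x|lborel. \<bar>conv h (eta t) x\<bar>) \<le> (LINT x|lborel. LINT y|lborel. \<bar>h y\<bar> * eta t (x - y))"
  proof (rule integral_mono)
    show "integrable lborel (\<lambda>x. \<bar>conv h (eta t) x\<bar>)" using ci by simp
    show "integrable lborel (\<lambda>x. LINT y|lborel. \<bar>h y\<bar> * eta t (x - y))"
      using lborel_pair.integrable_snd[OF i[OF ha]] by simp
    show "\<bar>conv h (eta t) x\<bar> \<le> (LINT y|lborel. \<bar>h y\<bar> * eta t (x - y))" for x
      unfolding conv_def using integral_abs_bound[of lborel "\<lambda>y. h y * eta t (x - y)"]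
      by (simp add: abs_mult eta_nonneg)
  qed
  also have "\<dots> = (LINT y|lborel. LINT x|lborel. \<bar>h y\<bar> * eta t (x - y))"
    using lborel_pair.Fubini_integral[OF i[OF ha]] by simp
  also have "\<dots> = (LINT y|lborel. \<bar>h y\<bar>)" using eta_shift_integral(1)[OF t] by simp
  finally show "(LINT x|lborel. \<bar>conv h (eta t) x\<bar>) \<le> (LINT x|lborel. \<bar>h x\<bar>)" .
qed

lemma conv_diff:
  assumes "integrable lborel h" "integrable lborel g" "t > 0"
  shows "conv (\<lambda>x. h x - g x) (eta t) x = conv h (eta t) x - conv g (eta t) x"
  using conv_eta_integrable[OF assms(1,3), of x] conv_eta_integrable[OF assms(2,3), of x]
  by (simp add: conv_def left_diff_distrib)

text \<open>Mollification is a contraction of \<open>L\<^sup>1\<close>, so it suffices to treat a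
  continuous approximation of \<open>h\<close>, for which the convergence is uniform on compact
  sets.\<close>

lemma mollify_L1:
  assumes h: "integrable lborel h" and W: "bounded W" "W \<in> sets borel" and e: "e > 0"
  shows "\<exists>t0>0. \<forall>t. 0 < t \<and> t < t0 \<longrightarrow> (LINT x|lborel. indicator W x * \<bar>conv h (eta t) x - h x\<bar>) < e"
proof -
  obtain g where g: "continuous_on UNIV g" "integrable lborel g" "(LINT x|lborel. \<bar>h x - g x\<bar>) < e / 3"
    using L1_approx_continuous[OF h, of "e/3"] e by auto
  obtain R where R: "R > 0" "W \<subseteq> cball 0 R" using W(1) by (auto simp: bounded_pos subset_iff)
  define V where "V = measure lborel W"
  have Wfin: "emeasure lborel W < \<infinity>" using emeasure_bounded_finite[OF W(1)] by simp
  have V: "V \<ge> 0" by (simp add: V_def)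
  define e' where "e' = e / (3 * (V + 1))"
  have e': "e' > 0" "V * e' < e / 3"
  proof -
    show "e' > 0" using e V by (simp add: e'_def)
    then have "V * e' < (V + 1) * e'" by simp
    also have "\<dots> = e / 3" using V by (simp add: e'_def field_simps)
    finally show "V * e' < e / 3" .
  qed
  have "uniformly_continuous_on (cball 0 (R + 2)) g"
    using g(1) by (intro compact_uniformly_continuous) (auto intro: continuous_on_subset)
  then obtain d where d: "d > 0" "\<And>x y. x \<in> cball 0 (R+2) \<Longrightarrow> y \<in> cball 0 (R+2) \<Longrightarrow> dist y x < d \<Longrightarrow> dist (g y) (g x) < e'"
    using e'(1) unfolding uniformly_continuous_on_def by metis
  show ?thesis
  proof (intro exI[of _ "min 1 (d / 2)"] conjI allI impI)
    show "0 < min 1 (d / 2)" using d by simp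
    fix t assume t: "0 < t \<and> t < min 1 (d / 2)"
    then have t0: "t > 0" by simp
    have gx: "\<bar>conv g (eta t) x - g x\<bar> \<le> e'" if x: "x \<in> W" for x
    proof -
      have "conv g (eta t) x - g x = (LINT y|lborel. g y * eta t (x - y)) - (LINT y|lborel. g x * eta t (x - y))"
        using eta_shift_integral(3)[OF t0] by (simp add: conv_def)
      also have "\<dots> = (LINT y|lborel. (g y - g x) * eta t (x - y))"
        using conv_eta_integrable[OF g(2) t0] eta_shift_integral(4)[OF t0]
        by (subst Bochner_Integration.integral_diff[symmetric]) (auto simp: left_diff_distrib)
      finally have "\<bar>conv g (eta t) x - g x\<bar> \<le> (LINT y|lborel. \<bar>(g y - g x) * eta t (x - y)\<bar>)"
        using integral_abs_bound[of lborel "\<lambda>y. (g y - g x) * eta t (x - y)"] by simp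
      also have "\<dots> \<le> (LINT y|lborel. e' * eta t (x - y))"
      proof (rule integral_mono)
        have "integrable lborel (\<lambda>y. g y * eta t (x - y) - g x * eta t (x - y))"
          using conv_eta_integrable[OF g(2) t0] eta_shift_integral(4)[OF t0] by (intro Bochner_Integration.integrable_diff) auto
        then show "integrable lborel (\<lambda>y. \<bar>(g y - g x) * eta t (x - y)\<bar>)" by (simp add: left_diff_distrib)
        show "integrable lborel (\<lambda>y. e' * eta t (x - y))" using eta_shift_integral(4)[OF t0] by simp
        fix y
        show "\<bar>(g y - g x) * eta t (x - y)\<bar> \<le> e' * eta t (x - y)"
        proof (cases "eta t (x - y) = 0")
          case False
          then have n: "norm (x - y) \<le> 2 * t" by (rule eta_supp[OF t0])
          have "norm x \<le> R" using x R(2) by auto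
          moreover have "norm y \<le> norm x + norm (x - y)" using norm_triangle_sub[of y x] by (simp add: norm_minus_commute)
          ultimately have "\<bar>g y - g x\<bar> \<le> e'" using d(2)[of x y] n t by (auto simp: dist_norm norm_minus_commute)
          then show ?thesis by (simp add: abs_mult eta_nonneg mult_right_mono)
        qed simp
      qed
      also have "\<dots> = e'" using eta_shift_integral(3)[OF t0] by simp
      finally show ?thesis .
    qed
    have hg: "integrable lborel (\<lambda>x. h x - g x)" using h g by simp
    have [measurable]: "h \<in> borel_measurable borel" "g \<in> borel_measurable borel"
      "conv h (eta t) \<in> borel_measurable borel" "conv g (eta t) \<in> borel_measurable borel" "W \<in> sets borel"
      using h g conv_eta_L1(1)[OF h t0] conv_eta_L1(1)[OF g(2) t0] W by auto
    have iW: "integrable lborel (indicator W :: _ \<Rightarrow> real)" using Wfin by simp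
    have i1: "integrable lborel (\<lambda>x. \<bar>conv (\<lambda>x. h x - g x) (eta t) x\<bar>)" using conv_eta_L1(1)[OF hg t0] by simp
    have "(LINT x|lborel. indicator W x * \<bar>conv h (eta t) x - h x\<bar>)
      \<le> (LINT x|lborel. \<bar>conv (\<lambda>x. h x - g x) (eta t) x\<bar> + \<bar>h x - g x\<bar> + e' * indicator W x)"
    proof (rule integral_mono')
      show "integrable lborel (\<lambda>x. \<bar>conv (\<lambda>x. h x - g x) (eta t) x\<bar> + \<bar>h x - g x\<bar> + e' * indicator W x)"
        using i1 hg iW by simp
      fix x
      show "indicator W x * \<bar>conv h (eta t) x - h x\<bar>
        \<le> \<bar>conv (\<lambda>x. h x - g x) (eta t) x\<bar> + \<bar>h x - g x\<bar> + e' * indicator W x"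
      proof (cases "x \<in> W")
        case True then show ?thesis using gx[OF True] unfolding conv_diff[OF h g(2) t0] by auto
      qed auto
      show "0 \<le> \<bar>conv (\<lambda>x. h x - g x) (eta t) x\<bar> + \<bar>h x - g x\<bar> + e' * indicator W x" using e' by simp
    qed
    also have "\<dots> = (LINT x|lborel. \<bar>conv (\<lambda>x. h x - g x) (eta t) x\<bar>) + (LINT x|lborel. \<bar>h x - g x\<bar>) + e' * V"
      using i1 hg iW by (simp add: V_def)
    also have "\<dots> < e / 3 + e / 3 + e / 3"
      using conv_eta_L1(2)[OF hg t0] g(3) e'(2) by (simp add: mult.commute)
    finally show "(LINT x|lborel. indicator W x * \<bar>conv h (eta t) x - h x\<bar>) < e" by simp
  qed
qed

lemma compact_in_open_thickening:
  fixes K U :: "'a::heine_borel set"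
  assumes "compact K" "open U" "K \<subseteq> U"
  obtains r where "r > 0" "\<And>x. x \<in> K \<Longrightarrow> cball x r \<subseteq> U"
proof (cases "K = {} \<or> U = UNIV")
  case False
  then have "setdist K (- U) > 0" using assms
    by (subst setdist_gt_0_compact_closed) auto
  then show ?thesis
  proof (intro that[of "setdist K (- U) / 2"])
    fix x assume x: "x \<in> K"
    show "cball x (setdist K (- U) / 2) \<subseteq> U"
    proof
      fix y assume y: "y \<in> cball x (setdist K (- U) / 2)"
      show "y \<in> U"
      proof (rule ccontr)
        assume "y \<notin> U"
        then have "setdist K (- U) \<le> dist x y" using x by (intro setdist_le_dist) auto
        with y \<open>setdist K (- U) > 0\<close> show False by auto
      qed
    qed
  qed simp
qed (use that[of 1] in auto)

text \<open>Translates of the mollifier are test functions, so all mollifications of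
  \<open>g\<close> with small parameter vanish on a compact subset, while they converge to
  \<open>g\<close> in the mean.\<close>

lemma fundamental_lemma:
  assumes U: "open U" and g: "integrable lborel g" and z: "\<And>\<theta>. \<theta> \<in> test_functions U \<Longrightarrow> (LINT p|lborel. g p * \<theta> p) = 0"
  shows "AE x in lborel. x \<in> U \<longrightarrow> g x = 0"
proof -
  obtain D where D: "countable D" "\<And>X. X \<in> D \<Longrightarrow> X \<subseteq> U \<and> (\<exists>a b. X = cbox a b)" "\<Union>D = U"
  proof -
    obtain D where "countable D" "D \<subseteq> Pow U" "\<And>X. X \<in> D \<Longrightarrow> \<exists>a b. X = cbox a b" "\<Union>D = U"
      using open_countable_Union_open_cbox[OF U] by metis
    then show ?thesis by (intro that[of D]) auto
  qed
  have "AE x in lborel. x \<in> K \<longrightarrow> g x = 0" if "K \<in> D" for K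
  proof -
    have K: "compact K" "K \<subseteq> U" using D(2)[OF that] by auto
    obtain r where r: "r > 0" "\<And>x. x \<in> K \<Longrightarrow> cball x r \<subseteq> U" using compact_in_open_thickening[OF K(1) U K(2)] by metis
    have Ks: "K \<in> sets borel" "bounded K" using K by (auto simp: compact_imp_bounded compact_imp_closed borel_closed)
    have i: "integrable lborel (\<lambda>x. indicator K x * \<bar>g x\<bar>)"
      using integrable_mult_indicator[of K lborel "\<lambda>x. \<bar>g x\<bar>"] g Ks by simp
    have "(LINT x|lborel. indicator K x * \<bar>g x\<bar>) < e" if e: "e > 0" for e
    proof -
      obtain t0 where t0: "t0 > 0" "\<And>t. 0 < t \<Longrightarrow> t < t0 \<Longrightarrow> (LINT x|lborel. indicator K x * \<bar>conv g (eta t) x - g x\<bar>) < e"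
        using mollify_L1[OF g Ks(2,1) e] by auto
      define t where "t = min (t0 / 2) (r / 2)"
      have t: "0 < t" "t < t0" "2 * t \<le> r" using t0 r by (auto simp: t_def)
      have "conv g (eta t) x = 0" if x: "x \<in> K" for x
      proof -
        have "(\<lambda>y. eta t (x - y)) \<in> test_functions U"
        proof (rule eta_shift_test[OF t(1)])
          show "cball x (2 * t) \<subseteq> U" using r(2)[OF x] t(3) by (meson order_trans subset_cball)
        qed
        from z[OF this] show ?thesis by (simp add: conv_def)
      qed
      then have eq: "indicator K x * \<bar>conv g (eta t) x - g x\<bar> = indicator K x * \<bar>g x\<bar>" for x by (simp add: indicator_def)
      show ?thesis using t0(2)[OF t(1,2)] unfolding eq .
    qed
    then have "(LINT x|lborel. indicator K x * \<bar>g x\<bar>) \<le> 0" by (meson not_le less_irrefl)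
    moreover have "(LINT x|lborel. indicator K x * \<bar>g x\<bar>) \<ge> 0" by (intro integral_nonneg_AE) auto
    ultimately have "AE x in lborel. indicator K x * \<bar>g x\<bar> = 0"
      using i by (subst integral_nonneg_eq_0_iff_AE[symmetric]) auto
    then show ?thesis by eventually_elim (auto simp: indicator_def split: if_splits)
  qed
  then have "AE x in lborel. \<forall>K\<in>D. x \<in> K \<longrightarrow> g x = 0" using D(1) by (subst AE_ball_countable) auto
  then show ?thesis by eventually_elim (use D(3) in auto)
qed

section \<open>Test functions and precompactness in \<open>W\<^sup>-\<^sup>1\<^sup>,\<^sup>2\<close>\<close>

lemma LINT_lebesgue_on_open:
  fixes F :: "real \<times> real \<Rightarrow> real"
  assumes "open U" "F \<in> borel_measurable borel"
  shows "(LINT p|lebesgue_on U. F p) = (LINT p|lborel. indicator U p * F p)"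
proof -
  have [measurable]: "U \<in> sets borel" using assms by simp
  have "(LINT p|lebesgue_on U. F p) = (LINT p|lebesgue. indicator U p *\<^sub>R F p)"
    by (rule integral_restrict_space) (use assms in auto)
  also have "\<dots> = (LINT p|lborel. indicator U p *\<^sub>R F p)"
    by (rule integral_completion) (use assms in measurable)
  finally show ?thesis by simp
qed

lemma test_zero_outside: "\<phi> \<in> test_functions U \<Longrightarrow> p \<notin> U \<Longrightarrow> \<phi> p = 0"
  by (metis subsetD test_supportE)

lemma LINT_lebesgue_on_test:
  fixes F :: "real \<times> real \<Rightarrow> real"
  assumes "open U" "F \<in> borel_measurable borel" "\<And>p. p \<notin> U \<Longrightarrow> F p = 0"
  shows "(LINT p|lebesgue_on U. F p) = (LINT p|lborel. F p)"
  unfolding LINT_lebesgue_on_open[OF assms(1,2)]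
  by (rule Bochner_Integration.integral_cong) (auto simp: indicator_def assms(3))

definition test_inner :: "(real \<times> real \<Rightarrow> real) \<Rightarrow> (real \<times> real \<Rightarrow> real) \<Rightarrow> real" where
  "test_inner \<phi> \<psi> = (LINT p|lborel. \<phi> p * \<psi> p + partial_x \<phi> p * partial_x \<psi> p + partial_y \<phi> p * partial_y \<psi> p)"

text \<open>The \<open>W\<^sup>1\<^sup>,\<^sup>2\<close> norm in terms of classical derivatives, as
  an integral over the whole plane: it does not refer to the domain.\<close>

definition test_norm :: "(real \<times> real \<Rightarrow> real) \<Rightarrow> real" where
  "test_norm \<phi> = sqrt (test_inner \<phi> \<phi>)"

lemma test_mult_integrable:
  assumes "\<phi> \<in> test_functions U" "\<psi> \<in> test_functions V"
  shows "integrable lborel (\<lambda>p. \<phi> p * \<psi> p)"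
proof -
  obtain C where "\<And>p. \<bar>\<psi> p\<bar> \<le> C" using test_bounded[OF assms(2)] by metis
  then show ?thesis
    by (intro Bochner_Integration.integrable_bound[OF integrable_mult_left[OF test_integrable[OF assms(1)], of C]])
      (use test_measurable[OF assms(1)] test_measurable[OF assms(2)] in \<open>auto simp: abs_mult intro!: AE_I2 mult_left_mono intro: order_trans[OF _ abs_ge_self]\<close>)
qed

lemma test_by_parts:
  assumes "\<phi> \<in> test_functions U" "\<theta> \<in> test_functions V"
  shows "(LINT p|lborel. \<phi> p * partial_x \<theta> p) = - (LINT p|lborel. partial_x \<phi> p * \<theta> p)"
    "(LINT p|lborel. \<phi> p * partial_y \<theta> p) = - (LINT p|lborel. partial_y \<phi> p * \<theta> p)"
proof -
  note t = test_cont[OF assms(1)] test_cont[OF assms(2)] test_cont[OF test_partial(1)[OF assms(1)]]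
    test_cont[OF test_partial(2)[OF assms(1)]] test_cont[OF test_partial(1)[OF assms(2)]] test_cont[OF test_partial(2)[OF assms(2)]]
  obtain K where K: "compact K" "\<And>p. p \<notin> K \<Longrightarrow> \<phi> p = 0" using test_supportE[OF assms(1)] by metis
  have g: "has_grad (\<lambda>p. \<phi> p * \<theta> p) (\<lambda>p. \<phi> p * partial_x \<theta> p + partial_x \<phi> p * \<theta> p) (\<lambda>p. \<phi> p * partial_y \<theta> p + partial_y \<phi> p * \<theta> p)"
    unfolding has_grad_def
  proof
    fix p
    show "((\<lambda>p. \<phi> p * \<theta> p) has_derivative (\<lambda>v. fst v * (\<phi> p * partial_x \<theta> p + partial_x \<phi> p * \<theta> p) + snd v * (\<phi> p * partial_y \<theta> p + partial_y \<phi> p * \<theta> p))) (at p)"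
      by (rule has_derivative_eq_rhs[OF has_derivative_mult[OF has_gradD[OF test_grad[OF assms(1)]] has_gradD[OF test_grad[OF assms(2)]]]])
        (simp add: fun_eq_iff algebra_simps)
  qed
  have z: "\<phi> p * \<theta> p = 0" if "p \<notin> K" for p using K(2)[OF that] by simp
  note * = integral_partial_zero[OF g _ _ K(1) z]
  note i = test_mult_integrable[OF assms(1) test_partial(1)[OF assms(2)]] test_mult_integrable[OF assms(1) test_partial(2)[OF assms(2)]]
    test_mult_integrable[OF test_partial(1)[OF assms(1)] assms(2)] test_mult_integrable[OF test_partial(2)[OF assms(1)] assms(2)]
  have "(LINT p|lborel. \<phi> p * partial_x \<theta> p + partial_x \<phi> p * \<theta> p) = 0" by (rule *(1)) (intro continuous_intros t)+
  then show "(LINT p|lborel. \<phi> p * partial_x \<theta> p) = - (LINT p|lborel. partial_x \<phi> p * \<theta> p)" using i by simp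
  have "(LINT p|lborel. \<phi> p * partial_y \<theta> p + partial_y \<phi> p * \<theta> p) = 0" by (rule *(2)) (intro continuous_intros t)+
  then show "(LINT p|lborel. \<phi> p * partial_y \<theta> p) = - (LINT p|lborel. partial_y \<phi> p * \<theta> p)" using i by simp
qed

lemma test_L2:
  assumes "open U" "\<phi> \<in> test_functions U" shows "\<phi> \<in> L2_on U"
proof -
  have "integrable lborel (\<lambda>p. (\<phi> p)\<^sup>2)" using test_mult_integrable[OF assms(2,2)] by (simp add: power2_eq_square)
  then have "integrable lebesgue (\<lambda>p. (\<phi> p)\<^sup>2)" using test_measurable[OF assms(2)] by (subst integrable_completion) auto
  moreover have "U \<in> sets lebesgue" using assms(1) by (simp add: borel_open)
  ultimately have "integrable (lebesgue_on U) (\<lambda>p. (\<phi> p)\<^sup>2)" 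
    using integrable_mult_indicator[of U lebesgue "\<lambda>p. (\<phi> p)\<^sup>2"] by (subst integrable_restrict_space) auto
  moreover have "\<phi> \<in> borel_measurable (lebesgue_on U)"
    using test_measurable[OF assms(2)] by (simp add: measurable_restrict_space1 measurable_completion)
  ultimately show ?thesis by (simp add: L2_on_def)
qed

lemma test_weak_partial:
  assumes "open U" "\<phi> \<in> test_functions U"
  shows "is_weak_partial U (1,0) \<phi> (partial_x \<phi>)" "is_weak_partial U (0,1) \<phi> (partial_y \<phi>)"
proof -
  have m: "(\<lambda>p. f p * g p) \<in> borel_measurable borel" if "f \<in> test_functions U" "g \<in> test_functions U" for f g
    using test_measurable[OF that(1)] test_measurable[OF that(2)] by simp
  have eq: "(LINT p|lebesgue_on U. f p * g p) = (LINT p|lborel. f p * g p)" if "f \<in> test_functions U" "g \<in> test_functions U" for f g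
    by (rule LINT_lebesgue_on_test[OF assms(1) m[OF that]]) (simp add: test_zero_outside[OF that(1)])
  show "is_weak_partial U (1,0) \<phi> (partial_x \<phi>)" "is_weak_partial U (0,1) \<phi> (partial_y \<phi>)"
    unfolding is_weak_partial_def distr_partial_def
    using assms test_partial eq test_by_parts by auto
qed

text \<open>The weak derivative is a choice; the fundamental lemma identifies it with any classical
  one.\<close>

lemma weak_partial_AE:
  assumes U: "open U" "bounded U" and \<phi>: "\<phi> \<in> test_functions U" and d: "d \<in> test_functions U"
    and e: "is_weak_partial U e \<phi> d"
  shows "AE p in lebesgue_on U. weak_partial U e \<phi> p = d p"
proof -
  define w where "w = weak_partial U e \<phi>"
  have w: "w \<in> L2_on U" "is_weak_partial U e \<phi> w"
    using someI[of "\<lambda>w. w \<in> L2_on U \<and> is_weak_partial U e \<phi> w" d] test_L2[OF U(1) d] e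
    by (auto simp: w_def weak_partial_def)
  have Us: "U \<in> sets lebesgue" "U \<in> lmeasurable" using U by (auto simp: borel_open lmeasurable_open)
  have one: "integrable (lebesgue_on U) (\<lambda>p. 1::real)"
    using Us by (subst integrable_restrict_space) (auto simp: fmeasurable_def)
  have wm: "w \<in> borel_measurable (lebesgue_on U)" using w by (simp add: L2_on_def)
  have wi: "integrable (lebesgue_on U) w"
  proof (rule Bochner_Integration.integrable_bound[where f="\<lambda>p. 1 + (w p)\<^sup>2"])
    show "integrable (lebesgue_on U) (\<lambda>p. 1 + (w p)\<^sup>2)" using w one by (auto simp: L2_on_def)
    have "\<bar>x\<bar> \<le> 1 + x\<^sup>2" for x :: real
      using zero_le_power2[of "\<bar>x\<bar> - 1/2"] by (simp add: power2_diff power_one_over)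
    then show "AE p in lebesgue_on U. norm (w p) \<le> norm (1 + (w p)\<^sup>2)" by (intro AE_I2) (simp add: abs_of_nonneg add_nonneg_nonneg)
  qed (rule wm)
  have di: "integrable (lebesgue_on U) d"
    using test_integrable[OF d] Us integrable_mult_indicator[of U lebesgue d]
    by (subst integrable_restrict_space) (simp_all add: integrable_completion test_measurable[OF d])
  define h where "h p = indicator U p * (w p - d p)" for p
  have hi: "integrable lebesgue h"
    using Bochner_Integration.integrable_diff[OF wi di] Us by (subst (asm) integrable_restrict_space) (auto simp: h_def[abs_def])
  then obtain h' where h': "h' \<in> borel_measurable lborel" "AE p in lborel. h p = h' p"
    using completion_ex_borel_measurable_real[of h lborel] by auto
  have h'i: "integrable lborel h'"
  proof -
    have "AE p in lebesgue. h p = h' p" using h'(2) by (rule AE_completion)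
    then have "integrable lebesgue h'" using hi h' by (subst integrable_cong_AE[of h' _ h]) (auto simp: measurable_completion)
    then show ?thesis using h'(1) by (subst (asm) integrable_completion) auto
  qed
  have z: "(LINT p|lborel. h' p * \<theta> p) = 0" if \<theta>: "\<theta> \<in> test_functions U" for \<theta>
  proof -
    obtain C where C: "\<And>p. \<bar>\<theta> p\<bar> \<le> C" using test_bounded[OF \<theta>] by metis
    have tm: "\<theta> \<in> borel_measurable borel" by (rule test_measurable[OF \<theta>])
    have b: "integrable (lebesgue_on U) (\<lambda>p. f p * \<theta> p)" if f: "integrable (lebesgue_on U) f" for f
    proof (rule Bochner_Integration.integrable_bound[where f="\<lambda>p. C * f p"])
      show "integrable (lebesgue_on U) (\<lambda>p. C * f p)" using f by simp
      have "\<theta> \<in> borel_measurable (lebesgue_on U)" using tm by (simp add: measurable_restrict_space1 measurable_completion)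
      then show "(\<lambda>p. f p * \<theta> p) \<in> borel_measurable (lebesgue_on U)" using f by auto
      show "AE p in lebesgue_on U. norm (f p * \<theta> p) \<le> norm (C * f p)"
        using mult_left_mono[OF C abs_ge_zero] by (intro AE_I2) (metis abs_ge_self abs_mult abs_ge_zero mult.commute mult_right_mono order_trans real_norm_def)
    qed
    have "(LINT p|lebesgue_on U. w p * \<theta> p) = (LINT p|lebesgue_on U. d p * \<theta> p)"
      using w(2) e \<theta> unfolding is_weak_partial_def by metis
    then have "0 = (LINT p|lebesgue_on U. (w p - d p) * \<theta> p)"
      using b[OF wi] b[OF di] by (simp add: left_diff_distrib)
    also have "\<dots> = (LINT p|lebesgue. indicator U p *\<^sub>R ((w p - d p) * \<theta> p))"
      by (rule integral_restrict_space) (use Us in auto)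
    also have "\<dots> = (LINT p|lebesgue. h' p * \<theta> p)"
    proof (rule integral_cong_AE)
      show "(\<lambda>p. h' p * \<theta> p) \<in> borel_measurable lebesgue" using h'(1) tm by (simp add: measurable_completion)
      have "(\<lambda>p. h p * \<theta> p) \<in> borel_measurable lebesgue" using hi tm
        by (intro borel_measurable_times) (auto simp: measurable_completion)
      then show "(\<lambda>p. indicator U p *\<^sub>R ((w p - d p) * \<theta> p)) \<in> borel_measurable lebesgue" by (simp add: h_def mult.assoc)
      show "AE p in lebesgue. indicator U p *\<^sub>R ((w p - d p) * \<theta> p) = h' p * \<theta> p"
        using AE_completion[OF h'(2)] by eventually_elim (simp add: h_def flip: mult.assoc)
    qed
    also have "\<dots> = (LINT p|lborel. h' p * \<theta> p)" by (rule integral_completion) (use h'(1) tm in auto)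
    finally show ?thesis by simp
  qed
  have "AE p in lborel. p \<in> U \<longrightarrow> h' p = 0" by (rule fundamental_lemma[OF U(1) h'i z])
  with h'(2) have "AE p in lborel. p \<in> U \<longrightarrow> w p = d p" by eventually_elim (auto simp: h_def)
  then have "AE p in lebesgue. p \<in> U \<longrightarrow> w p = d p" by (rule AE_completion)
  then show ?thesis using Us by (subst AE_restrict_space_iff) (auto simp: w_def)
qed

lemma W12_norm_test:
  assumes U: "open U" "bounded U" and \<phi>: "\<phi> \<in> test_functions U"
  shows "W12_norm U \<phi> = test_norm \<phi>"
proof -
  have sq: "(LINT p|lebesgue_on U. (f p)\<^sup>2) = (LINT p|lborel. f p * f p)" if "f \<in> test_functions U" for f
    unfolding power2_eq_square using test_measurable[OF that]
    by (intro LINT_lebesgue_on_test[OF U(1)]) (auto simp: test_zero_outside[OF that])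
  have wp: "(LINT p|lebesgue_on U. (weak_partial U e \<phi> p)\<^sup>2) = (LINT p|lborel. d p * d p)"
    if d: "d \<in> test_functions U" "is_weak_partial U e \<phi> d" for e d
  proof -
    have w: "weak_partial U e \<phi> \<in> L2_on U"
      using someI[of "\<lambda>w. w \<in> L2_on U \<and> is_weak_partial U e \<phi> w" d] test_L2[OF U(1) d(1)] d(2)
      by (auto simp: weak_partial_def)
    have "(LINT p|lebesgue_on U. (weak_partial U e \<phi> p)\<^sup>2) = (LINT p|lebesgue_on U. (d p)\<^sup>2)"
      by (rule integral_cong_AE)
        (use w test_L2[OF U(1) d(1)] weak_partial_AE[OF U \<phi> d] in \<open>auto simp: L2_on_def\<close>)
    then show ?thesis using sq[OF d(1)] by simp
  qed
  note i = test_mult_integrable[OF \<phi> \<phi>] test_mult_integrable[OF test_partial(1)[OF \<phi>] test_partial(1)[OF \<phi>]]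
    test_mult_integrable[OF test_partial(2)[OF \<phi>] test_partial(2)[OF \<phi>]]
  show ?thesis
    unfolding W12_norm_def test_norm_def test_inner_def
    using wp[OF test_partial(1)[OF \<phi>] test_weak_partial(1)[OF U(1) \<phi>]]
      wp[OF test_partial(2)[OF \<phi>] test_weak_partial(2)[OF U(1) \<phi>]] sq[OF \<phi>] i by simp
qed

lemma test_W12_0:
  assumes U: "open U" "bounded U" and \<phi>: "\<phi> \<in> test_functions U"
  shows "\<phi> \<in> W12_0 U"
proof -
  have "\<phi> \<in> W12 U" unfolding W12_def
    using test_L2[OF U(1)] test_partial[OF \<phi>] test_weak_partial[OF U(1) \<phi>] \<phi> by blast
  moreover have "W12_norm U (\<lambda>p. \<phi> p - \<phi> p) = 0"
  proof -
    have z: "(\<lambda>p. \<phi> p - \<phi> p) = (\<lambda>p. 0 * \<phi> p + 0 * \<phi> p)" by simp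
    have "W12_norm U (\<lambda>p. \<phi> p - \<phi> p) = test_norm (\<lambda>p. 0 * \<phi> p + 0 * \<phi> p)"
      unfolding z by (rule W12_norm_test[OF U test_lin[OF \<phi> \<phi>]])
    also have "\<dots> = 0" unfolding test_norm_def test_inner_def test_partial_lin[OF \<phi> \<phi>] by simp
    finally show ?thesis .
  qed
  ultimately show ?thesis unfolding W12_0_def using \<phi> by (auto intro!: exI[of _ "\<lambda>_. \<phi>"])
qed

text \<open>A sequence in a compact closure has a convergent subsequence. Its limit is eliminated in
  favour of a Cauchy estimate, which involves test functions only.\<close>

lemma precompact_subseq:
  fixes T :: "nat \<Rightarrow> (real \<times> real \<Rightarrow> real) \<Rightarrow> real" and s :: "nat \<Rightarrow> nat"
  assumes pc: "precompact_W_minus12_loc \<Omega> (range T)" and U: "open U" "bounded U" "closure U \<subseteq> \<Omega>"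
  shows "\<exists>r::nat \<Rightarrow> nat. strict_mono r \<and> (\<forall>e>0. \<exists>N. \<forall>n\<ge>N. \<forall>m\<ge>N. \<forall>\<phi>\<in>test_functions U.
    \<bar>T (s (r n)) \<phi> - T (s (r m)) \<phi>\<bar> \<le> e * test_norm \<phi>)"
proof -
  interpret Metric_space "W_minus12 U" "W_minus12_dist U" by (rule Metric_space_W_minus12)
  define S where "S = {L. \<exists>T'\<in>range T. extends_distr U T' L}"
  have ex: "\<forall>T'\<in>range T. \<exists>L. extends_distr U T' L" and comp: "compactin mtopology (mtopology closure_of S)"
    using pc U unfolding precompact_W_minus12_loc_def S_def W_minus12_topology_def by blast+
  define L where "L n = (SOME L. extends_distr U (T n) L)" for n
  have L: "extends_distr U (T n) (L n)" for n unfolding L_def using ex by (metis rangeI someI_ex)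
  have LW: "L n \<in> W_minus12 U" for n using L by (auto simp: extends_distr_def)
  have "S \<subseteq> topspace mtopology" by (auto simp: S_def extends_distr_def)
  moreover have "L n \<in> S" for n unfolding S_def using L by blast
  ultimately have "L n \<in> mtopology closure_of S" for n using closure_of_subset[of S mtopology] by blast
  then have rg: "range (\<lambda>n. L (s n)) \<subseteq> mtopology closure_of S" by auto
  obtain l r where lr: "strict_mono r" "limitin mtopology ((\<lambda>n. L (s n)) \<circ> r) l sequentially"
    using comp rg unfolding compactin_sequentially by blast
  have lW: "l \<in> W_minus12 U" using lr(2) by (simp add: limitin_metric)
  show ?thesis
  proof (intro exI[of _ r] conjI lr allI impI)
    fix e :: real assume "e > 0"
    then have "\<forall>\<^sub>F n in sequentially. L (s (r n)) \<in> W_minus12 U \<and> W_minus12_dist U (L (s (r n))) l < e / 2"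
      using lr(2) unfolding limitin_metric comp_def by (meson half_gt_zero)
    then obtain N where N: "\<And>n. n \<ge> N \<Longrightarrow> W_minus12_dist U (L (s (r n))) l < e / 2" by (auto simp: eventually_sequentially)
    show "\<exists>N. \<forall>n\<ge>N. \<forall>m\<ge>N. \<forall>\<phi>\<in>test_functions U. \<bar>T (s (r n)) \<phi> - T (s (r m)) \<phi>\<bar> \<le> e * test_norm \<phi>"
    proof (intro exI[of _ N] allI impI ballI)
      fix n m \<phi> assume nm: "n \<ge> N" "m \<ge> N" and \<phi>: "\<phi> \<in> test_functions U"
      have W: "\<phi> \<in> W12_0 U" by (rule test_W12_0[OF U(1,2) \<phi>])
      have nn: "test_norm \<phi> \<ge> 0" using W12_norm_nonneg[of U \<phi>] W12_norm_test[OF U(1,2) \<phi>] by simp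
      have *: "\<bar>T (s (r n)) \<phi> - l \<phi>\<bar> \<le> e / 2 * test_norm \<phi>" if "n \<ge> N" for n
      proof -
        have "\<bar>T (s (r n)) \<phi> - l \<phi>\<bar> \<le> W_minus12_dist U (L (s (r n))) l * test_norm \<phi>"
          using W_minus12_dist_bound(2)[OF LW lW W, of "s (r n)"] L[of "s (r n)"] \<phi> W12_norm_test[OF U(1,2) \<phi>]
          by (auto simp: extends_distr_def)
        also have "\<dots> \<le> e / 2 * test_norm \<phi>" using N[OF that] nn by (intro mult_right_mono) auto
        finally show ?thesis .
      qed
      show "\<bar>T (s (r n)) \<phi> - T (s (r m)) \<phi>\<bar> \<le> e * test_norm \<phi>"
      proof -
        have "e * test_norm \<phi> = e / 2 * test_norm \<phi> + e / 2 * test_norm \<phi>" by simp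
        then show ?thesis using *[OF nm(1)] *[OF nm(2)] by linarith
      qed
    qed
  qed
qed

section \<open>Approximate stream functions\<close>

text \<open>Differentiation under the integral sign.\<close>

lemma has_grad_integral:
  fixes h h1 h2 :: "real \<times> real \<Rightarrow> real \<Rightarrow> real"
  assumes d: "\<And>p s. ((\<lambda>p. h p s) has_derivative (\<lambda>v. fst v * h1 p s + snd v * h2 p s)) (at p)"
    and c: "\<And>p. continuous_on {0..1} (h p)"
    and c1: "continuous_on UNIV (\<lambda>z. h1 (fst z) (snd z))" and c2: "continuous_on UNIV (\<lambda>z. h2 (fst z) (snd z))"
  shows "has_grad (\<lambda>p. integral {0..1} (h p)) (\<lambda>p. integral {0..1} (h1 p)) (\<lambda>p. integral {0..1} (h2 p))"
  unfolding has_grad_def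
proof
  fix p :: "real \<times> real"
  define H where "H p s = h1 p s *\<^sub>R fst_blinfun + h2 p s *\<^sub>R (snd_blinfun :: (real \<times> real) \<Rightarrow>\<^sub>L real)" for p s
  have ci: "continuous_on {0..1} (h1 p)" "continuous_on {0..1} (h2 p)" for p
  proof -
    have "continuous_on {0..1} (\<lambda>s. h1 (fst (p, s)) (snd (p, s)))" "continuous_on {0..1} (\<lambda>s. h2 (fst (p, s)) (snd (p, s)))"
      by (rule continuous_on_compose2[OF c1 continuous_on_Pair[OF continuous_on_const continuous_on_id]]
          continuous_on_compose2[OF c2 continuous_on_Pair[OF continuous_on_const continuous_on_id]]; simp)+
    then show "continuous_on {0..1} (h1 p)" "continuous_on {0..1} (h2 p)" by simp_all
  qed
  have "((\<lambda>p. integral (cbox 0 1) (h p)) has_derivative integral (cbox 0 1) (H p)) (at p within UNIV)"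
  proof (rule leibniz_rule)
    fix p :: "real \<times> real" and t :: real
    show "((\<lambda>p. h p t) has_derivative blinfun_apply (H p t)) (at p within UNIV)"
      using d[where p=p and s=t] by (rule has_derivative_eq_rhs) (auto simp: H_def blinfun.bilinear_simps fst_blinfun.rep_eq snd_blinfun.rep_eq)
    show "h p integrable_on cbox 0 1" using c[of p] by (intro integrable_continuous) auto
  next
    show "continuous_on (UNIV \<times> cbox 0 1) (\<lambda>(x, t). H x t)"
      unfolding H_def split_beta' using c1 c2 by (auto intro!: continuous_intros intro: continuous_on_subset)
  qed auto
  moreover have "integral (cbox 0 1) (H p) = integral {0..1} (h1 p) *\<^sub>R fst_blinfun + integral {0..1} (h2 p) *\<^sub>R snd_blinfun"
  proof (rule integral_unique)
    have "(h1 p has_integral integral {0..1} (h1 p)) {0..1}" "(h2 p has_integral integral {0..1} (h2 p)) {0..1}"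
      using ci[of p] by (auto intro!: integrable_integral integrable_continuous_interval)
    then show "(H p has_integral (integral {0..1} (h1 p) *\<^sub>R fst_blinfun + integral {0..1} (h2 p) *\<^sub>R snd_blinfun)) (cbox 0 1)"
      unfolding H_def by (intro has_integral_add has_integral_scaleR_left) auto
  qed
  ultimately show "((\<lambda>p. integral {0..1} (h p)) has_derivative (\<lambda>v. fst v * integral {0..1} (h1 p) + snd v * integral {0..1} (h2 p))) (at p)"
    by (auto simp: blinfun.bilinear_simps fst_blinfun.rep_eq snd_blinfun.rep_eq mult.commute elim!: has_derivative_eq_rhs)
qed

text \<open>The function \<open>\<psi>\<close> is the primitive of \<open>b1\<close> along the
  vertical line \<open>x = xl\<close> minus the primitive of \<open>b2\<close> along horizontal
  segments. Its gradient is \<open>(- b2, b1)\<close> up to \<open>E\<close>, the integral of the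
  divergence \<open>b1x + b2y\<close> along the horizontal segment. All integrals are written over
  \<open>{0..1}\<close>, so that the domain of integration does not depend on the point.\<close>

lemma stream_function_error:
  fixes xl :: real
  assumes g1: "has_grad b1 b1x b1y" and g2: "has_grad b2 b2x b2y"
    and c: "continuous_on UNIV b1x" "continuous_on UNIV b1y" "continuous_on UNIV b2x" "continuous_on UNIV b2y"
  defines "E \<equiv> \<lambda>p. integral {0..1} (\<lambda>s. (fst p - xl) * (b1x (xl + s * (fst p - xl), snd p) + b2y (xl + s * (fst p - xl), snd p)))"
  shows "\<exists>\<psi>. has_grad \<psi> (\<lambda>p. - b2 p) (\<lambda>p. b1 p - E p)" "continuous_on UNIV E"
proof -
  define G where "G p s = (xl + s * (fst p - xl), snd p)" for p :: "real \<times> real" and s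
  have Gc: "continuous_on S (\<lambda>z. G (fst z) (snd z))" "continuous_on T (G p)" for S T p
    unfolding G_def by (auto intro!: continuous_intros)
  have cc: "continuous_on S (\<lambda>z. b (G (fst z) (snd z)))" "continuous_on T (\<lambda>s. b (G p s))"
    if "continuous_on UNIV b" for S T and b :: "real \<times> real \<Rightarrow> real" and p
    using continuous_on_compose2[OF that Gc(1)] continuous_on_compose2[OF that Gc(2)] by auto
  have bc: "continuous_on UNIV b1" "continuous_on UNIV b2" using has_grad_cont[OF g1] has_grad_cont[OF g2] by auto
  have Gd: "((\<lambda>p. b (G p s)) has_derivative (\<lambda>v. fst v * (s * bx (G p s)) + snd v * by (G p s))) (at p)"
    if "has_grad b bx by" for b bx "by" p s
  proof -
    have "((\<lambda>p. G p s) has_derivative (\<lambda>v. (s * fst v, snd v))) (at p)"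
      unfolding G_def by (auto intro!: derivative_eq_intros)
    from has_derivative_compose[OF this has_gradD[OF that]] show ?thesis
      by (rule has_derivative_eq_rhs) (auto simp: algebra_simps)
  qed
  have Gs: "((\<lambda>s. b (G p s)) has_vector_derivative (fst p - xl) * bx (G p s)) (at s within S)"
    if "has_grad b bx by" for b bx "by" p s S
  proof -
    have "((\<lambda>s. G p s) has_derivative (\<lambda>t. (t * (fst p - xl), 0))) (at s within S)"
      unfolding G_def by (auto intro!: derivative_eq_intros)
    from has_derivative_compose[OF this has_gradD[OF that]] show ?thesis
      unfolding has_vector_derivative_def by (rule has_derivative_eq_rhs) (auto simp: algebra_simps)
  qed
  have G1: "G p 1 = p" "G p 0 = (xl, snd p)" for p by (auto simp: G_def)
  show Ec: "continuous_on UNIV E"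
  proof -
    have "continuous_on UNIV (\<lambda>p. integral (cbox 0 1) (\<lambda>s. (fst p - xl) * (b1x (G p s) + b2y (G p s))))"
      using cc(1)[OF c(1)] cc(1)[OF c(4)] by (intro integral_continuous_on_param) (auto simp: split_beta' intro!: continuous_intros)
    then show ?thesis by (simp add: E_def G_def)
  qed
  have "has_grad (\<lambda>p. integral {0..1} (\<lambda>s. (fst p - xl) * b2 (G p s)))
     (\<lambda>p. integral {0..1} (\<lambda>s. b2 (G p s) + (fst p - xl) * (s * b2x (G p s)))) (\<lambda>p. integral {0..1} (\<lambda>s. (fst p - xl) * b2y (G p s)))"
  proof (rule has_grad_integral)
    fix p s
    show "((\<lambda>p. (fst p - xl) * b2 (G p s)) has_derivative
        (\<lambda>v. fst v * (b2 (G p s) + (fst p - xl) * (s * b2x (G p s))) + snd v * ((fst p - xl) * b2y (G p s)))) (at p)"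
      by (rule has_derivative_eq_rhs[OF has_derivative_mult[OF _ Gd[OF g2]]]) (auto intro!: derivative_eq_intros simp: algebra_simps)
  qed (intro continuous_intros cc bc c)+
  moreover have "integral {0..1} (\<lambda>s. b2 (G p s) + (fst p - xl) * (s * b2x (G p s))) = b2 p" for p
  proof -
    have "((\<lambda>s. b2 (G p s) + (fst p - xl) * (s * b2x (G p s))) has_integral (1 * b2 (G p 1) - 0 * b2 (G p 0))) {0..1}"
    proof (rule fundamental_theorem_of_calculus)
      fix s :: real
      show "((\<lambda>s. s * b2 (G p s)) has_vector_derivative b2 (G p s) + (fst p - xl) * (s * b2x (G p s))) (at s within {0..1})"
        using has_vector_derivative_mult[OF has_vector_derivative_id Gs[OF g2, where p=p and s=s and S="{0..1}"]] by (simp add: algebra_simps)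
    qed simp
    then show ?thesis by (simp add: integral_unique G1)
  qed
  ultimately have h2: "has_grad (\<lambda>p. integral {0..1} (\<lambda>s. (fst p - xl) * b2 (G p s))) b2 (\<lambda>p. integral {0..1} (\<lambda>s. (fst p - xl) * b2y (G p s)))"
    by simp
  define L where "L p s = (xl, s * snd p)" for p :: "real \<times> real" and s :: real
  have Lc: "continuous_on S (\<lambda>z. L (fst z) (snd z))" "continuous_on T (L p)" for S T p
    unfolding L_def by (auto intro!: continuous_intros)
  have lc: "continuous_on S (\<lambda>z. b (L (fst z) (snd z)))" "continuous_on T (\<lambda>s. b (L p s))"
    if "continuous_on UNIV b" for S T and b :: "real \<times> real \<Rightarrow> real" and p
    using continuous_on_compose2[OF that Lc(1)] continuous_on_compose2[OF that Lc(2)] by auto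
  have "has_grad (\<lambda>p. integral {0..1} (\<lambda>s. snd p * b1 (L p s))) (\<lambda>p. integral {0..1} (\<lambda>s::real. 0))
     (\<lambda>p. integral {0..1} (\<lambda>s. b1 (L p s) + s * snd p * b1y (L p s)))"
  proof (rule has_grad_integral)
    fix p s
    have "((\<lambda>p. L p s) has_derivative (\<lambda>v. (0, s * snd v))) (at p)"
      unfolding L_def by (auto intro!: derivative_eq_intros)
    note hd = has_derivative_compose[OF this has_gradD[OF g1]]
    show "((\<lambda>p. snd p * b1 (L p s)) has_derivative
        (\<lambda>v. fst v * 0 + snd v * (b1 (L p s) + s * snd p * b1y (L p s)))) (at p)"
      by (rule has_derivative_eq_rhs[OF has_derivative_mult[OF _ hd]]) (auto intro!: derivative_eq_intros simp: algebra_simps)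
  qed (intro continuous_intros lc bc c)+
  moreover have "integral {0..1} (\<lambda>s. b1 (L p s) + s * snd p * b1y (L p s)) = b1 (xl, snd p)" for p
  proof -
    have "((\<lambda>s. b1 (L p s) + s * snd p * b1y (L p s)) has_integral (1 * b1 (L p 1) - 0 * b1 (L p 0))) {0..1}"
    proof (rule fundamental_theorem_of_calculus)
      fix s :: real
      have "((\<lambda>s. L p s) has_derivative (\<lambda>t. (0, t * snd p))) (at s within {0..1})"
        unfolding L_def by (auto intro!: derivative_eq_intros)
      from has_derivative_compose[OF this has_gradD[OF g1]]
      have "((\<lambda>s. b1 (L p s)) has_vector_derivative snd p * b1y (L p s)) (at s within {0..1})"
        unfolding has_vector_derivative_def by (rule has_derivative_eq_rhs) (auto simp: algebra_simps)
      from has_vector_derivative_mult[OF has_vector_derivative_id this]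
      show "((\<lambda>s. s * b1 (L p s)) has_vector_derivative b1 (L p s) + s * snd p * b1y (L p s)) (at s within {0..1})"
        by (simp add: algebra_simps)
    qed simp
    then show ?thesis by (simp add: integral_unique L_def)
  qed
  ultimately have h1: "has_grad (\<lambda>p. integral {0..1} (\<lambda>s. snd p * b1 (L p s))) (\<lambda>p. 0) (\<lambda>p. b1 (xl, snd p))" by simp
  have e: "b1 (xl, snd p) - integral {0..1} (\<lambda>s. (fst p - xl) * b2y (G p s)) = b1 p - E p" for p
  proof -
    have "((\<lambda>s. (fst p - xl) * b1x (G p s)) has_integral (b1 (G p 1) - b1 (G p 0))) {0..1}"
      by (rule fundamental_theorem_of_calculus) (use Gs[OF g1] in auto)
    then have 1: "integral {0..1} (\<lambda>s. (fst p - xl) * b1x (G p s)) = b1 p - b1 (xl, snd p)" unfolding G1 by (rule integral_unique)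
    have "E p = integral {0..1} (\<lambda>s. (fst p - xl) * b1x (G p s) + (fst p - xl) * b2y (G p s))"
      by (simp add: E_def G_def algebra_simps)
    also have "\<dots> = integral {0..1} (\<lambda>s. (fst p - xl) * b1x (G p s)) + integral {0..1} (\<lambda>s. (fst p - xl) * b2y (G p s))"
      by (intro Henstock_Kurzweil_Integration.integral_add integrable_continuous_interval continuous_intros cc c)
    finally show ?thesis using 1 by simp
  qed
  show "\<exists>\<psi>. has_grad \<psi> (\<lambda>p. - b2 p) (\<lambda>p. b1 p - E p)"
  proof
    have "((\<lambda>p. integral {0..1} (\<lambda>s. snd p * b1 (L p s)) - integral {0..1} (\<lambda>s. (fst p - xl) * b2 (G p s))) has_derivative
      (\<lambda>v. fst v * - b2 p + snd v * (b1 (xl, snd p) - integral {0..1} (\<lambda>s. (fst p - xl) * b2y (G p s))))) (at p)" for p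
      by (rule has_derivative_eq_rhs[OF has_derivative_diff[OF has_gradD[OF h1] has_gradD[OF h2]]]) (auto simp: algebra_simps)
    then show "has_grad (\<lambda>p. integral {0..1} (\<lambda>s. snd p * b1 (L p s)) - integral {0..1} (\<lambda>s. (fst p - xl) * b2 (G p s)))
      (\<lambda>p. - b2 p) (\<lambda>p. b1 p - E p)" unfolding has_grad_def e by blast
  qed
qed

lemma test_times_integrable:
  fixes f :: "real \<times> real \<Rightarrow> real"
  assumes "integrable lborel f" "\<phi> \<in> test_functions U"
  shows "integrable lborel (\<lambda>p. f p * \<phi> p)"
proof -
  obtain C where C: "\<And>p. \<bar>\<phi> p\<bar> \<le> C" using test_bounded[OF assms(2)] by metis
  have "\<bar>f p * \<phi> p\<bar> \<le> \<bar>f p * C\<bar>" for p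
    using C[of p] unfolding abs_mult by (intro mult_left_mono) auto
  then show ?thesis
    using assms(1) test_measurable[OF assms(2)]
    by (intro Bochner_Integration.integrable_bound[OF integrable_mult_left[OF assms(1), of C]]) auto
qed

lemma test_inner_integrable:
  assumes "\<phi> \<in> test_functions U" "\<psi> \<in> test_functions V"
  shows "integrable lborel (\<lambda>p. \<phi> p * \<psi> p + partial_x \<phi> p * partial_x \<psi> p + partial_y \<phi> p * partial_y \<psi> p)"
  using assms by (intro Bochner_Integration.integrable_add test_mult_integrable test_partial)

lemma test_inner_lin:
  assumes "\<eta> \<in> test_functions U" "\<phi> \<in> test_functions U"
  shows "test_inner (\<lambda>p. 1 * \<eta> p + s * \<phi> p) (\<lambda>p. 1 * \<eta> p + s * \<phi> p)
    = test_inner \<eta> \<eta> + 2 * s * test_inner \<eta> \<phi> + s\<^sup>2 * test_inner \<phi> \<phi>"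
proof -
  note i = test_inner_integrable[OF assms(1,1)] test_inner_integrable[OF assms] test_inner_integrable[OF assms(2,2)]
  have "test_inner (\<lambda>p. 1 * \<eta> p + s * \<phi> p) (\<lambda>p. 1 * \<eta> p + s * \<phi> p)
    = (LINT p|lborel. (\<eta> p * \<eta> p + partial_x \<eta> p * partial_x \<eta> p + partial_y \<eta> p * partial_y \<eta> p)
      + 2 * s * (\<eta> p * \<phi> p + partial_x \<eta> p * partial_x \<phi> p + partial_y \<eta> p * partial_y \<phi> p)
      + s\<^sup>2 * (\<phi> p * \<phi> p + partial_x \<phi> p * partial_x \<phi> p + partial_y \<phi> p * partial_y \<phi> p))"
    unfolding test_inner_def test_partial_lin[OF assms]
    by (intro Bochner_Integration.integral_cong refl) (simp add: algebra_simps power2_eq_square)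
  also have "\<dots> = test_inner \<eta> \<eta> + 2 * s * test_inner \<eta> \<phi> + s\<^sup>2 * test_inner \<phi> \<phi>"
    using i unfolding test_inner_def by simp
  finally show ?thesis .
qed

lemma test_inner_nonneg: "test_inner \<phi> \<phi> \<ge> 0"
  unfolding test_inner_def by (intro integral_nonneg_AE AE_I2) simp

text \<open>An approximate Helmholtz decomposition within the test functions. The functional
  \<open>\<phi> \<mapsto> test_inner \<phi> \<phi> / 2 - T \<phi>\<close> is bounded below on test
  functions, where \<open>T\<close> is the functional that is bounded by \<open>\<epsilon>\<close>.
  At a test function whose value is within \<open>\<delta>\<^sup>2 / 2\<close> of the infimum the
  first variation is at most \<open>\<delta>\<close>.\<close>

lemma near_minimizer:
  assumes pq: "integrable lborel p" "integrable lborel q" and eps: "\<epsilon> > 0" "\<delta> > 0"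
    and bd: "\<And>\<phi>. \<phi> \<in> test_functions U \<Longrightarrow> \<bar>LINT z|lborel. p z * partial_x \<phi> z + q z * partial_y \<phi> z\<bar> \<le> \<epsilon> * test_norm \<phi>"
  obtains \<eta> where "\<eta> \<in> test_functions U" "test_inner \<eta> \<eta> \<le> 4 * \<epsilon>\<^sup>2"
    "\<And>\<phi>. \<phi> \<in> test_functions U \<Longrightarrow> \<bar>test_inner \<eta> \<phi> - (LINT z|lborel. p z * partial_x \<phi> z + q z * partial_y \<phi> z)\<bar> \<le> \<delta> * test_norm \<phi>"
proof -
  define T where "T \<phi> = (LINT z|lborel. p z * partial_x \<phi> z + q z * partial_y \<phi> z)" for \<phi>
  define J where "J \<phi> = test_inner \<phi> \<phi> / 2 - T \<phi>" for \<phi>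
  have nsq: "(test_norm \<phi>)\<^sup>2 = test_inner \<phi> \<phi>" "test_norm \<phi> \<ge> 0" for \<phi>
    using test_inner_nonneg[of \<phi>] by (simp_all add: test_norm_def)
  have Tlin: "T (\<lambda>p. 1 * \<eta> p + s * \<phi> p) = T \<eta> + s * T \<phi>" if "\<eta> \<in> test_functions U" "\<phi> \<in> test_functions U" for \<eta> \<phi> s
  proof -
    note i = test_times_integrable[OF pq(1) test_partial(1)[OF that(1)]] test_times_integrable[OF pq(2) test_partial(2)[OF that(1)]]
      test_times_integrable[OF pq(1) test_partial(1)[OF that(2)]] test_times_integrable[OF pq(2) test_partial(2)[OF that(2)]]
    have "T (\<lambda>p. 1 * \<eta> p + s * \<phi> p) = (LINT z|lborel. (p z * partial_x \<eta> z + q z * partial_y \<eta> z) + s * (p z * partial_x \<phi> z + q z * partial_y \<phi> z))"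
      unfolding T_def test_partial_lin[OF that] by (intro Bochner_Integration.integral_cong refl) (simp add: algebra_simps)
    also have "\<dots> = T \<eta> + s * T \<phi>" unfolding T_def using i by simp
    finally show ?thesis .
  qed
  have lower: "J \<phi> \<ge> - \<epsilon>\<^sup>2 / 2" if "\<phi> \<in> test_functions U" for \<phi>
  proof -
    have "T \<phi> \<le> \<epsilon> * test_norm \<phi>" using bd[OF that] by (simp add: T_def abs_le_iff)
    moreover have "0 \<le> (test_norm \<phi> - \<epsilon>)\<^sup>2" by simp
    ultimately show ?thesis unfolding J_def nsq(1)[symmetric] by (simp add: power2_diff mult_ac)
  qed
  have zt: "(\<lambda>_. 0) \<in> test_functions U"
  proof -
    have "Ck_plane n (\<lambda>_. 0)" for n using Ck_plane_tensor[OF Ck_line_const Ck_line_const, of n 0 0] by simp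
    then show ?thesis by (auto simp: test_functions_def intro: compact_support_inI[of "{}"])
  qed
  have J0: "J (\<lambda>_. 0) = 0"
  proof -
    have "has_grad (\<lambda>_. 0) (\<lambda>_. 0) (\<lambda>_. 0)" unfolding has_grad_def by simp
    from has_grad_partial[OF this] show ?thesis by (simp add: J_def T_def test_inner_def)
  qed
  define I where "I = (INF \<phi>\<in>test_functions U. J \<phi>)"
  have bdd: "bdd_below (J ` test_functions U)" using lower by (intro bdd_belowI2[of _ "- \<epsilon>\<^sup>2 / 2"])
  have I: "I \<le> J \<phi>" if "\<phi> \<in> test_functions U" for \<phi> unfolding I_def using bdd that by (rule cINF_lower)
  have "\<exists>\<phi>\<in>test_functions U. J \<phi> < I + \<delta>\<^sup>2 / 2"
    using cINF_less_iff[OF _ bdd, of "I + \<delta>\<^sup>2 / 2"] zt eps unfolding I_def by auto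
  then obtain \<eta>0 where \<eta>0: "\<eta>0 \<in> test_functions U" "J \<eta>0 < I + \<delta>\<^sup>2 / 2" by auto
  \<comment> \<open>the value at zero is zero, so the comparison with zero bounds the norm of \<open>\<eta>\<close>\<close>
  define \<eta> where "\<eta> = (if J \<eta>0 \<le> 0 then \<eta>0 else (\<lambda>_. 0))"
  have \<eta>: "\<eta> \<in> test_functions U" "J \<eta> < I + \<delta>\<^sup>2 / 2" "J \<eta> \<le> 0" using \<eta>0 zt J0 by (auto simp: \<eta>_def)
  show ?thesis
  proof (rule that[OF \<eta>(1)])
    have "(test_norm \<eta>)\<^sup>2 / 2 \<le> \<epsilon> * test_norm \<eta>"
      using \<eta>(3) bd[OF \<eta>(1)] by (simp add: J_def nsq T_def abs_le_iff)
    then have "test_norm \<eta> * test_norm \<eta> \<le> (2 * \<epsilon>) * test_norm \<eta>" by (simp add: power2_eq_square)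
    then have "test_norm \<eta> \<le> 2 * \<epsilon>" using nsq(2)[of \<eta>] eps by (cases "test_norm \<eta> = 0") (auto simp: mult_le_cancel_right)
    then have "(test_norm \<eta>)\<^sup>2 \<le> (2 * \<epsilon>)\<^sup>2" using nsq(2) by (intro power_mono) auto
    then show "test_inner \<eta> \<eta> \<le> 4 * \<epsilon>\<^sup>2" by (simp add: nsq power_mult_distrib)
    fix \<phi> assume \<phi>: "\<phi> \<in> test_functions U"
    define D where "D = test_inner \<eta> \<phi> - T \<phi>"
    define n where "n = test_inner \<phi> \<phi>"
    have n: "n \<ge> 0" unfolding n_def by (rule test_inner_nonneg)
    \<comment> \<open>near-minimality tested in direction \<open>\<phi>\<close> with an arbitrary step \<open>s\<close>\<close>
    have pos: "s * D + s\<^sup>2 * n / 2 + \<delta>\<^sup>2 / 2 > 0" for s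
    proof -
      have "I \<le> J (\<lambda>p. 1 * \<eta> p + s * \<phi> p)" by (rule I[OF test_lin[OF \<eta>(1) \<phi>]])
      also have "\<dots> = J \<eta> + s * D + s\<^sup>2 * n / 2"
        unfolding J_def Tlin[OF \<eta>(1) \<phi>] test_inner_lin[OF \<eta>(1) \<phi>] D_def n_def by (simp add: field_simps)
      finally show ?thesis using \<eta>(2) by simp
    qed
    have "D\<^sup>2 \<le> \<delta>\<^sup>2 * n"
    proof (cases "n = 0")
      case True
      have "D = 0"
      proof (rule ccontr)
        assume "D \<noteq> 0"
        with pos[of "- \<delta>\<^sup>2 / D"] True eps show False by (simp add: field_simps)
      qed
      then show ?thesis using n by simp
    next
      case False
      then have np: "n > 0" using n by simp
      have "- D / n * D + (- D / n)\<^sup>2 * n / 2 = - D\<^sup>2 / (2 * n)" using np by (simp add: field_simps power2_eq_square)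
      then have "D\<^sup>2 / (2 * n) < \<delta>\<^sup>2 / 2" using pos[of "- D / n"] by simp
      then show ?thesis using np by (simp add: field_simps)
    qed
    then have "D\<^sup>2 \<le> (\<delta> * test_norm \<phi>)\<^sup>2" by (simp add: power_mult_distrib nsq n_def)
    then have "\<bar>D\<bar> \<le> \<delta> * test_norm \<phi>" using abs_le_square_iff[of D "\<delta> * test_norm \<phi>"] nsq(2)[of \<phi>] eps by simp
    then show "\<bar>test_inner \<eta> \<phi> - (LINT z|lborel. p z * partial_x \<phi> z + q z * partial_y \<phi> z)\<bar> \<le> \<delta> * test_norm \<phi>"
      by (simp add: D_def T_def)
  qed
qed

text \<open>Integrate \<open>2 * \<bar>f\<bar> \<le> \<epsilon> + f\<^sup>2 / \<epsilon>\<close>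
  over \<open>U\<close>. The bound is linear in \<open>\<epsilon>\<close>, as the Cauchy--Schwarz
  inequality would give.\<close>

lemma test_L1_bound:
  assumes U: "open U" "bounded U" and f: "f \<in> test_functions U" and e: "\<epsilon> > 0" "(LINT z|lborel. f z * f z) \<le> 4 * \<epsilon>\<^sup>2"
  shows "(LINT z|lborel. \<bar>f z\<bar>) \<le> \<epsilon> * (measure lborel U + 4) / 2"
proof -
  have fin: "emeasure lborel U < \<infinity>" using emeasure_bounded_finite[OF U(2)] by simp
  have i: "integrable lborel (\<lambda>z. (\<epsilon> * indicator U z + f z * f z / \<epsilon>) / 2)"
    using fin U test_mult_integrable[OF f f] by (auto intro!: integrable_real_indicator)
  have "(LINT z|lborel. \<bar>f z\<bar>) \<le> (LINT z|lborel. (\<epsilon> * indicator U z + f z * f z / \<epsilon>) / 2)"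
  proof (rule integral_mono[OF _ i])
    show "integrable lborel (\<lambda>z. \<bar>f z\<bar>)" using test_integrable[OF f] by simp
    fix z
    show "\<bar>f z\<bar> \<le> (\<epsilon> * indicator U z + f z * f z / \<epsilon>) / 2"
    proof (cases "z \<in> U")
      case True
      have "0 \<le> (\<epsilon> - \<bar>f z\<bar>)\<^sup>2 / \<epsilon>" using e by simp
      also have "\<dots> = \<epsilon> - 2 * \<bar>f z\<bar> + f z * f z / \<epsilon>" using e by (simp add: power2_diff power2_eq_square field_simps)
      finally show ?thesis using True by simp
    qed (simp add: test_zero_outside[OF f])
  qed
  also have "\<dots> = (\<epsilon> * measure lborel U + (LINT z|lborel. f z * f z) / \<epsilon>) / 2"
    using fin U test_mult_integrable[OF f f] by simp
  also have "\<dots> \<le> (\<epsilon> * measure lborel U + 4 * \<epsilon>\<^sup>2 / \<epsilon>) / 2" using e by (intro divide_right_mono add_left_mono) auto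
  also have "\<dots> = \<epsilon> * (measure lborel U + 4) / 2" using e by (simp add: power2_eq_square field_simps)
  finally show ?thesis .
qed

text \<open>Uniformity in the centre \<open>x\<close> allows the tolerance in
  \<open>near_minimizer\<close> to be fixed after the scale \<open>t\<close>.\<close>

lemma eta_shift_norm_bound:
  assumes U: "open U" "bounded U" and t: "t > 0"
  obtains C where "C \<ge> 0" "\<And>x. cball x (2 * t) \<subseteq> U \<Longrightarrow> test_norm (\<lambda>y. eta t (x - y)) \<le> C"
proof -
  obtain C0 where C0: "\<And>p. \<bar>eta t p\<bar> \<le> C0" using test_bounded[OF eta_test[OF t]] by metis
  obtain C1 where C1: "\<And>p. \<bar>partial_x (eta t) p\<bar> \<le> C1" using test_bounded[OF test_partial(1)[OF eta_test[OF t]]] by metis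
  obtain C2 where C2: "\<And>p. \<bar>partial_y (eta t) p\<bar> \<le> C2" using test_bounded[OF test_partial(2)[OF eta_test[OF t]]] by metis
  define C where "C = sqrt ((C0\<^sup>2 + C1\<^sup>2 + C2\<^sup>2) * measure lborel U)"
  show ?thesis
  proof (rule that[of C])
    show "C \<ge> 0" by (simp add: C_def)
    fix x assume x: "cball x (2 * t) \<subseteq> U"
    define \<phi> where "\<phi> = (\<lambda>y. eta t (x - y))"
    have \<phi>: "\<phi> \<in> test_functions U" unfolding \<phi>_def by (rule eta_shift_test[OF t x])
    have fin: "emeasure lborel U < \<infinity>" using emeasure_bounded_finite[OF U(2)] by simp
    have "test_inner \<phi> \<phi> \<le> (LINT z|lborel. (C0\<^sup>2 + C1\<^sup>2 + C2\<^sup>2) * indicator U z)"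
      unfolding test_inner_def
    proof (rule integral_mono[OF test_inner_integrable[OF \<phi> \<phi>]])
      show "integrable lborel (\<lambda>z. (C0\<^sup>2 + C1\<^sup>2 + C2\<^sup>2) * indicator U z)" using fin U by (auto intro!: integrable_real_indicator)
      fix y
      have b: "a * a \<le> c\<^sup>2" if "\<bar>a\<bar> \<le> c" for a c :: real
        using power_mono[OF that, of 2] by (simp add: power2_eq_square)
      show "\<phi> y * \<phi> y + partial_x \<phi> y * partial_x \<phi> y + partial_y \<phi> y * partial_y \<phi> y \<le> (C0\<^sup>2 + C1\<^sup>2 + C2\<^sup>2) * indicator U y"
      proof (cases "y \<in> U")
        case True
        have "\<bar>\<phi> y\<bar> \<le> C0" "\<bar>partial_x \<phi> y\<bar> \<le> C1" "\<bar>partial_y \<phi> y\<bar> \<le> C2"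
          using C0 C1 C2 by (simp_all add: \<phi>_def eta_shift_partial[OF t])
        from b[OF this(1)] b[OF this(2)] b[OF this(3)] show ?thesis using True by simp
      next
        case False
        then show ?thesis using test_zero_outside[OF \<phi> False] test_zero_outside[OF test_partial(1)[OF \<phi>] False]
            test_zero_outside[OF test_partial(2)[OF \<phi>] False] by simp
      qed
    qed
    also have "\<dots> = (C0\<^sup>2 + C1\<^sup>2 + C2\<^sup>2) * measure lborel U" using fin U by simp
    finally show "test_norm (\<lambda>y. eta t (x - y)) \<le> C"
      unfolding test_norm_def C_def \<phi>_def[symmetric] by simp
  qed
qed

text \<open>Fubini: the line integral at a point is at most the integral of
  \<open>\<bar>d\<bar>\<close> over the whole horizontal segment through the box, and this bound is
  constant in the first variable.\<close>

lemma line_integral_L1_bound: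
  fixes d :: "real \<times> real \<Rightarrow> real"
  assumes d: "continuous_on UNIV d" and lt: "xl < xu" "yl < yu"
  defines "E \<equiv> \<lambda>p. integral {0..1} (\<lambda>s. (fst p - xl) * d (xl + s * (fst p - xl), snd p))"
  defines "Y \<equiv> cbox (xl, yl) (xu, yu)"
  assumes E: "continuous_on UNIV E"
  shows "integrable lborel (\<lambda>p. indicator Y p * \<bar>d p\<bar>)" "integrable lborel (\<lambda>p. indicator Y p * \<bar>E p\<bar>)"
    "(LINT p|lborel. indicator Y p * \<bar>E p\<bar>) \<le> (xu - xl) * (LINT p|lborel. indicator Y p * \<bar>d p\<bar>)"
proof -
  have int: "integrable lborel (\<lambda>p. indicator Y p * \<bar>f p\<bar>)" if "continuous_on UNIV f" for f :: "real \<times> real \<Rightarrow> real"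
  proof -
    have "integrable lborel (\<lambda>p. indicator Y p *\<^sub>R \<bar>f p\<bar>)"
      unfolding Y_def using that by (intro borel_integrable_compact) (auto intro!: continuous_intros intro: continuous_on_subset)
    then show ?thesis by simp
  qed
  show id: "integrable lborel (\<lambda>p. indicator Y p * \<bar>d p\<bar>)" by (rule int[OF d])
  show iE: "integrable lborel (\<lambda>p. indicator Y p * \<bar>E p\<bar>)" by (rule int[OF E])
  have [measurable]: "d \<in> borel_measurable borel" "E \<in> borel_measurable borel"
    using d E by (auto intro: borel_measurable_continuous_onI)
  have Yb[measurable]: "Y \<in> sets borel" by (simp add: Y_def)
  have dm[measurable]: "d \<in> borel_measurable (borel \<Otimes>\<^sub>M borel)" by (simp add: borel_prod)
  have Ym[measurable]: "Y \<in> sets (borel \<Otimes>\<^sub>M borel)" unfolding borel_prod by (rule Yb)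
  define D where "D p = ennreal (indicator Y p * \<bar>d p\<bar>)" for p
  have Dm[measurable]: "D \<in> borel_measurable (lborel \<Otimes>\<^sub>M lborel)" unfolding D_def[abs_def] by measurable
  define K where "K y = (\<integral>\<^sup>+t. D (t, y) \<partial>lborel)" for y
  have Km[measurable]: "K \<in> borel_measurable lborel" unfolding K_def by measurable
  have pt: "ennreal (indicator Y p * \<bar>E p\<bar>) \<le> indicator {xl..xu} (fst p) * K (snd p)" for p
  proof (cases "p \<in> Y")
    case True
    obtain x y where p: "p = (x, y)" by (cases p)
    have xy: "xl \<le> x" "x \<le> xu" "yl \<le> y" "y \<le> yu" using True by (auto simp: Y_def p)
    show ?thesis
    proof (cases "x = xl")
      case False
      define c where "c = x - xl"
      have c: "c > 0" using False xy by (simp add: c_def)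
      have dc: "continuous_on UNIV (\<lambda>s. d (xl + s * c, y))"
        by (rule continuous_on_compose2[OF d]) (auto intro!: continuous_intros)
      have dc': "continuous_on {0..1} (\<lambda>s. d (xl + s * c, y))" by (rule continuous_on_subset[OF dc]) simp
      have "\<bar>E p\<bar> \<le> integral {0..1} (\<lambda>s. c * \<bar>d (xl + s * c, y)\<bar>)"
      proof -
        have "norm (integral {0..1} (\<lambda>s. c * d (xl + s * c, y))) \<le> integral {0..1} (\<lambda>s. c * \<bar>d (xl + s * c, y)\<bar>)"
          by (rule integral_norm_bound_integral) (use c dc' in \<open>auto simp: abs_mult intro!: integrable_continuous_interval continuous_intros\<close>)
        then show ?thesis by (simp add: E_def p c_def)
      qed
      also have "\<dots> = (LINT s|lborel. indicator {0..1} s * (c * \<bar>d (xl + s * c, y)\<bar>))"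
      proof -
        have "set_integrable lborel {0..1} (\<lambda>s. c * \<bar>d (xl + s * c, y)\<bar>)"
          unfolding set_integrable_def by (rule borel_integrable_compact) (use dc' in \<open>auto intro!: continuous_intros\<close>)
        from set_borel_integral_eq_integral(2)[OF this] show ?thesis
          unfolding set_lebesgue_integral_def real_scaleR_def by (rule sym)
      qed
      finally have "ennreal \<bar>E p\<bar> \<le> ennreal (LINT s|lborel. indicator {0..1} s * (c * \<bar>d (xl + s * c, y)\<bar>))" by (rule ennreal_leI)
      also have "\<dots> = (\<integral>\<^sup>+s. ennreal (indicator {0..1} s * (c * \<bar>d (xl + s * c, y)\<bar>)) \<partial>lborel)"
      proof (rule nn_integral_eq_integral[symmetric])
        have "integrable lborel (\<lambda>s. indicator {0..1::real} s *\<^sub>R (c * \<bar>d (xl + s * c, y)\<bar>))"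
          by (rule borel_integrable_compact) (use dc' in \<open>auto intro!: continuous_intros\<close>)
        then show "integrable lborel (\<lambda>s. indicator {0..1} s * (c * \<bar>d (xl + s * c, y)\<bar>))" by simp
      qed (use c in auto)
      also have "\<dots> = ennreal \<bar>c\<bar> * (\<integral>\<^sup>+s. ennreal (indicator {0..1} s * \<bar>d (xl + c * s, y)\<bar>) \<partial>lborel)"
        using c by (subst nn_integral_cmult[symmetric]) (auto intro!: nn_integral_cong simp: ennreal_mult'[symmetric] mult_ac)
      also have "\<dots> = ennreal \<bar>c\<bar> * (\<integral>\<^sup>+s. ennreal (indicator {xl..x} (xl + c * s) * \<bar>d (xl + c * s, y)\<bar>) \<partial>lborel)"
      proof -
        have "indicator {0..1} s = (indicator {xl..x} (xl + c * s) :: real)" for s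
        proof -
          have "xl + c * s \<le> x \<longleftrightarrow> s \<le> 1" "xl \<le> xl + c * s \<longleftrightarrow> 0 \<le> s" using c
          proof -
            have x: "x = xl + c * 1" by (simp add: c_def)
            show "xl + c * s \<le> x \<longleftrightarrow> s \<le> 1" using mult_le_cancel_left_pos[OF c, of s 1] x by linarith
            show "xl \<le> xl + c * s \<longleftrightarrow> 0 \<le> s" using c by (simp add: zero_le_mult_iff)
          qed
          then show ?thesis by (simp add: indicator_def)
        qed
        then show ?thesis by simp
      qed
      also have "\<dots> = (\<integral>\<^sup>+t. ennreal (indicator {xl..x} t * \<bar>d (t, y)\<bar>) \<partial>lborel)"
        by (rule nn_integral_real_affine[symmetric]) (use c in auto)
      also have "\<dots> \<le> K y"
        unfolding K_def D_def by (intro nn_integral_mono ennreal_leI) (use xy in \<open>auto simp: indicator_def Y_def\<close>)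
      finally show ?thesis using True xy by (simp add: p)
    qed (use True in \<open>simp add: E_def p\<close>)
  qed simp
  have "ennreal (LINT p|lborel. indicator Y p * \<bar>E p\<bar>) = (\<integral>\<^sup>+p. ennreal (indicator Y p * \<bar>E p\<bar>) \<partial>lborel)"
    by (rule nn_integral_eq_integral[symmetric, OF iE]) auto
  also have "\<dots> \<le> (\<integral>\<^sup>+p. indicator {xl..xu} (fst p) * K (snd p) \<partial>lborel)" by (rule nn_integral_mono) (rule pt)
  also have "\<dots> = (\<integral>\<^sup>+p. indicator {xl..xu} (fst p) * K (snd p) \<partial>(lborel \<Otimes>\<^sub>M lborel))" by (simp add: lborel_prod)
  also have "\<dots> = (\<integral>\<^sup>+y. (\<integral>\<^sup>+x. indicator {xl..xu} (fst (x, y)) * K (snd (x, y)) \<partial>lborel) \<partial>lborel)"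
    by (rule lborel_pair.nn_integral_snd[symmetric]) measurable
  also have "\<dots> = (\<integral>\<^sup>+y. ennreal (xu - xl) * K y \<partial>lborel)"
    using lt by (intro nn_integral_cong) (simp add: nn_integral_multc)
  also have "\<dots> = ennreal (xu - xl) * (\<integral>\<^sup>+y. K y \<partial>lborel)" by (rule nn_integral_cmult) simp
  also have "(\<integral>\<^sup>+y. K y \<partial>lborel) = (\<integral>\<^sup>+p. D p \<partial>(lborel \<Otimes>\<^sub>M lborel))"
    unfolding K_def by (rule lborel_pair.nn_integral_snd) measurable
  also have "\<dots> = (\<integral>\<^sup>+p. D p \<partial>lborel)" by (simp add: lborel_prod)
  also have "\<dots> = ennreal (LINT p|lborel. indicator Y p * \<bar>d p\<bar>)"
    unfolding D_def by (rule nn_integral_eq_integral[OF id]) auto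
  finally have *: "ennreal (LINT p|lborel. indicator Y p * \<bar>E p\<bar>) \<le> ennreal ((xu - xl) * (LINT p|lborel. indicator Y p * \<bar>d p\<bar>))"
    using lt by (simp add: ennreal_mult')
  moreover have "0 \<le> (xu - xl) * (LINT p|lborel. indicator Y p * \<bar>d p\<bar>)"
    using lt by (intro mult_nonneg_nonneg integral_nonneg_AE) auto
  ultimately show "(LINT p|lborel. indicator Y p * \<bar>E p\<bar>) \<le> (xu - xl) * (LINT p|lborel. indicator Y p * \<bar>d p\<bar>)"
    by (simp add: ennreal_le_iff)
qed

text \<open>Subtract from \<open>(p, q)\<close> the gradient of the near-minimizer
  \<open>\<eta>\<close>, which is of order \<open>\<epsilon>\<close> in \<open>L\<^sup>2\<close> and
  so in \<open>L\<^sup>1\<close>. The remaining field has divergence close to \<open>-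
  \<eta>\<close>, so after mollification its divergence is small in \<open>L\<^sup>1\<close> and
  \<open>stream_function_error\<close> applies.\<close>

lemma approx_stream_function:
  fixes xl xu yl yu :: real
  assumes U: "open U" "bounded U" and pq: "integrable lborel p" "integrable lborel q" and e: "\<epsilon> > 0" "\<xi> > 0"
    and bd: "\<And>\<phi>. \<phi> \<in> test_functions U \<Longrightarrow> \<bar>LINT z|lborel. p z * partial_x \<phi> z + q z * partial_y \<phi> z\<bar> \<le> \<epsilon> * test_norm \<phi>"
    and lt: "xl < xu" "yl < yu" and sub: "cbox (xl, yl) (xu, yu) \<subseteq> U"
  defines "Y \<equiv> cbox (xl, yl) (xu, yu)"
  shows "\<exists>\<psi> g1 g2. has_grad \<psi> g1 g2 \<and> continuous_on UNIV g1 \<and> continuous_on UNIV g2 \<and>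
    (LINT z|lborel. indicator Y z * (\<bar>g1 z + q z\<bar> + \<bar>g2 z - p z\<bar>)) \<le> \<epsilon> * (measure lborel U + 4) * (2 + (xu - xl)) + \<xi>"
proof -
  define B where "B = \<epsilon> * (measure lborel U + 4) / 2"
  define w where "w = xu - xl"
  have w: "w > 0" using lt by (simp add: w_def)
  define V where "V = measure lborel Y"
  have V: "V \<ge> 0" by (simp add: V_def)
  have Ys[measurable]: "Y \<in> sets borel" and Yb: "bounded Y" and Yfin: "emeasure lborel Y < \<infinity>"
    unfolding Y_def by (auto simp: emeasure_lborel_cbox_eq)
  obtain r where r: "r > 0" "\<And>x. x \<in> Y \<Longrightarrow> cball x r \<subseteq> U"
    using compact_in_open_thickening[OF _ U(1) sub] Y_def by (metis compact_cbox)
  have "\<xi> / 4 > 0" using e by simp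
  obtain t1 where t1: "t1 > 0" "\<And>t. 0 < t \<Longrightarrow> t < t1 \<Longrightarrow> (LINT x|lborel. indicator Y x * \<bar>conv p (eta t) x - p x\<bar>) < \<xi> / 4"
    using mollify_L1[OF pq(1) Yb Ys \<open>\<xi> / 4 > 0\<close>] by metis
  obtain t2 where t2: "t2 > 0" "\<And>t. 0 < t \<Longrightarrow> t < t2 \<Longrightarrow> (LINT x|lborel. indicator Y x * \<bar>conv q (eta t) x - q x\<bar>) < \<xi> / 4"
    using mollify_L1[OF pq(2) Yb Ys \<open>\<xi> / 4 > 0\<close>] by metis
  define t where "t = min (r / 2) (min (t1 / 2) (t2 / 2))"
  have t: "t > 0" "2 * t \<le> r" "t < t1" "t < t2" using r t1 t2 by (auto simp: t_def)
  have cb: "cball x (2 * t) \<subseteq> U" if "x \<in> Y" for x using r(2)[OF that] t(2) by (meson order_trans subset_cball)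
  obtain C where C: "C \<ge> 0" "\<And>x. cball x (2 * t) \<subseteq> U \<Longrightarrow> test_norm (\<lambda>y. eta t (x - y)) \<le> C"
    using eta_shift_norm_bound[OF U t(1)] by metis
  define \<delta> where "\<delta> = \<xi> / (4 * (C * V * w + 1))"
  have cvw: "C * V * w \<ge> 0" using C V w by simp
  have \<delta>: "\<delta> > 0" "w * (\<delta> * C * V) \<le> \<xi> / 4"
  proof -
    show d: "\<delta> > 0" using e cvw by (simp add: \<delta>_def)
    have "w * (\<delta> * C * V) \<le> \<delta> * (C * V * w + 1)" using d by (simp add: algebra_simps)
    also have "\<dots> = \<xi> / 4" using cvw by (simp add: \<delta>_def field_simps)
    finally show "w * (\<delta> * C * V) \<le> \<xi> / 4" .
  qed
  obtain \<eta> where \<eta>: "\<eta> \<in> test_functions U" "test_inner \<eta> \<eta> \<le> 4 * \<epsilon>\<^sup>2"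
    "\<And>\<phi>. \<phi> \<in> test_functions U \<Longrightarrow> \<bar>test_inner \<eta> \<phi> - (LINT z|lborel. p z * partial_x \<phi> z + q z * partial_y \<phi> z)\<bar> \<le> \<delta> * test_norm \<phi>"
    by (rule near_minimizer[OF pq e(1) \<delta>(1) bd], assumption) (rule that)
  note \<eta>p = test_partial[OF \<eta>(1)]
  have L2: "(LINT z|lborel. \<eta> z * \<eta> z) \<le> 4 * \<epsilon>\<^sup>2" "(LINT z|lborel. partial_x \<eta> z * partial_x \<eta> z) \<le> 4 * \<epsilon>\<^sup>2"
    "(LINT z|lborel. partial_y \<eta> z * partial_y \<eta> z) \<le> 4 * \<epsilon>\<^sup>2"
  proof -
    have ti: "test_inner \<eta> \<eta> = (LINT z|lborel. \<eta> z * \<eta> z) + (LINT z|lborel. partial_x \<eta> z * partial_x \<eta> z) + (LINT z|lborel. partial_y \<eta> z * partial_y \<eta> z)"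
      unfolding test_inner_def using test_mult_integrable[OF \<eta>(1,1)] test_mult_integrable[OF \<eta>p(1) \<eta>p(1)] test_mult_integrable[OF \<eta>p(2) \<eta>p(2)] by simp
    have nn: "(LINT z|lborel. f z * f z) \<ge> 0" for f :: "real \<times> real \<Rightarrow> real" by (intro integral_nonneg_AE) auto
    note nn[of \<eta>] nn[of "partial_x \<eta>"] nn[of "partial_y \<eta>"] ti
    then show "(LINT z|lborel. \<eta> z * \<eta> z) \<le> 4 * \<epsilon>\<^sup>2" "(LINT z|lborel. partial_x \<eta> z * partial_x \<eta> z) \<le> 4 * \<epsilon>\<^sup>2"
    "(LINT z|lborel. partial_y \<eta> z * partial_y \<eta> z) \<le> 4 * \<epsilon>\<^sup>2" using \<eta>(2) by linarith+
  qed
  note L1 = test_L1_bound[OF U \<eta>(1) e(1) L2(1), folded B_def] test_L1_bound[OF U \<eta>p(1) e(1) L2(2), folded B_def]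
    test_L1_bound[OF U \<eta>p(2) e(1) L2(3), folded B_def]
  note \<eta>i = test_integrable[OF \<eta>(1)] test_integrable[OF \<eta>p(1)] test_integrable[OF \<eta>p(2)]
  define a1 where "a1 = (\<lambda>z. p z - partial_x \<eta> z)"
  define a2 where "a2 = (\<lambda>z. q z - partial_y \<eta> z)"
  have ai: "integrable lborel a1" "integrable lborel a2" unfolding a1_def a2_def using pq \<eta>i by auto
  note tt = eta_test[OF t(1)] test_partial[OF eta_test[OF t(1)]]
  define b1 where "b1 = conv a1 (eta t)"
  define b2 where "b2 = conv a2 (eta t)"
  define b1x where "b1x = conv a1 (partial_x (eta t))"
  define b1y where "b1y = conv a1 (partial_y (eta t))"
  define b2x where "b2x = conv a2 (partial_x (eta t))"
  define b2y where "b2y = conv a2 (partial_y (eta t))"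
  have g: "has_grad b1 b1x b1y" "has_grad b2 b2x b2y"
    unfolding b1_def b2_def b1x_def b1y_def b2x_def b2y_def by (rule has_grad_conv_test[OF ai(1) tt(1)] has_grad_conv_test[OF ai(2) tt(1)])+
  have c: "continuous_on UNIV b1x" "continuous_on UNIV b1y" "continuous_on UNIV b2x" "continuous_on UNIV b2y"
    unfolding b1x_def b1y_def b2x_def b2y_def
    using Ck_plane_conv[OF ai(1) tt(2), of 0] Ck_plane_conv[OF ai(1) tt(3), of 0] Ck_plane_conv[OF ai(2) tt(2), of 0] Ck_plane_conv[OF ai(2) tt(3), of 0]
    by simp_all
  define d where "d p = b1x p + b2y p" for p
  have dc: "continuous_on UNIV d" unfolding d_def[abs_def] using c by (auto intro!: continuous_intros)
  define E where "E p = integral {0..1} (\<lambda>s. (fst p - xl) * d (xl + s * (fst p - xl), snd p))" for p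
  note sf = stream_function_error[OF g c, of xl, folded d_def, folded E_def]
  obtain \<psi> where \<psi>: "has_grad \<psi> (\<lambda>p. - b2 p) (\<lambda>p. b1 p - E p)" using sf(1) ..
  have Ec: "continuous_on UNIV E" using sf(2) .
  note lb = line_integral_L1_bound[OF dc lt Ec[unfolded E_def[abs_def]], folded E_def Y_def w_def]
  define m where "m = conv \<eta> (eta t)"
  have mi: "integrable lborel m" "(LINT z|lborel. \<bar>m z\<bar>) \<le> B"
    using conv_eta_L1[OF \<eta>i(1) t(1)] L1(1) by (auto simp: m_def)
  \<comment> \<open>the divergence of the mollified field at \<open>x\<close> is the near-minimality defect tested with the kernel centred at \<open>x\<close>\<close>
  have dle: "\<bar>d x\<bar> \<le> \<bar>m x\<bar> + \<delta> * C" if x: "x \<in> Y" for x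
  proof -
    define \<phi> where "\<phi> = (\<lambda>y. eta t (x - y))"
    have \<phi>: "\<phi> \<in> test_functions U" unfolding \<phi>_def by (rule eta_shift_test[OF t(1) cb[OF x]])
    have px: "partial_x \<phi> = (\<lambda>y. - partial_x (eta t) (x - y))" "partial_y \<phi> = (\<lambda>y. - partial_y (eta t) (x - y))"
      unfolding \<phi>_def by (rule eta_shift_partial[OF t(1)])+
    note \<phi>p = test_partial[OF \<phi>]
    note i = test_times_integrable[OF \<eta>i(1) \<phi>] test_times_integrable[OF \<eta>i(2) \<phi>p(1)] test_times_integrable[OF \<eta>i(3) \<phi>p(2)]
      test_times_integrable[OF pq(1) \<phi>p(1)] test_times_integrable[OF pq(2) \<phi>p(2)]
    have "b1x x = - (LINT y|lborel. a1 y * partial_x \<phi> y)" "b2y x = - (LINT y|lborel. a2 y * partial_y \<phi> y)"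
      by (simp_all add: b1x_def b2y_def conv_def px)
    then have "d x = (LINT y|lborel. partial_x \<eta> y * partial_x \<phi> y) - (LINT y|lborel. p y * partial_x \<phi> y)
       + (LINT y|lborel. partial_y \<eta> y * partial_y \<phi> y) - (LINT y|lborel. q y * partial_y \<phi> y)"
      using i by (simp add: d_def a1_def a2_def left_diff_distrib)
    moreover have "m x = (LINT y|lborel. \<eta> y * \<phi> y)" by (simp add: m_def conv_def \<phi>_def)
    ultimately have "m x + d x = test_inner \<eta> \<phi> - (LINT z|lborel. p z * partial_x \<phi> z + q z * partial_y \<phi> z)"
      unfolding test_inner_def using i by simp
    then have "\<bar>m x + d x\<bar> \<le> \<delta> * test_norm \<phi>" using \<eta>(3)[OF \<phi>] by simp
    also have "\<dots> \<le> \<delta> * C" using C(2)[OF cb[OF x]] \<delta>(1) by (simp add: \<phi>_def)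
    finally show ?thesis by linarith
  qed
  have iY: "integrable lborel (indicator Y :: _ \<Rightarrow> real)" using Yfin by (intro integrable_real_indicator) auto
  have "(LINT z|lborel. indicator Y z * \<bar>d z\<bar>) \<le> (LINT z|lborel. \<bar>m z\<bar> + \<delta> * C * indicator Y z)"
  proof (rule integral_mono[OF lb(1)])
    show "integrable lborel (\<lambda>z. \<bar>m z\<bar> + \<delta> * C * indicator Y z)" using mi iY by simp
    show "indicator Y z * \<bar>d z\<bar> \<le> \<bar>m z\<bar> + \<delta> * C * indicator Y z" for z using dle[of z] by (cases "z \<in> Y") auto
  qed
  also have "\<dots> \<le> B + \<delta> * C * V" using mi iY by (simp add: V_def)
  finally have "(LINT z|lborel. indicator Y z * \<bar>d z\<bar>) \<le> B + \<delta> * C * V" .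
  then have "(LINT z|lborel. indicator Y z * \<bar>E z\<bar>) \<le> w * (B + \<delta> * C * V)"
    using lb(3) w by (meson mult_left_mono less_imp_le order_trans)
  also have "\<dots> \<le> w * B + \<xi> / 4" using \<delta>(2) by (simp add: distrib_left)
  finally have EB: "(LINT z|lborel. indicator Y z * \<bar>E z\<bar>) \<le> w * B + \<xi> / 4" .
  note cp = conv_eta_L1[OF pq(1) t(1)] conv_eta_L1[OF pq(2) t(1)] conv_eta_L1[OF \<eta>i(2) t(1)] conv_eta_L1[OF \<eta>i(3) t(1)]
  have iYm: "integrable lborel (\<lambda>z. indicator Y z * \<bar>f z\<bar>)" if "integrable lborel f" for f :: "real \<times> real \<Rightarrow> real"
    using integrable_mult_indicator[of Y lborel "\<lambda>z. \<bar>f z\<bar>"] that by simp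
  note * = iYm[OF Bochner_Integration.integrable_diff[OF cp(3) pq(2)]] iYm[OF Bochner_Integration.integrable_diff[OF cp(1) pq(1)]]
      integrable_abs[OF cp(5)] integrable_abs[OF cp(7)] lb(2)
  have "(LINT z|lborel. indicator Y z * (\<bar>- b2 z + q z\<bar> + \<bar>b1 z - E z - p z\<bar>))
    \<le> (LINT z|lborel. indicator Y z * \<bar>conv q (eta t) z - q z\<bar> + \<bar>conv (partial_y \<eta>) (eta t) z\<bar>
      + indicator Y z * \<bar>conv p (eta t) z - p z\<bar> + \<bar>conv (partial_x \<eta>) (eta t) z\<bar> + indicator Y z * \<bar>E z\<bar>)"
    (is "_ \<le> (LINT z|lborel. ?f z)")
  proof (rule integral_mono')
    show "integrable lborel ?f"
      by (intro Bochner_Integration.integrable_add *)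
    show "0 \<le> ?f z" for z by (intro add_nonneg_nonneg) auto
    show "indicator Y z * (\<bar>- b2 z + q z\<bar> + \<bar>b1 z - E z - p z\<bar>) \<le> ?f z" for z
      unfolding b1_def b2_def a1_def a2_def conv_diff[OF pq(1) \<eta>i(2) t(1)] conv_diff[OF pq(2) \<eta>i(3) t(1)]
      by (cases "z \<in> Y") auto
  qed
  also have "\<dots> = (LINT z|lborel. indicator Y z * \<bar>conv q (eta t) z - q z\<bar>) + (LINT z|lborel. \<bar>conv (partial_y \<eta>) (eta t) z\<bar>)
      + (LINT z|lborel. indicator Y z * \<bar>conv p (eta t) z - p z\<bar>) + (LINT z|lborel. \<bar>conv (partial_x \<eta>) (eta t) z\<bar>) + (LINT z|lborel. indicator Y z * \<bar>E z\<bar>)"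
  proof -
    show ?thesis using * by simp
  qed
  also have "\<dots> \<le> \<xi> / 4 + B + \<xi> / 4 + B + (w * B + \<xi> / 4)"
    using t1(2)[OF t(1,3)] t2(2)[OF t(1,4)] cp L1 EB by (intro add_mono) auto
  also have "\<dots> \<le> \<epsilon> * (measure lborel U + 4) * (2 + (xu - xl)) + \<xi>"
  proof -
    have "\<epsilon> * (measure lborel U + 4) * (2 + (xu - xl)) = 2 * B * (2 + w)" by (simp add: B_def w_def)
    moreover have "B \<ge> 0" unfolding B_def using e by simp
    ultimately show ?thesis using e w by (simp add: algebra_simps)
  qed
  finally show ?thesis using \<psi> Ec has_grad_cont[OF g(1)] has_grad_cont[OF g(2)]
    by (intro exI[of _ \<psi>] exI[of _ "\<lambda>p. - b2 p"] exI[of _ "\<lambda>p. b1 p - E p"]) (auto intro!: continuous_intros)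
qed

lemma abs_fst_le: "\<bar>fst v\<bar> \<le> norm v" and abs_snd_le: "\<bar>snd v\<bar> \<le> norm v" for v :: "real \<times> real"
  using norm_fst_le[of "fst v" "snd v"] norm_snd_le[of "snd v" "fst v"] by simp_all

section \<open>The maximal function\<close>

text \<open>The set where the noncentred maximal function of \<open>e\<close> exceeds
  \<open>c\<close>. As a union of open balls it is open, so its measurability is immediate.\<close>

definition maximal_superlevel :: "real \<Rightarrow> (real \<times> real \<Rightarrow> real) \<Rightarrow> (real \<times> real) set" where
  "maximal_superlevel c e = (\<Union>(z, \<rho>)\<in>{(z, \<rho>). \<rho> > 0 \<and> c * measure lborel (ball z \<rho>) < (LINT y|lborel. indicator (ball z \<rho>) y * e y)}. ball z \<rho>)"

lemma measure_ball2: "\<rho> \<ge> 0 \<Longrightarrow> measure lborel (ball z \<rho> :: (real \<times> real) set) = pi * \<rho>\<^sup>2"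
  using content_ball[of \<rho> z] by (simp add: unit_ball_vol_2 power2_eq_square)

lemma emeasure_cball2: "\<rho> \<ge> 0 \<Longrightarrow> emeasure lborel (cball z \<rho> :: (real \<times> real) set) = ennreal (pi * \<rho>\<^sup>2)"
  using emeasure_cball[of \<rho> z] by (simp add: unit_ball_vol_2 power2_eq_square)

lemma open_maximal_superlevel: "open (maximal_superlevel c e)"
  unfolding maximal_superlevel_def by (intro open_UN) auto

text \<open>The weak type estimate of Hardy and Littlewood, by the Vitali covering lemma; the factor
  \<open>25\<close> is the fivefold enlargement of radii in dimension two.\<close>

lemma maximal_weak_type:
  assumes e: "integrable lborel e" "\<And>x. e x \<ge> 0" and c: "c > 0"
  shows "emeasure lborel (maximal_superlevel c e) \<le> ennreal (25 / c * (LINT x|lborel. e x))"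
proof -
  define K where "K = {(z :: real \<times> real, \<rho>). \<rho> > 0 \<and> c * measure lborel (ball z \<rho>) < (LINT y|lborel. indicator (ball z \<rho>) y * e y)}"
  define I where "I = (LINT x|lborel. e x)"
  have I: "I \<ge> 0" unfolding I_def using e by (intro integral_nonneg_AE) auto
  have iB: "integrable lborel (\<lambda>y. indicator B y * e y)" if "B \<in> sets borel" for B
    using integrable_mult_indicator[of B lborel e] that e by simp
  define B where "B = I / (c * pi) + 1"
  have bnd: "0 < snd i \<and> snd i \<le> B" if i: "i \<in> K" for i
  proof -
    obtain z \<rho> where z: "i = (z, \<rho>)" by (cases i)
    have r: "\<rho> > 0" and lt: "c * measure lborel (ball z \<rho>) < (LINT y|lborel. indicator (ball z \<rho>) y * e y)" using i z by (auto simp: K_def)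
    have "(LINT y|lborel. indicator (ball z \<rho>) y * e y) \<le> I" unfolding I_def
      using e iB[of "ball z \<rho>"] by (intro integral_mono) (auto simp: indicator_def)
    then have "c * (pi * \<rho>\<^sup>2) \<le> I" using lt r measure_ball2[of \<rho> z] by simp
    then have "\<rho>\<^sup>2 \<le> I / (c * pi)" using c by (simp add: field_simps)
    moreover have "\<rho> \<le> \<rho>\<^sup>2 + 1" using zero_le_power2[of "\<rho> - 1/2"] by (simp add: power2_diff power_one_over)
    ultimately show ?thesis using r z by (simp add: B_def)
  qed
  have cov0: "maximal_superlevel c e \<subseteq> (\<Union>i\<in>K. cball (fst i) (snd i))" unfolding maximal_superlevel_def K_def by force
  obtain C where C: "countable C" "C \<subseteq> K" "pairwise (\<lambda>i j. disjnt (cball (fst i) (snd i)) (cball (fst j) (snd j))) C"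
    and cov: "maximal_superlevel c e \<subseteq> (\<Union>i\<in>C. cball (fst i) (5 * snd i))"
    by (rule Vitali_covering_lemma_cballs[OF cov0 bnd], assumption) (rule that)
  define N where "N = to_nat_on C ` C"
  define X where "X n = (if n \<in> N then cball (fst (from_nat_into C n)) (5 * snd (from_nat_into C n)) else {})" for n
  define X' where "X' n = (if n \<in> N then ball (fst (from_nat_into C n)) (snd (from_nat_into C n)) else {})" for n
  have inC: "from_nat_into C n \<in> C" if "n \<in> N" for n using that C(1) by (auto simp: N_def)
  have "maximal_superlevel c e \<subseteq> (\<Union>n. X n)"
  proof
    fix x assume "x \<in> maximal_superlevel c e"
    then obtain i where "i \<in> C" "x \<in> cball (fst i) (5 * snd i)" using cov by blast
    then show "x \<in> (\<Union>n. X n)" using C(1) by (intro UN_I[of "to_nat_on C i"]) (auto simp: X_def N_def)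
  qed
  then have "emeasure lborel (maximal_superlevel c e) \<le> emeasure lborel (\<Union>n. X n)" by (intro emeasure_mono) (auto simp: X_def)
  also have "\<dots> \<le> (\<Sum>n. emeasure lborel (X n))" by (rule emeasure_subadditive_countably) (auto simp: X_def)
  also have "\<dots> \<le> (\<Sum>n. ennreal (25 / c) * emeasure (density lborel (\<lambda>x. ennreal (e x))) (X' n))"
  proof (intro suminf_le summableI)
    fix n
    show "emeasure lborel (X n) \<le> ennreal (25 / c) * emeasure (density lborel (\<lambda>x. ennreal (e x))) (X' n)"
    proof (cases "n \<in> N")
      case True
      obtain z \<rho> where z: "from_nat_into C n = (z, \<rho>)" by (cases "from_nat_into C n")
      have "(z, \<rho>) \<in> K" using inC[OF True] C(2) z by auto
      then have r: "\<rho> > 0" and lt: "c * measure lborel (ball z \<rho>) < (LINT y|lborel. indicator (ball z \<rho>) y * e y)" by (auto simp: K_def)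
      have "emeasure (density lborel (\<lambda>x. ennreal (e x))) (X' n) = (\<integral>\<^sup>+y. ennreal (e y) * indicator (ball z \<rho>) y \<partial>lborel)"
        using e(1) True z by (subst emeasure_density) (auto simp: X'_def)
      also have "\<dots> = (\<integral>\<^sup>+y. ennreal (indicator (ball z \<rho>) y * e y) \<partial>lborel)"
        by (intro nn_integral_cong) (auto simp: indicator_def)
      also have "\<dots> = ennreal (LINT y|lborel. indicator (ball z \<rho>) y * e y)"
        by (rule nn_integral_eq_integral[OF iB]) (use e in auto)
      finally have eq: "emeasure (density lborel (\<lambda>x. ennreal (e x))) (X' n) = ennreal (LINT y|lborel. indicator (ball z \<rho>) y * e y)" .
      have "emeasure lborel (X n) = ennreal (25 / c * (c * (pi * \<rho>\<^sup>2)))"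
        using True z r c by (simp add: X_def emeasure_cball2 power_mult_distrib)
      also have "\<dots> \<le> ennreal (25 / c * (LINT y|lborel. indicator (ball z \<rho>) y * e y))"
        using lt r c measure_ball2[of \<rho> z] by (intro ennreal_leI mult_left_mono) auto
      also have "\<dots> = ennreal (25 / c) * ennreal (LINT y|lborel. indicator (ball z \<rho>) y * e y)"
        using c by (intro ennreal_mult') auto
      finally show ?thesis unfolding eq .
    qed (simp add: X_def)
  qed
  also have "\<dots> = ennreal (25 / c) * (\<Sum>n. emeasure (density lborel (\<lambda>x. ennreal (e x))) (X' n))" by simp
  also have "(\<Sum>n. emeasure (density lborel (\<lambda>x. ennreal (e x))) (X' n)) = emeasure (density lborel (\<lambda>x. ennreal (e x))) (\<Union>n. X' n)"
  proof (rule suminf_emeasure)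
    show "range X' \<subseteq> sets (density lborel (\<lambda>x. ennreal (e x)))" by (auto simp: X'_def)
    show "disjoint_family X'"
    proof (unfold disjoint_family_on_def, intro ballI impI)
      fix m n :: nat assume mn: "m \<noteq> n"
      show "X' m \<inter> X' n = {}"
      proof (cases "m \<in> N \<and> n \<in> N")
        case True
        have "to_nat_on C (from_nat_into C k) = k" if "k \<in> N" for k using that C(1) by (auto simp: N_def)
        then have "from_nat_into C m \<noteq> from_nat_into C n" using True mn by metis
        then have "disjnt (cball (fst (from_nat_into C m)) (snd (from_nat_into C m))) (cball (fst (from_nat_into C n)) (snd (from_nat_into C n)))"
          using C(3) inC True unfolding pairwise_def by blast
        then show ?thesis using True unfolding X'_def disjnt_def by simp (meson ball_subset_cball disjoint_iff subsetD)
      qed (auto simp: X'_def)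
    qed
  qed
  also have "\<dots> \<le> emeasure (density lborel (\<lambda>x. ennreal (e x))) UNIV" by (rule emeasure_mono) auto
  also have "\<dots> = (\<integral>\<^sup>+y. ennreal (e y) \<partial>lborel)" using e(1) by (subst emeasure_density) auto
  also have "\<dots> = ennreal I" unfolding I_def by (rule nn_integral_eq_integral) (use e in auto)
  also have "ennreal (25 / c) * ennreal I = ennreal (25 / c * I)" using c I by (intro ennreal_mult[symmetric]) auto
  finally show ?thesis unfolding I_def by (simp add: mult_left_mono)
qed

section \<open>Oscillation of functions with bounded gradient averages\<close>

text \<open>Integrate the gradient along the segment from \<open>x\<close> to \<open>z\<close>. For
  fixed \<open>s\<close>, the points \<open>(1 - s) x + s z\<close> with \<open>z\<close> in the
  ball fill a ball of radius \<open>s * \<rho>\<close> that contains \<open>x\<close>, and there the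
  average of the gradient is at most \<open>K\<close>.\<close>

lemma oscillation_on_ball:
  assumes g: "has_grad \<psi> g1 g2" "continuous_on UNIV g1" "continuous_on UNIV g2"
    and x: "x \<in> ball z0 \<rho>" and K: "K \<ge> 0"
    and H: "\<And>z' \<rho>'. 0 < \<rho>' \<Longrightarrow> x \<in> ball z' \<rho>' \<Longrightarrow> ball z' \<rho>' \<subseteq> ball z0 \<rho> \<Longrightarrow>
      (LINT y|lborel. indicator (ball z' \<rho>') y * (\<bar>g1 y\<bar> + \<bar>g2 y\<bar>)) \<le> K * (pi * \<rho>'\<^sup>2)"
  shows "(LINT y|lborel. indicator (ball z0 \<rho>) y * \<bar>\<psi> y - \<psi> x\<bar>) \<le> 2 * \<rho> * K * (pi * \<rho>\<^sup>2)"
proof -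
  have \<rho>: "\<rho> > 0" using x by (auto intro: le_less_trans[OF zero_le_dist])
  define a where "a y = \<bar>g1 y\<bar> + \<bar>g2 y\<bar>" for y
  have ac: "continuous_on UNIV a" unfolding a_def[abs_def] using g by (auto intro!: continuous_intros)
  have \<psi>c: "continuous_on UNIV \<psi>" by (rule has_grad_cont[OF g(1)])
  have [measurable]: "a \<in> borel_measurable borel" "\<psi> \<in> borel_measurable borel" using ac \<psi>c by (auto intro: borel_measurable_continuous_onI)
  have bi: "integrable lborel (\<lambda>y. indicator (ball z r) y * f y)" if "continuous_on UNIV f" for f :: "real \<times> real \<Rightarrow> real" and z r
  proof -
    have fm[measurable]: "f \<in> borel_measurable borel" using that by (rule borel_measurable_continuous_onI)
    have "integrable lborel (\<lambda>y. indicator (cball z r) y *\<^sub>R f y)"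
      by (rule borel_integrable_compact) (use that in \<open>auto intro: continuous_on_subset\<close>)
    from integrable_mult_indicator[OF _ this, of "ball z r"]
    have "integrable lborel (\<lambda>y. indicator (ball z r) y *\<^sub>R indicator (cball z r) y *\<^sub>R f y)" by simp
    moreover have "(\<lambda>y. indicator (ball z r) y *\<^sub>R indicator (cball z r) y *\<^sub>R f y) = (\<lambda>y. indicator (ball z r) y * f y)"
      by (auto simp: fun_eq_iff indicator_def)
    ultimately show ?thesis by simp
  qed
  define T where "T s z = (1 - s) *\<^sub>R x + s *\<^sub>R z" for s and z :: "real \<times> real"
  have pt: "ennreal \<bar>\<psi> z - \<psi> x\<bar> \<le> ennreal (2 * \<rho>) * (\<integral>\<^sup>+s. indicator {0..1} s * ennreal (a (T s z)) \<partial>lborel)" if z: "z \<in> ball z0 \<rho>" for z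
  proof -
    have Tc: "continuous_on S (\<lambda>s. T s z)" for S unfolding T_def by (intro continuous_intros)
    have aTc: "continuous_on S (\<lambda>s. a (T s z))" for S by (rule continuous_on_compose2[OF ac Tc]) simp
    have "((\<lambda>s. fst (z - x) * g1 (T s z) + snd (z - x) * g2 (T s z)) has_integral (\<psi> (T 1 z) - \<psi> (T 0 z))) {0..1}"
    proof (rule fundamental_theorem_of_calculus)
      fix s :: real
      have "((\<lambda>s. T s z) has_derivative (\<lambda>t. t *\<^sub>R (z - x))) (at s within {0..1})"
        unfolding T_def by (auto intro!: derivative_eq_intros simp: algebra_simps)
      from has_derivative_compose[OF this has_gradD[OF g(1)]]
      show "((\<lambda>s. \<psi> (T s z)) has_vector_derivative fst (z - x) * g1 (T s z) + snd (z - x) * g2 (T s z)) (at s within {0..1})"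
        unfolding has_vector_derivative_def by (rule has_derivative_eq_rhs) (auto simp: algebra_simps)
    qed simp
    then have hi: "((\<lambda>s. fst (z - x) * g1 (T s z) + snd (z - x) * g2 (T s z)) has_integral (\<psi> z - \<psi> x)) {0..1}" by (simp add: T_def)
    have nz: "norm (z - x) \<le> 2 * \<rho>"
      using z x norm_triangle_ineq4[of "z - z0" "x - z0"] by (simp add: dist_norm norm_minus_commute)
    have "norm (\<psi> z - \<psi> x) \<le> integral {0..1} (\<lambda>s. 2 * \<rho> * a (T s z))"
      unfolding integral_unique[OF hi, symmetric]
    proof (rule integral_norm_bound_integral)
      show "(\<lambda>s. 2 * \<rho> * a (T s z)) integrable_on {0..1}" by (intro integrable_continuous_interval continuous_intros aTc)
      fix s :: real
      have "\<bar>fst (z - x) * g1 (T s z) + snd (z - x) * g2 (T s z)\<bar> \<le> \<bar>fst (z - x)\<bar> * \<bar>g1 (T s z)\<bar> + \<bar>snd (z - x)\<bar> * \<bar>g2 (T s z)\<bar>"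
        by (metis abs_mult abs_triangle_ineq)
      also have "\<dots> \<le> (2 * \<rho>) * \<bar>g1 (T s z)\<bar> + (2 * \<rho>) * \<bar>g2 (T s z)\<bar>"
        by (intro add_mono mult_right_mono order_trans[OF abs_fst_le nz] order_trans[OF abs_snd_le nz]) auto
      finally show "norm (fst (z - x) * g1 (T s z) + snd (z - x) * g2 (T s z)) \<le> 2 * \<rho> * a (T s z)" by (simp add: a_def algebra_simps)
    qed (use hi in auto)
    also have "\<dots> = 2 * \<rho> * integral {0..1} (\<lambda>s. a (T s z))" by simp
    also have "integral {0..1} (\<lambda>s. a (T s z)) = (LINT s|lborel. indicator {0..1} s * a (T s z))"
    proof -
      have "set_integrable lborel {0..1} (\<lambda>s. a (T s z))"
        unfolding set_integrable_def by (rule borel_integrable_compact) (use aTc in auto)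
      from set_borel_integral_eq_integral(2)[OF this] show ?thesis
        unfolding set_lebesgue_integral_def real_scaleR_def by (rule sym)
    qed
    finally have "ennreal \<bar>\<psi> z - \<psi> x\<bar> \<le> ennreal (2 * \<rho> * (LINT s|lborel. indicator {0..1} s * a (T s z)))" by (intro ennreal_leI) simp
    also have "\<dots> = ennreal (2 * \<rho>) * ennreal (LINT s|lborel. indicator {0..1} s * a (T s z))" using \<rho> by (intro ennreal_mult') simp
    also have "ennreal (LINT s|lborel. indicator {0..1} s * a (T s z)) = (\<integral>\<^sup>+s. ennreal (indicator {0..1} s * a (T s z)) \<partial>lborel)"
    proof (rule nn_integral_eq_integral[symmetric])
      have "integrable lborel (\<lambda>s. indicator {0..1::real} s *\<^sub>R a (T s z))" by (rule borel_integrable_compact) (use aTc in auto)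
      then show "integrable lborel (\<lambda>s. indicator {0..1} s * a (T s z))" by simp
    qed (auto simp: a_def)
    also have "\<dots> = (\<integral>\<^sup>+s. indicator {0..1} s * ennreal (a (T s z)) \<partial>lborel)" by (intro nn_integral_cong) (auto simp: indicator_def)
    finally show ?thesis .
  qed
  have inner: "(\<integral>\<^sup>+z. indicator (ball z0 \<rho>) z * ennreal (a (T s z)) \<partial>lborel) \<le> ennreal (K * (pi * \<rho>\<^sup>2))" if s: "0 < s" "s \<le> 1" for s
  proof -
    have dT: "dist (T s z) (T s z') = s * dist z z'" for z z' using s by (simp add: T_def dist_norm flip: scaleR_diff_right)
    have xT: "T s x = x" by (simp add: T_def algebra_simps flip: scaleR_add_left)
    have b1: "x \<in> ball (T s z0) (s * \<rho>)" using dT[of z0 x] xT x s by simp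
    have b2: "ball (T s z0) (s * \<rho>) \<subseteq> ball z0 \<rho>"
    proof
      fix y assume y: "y \<in> ball (T s z0) (s * \<rho>)"
      have "z0 - T s z0 = (1 - s) *\<^sub>R (z0 - x)" by (simp add: T_def algebra_simps)
      then have "dist z0 (T s z0) = (1 - s) * dist z0 x" using s by (simp add: dist_norm)
      also have "\<dots> \<le> (1 - s) * \<rho>" using s x by (intro mult_left_mono) auto
      finally have "dist z0 (T s z0) \<le> (1 - s) * \<rho>" .
      then show "y \<in> ball z0 \<rho>" using y dist_triangle[of z0 y "T s z0"] by (simp add: algebra_simps)
    qed
    define F where "F z = indicator (ball (T s z0) (s * \<rho>)) z * ennreal (a z)" for z
    have [measurable]: "ball (T s z0) (s * \<rho>) \<in> sets borel" by simp
    have Fm[measurable]: "F \<in> borel_measurable borel" unfolding F_def[abs_def] by measurable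
    have FT: "F ((1 - s) *\<^sub>R x + s *\<^sub>R z) = indicator (ball z0 \<rho>) z * ennreal (a (T s z))" for z
      using dT[of z0 z] s by (auto simp: F_def indicator_def T_def)
    have "(\<integral>\<^sup>+z. F z \<partial>lborel) = ennreal (s\<^sup>2) * (\<integral>\<^sup>+z. F ((1 - s) *\<^sub>R x + s *\<^sub>R z) \<partial>lborel)"
      using s by (subst lborel_affine[of s "(1 - s) *\<^sub>R x"]) (auto simp: nn_integral_density nn_integral_distr nn_integral_cmult power2_eq_square)
    moreover have "(\<integral>\<^sup>+z. F z \<partial>lborel) \<le> ennreal (K * (pi * (s * \<rho>)\<^sup>2))"
    proof -
      have "(\<integral>\<^sup>+z. F z \<partial>lborel) = (\<integral>\<^sup>+z. ennreal (indicator (ball (T s z0) (s * \<rho>)) z * a z) \<partial>lborel)"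
        by (intro nn_integral_cong) (auto simp: F_def indicator_def)
      also have "\<dots> = ennreal (LINT z|lborel. indicator (ball (T s z0) (s * \<rho>)) z * a z)"
        by (rule nn_integral_eq_integral[OF bi[OF ac]]) (auto simp: a_def)
      also have "\<dots> \<le> ennreal (K * (pi * (s * \<rho>)\<^sup>2))" using H[OF _ b1 b2] s \<rho> by (intro ennreal_leI) (simp add: a_def)
      finally show ?thesis .
    qed
    ultimately have "ennreal (s\<^sup>2) * (\<integral>\<^sup>+z. indicator (ball z0 \<rho>) z * ennreal (a (T s z)) \<partial>lborel) \<le> ennreal (s\<^sup>2) * ennreal (K * (pi * \<rho>\<^sup>2))"
      unfolding FT using K by (simp add: ennreal_mult'[symmetric] power_mult_distrib mult_ac)
    then show ?thesis using s by (subst (asm) ennreal_mult_le_mult_iff) auto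
  qed
  have [measurable]: "ball z0 \<rho> \<in> sets borel" by simp
  have [measurable]: "(\<lambda>(s, z). T s z) \<in> borel_measurable (lborel \<Otimes>\<^sub>M lborel)" unfolding T_def by measurable
  have iL: "integrable lborel (\<lambda>y. indicator (ball z0 \<rho>) y * \<bar>\<psi> y - \<psi> x\<bar>)" by (rule bi) (use \<psi>c in \<open>auto intro!: continuous_intros\<close>)
  have "ennreal (LINT y|lborel. indicator (ball z0 \<rho>) y * \<bar>\<psi> y - \<psi> x\<bar>) = (\<integral>\<^sup>+y. ennreal (indicator (ball z0 \<rho>) y * \<bar>\<psi> y - \<psi> x\<bar>) \<partial>lborel)"
    by (rule nn_integral_eq_integral[symmetric, OF iL]) auto
  also have "\<dots> \<le> (\<integral>\<^sup>+z. ennreal (2 * \<rho>) * (\<integral>\<^sup>+s. indicator (ball z0 \<rho>) z * (indicator {0..1} s * ennreal (a (T s z))) \<partial>lborel) \<partial>lborel)"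
  proof (intro nn_integral_mono)
    fix z show "ennreal (indicator (ball z0 \<rho>) z * \<bar>\<psi> z - \<psi> x\<bar>) \<le> ennreal (2 * \<rho>) * (\<integral>\<^sup>+s. indicator (ball z0 \<rho>) z * (indicator {0..1} s * ennreal (a (T s z))) \<partial>lborel)"
      using pt[of z] by (cases "z \<in> ball z0 \<rho>") auto
  qed
  also have "\<dots> = ennreal (2 * \<rho>) * (\<integral>\<^sup>+z. (\<integral>\<^sup>+s. indicator (ball z0 \<rho>) z * (indicator {0..1} s * ennreal (a (T s z))) \<partial>lborel) \<partial>lborel)"
    by (rule nn_integral_cmult) measurable
  also have "(\<integral>\<^sup>+z. (\<integral>\<^sup>+s. indicator (ball z0 \<rho>) z * (indicator {0..1} s * ennreal (a (T s z))) \<partial>lborel) \<partial>lborel)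
    = (\<integral>\<^sup>+s. (\<integral>\<^sup>+z. indicator (ball z0 \<rho>) z * (indicator {0..1} s * ennreal (a (T s z))) \<partial>lborel) \<partial>lborel)"
    by (rule lborel_pair.Fubini') measurable
  also have "\<dots> \<le> (\<integral>\<^sup>+s. ennreal (K * (pi * \<rho>\<^sup>2)) * indicator {0..1::real} s \<partial>lborel)"
  proof (rule nn_integral_mono_AE)
    have "AE s in lborel. s \<noteq> (0::real)" by (rule AE_lborel_singleton)
    then show "AE s in lborel. (\<integral>\<^sup>+z. indicator (ball z0 \<rho>) z * (indicator {0..1} s * ennreal (a (T s z))) \<partial>lborel) \<le> ennreal (K * (pi * \<rho>\<^sup>2)) * indicator {0..1} s"
    proof eventually_elim
      case (elim s)
      show ?case using inner[of s] elim by (cases "s \<in> {0..1}") auto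
    qed
  qed
  also have "\<dots> = ennreal (K * (pi * \<rho>\<^sup>2))" by (simp add: nn_integral_cmult)
  finally have "ennreal (LINT y|lborel. indicator (ball z0 \<rho>) y * \<bar>\<psi> y - \<psi> x\<bar>) \<le> ennreal (2 * \<rho> * (K * (pi * \<rho>\<^sup>2)))"
    using \<rho> by (simp add: ennreal_mult' mult_left_mono)
  then show ?thesis using \<rho> K by (simp add: ennreal_le_iff mult.assoc)
qed

section \<open>Lipschitz truncation\<close>

text \<open>The noncentred maximal function of \<open>a\<close> relative to \<open>Y\<close> is at
  most \<open>K\<close> at \<open>x\<close>.\<close>

definition avg_bounded :: "real \<Rightarrow> (real \<times> real) set \<Rightarrow> (real \<times> real \<Rightarrow> real) \<Rightarrow> real \<times> real \<Rightarrow> bool" where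
  "avg_bounded K Y a x \<longleftrightarrow> (\<forall>z \<rho>. 0 < \<rho> \<longrightarrow> x \<in> ball z \<rho> \<longrightarrow> ball z \<rho> \<subseteq> Y \<longrightarrow>
    (LINT y|lborel. indicator (ball z \<rho>) y * a y) \<le> K * (pi * \<rho>\<^sup>2))"

lemma integrable_indicator_ball:
  fixes f :: "real \<times> real \<Rightarrow> real"
  assumes "continuous_on UNIV f" shows "integrable lborel (\<lambda>y. indicator (ball z r) y * f y)"
proof -
  have fm[measurable]: "f \<in> borel_measurable borel" using assms by (rule borel_measurable_continuous_onI)
  have "integrable lborel (\<lambda>y. indicator (cball z r) y *\<^sub>R f y)"
    by (rule borel_integrable_compact) (use assms in \<open>auto intro: continuous_on_subset\<close>)
  from integrable_mult_indicator[OF _ this, of "ball z r"]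
  have "integrable lborel (\<lambda>y. indicator (ball z r) y *\<^sub>R indicator (cball z r) y *\<^sub>R f y)" by simp
  moreover have "(\<lambda>y. indicator (ball z r) y *\<^sub>R indicator (cball z r) y *\<^sub>R f y) = (\<lambda>y. indicator (ball z r) y * f y)"
    by (auto simp: fun_eq_iff indicator_def)
  ultimately show ?thesis by simp
qed

lemma integral_indicator_ball: "\<rho> \<ge> 0 \<Longrightarrow> (LINT y|lborel. indicator (ball z \<rho> :: (real \<times> real) set) y * c) = c * (pi * \<rho>\<^sup>2)"
  using measure_ball2[of \<rho> z] by (simp add: mult.commute)

lemma integrable_indicator_ball_const: "integrable lborel (\<lambda>y. indicator (ball z \<rho> :: (real \<times> real) set) y * (c::real))"
  by (rule integrable_indicator_ball) simp

text \<open>Average \<open>\<bar>\<psi> x - \<psi> y\<bar> \<le> \<bar>\<psi> w - \<psi> x\<bar> +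
  \<bar>\<psi> w - \<psi> y\<bar>\<close> over the points \<open>w\<close> of a ball that contains
  both \<open>x\<close> and \<open>y\<close> and has radius comparable to their distance.\<close>

lemma avg_bounded_Lipschitz:
  assumes g: "has_grad \<psi> g1 g2" "continuous_on UNIV g1" "continuous_on UNIV g2" and K: "K \<ge> 0"
    and a: "avg_bounded K Y (\<lambda>y. \<bar>g1 y\<bar> + \<bar>g2 y\<bar>) x" "avg_bounded K Y (\<lambda>y. \<bar>g1 y\<bar> + \<bar>g2 y\<bar>) y"
    and sub: "ball ((1/2) *\<^sub>R (x + y)) (dist x y) \<subseteq> Y"
  shows "\<bar>\<psi> x - \<psi> y\<bar> \<le> 4 * K * dist x y"
proof (cases "x = y")
  case False
  define \<rho> where "\<rho> = dist x y"
  define z where "z = (1/2) *\<^sub>R (x + y)"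
  have \<rho>: "\<rho> > 0" using False by (simp add: \<rho>_def)
  have "z - x = (1/2) *\<^sub>R (y - x)" "z - y = (1/2) *\<^sub>R (x - y)" by (simp_all add: z_def algebra_simps flip: scaleR_add_left)
  then have "dist z x = \<rho> / 2" "dist z y = \<rho> / 2" by (simp_all add: dist_norm \<rho>_def norm_minus_commute)
  then have xy: "x \<in> ball z \<rho>" "y \<in> ball z \<rho>" using \<rho> by auto
  have o: "(LINT w|lborel. indicator (ball z \<rho>) w * \<bar>\<psi> w - \<psi> p\<bar>) \<le> 2 * \<rho> * K * (pi * \<rho>\<^sup>2)"
    if "p \<in> ball z \<rho>" "avg_bounded K Y (\<lambda>y. \<bar>g1 y\<bar> + \<bar>g2 y\<bar>) p" for p
    by (rule oscillation_on_ball[OF g that(1) K]) (use that(2) sub in \<open>auto simp: avg_bounded_def z_def \<rho>_def\<close>)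
  have c: "continuous_on UNIV (\<lambda>w. \<bar>\<psi> w - \<psi> p\<bar>)" for p using has_grad_cont[OF g(1)] by (auto intro!: continuous_intros)
  have "\<bar>\<psi> x - \<psi> y\<bar> * (pi * \<rho>\<^sup>2) = (LINT w|lborel. indicator (ball z \<rho>) w * \<bar>\<psi> x - \<psi> y\<bar>)"
    by (subst integral_indicator_ball) (use \<rho> in auto)
  also have "\<dots> \<le> (LINT w|lborel. indicator (ball z \<rho>) w * \<bar>\<psi> w - \<psi> x\<bar> + indicator (ball z \<rho>) w * \<bar>\<psi> w - \<psi> y\<bar>)"
    by (intro integral_mono integrable_indicator_ball_const Bochner_Integration.integrable_add integrable_indicator_ball c)
      (auto simp: indicator_def)
  also have "\<dots> \<le> 2 * \<rho> * K * (pi * \<rho>\<^sup>2) + 2 * \<rho> * K * (pi * \<rho>\<^sup>2)"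
    by (subst Bochner_Integration.integral_add) (intro integrable_indicator_ball c add_mono o xy a)+
  also have "\<dots> = (4 * K * \<rho>) * (pi * \<rho>\<^sup>2)" by simp
  finally show ?thesis using \<rho> by (simp add: \<rho>_def[symmetric] mult_le_cancel_right)
qed simp

lemma avg_bounded_value:
  assumes c: "continuous_on UNIV a" and Y: "open Y" "x \<in> Y" and b: "avg_bounded K Y a x"
  shows "a x \<le> K"
proof (rule ccontr)
  assume "\<not> a x \<le> K"
  then have lt: "K < a x" by simp
  define k where "k = (K + a x) / 2"
  have k: "K < k" "k < a x" using lt by (auto simp: k_def)
  have "open {y. k < a y}" using c by (simp add: open_Collect_less)
  then have "open (Y \<inter> {y. k < a y})" using Y by blast
  moreover have "x \<in> Y \<inter> {y. k < a y}" using k Y by auto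
  ultimately obtain \<rho> where \<rho>: "\<rho> > 0" "ball x \<rho> \<subseteq> Y \<inter> {y. k < a y}" by (meson open_contains_ball)
  have "k * (pi * \<rho>\<^sup>2) = (LINT y|lborel. indicator (ball x \<rho>) y * k)" by (subst integral_indicator_ball) (use \<rho> in auto)
  also have "\<dots> \<le> (LINT y|lborel. indicator (ball x \<rho>) y * a y)"
    by (intro integral_mono integrable_indicator_ball_const integrable_indicator_ball c) (use \<rho> in \<open>auto simp: indicator_def\<close>)
  also have "\<dots> \<le> K * (pi * \<rho>\<^sup>2)" using b[unfolded avg_bounded_def, rule_format, of \<rho> x] \<rho> by auto
  finally show False using k \<rho> by (simp add: mult_le_cancel_right)
qed

text \<open>Split \<open>a \<le> C + max 0 (a - C)\<close>. Truncating at \<open>C\<close> first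
  makes the exceptional set as small as the excess of \<open>a\<close> over
  \<open>C\<close>.\<close>

lemma avg_bounded_outside_superlevel:
  assumes c: "continuous_on UNIV a" and e: "integrable lborel (\<lambda>y. indicator Y y * max 0 (a y - C))"
    and x: "x \<notin> maximal_superlevel 1 (\<lambda>y. indicator Y y * max 0 (a y - C))"
  shows "avg_bounded (C + 1) Y a x"
  unfolding avg_bounded_def
proof (intro allI impI)
  fix z \<rho> assume \<rho>: "0 < \<rho>" and xb: "x \<in> ball z \<rho>" and sub: "ball z \<rho> \<subseteq> Y"
  define e where "e = (\<lambda>y. indicator Y y * max 0 (a y - C))"
  have ei: "integrable lborel (\<lambda>y. indicator (ball z \<rho>) y * e y)"
    using integrable_mult_indicator[of "ball z \<rho>" lborel e] assms(2) by (simp add: e_def)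
  have "\<not> (1 * measure lborel (ball z \<rho>) < (LINT y|lborel. indicator (ball z \<rho>) y * e y))"
  proof
    assume "1 * measure lborel (ball z \<rho>) < (LINT y|lborel. indicator (ball z \<rho>) y * e y)"
    then have "x \<in> maximal_superlevel 1 e" unfolding maximal_superlevel_def by (intro UN_I[of "(z, \<rho>)"]) (use xb \<rho> in auto)
    then show False using x by (simp add: e_def)
  qed
  then have *: "(LINT y|lborel. indicator (ball z \<rho>) y * e y) \<le> pi * \<rho>\<^sup>2" using \<rho> measure_ball2[of \<rho> z] by simp
  have "(LINT y|lborel. indicator (ball z \<rho>) y * a y) \<le> (LINT y|lborel. indicator (ball z \<rho>) y * C + indicator (ball z \<rho>) y * e y)"
    by (intro integral_mono integrable_indicator_ball c Bochner_Integration.integrable_add integrable_indicator_ball_const ei)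
      (use sub in \<open>auto simp: indicator_def e_def\<close>)
  also have "\<dots> = C * (pi * \<rho>\<^sup>2) + (LINT y|lborel. indicator (ball z \<rho>) y * e y)"
    by (subst Bochner_Integration.integral_add[OF integrable_indicator_ball_const ei], subst integral_indicator_ball) (use \<rho> in auto)
  finally show "(LINT y|lborel. indicator (ball z \<rho>) y * a y) \<le> (C + 1) * (pi * \<rho>\<^sup>2)" using * by (simp add: algebra_simps)
qed

lemma eta_sup_bound:
  obtains C where "C > 0" "\<And>s p. s > 0 \<Longrightarrow> eta s p \<le> C / s\<^sup>2"
proof -
  obtain C where C: "C > 0" "\<And>p. \<bar>eta 1 p\<bar> \<le> C" using eta_bounded[of 1] by auto
  show ?thesis
  proof (rule that[OF C(1)])
    fix s :: real and p assume s: "s > 0"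
    have "eta 1 ((1 / s) *\<^sub>R p) \<le> C" using C(2)[of "(1 / s) *\<^sub>R p"] by (simp add: abs_le_iff)
    then show "eta s p \<le> C / s\<^sup>2" unfolding eta_scale[OF s] by (rule divide_right_mono) simp
  qed
qed

text \<open>At good points \<open>\<psi>\<close> differs from its mollification by at most a
  multiple of \<open>s * K\<close>, by \<open>oscillation_on_ball\<close>; the mollification has
  gradient at most \<open>m\<close>. So smallness of the mollified gradient, which weak convergence
  provides, controls the oscillation of \<open>\<psi>\<close> itself.\<close>

lemma mean_oscillation:
  assumes C0: "C0 > 0" "\<And>s p. s > 0 \<Longrightarrow> eta s p \<le> C0 / s\<^sup>2"
    and g: "has_grad \<psi> g1 g2" "continuous_on UNIV g1" "continuous_on UNIV g2" and K: "K \<ge> (0::real)"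
    and s: "0 < s" "s \<le> r" and x: "x \<in> ball x0 (2 * r)" "x' \<in> ball x0 (2 * r)"
    and ab: "avg_bounded K (ball x0 (6 * r)) (\<lambda>y. \<bar>g1 y\<bar> + \<bar>g2 y\<bar>) x" "avg_bounded K (ball x0 (6 * r)) (\<lambda>y. \<bar>g1 y\<bar> + \<bar>g2 y\<bar>) x'"
    and m: "\<And>p. p \<in> ball x0 (2 * r) \<Longrightarrow> \<bar>LINT y|lborel. g1 y * eta s (p - y)\<bar> \<le> m"
      "\<And>p. p \<in> ball x0 (2 * r) \<Longrightarrow> \<bar>LINT y|lborel. g2 y * eta s (p - y)\<bar> \<le> m"
  shows "\<bar>\<psi> x - \<psi> x'\<bar> \<le> 8 * r * m + 108 * pi * C0 * s * K"
proof -
  have \<psi>c: "continuous_on UNIV \<psi>" by (rule has_grad_cont[OF g(1)])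
  define h where "h y = indicator (ball x0 (6 * r)) y * \<psi> y" for y
  have hi: "integrable lborel h" unfolding h_def by (rule integrable_indicator_ball[OF \<psi>c])
  define \<Phi> where "\<Phi> = conv h (eta s)"
  note et = eta_test[OF s(1)]
  have hg: "has_grad \<Phi> (conv h (partial_x (eta s))) (conv h (partial_y (eta s)))"
    unfolding \<Phi>_def by (rule has_grad_conv_test[OF hi et])
  have in6: "y \<in> ball x0 (6 * r)" if "p \<in> ball x0 (2 * r)" "eta s (p - y) \<noteq> 0" for p y
  proof -
    have "norm (p - y) \<le> 2 * s" using eta_supp[OF s(1) that(2)] .
    then have "dist x0 y < 2 * r + 2 * s" using that(1) dist_triangle[of x0 y p] by (simp add: dist_norm)
    then show ?thesis using s by simp
  qed
  have grad: "conv h (partial_x (eta s)) p = (LINT y|lborel. g1 y * eta s (p - y))"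
    "conv h (partial_y (eta s)) p = (LINT y|lborel. g2 y * eta s (p - y))" if p: "p \<in> ball x0 (2 * r)" for p
  proof -
    define \<phi> where "\<phi> = (\<lambda>y. eta s (p - y))"
    have \<phi>: "\<phi> \<in> test_functions (ball x0 (6 * r))" unfolding \<phi>_def
    proof (rule eta_shift_test[OF s(1)])
      show "cball p (2 * s) \<subseteq> ball x0 (6 * r)"
      proof
        fix y assume "y \<in> cball p (2 * s)"
        then show "y \<in> ball x0 (6 * r)" using p s dist_triangle[of x0 y p] by simp
      qed
    qed
    note px = eta_shift_partial[OF s(1), of p, folded \<phi>_def]
    note \<phi>p = test_partial[OF \<phi>]
    obtain L where L: "compact L" "\<And>y. y \<notin> L \<Longrightarrow> \<phi> y = 0" using test_supportE[OF \<phi>] by metis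
    have hgu: "has_grad (\<lambda>y. \<psi> y * \<phi> y) (\<lambda>y. \<psi> y * partial_x \<phi> y + g1 y * \<phi> y) (\<lambda>y. \<psi> y * partial_y \<phi> y + g2 y * \<phi> y)"
      unfolding has_grad_def
    proof
      fix y
      show "((\<lambda>y. \<psi> y * \<phi> y) has_derivative (\<lambda>v. fst v * (\<psi> y * partial_x \<phi> y + g1 y * \<phi> y) + snd v * (\<psi> y * partial_y \<phi> y + g2 y * \<phi> y))) (at y)"
        by (rule has_derivative_eq_rhs[OF has_derivative_mult[OF has_gradD[OF g(1)] has_gradD[OF test_grad[OF \<phi>]]]])
          (simp add: fun_eq_iff algebra_simps)
    qed
    have z: "\<psi> y * \<phi> y = 0" if "y \<notin> L" for y using L(2)[OF that] by simp
    note cc = \<psi>c g(2,3) test_cont[OF \<phi>] test_cont[OF \<phi>p(1)] test_cont[OF \<phi>p(2)]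
    have i: "integrable lborel (\<lambda>y. f y * \<theta> y)" if f: "continuous_on UNIV f" and \<theta>: "\<theta> \<in> test_functions (ball x0 (6 * r))" for f \<theta> :: "real \<times> real \<Rightarrow> real"
    proof -
      obtain M where M: "compact M" "\<And>y. y \<notin> M \<Longrightarrow> \<theta> y = 0" using test_supportE[OF \<theta>] by metis
      show ?thesis by (rule integrable_compact_support[OF _ M(1)]) (use M f test_cont[OF \<theta>] in \<open>auto intro!: continuous_intros\<close>)
    qed
    have "(LINT y|lborel. \<psi> y * partial_x \<phi> y + g1 y * \<phi> y) = 0" "(LINT y|lborel. \<psi> y * partial_y \<phi> y + g2 y * \<phi> y) = 0"
      by (rule integral_partial_zero[OF hgu _ _ L(1) z]; (intro continuous_intros cc)?; assumption?)+
    then have by_parts: "(LINT y|lborel. \<psi> y * partial_x \<phi> y) = - (LINT y|lborel. g1 y * \<phi> y)"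
      "(LINT y|lborel. \<psi> y * partial_y \<phi> y) = - (LINT y|lborel. g2 y * \<phi> y)"
      using i[OF \<psi>c \<phi>p(1)] i[OF \<psi>c \<phi>p(2)] i[OF g(2) \<phi>] i[OF g(3) \<phi>] by simp_all
    have hz: "h y * - \<theta> y = - (\<psi> y * \<theta> y)" if "\<theta> \<in> test_functions (ball x0 (6 * r))" for \<theta> y
      using test_zero_outside[OF that, of y] by (cases "y \<in> ball x0 (6 * r)") (auto simp: h_def)
    have pe: "partial_x (eta s) (p - y) = - partial_x \<phi> y" "partial_y (eta s) (p - y) = - partial_y \<phi> y" for y using px by simp_all
    show "conv h (partial_x (eta s)) p = (LINT y|lborel. g1 y * eta s (p - y))"
      "conv h (partial_y (eta s)) p = (LINT y|lborel. g2 y * eta s (p - y))"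
      unfolding conv_def pe hz[OF \<phi>p(1)] hz[OF \<phi>p(2)] using by_parts by (simp_all add: \<phi>_def)
  qed
  have d\<Phi>: "\<bar>\<Phi> x - \<Phi> x'\<bar> \<le> 2 * m * norm (x - x')"
    by (rule grad_bound_Lipschitz[OF convex_ball has_gradD[OF hg] _ _ x]) (use grad m in auto)
  have "m \<ge> 0" using m(1)[OF x(1)] by linarith
  moreover have "norm (x - x') \<le> 4 * r" using x dist_triangle[of x x' x0] by (simp add: dist_norm norm_minus_commute)
  ultimately have "2 * m * norm (x - x') \<le> 2 * m * (4 * r)" by (intro mult_left_mono) auto
  with d\<Phi> have d: "\<bar>\<Phi> x - \<Phi> x'\<bar> \<le> 8 * r * m" by (simp add: mult_ac)
  have near: "\<bar>\<psi> p - \<Phi> p\<bar> \<le> 54 * pi * C0 * s * K"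
    if p: "p \<in> ball x0 (2 * r)" and abp: "avg_bounded K (ball x0 (6 * r)) (\<lambda>y. \<bar>g1 y\<bar> + \<bar>g2 y\<bar>) p" for p
  proof -
    have sub: "ball p (3 * s) \<subseteq> ball x0 (6 * r)"
    proof
      fix y assume "y \<in> ball p (3 * s)"
      then show "y \<in> ball x0 (6 * r)" using p s dist_triangle[of x0 y p] by simp
    qed
    have o: "(LINT y|lborel. indicator (ball p (3 * s)) y * \<bar>\<psi> y - \<psi> p\<bar>) \<le> 2 * (3 * s) * K * (pi * (3 * s)\<^sup>2)"
    proof (rule oscillation_on_ball[OF g _ K])
      show "p \<in> ball p (3 * s)" using s by simp
      fix z' \<rho>' assume *: "0 < \<rho>'" "p \<in> ball z' \<rho>'" "ball z' \<rho>' \<subseteq> ball p (3 * s)"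
      from *(3) sub have "ball z' \<rho>' \<subseteq> ball x0 (6 * r)" by (rule order_trans)
      with * abp show "(LINT y|lborel. indicator (ball z' \<rho>') y * (\<bar>g1 y\<bar> + \<bar>g2 y\<bar>)) \<le> K * (pi * \<rho>'\<^sup>2)"
        unfolding avg_bounded_def by blast
    qed
    have i1: "integrable lborel (\<lambda>y. \<psi> p * eta s (p - y))" using eta_shift_integral(4)[OF s(1)] by simp
    have i2: "integrable lborel (\<lambda>y. h y * eta s (p - y))" by (rule conv_eta_integrable[OF hi s(1)])
    have "\<psi> p - \<Phi> p = (LINT y|lborel. \<psi> p * eta s (p - y)) - (LINT y|lborel. h y * eta s (p - y))"
      using eta_shift_integral(3)[OF s(1)] by (simp add: \<Phi>_def conv_def)
    also have "\<dots> = (LINT y|lborel. \<psi> p * eta s (p - y) - h y * eta s (p - y))" using i1 i2 by simp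
    finally have "\<bar>\<psi> p - \<Phi> p\<bar> \<le> (LINT y|lborel. \<bar>\<psi> p * eta s (p - y) - h y * eta s (p - y)\<bar>)"
      using integral_abs_bound[of lborel "\<lambda>y. \<psi> p * eta s (p - y) - h y * eta s (p - y)"] by simp
    also have "\<dots> \<le> (LINT y|lborel. C0 / s\<^sup>2 * (indicator (ball p (3 * s)) y * \<bar>\<psi> y - \<psi> p\<bar>))"
    proof (rule integral_mono)
      show "integrable lborel (\<lambda>y. \<bar>\<psi> p * eta s (p - y) - h y * eta s (p - y)\<bar>)" using i1 i2 by simp
      show "integrable lborel (\<lambda>y. C0 / s\<^sup>2 * (indicator (ball p (3 * s)) y * \<bar>\<psi> y - \<psi> p\<bar>))"
        by (rule integrable_mult_right[OF integrable_indicator_ball]) (use \<psi>c in \<open>auto intro!: continuous_intros\<close>)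
      fix y
      show "\<bar>\<psi> p * eta s (p - y) - h y * eta s (p - y)\<bar> \<le> C0 / s\<^sup>2 * (indicator (ball p (3 * s)) y * \<bar>\<psi> y - \<psi> p\<bar>)"
      proof (cases "eta s (p - y) = 0")
        case False
        have y6: "y \<in> ball x0 (6 * r)" by (rule in6[OF p False])
        have "norm (p - y) \<le> 2 * s" by (rule eta_supp[OF s(1) False])
        then have y3: "y \<in> ball p (3 * s)" using s by (simp add: dist_norm)
        have "\<bar>\<psi> p * eta s (p - y) - h y * eta s (p - y)\<bar> = eta s (p - y) * \<bar>\<psi> y - \<psi> p\<bar>"
          using y6 eta_nonneg[of s "p - y"] by (simp add: h_def abs_mult abs_minus_commute flip: left_diff_distrib)
        also have "\<dots> \<le> C0 / s\<^sup>2 * \<bar>\<psi> y - \<psi> p\<bar>" by (intro mult_right_mono C0(2) s) auto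
        finally show ?thesis using y3 by simp
      qed (use C0 in simp)
    qed
    also have "\<dots> = C0 / s\<^sup>2 * (LINT y|lborel. indicator (ball p (3 * s)) y * \<bar>\<psi> y - \<psi> p\<bar>)" by simp
    also have "\<dots> \<le> C0 / s\<^sup>2 * (2 * (3 * s) * K * (pi * (3 * s)\<^sup>2))" using C0 by (intro mult_left_mono o) auto
    also have "\<dots> = 54 * pi * C0 * s * K" using s by (simp add: power2_eq_square field_simps)
    finally show ?thesis .
  qed
  show ?thesis
    using near[OF x(1) ab(1)] near[OF x(2) ab(2)] d by linarith
qed

text \<open>The extension of McShane, clipped at \<open>s\<close> and \<open>- s\<close>.\<close>

lemma Lipschitz_extension:
  fixes f :: "'a::metric_space \<Rightarrow> real"
  assumes L: "L \<ge> 0" "\<And>x y. x \<in> G \<Longrightarrow> y \<in> G \<Longrightarrow> \<bar>f x - f y\<bar> \<le> L * dist x y"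
    and s: "s \<ge> 0" "\<And>x. x \<in> G \<Longrightarrow> \<bar>f x\<bar> \<le> s"
  shows "\<exists>F. (\<forall>x y. \<bar>F x - F y\<bar> \<le> L * dist x y) \<and> (\<forall>x. \<bar>F x\<bar> \<le> s) \<and> (\<forall>x\<in>G. F x = f x)"
proof (cases "G = {}")
  case True
  then show ?thesis using L s by (intro exI[of _ "\<lambda>_. 0"]) auto
next
  case False
  define F where "F x = (INF y\<in>G. f y + L * dist x y)" for x
  have bdd: "bdd_below ((\<lambda>y. f y + L * dist x y) ` G)" for x
  proof (rule bdd_belowI2)
    fix y assume "y \<in> G"
    then show "- s \<le> f y + L * dist x y" using s(2)[of y] L mult_nonneg_nonneg[OF L(1) zero_le_dist, of x y] by linarith
  qed
  have F1: "F x \<le> F x' + L * dist x x'" for x x'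
  proof -
    have "F x - L * dist x x' \<le> f y + L * dist x' y" if y: "y \<in> G" for y
    proof -
      have "F x \<le> f y + L * dist x y" unfolding F_def by (rule cINF_lower[OF bdd y])
      also have "\<dots> \<le> f y + L * (dist x x' + dist x' y)" using L by (intro add_left_mono mult_left_mono dist_triangle) auto
      finally show ?thesis by (simp add: distrib_left)
    qed
    then have "F x - L * dist x x' \<le> F x'" unfolding F_def[of x'] by (intro cINF_greatest False)
    then show ?thesis by simp
  qed
  have F2: "F x = f x" if x: "x \<in> G" for x
  proof (rule antisym)
    show "F x \<le> f x" unfolding F_def using cINF_lower[OF bdd x, of x] by simp
    show "f x \<le> F x" unfolding F_def
    proof (rule cINF_greatest[OF False])
      fix y assume "y \<in> G" then show "f x \<le> f y + L * dist x y" using L(2)[OF x, of y] by linarith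
    qed
  qed
  define F' where "F' x = max (- s) (min s (F x))" for x
  show ?thesis
  proof (intro exI[of _ F'] conjI allI ballI)
    fix x y
    show "\<bar>F' x - F' y\<bar> \<le> L * dist x y" using F1[of x y] F1[of y x] by (simp add: F'_def dist_commute max_def min_def abs_le_iff)
    show "\<bar>F' x\<bar> \<le> s" using s by (auto simp: F'_def)
  next
    fix x assume "x \<in> G" then show "F' x = f x" using F2 s(2)[of x] by (auto simp: F'_def)
  qed
qed

lemma integral_reflect:
  fixes f :: "real \<times> real \<Rightarrow> real"
  assumes "f \<in> borel_measurable borel"
  shows "(LINT y|lborel. f (x - y)) = (LINT y|lborel. f y)"
proof -
  have "lborel = distr lborel borel (\<lambda>y. x - y :: real \<times> real)"
    using lborel_affine[of "-1" x] by (simp add: density_1)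
  then have "(LINT y|lborel. f y) = (LINT y|distr lborel borel (\<lambda>y. x - y). f y)" by simp
  also have "\<dots> = (LINT y|lborel. f (x - y))" by (rule integral_distr) (use assms in auto)
  finally show ?thesis by simp
qed

lemma conv_flip:
  assumes "h \<in> borel_measurable borel" "z \<in> borel_measurable borel"
  shows "conv h z x = conv z h x"
  using integral_reflect[of "\<lambda>y. h y * z (x - y)" x] assms by (simp add: conv_def mult.commute)

lemma conv_Lipschitz:
  assumes w: "continuous_on UNIV w" "integrable lborel w" and L: "\<And>x y. \<bar>w x - w y\<bar> \<le> L * dist x y" and t: "t > 0"
  shows "\<bar>conv w (eta t) x - conv w (eta t) x'\<bar> \<le> L * dist x x'"
proof -
  have wm[measurable]: "w \<in> borel_measurable borel" using w(1) by (rule borel_measurable_continuous_onI)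
  have i: "integrable lborel (\<lambda>y. eta t y * w (x - y))" for x
  proof -
    obtain C where C: "\<And>y. y \<in> cball 0 (2 * t) \<Longrightarrow> \<bar>w (x - y)\<bar> \<le> C"
    proof -
      have "continuous_on (cball 0 (2 * t)) (\<lambda>y. w (x - y))"
        by (rule continuous_on_compose2[OF w(1)]) (auto intro!: continuous_intros)
      then have "bounded ((\<lambda>y. w (x - y)) ` cball 0 (2 * t))" by (intro compact_imp_bounded compact_continuous_image) auto
      then obtain C where "\<forall>v\<in>(\<lambda>y. w (x - y)) ` cball 0 (2 * t). norm v \<le> C" by (auto simp: bounded_iff)
      then show ?thesis by (intro that[of C]) (auto simp del: mem_cball)
    qed
    show ?thesis
    proof (rule Bochner_Integration.integrable_bound[where f="\<lambda>y. C * eta t y"])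
      show "integrable lborel (\<lambda>y. C * eta t y)" using eta_integrable[OF t] by simp
      show "AE y in lborel. norm (eta t y * w (x - y)) \<le> norm (C * eta t y)"
      proof (rule AE_I2)
        fix y show "norm (eta t y * w (x - y)) \<le> norm (C * eta t y)"
        proof (cases "eta t y = 0")
          case False
          then have "\<bar>w (x - y)\<bar> \<le> C" using C[of y] eta_supp[OF t, of y] by simp
          then have "eta t y * \<bar>w (x - y)\<bar> \<le> eta t y * \<bar>C\<bar>" by (intro mult_left_mono eta_nonneg) auto
          then show ?thesis by (simp add: abs_mult eta_nonneg mult.commute)
        qed simp
      qed
    qed simp
  qed
  have "conv w (eta t) x - conv w (eta t) x' = (LINT y|lborel. eta t y * w (x - y)) - (LINT y|lborel. eta t y * w (x' - y))"
    unfolding conv_flip[OF wm eta_measurable] unfolding conv_def ..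
  also have "\<dots> = (LINT y|lborel. eta t y * (w (x - y) - w (x' - y)))" using i by (simp add: right_diff_distrib)
  finally have "\<bar>conv w (eta t) x - conv w (eta t) x'\<bar> \<le> (LINT y|lborel. \<bar>eta t y * (w (x - y) - w (x' - y))\<bar>)"
    using integral_abs_bound[of lborel "\<lambda>y. eta t y * (w (x - y) - w (x' - y))"] by simp
  also have "\<dots> \<le> (LINT y|lborel. eta t y * (L * dist x x'))"
  proof (rule integral_mono)
    have "integrable lborel (\<lambda>y. eta t y * w (x - y) - eta t y * w (x' - y))" using i by simp
    then show "integrable lborel (\<lambda>y. \<bar>eta t y * (w (x - y) - w (x' - y))\<bar>)" by (simp add: right_diff_distrib)
    show "integrable lborel (\<lambda>y. eta t y * (L * dist x x'))" using eta_integrable[OF t] by simp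
    show "\<bar>eta t y * (w (x - y) - w (x' - y))\<bar> \<le> eta t y * (L * dist x x')" for y
      using L[of "x - y" "x' - y"] by (simp add: abs_mult eta_nonneg mult_left_mono dist_norm)
  qed
  also have "\<dots> = L * dist x x'" using eta_integral[OF t] by simp
  finally show ?thesis .
qed

lemma Lipschitz_grad_bound:
  assumes g: "has_grad f f1 f2" and L: "\<And>x y. \<bar>f x - f y\<bar> \<le> L * dist x y"
  shows "\<bar>f1 p\<bar> \<le> L" "\<bar>f2 p\<bar> \<le> L"
proof -
  have *: "\<bar>fst e * f1 p + snd e * f2 p\<bar> \<le> L * norm e" for e
  proof -
    have "((\<lambda>t. f (p + t *\<^sub>R e)) has_derivative (\<lambda>t. fst (t *\<^sub>R e) * f1 (p + 0 *\<^sub>R e) + snd (t *\<^sub>R e) * f2 (p + 0 *\<^sub>R e))) (at 0)"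
      by (rule has_derivative_compose[OF _ has_gradD[OF g]]) (auto intro!: derivative_eq_intros)
    then have "((\<lambda>t. f (p + t *\<^sub>R e)) has_real_derivative (fst e * f1 p + snd e * f2 p)) (at 0)"
      unfolding has_field_derivative_def by (rule has_derivative_eq_rhs) (simp add: fun_eq_iff algebra_simps)
    then have "((\<lambda>t. (f (p + t *\<^sub>R e) - f p) / t) \<longlongrightarrow> fst e * f1 p + snd e * f2 p) (at 0)" by (simp add: DERIV_def)
    then have "((\<lambda>t. \<bar>(f (p + t *\<^sub>R e) - f p) / t\<bar>) \<longlongrightarrow> \<bar>fst e * f1 p + snd e * f2 p\<bar>) (at 0)" by (rule tendsto_rabs)
    moreover have "\<forall>\<^sub>F t in at 0. \<bar>(f (p + t *\<^sub>R e) - f p) / t\<bar> \<le> L * norm e"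
    proof (rule eventually_at_filter[THEN iffD2], intro always_eventually allI impI)
      fix t :: real assume t: "t \<noteq> 0"
      show "\<bar>(f (p + t *\<^sub>R e) - f p) / t\<bar> \<le> L * norm e"
        using L[of "p + t *\<^sub>R e" p] t by (simp add: dist_norm field_simps)
    qed
    ultimately show ?thesis by (rule tendsto_upperbound) simp
  qed
  show "\<bar>f1 p\<bar> \<le> L" "\<bar>f2 p\<bar> \<le> L" using *[of "(1,0)"] *[of "(0,1)"] by simp_all
qed

lemma test_norm_le:
  assumes U: "open U" "bounded U" and \<phi>: "\<phi> \<in> test_functions U"
    and b: "\<And>y. \<bar>\<phi> y\<bar> \<le> A" "\<And>y. \<bar>partial_x \<phi> y\<bar> \<le> B" "\<And>y. \<bar>partial_y \<phi> y\<bar> \<le> B"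
  shows "test_norm \<phi> \<le> sqrt ((A\<^sup>2 + 2 * B\<^sup>2) * measure lborel U)"
proof -
  have fin: "emeasure lborel U < \<infinity>" using emeasure_bounded_finite[OF U(2)] by simp
  have "test_inner \<phi> \<phi> \<le> (LINT z|lborel. (A\<^sup>2 + 2 * B\<^sup>2) * indicator U z)"
    unfolding test_inner_def
  proof (rule integral_mono[OF test_inner_integrable[OF \<phi> \<phi>]])
    show "integrable lborel (\<lambda>z. (A\<^sup>2 + 2 * B\<^sup>2) * indicator U z)" using fin U by (auto intro!: integrable_real_indicator)
    fix y
    have sq: "a * a \<le> c\<^sup>2" if "\<bar>a\<bar> \<le> c" for a c :: real
      using power_mono[OF that, of 2] by (simp add: power2_eq_square)
    show "\<phi> y * \<phi> y + partial_x \<phi> y * partial_x \<phi> y + partial_y \<phi> y * partial_y \<phi> y \<le> (A\<^sup>2 + 2 * B\<^sup>2) * indicator U y"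
    proof (cases "y \<in> U")
      case True
      from sq[OF b(1)[of y]] sq[OF b(2)[of y]] sq[OF b(3)[of y]] show ?thesis using True by simp
    next
      case False
      then show ?thesis using test_zero_outside[OF \<phi> False] test_zero_outside[OF test_partial(1)[OF \<phi>] False]
          test_zero_outside[OF test_partial(2)[OF \<phi>] False] by simp
    qed
  qed
  also have "\<dots> = (A\<^sup>2 + 2 * B\<^sup>2) * measure lborel U" using fin U by simp
  finally show ?thesis unfolding test_norm_def by simp
qed

lemma conv_bounded:
  assumes w: "integrable lborel w" "\<And>x. \<bar>w x\<bar> \<le> s" and t: "t > 0"
  shows "\<bar>conv w (eta t) x\<bar> \<le> s"
proof -
  have "\<bar>conv w (eta t) x\<bar> \<le> (LINT y|lborel. \<bar>w y * eta t (x - y)\<bar>)" unfolding conv_def by (rule integral_abs_bound)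
  also have "\<dots> \<le> (LINT y|lborel. s * eta t (x - y))"
    using conv_eta_integrable[OF w(1) t, of x] eta_shift_integral(4)[OF t, of x]
    by (intro integral_mono integrable_abs) (auto simp: abs_mult eta_nonneg intro!: mult_right_mono w(2))
  also have "\<dots> = s" using eta_shift_integral(3)[OF t] by simp
  finally show ?thesis .
qed

lemma mollify_AE_subseq:
  assumes h: "integrable lborel h" and W: "bounded W" "W \<in> sets borel" and t: "\<And>n. t n > 0" "t \<longlonglongrightarrow> 0"
  shows "\<exists>\<sigma>. strict_mono \<sigma> \<and> (AE x in lborel. x \<in> W \<longrightarrow> (\<lambda>n. conv h (eta (t (\<sigma> n))) x) \<longlonglongrightarrow> h x)"
proof -
  define F where "F n x = indicator W x * \<bar>conv h (eta (t n)) x - h x\<bar>" for n x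
  have Fi: "integrable lborel (F n)" for n
    using integrable_mult_indicator[of W lborel "\<lambda>x. \<bar>conv h (eta (t n)) x - h x\<bar>"] W conv_eta_L1(1)[OF h t(1)] h
    by (simp add: F_def[abs_def])
  have "(\<lambda>n. LINT x|lborel. norm (F n x - 0)) \<longlonglongrightarrow> 0"
  proof (rule LIMSEQ_I)
    fix e :: real assume "e > 0"
    then obtain t0 where t0: "t0 > 0" "\<And>t. 0 < t \<Longrightarrow> t < t0 \<Longrightarrow> (LINT x|lborel. indicator W x * \<bar>conv h (eta t) x - h x\<bar>) < e"
      using mollify_L1[OF h W] by metis
    have "\<forall>\<^sub>F n in sequentially. t n < t0" using t(2) t0(1) by (rule order_tendstoD(2))
    then obtain N where N: "\<And>n. n \<ge> N \<Longrightarrow> t n < t0" by (auto simp: eventually_sequentially)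
    show "\<exists>N. \<forall>n\<ge>N. norm ((LINT x|lborel. norm (F n x - 0)) - 0) < e"
    proof (intro exI[of _ N] allI impI)
      fix n assume "n \<ge> N"
      have "norm ((LINT x|lborel. norm (F n x - 0)) - 0) = (LINT x|lborel. norm (F n x - 0))" by (simp add: integral_nonneg_AE)
      also have "\<dots> = (LINT x|lborel. indicator W x * \<bar>conv h (eta (t n)) x - h x\<bar>)" by (simp add: F_def abs_mult)
      also have "\<dots> < e" by (rule t0(2)[OF t(1) N[OF \<open>n \<ge> N\<close>]])
      finally show "norm ((LINT x|lborel. norm (F n x - 0)) - 0) < e" .
    qed
  qed
  then obtain \<sigma> where \<sigma>: "strict_mono \<sigma>" "AE x in lborel. (\<lambda>n. F (\<sigma> n) x) \<longlonglongrightarrow> 0"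
    using tendsto_L1_AE_subseq[of lborel F] Fi by auto
  show ?thesis
  proof (intro exI[of _ \<sigma>] conjI \<sigma>(1))
    show "AE x in lborel. x \<in> W \<longrightarrow> (\<lambda>n. conv h (eta (t (\<sigma> n))) x) \<longlonglongrightarrow> h x"
      using \<sigma>(2)
    proof eventually_elim
      case (elim x)
      show ?case
      proof
        assume "x \<in> W"
        then have "(\<lambda>n. \<bar>conv h (eta (t (\<sigma> n))) x - h x\<bar>) \<longlonglongrightarrow> 0" using elim by (simp add: F_def)
        then show "(\<lambda>n. conv h (eta (t (\<sigma> n))) x) \<longlonglongrightarrow> h x"
          by (simp add: tendsto_rabs_zero_iff LIM_zero_iff)
      qed
    qed
  qed
qed

text \<open>Extend \<open>\<psi> - m\<close> from \<open>G\<close> to a Lipschitz function bounded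
  by \<open>s\<close>, multiply by the cutoff \<open>\<omega>\<close> and mollify: the result
  \<open>wt\<close> is a test function whose gradient is bounded by \<open>Lw\<close>. On
  \<open>G\<close> the gradients converge almost everywhere to the gradient of \<open>\<omega> *
  (\<psi> - m)\<close>. The reason is that the difference of the two functions vanishes on
  \<open>G\<close> and is Lipschitz, so its mollified gradient is bounded by a mollification of the
  indicator of \<open>W - G\<close>, which tends to zero almost everywhere on \<open>G\<close>. The
  first term of the bound is the divergence tested with \<open>wt\<close>, the second the
  contribution of \<open>W - G\<close>, the third the derivative of the cutoff.\<close>

section \<open>Testing with a Lipschitz truncation\<close>

lemma Lipschitz_truncation_estimate:
  assumes U: "open U" "bounded U" and W: "open W" "W \<subseteq> U" and g: "has_grad \<psi> g1 g2" "continuous_on UNIV g1" "continuous_on UNIV g2"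
    and G: "G \<in> sets borel" "G \<subseteq> W" and L: "L \<ge> 0" "\<And>x y. x \<in> G \<Longrightarrow> y \<in> G \<Longrightarrow> \<bar>\<psi> x - \<psi> y\<bar> \<le> L * dist x y"
    and s: "s \<ge> 0" "\<And>x. x \<in> G \<Longrightarrow> \<bar>\<psi> x - m\<bar> \<le> s"
    and q: "integrable lborel q" and r: "integrable lborel r"
    and bd: "\<And>\<phi>. \<phi> \<in> test_functions U \<Longrightarrow> \<bar>LINT z|lborel. q z * partial_x \<phi> z + r z * partial_y \<phi> z\<bar> \<le> \<epsilon> * test_norm \<phi>"
    and \<epsilon>: "\<epsilon> \<ge> 0"
    and \<omega>: "\<omega> \<in> test_functions W" "\<And>x. \<bar>\<omega> x\<bar> \<le> 1" "\<And>x. \<bar>partial_x \<omega> x\<bar> \<le> C" "\<And>x. \<bar>partial_y \<omega> x\<bar> \<le> C"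
  defines "Lw \<equiv> L + 2 * s * C"
  shows "\<bar>LINT x|lborel. indicator G x * (\<omega> x * (q x * g1 x + r x * g2 x))\<bar>
    \<le> \<epsilon> * sqrt ((s\<^sup>2 + 2 * Lw\<^sup>2) * measure lborel U) + Lw * (LINT x|lborel. indicator (W - G) x * (\<bar>q x\<bar> + \<bar>r x\<bar>))
      + s * C * (LINT x|lborel. indicator W x * (\<bar>q x\<bar> + \<bar>r x\<bar>))"
proof -
  have C: "C \<ge> 0" using \<omega>(3)[of 0] by linarith
  have Lw: "Lw \<ge> 0" using L s C by (simp add: Lw_def)
  have "\<exists>F. (\<forall>x y. \<bar>F x - F y\<bar> \<le> L * dist x y) \<and> (\<forall>x. \<bar>F x\<bar> \<le> s) \<and> (\<forall>x\<in>G. F x = \<psi> x - m)"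
  proof (rule Lipschitz_extension[OF L(1) _ s])
    show "\<bar>\<psi> x - m - (\<psi> y - m)\<bar> \<le> L * dist x y" if "x \<in> G" "y \<in> G" for x y using L(2)[OF that] by simp
  qed
  then obtain F where F: "\<And>x y. \<bar>F x - F y\<bar> \<le> L * dist x y" "\<And>x. \<bar>F x\<bar> \<le> s" "\<And>x. x \<in> G \<Longrightarrow> F x = \<psi> x - m"
    by metis
  obtain K where K: "compact K" "K \<subseteq> W" "\<And>x. x \<notin> K \<Longrightarrow> \<omega> x = 0" using test_supportE[OF \<omega>(1)] by metis
  define w where "w x = \<omega> x * F x" for x
  define w0 where "w0 x = \<omega> x * (\<psi> x - m)" for x
  have \<omega>L: "\<bar>\<omega> x - \<omega> y\<bar> \<le> 2 * C * dist x y" for x y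
    unfolding dist_norm by (rule grad_bound_Lipschitz[of UNIV]) (use \<omega> has_gradD[OF test_grad[OF \<omega>(1)]] in auto)
  have wL: "\<bar>w x - w y\<bar> \<le> Lw * dist x y" for x y
  proof -
    have "w x - w y = \<omega> x * (F x - F y) + (\<omega> x - \<omega> y) * F y" by (simp add: w_def algebra_simps)
    then have "\<bar>w x - w y\<bar> \<le> \<bar>\<omega> x\<bar> * \<bar>F x - F y\<bar> + \<bar>\<omega> x - \<omega> y\<bar> * \<bar>F y\<bar>" by (metis abs_mult abs_triangle_ineq)
    also have "\<dots> \<le> 1 * (L * dist x y) + (2 * C * dist x y) * s"
      by (intro add_mono mult_mono \<omega>(2) F \<omega>L) (use L C in auto)
    finally show ?thesis by (simp add: Lw_def algebra_simps)
  qed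
  have ws: "\<bar>w x\<bar> \<le> s" for x
  proof -
    have "\<bar>\<omega> x\<bar> * \<bar>F x\<bar> \<le> 1 * s" by (intro mult_mono \<omega>(2) F) auto
    then show ?thesis by (simp add: w_def abs_mult)
  qed
  have wc: "continuous_on UNIV w"
  proof (rule lipschitz_on_continuous_on, rule lipschitz_onI)
    show "dist (w x) (w y) \<le> Lw * dist x y" for x y using wL[of x y] by (simp add: dist_real_def)
  qed (rule Lw)
  have wz: "w x = 0" "w0 x = 0" if "x \<notin> K" for x using K(3)[OF that] by (simp_all add: w_def w0_def)
  have wi: "integrable lborel w" by (rule integrable_compact_support[OF wc K(1) wz(1)])
  define h1 where "h1 x = \<omega> x * g1 x + (\<psi> x - m) * partial_x \<omega> x" for x
  define h2 where "h2 x = \<omega> x * g2 x + (\<psi> x - m) * partial_y \<omega> x" for x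
  have w0g: "has_grad w0 h1 h2" unfolding has_grad_def
  proof
    fix x
    have *: "((\<lambda>x. \<psi> x - m) has_derivative (\<lambda>v. fst v * g1 x + snd v * g2 x)) (at x)"
      using has_derivative_diff[OF has_gradD[OF g(1)] has_derivative_const[of m]] by simp
    show "(w0 has_derivative (\<lambda>v. fst v * h1 x + snd v * h2 x)) (at x)"
      unfolding w0_def[abs_def]
      by (rule has_derivative_eq_rhs[OF has_derivative_mult[OF has_gradD[OF test_grad[OF \<omega>(1)]] *]])
        (simp add: fun_eq_iff h1_def h2_def algebra_simps)
  qed
  have \<psi>c: "continuous_on UNIV \<psi>" by (rule has_grad_cont[OF g(1)])
  have hc: "continuous_on UNIV h1" "continuous_on UNIV h2"
    unfolding h1_def[abs_def] h2_def[abs_def]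
    by (intro continuous_intros g \<psi>c test_cont[OF \<omega>(1)] test_cont[OF test_partial(1)[OF \<omega>(1)]] test_cont[OF test_partial(2)[OF \<omega>(1)]])+
  note hz = has_grad_zero_outside[OF w0g compact_imp_closed[OF K(1)] wz(2)]
  have hi: "integrable lborel h1" "integrable lborel h2"
    by (rule integrable_compact_support[OF hc(1) K(1) hz(1)] integrable_compact_support[OF hc(2) K(1) hz(2)]; assumption)+
  have w0c: "continuous_on UNIV w0" by (rule has_grad_cont[OF w0g])
  have w0i: "integrable lborel w0" by (rule integrable_compact_support[OF w0c K(1) wz(2)])
  obtain D0 where D0: "\<And>x. \<bar>w0 x\<bar> \<le> D0" using bounded_compact_support[OF w0c K(1) wz(2)] by metis
  obtain D1 where D1: "\<And>x. \<bar>h1 x\<bar> \<le> D1" using bounded_compact_support[OF hc(1) K(1) hz(1)] by metis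
  obtain D2 where D2: "\<And>x. \<bar>h2 x\<bar> \<le> D2" using bounded_compact_support[OF hc(2) K(1) hz(2)] by metis
  define D where "D = max D0 (max D1 D2)"
  have D: "\<bar>w0 x\<bar> \<le> D" "\<bar>h1 x\<bar> \<le> D" "\<bar>h2 x\<bar> \<le> D" for x using D0[of x] D1[of x] D2[of x] by (auto simp: D_def)
  have w0L: "\<bar>w0 x - w0 y\<bar> \<le> 2 * D * dist x y" for x y
    unfolding dist_norm by (rule grad_bound_Lipschitz[of UNIV]) (use D has_gradD[OF w0g] in auto)
  define L' where "L' = Lw + 2 * D"
  have L': "L' \<ge> 0" using Lw D(1)[of 0] by (simp add: L'_def)
  define B where "B = W - G"
  have Ws[measurable]: "W \<in> sets borel" and Wb: "bounded W" using W U by (auto intro: bounded_subset)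
  have Bs[measurable]: "B \<in> sets borel" and Bb: "bounded B" using G Wb by (auto simp: B_def intro: bounded_subset)
  have Gm[measurable]: "G \<in> sets borel" by (rule G)
  have Bi: "integrable lborel (indicator B :: _ \<Rightarrow> real)" using emeasure_bounded_finite[OF Bb] by (intro integrable_real_indicator) auto
  \<comment> \<open>the extension and the original differ only on \<open>B\<close>, and there by at most a multiple of the distance to any point of \<open>G\<close>\<close>
  have df: "\<bar>w y - w0 y\<bar> \<le> indicator B y * (L' * dist x y)" if x: "x \<in> G" for x y
  proof (cases "y \<in> B")
    case True
    have "w x - w0 x = 0" using F(3)[OF x] by (simp add: w_def w0_def)
    then have "\<bar>w y - w0 y\<bar> \<le> \<bar>w x - w y\<bar> + \<bar>w0 x - w0 y\<bar>" by linarith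
    also have "\<dots> \<le> L' * dist x y" using wL[of x y] w0L[of x y] by (simp add: L'_def distrib_right)
    finally show ?thesis using True by simp
  next
    case False
    then have "w y = w0 y" using K(2) K(3)[of y] F(3)[of y] by (cases "y \<in> G") (auto simp: w_def w0_def B_def)
    then show ?thesis using False by simp
  qed
  obtain CE where CE: "CE > 0" "\<And>t p. t > 0 \<Longrightarrow> \<bar>partial_x (eta t) p\<bar> \<le> CE / t * eta (2 * t) p"
    "\<And>t p. t > 0 \<Longrightarrow> \<bar>partial_y (eta t) p\<bar> \<le> CE / t * eta (2 * t) p" by (rule eta_grad_bound) (rule that)
  obtain \<rho> where \<rho>: "\<rho> > 0" "\<And>x. x \<in> K \<Longrightarrow> cball x \<rho> \<subseteq> W" using compact_in_open_thickening[OF K(1) W(1) K(2)] by metis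
  define t where "t n = \<rho> / (2 * real (Suc n))" for n
  have t: "t n > 0" "2 * t n \<le> \<rho>" for n
  proof -
    show "t n > 0" using \<rho>(1) by (simp add: t_def)
    have "\<rho> / real (Suc n) \<le> \<rho> / 1" using \<rho>(1) by (intro divide_left_mono) auto
    moreover have "2 * t n = \<rho> / real (Suc n)" unfolding t_def by (simp del: of_nat_Suc)
    ultimately show "2 * t n \<le> \<rho>" by simp
  qed
  have "t = (\<lambda>n. (\<rho> / 2) * inverse (real (Suc n)))"
    by (rule ext) (simp only: t_def divide_inverse inverse_mult_distrib mult.assoc)
  then have tl: "t \<longlonglongrightarrow> 0" by (simp only: tendsto_mult_right_zero[OF LIMSEQ_inverse_real_of_nat])
  define wt where "wt n = conv w (eta (t n))" for n
  have wtW: "wt n \<in> test_functions W" for n unfolding wt_def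
  proof (rule conv_test[OF wi eta_test[OF t(1)] K(1) wz(1)])
    show "norm p \<le> 2 * t n" if "eta (t n) p \<noteq> 0" for p by (rule eta_supp[OF t(1) that])
    show "x \<in> W" if "y \<in> K" "dist x y \<le> 2 * t n" for x y
    proof -
      have "x \<in> cball y \<rho>" using that(2) t(2)[of n] by (simp add: dist_commute)
      then show ?thesis using \<rho>(2)[OF that(1)] by blast
    qed
  qed
  have wtU: "wt n \<in> test_functions U" for n by (rule test_mono[OF wtW W(2)])
  note wtp = test_partial[OF wtW]
  have wtg: "has_grad (wt n) (conv w (partial_x (eta (t n)))) (conv w (partial_y (eta (t n))))" for n
    unfolding wt_def by (rule has_grad_conv_test[OF wi eta_test[OF t(1)]])
  have wtL: "\<bar>partial_x (wt n) x\<bar> \<le> Lw" "\<bar>partial_y (wt n) x\<bar> \<le> Lw" for n x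
  proof -
    have "\<bar>wt n x - wt n y\<bar> \<le> Lw * dist x y" for x y unfolding wt_def by (rule conv_Lipschitz[OF wc wi wL t(1)])
    then show "\<bar>partial_x (wt n) x\<bar> \<le> Lw" "\<bar>partial_y (wt n) x\<bar> \<le> Lw"
      using Lipschitz_grad_bound[OF test_grad[OF wtW[of n]], of Lw x] by blast+
  qed
  have wts: "\<bar>wt n x\<bar> \<le> s" for n x unfolding wt_def by (rule conv_bounded[OF wi ws t(1)])
  have Twt: "\<bar>LINT z|lborel. q z * partial_x (wt n) z + r z * partial_y (wt n) z\<bar> \<le> \<epsilon> * sqrt ((s\<^sup>2 + 2 * Lw\<^sup>2) * measure lborel U)" for n
    using bd[OF wtU, of n] test_norm_le[OF U wtU wts wtL] \<epsilon> by (meson mult_left_mono order_trans)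
  have em: "eta t \<in> borel_measurable borel" for t by simp
  have w0m: "w0 \<in> borel_measurable borel" and h1m: "h1 \<in> borel_measurable borel" and h2m: "h2 \<in> borel_measurable borel"
    using w0c hc by (auto intro: borel_measurable_continuous_onI)
  \<comment> \<open>for the smooth function the derivative may be moved to either factor of the convolution\<close>
  have w0t: "conv w0 (partial_x (eta (t n))) = conv h1 (eta (t n))" "conv w0 (partial_y (eta (t n))) = conv h2 (eta (t n))" for n
  proof -
    have a: "has_grad (conv w0 (eta (t n))) (conv w0 (partial_x (eta (t n)))) (conv w0 (partial_y (eta (t n))))"
      by (rule has_grad_conv_test[OF w0i eta_test[OF t(1)]])
    have b: "has_grad (conv (eta (t n)) w0) (conv (eta (t n)) h1) (conv (eta (t n)) h2)"
      by (rule has_grad_conv[OF eta_integrable[OF t(1)] w0g hc D])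
    have e: "conv (eta (t n)) z = conv z (eta (t n))" if "z \<in> borel_measurable borel" for z
      using conv_flip[OF em that] by (rule ext)
    show "conv w0 (partial_x (eta (t n))) = conv h1 (eta (t n))" "conv w0 (partial_y (eta (t n))) = conv h2 (eta (t n))"
      using has_grad_partial[OF a] has_grad_partial[OF b] unfolding e[OF w0m] e[OF h1m] e[OF h2m] by simp_all
  qed
  have close: "\<bar>conv w \<zeta> x - conv w0 \<zeta> x\<bar> \<le> 4 * CE * L' * conv (indicator B) (eta (2 * t n)) x"
    if x: "x \<in> G" and \<zeta>: "\<zeta> = partial_x (eta (t n)) \<or> \<zeta> = partial_y (eta (t n))" for x n \<zeta>
  proof -
    have \<zeta>t: "\<zeta> \<in> test_functions UNIV" using \<zeta> test_partial[OF eta_test[OF t(1)]] by auto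
    obtain M where M: "\<And>p. \<bar>\<zeta> p\<bar> \<le> M" using test_bounded[OF \<zeta>t] by metis
    have i: "integrable lborel (\<lambda>y. w y * \<zeta> (x - y))" "integrable lborel (\<lambda>y. w0 y * \<zeta> (x - y))"
      by (rule conv_integrable[OF wi test_measurable[OF \<zeta>t] M] conv_integrable[OF w0i test_measurable[OF \<zeta>t] M])+
    have "conv w \<zeta> x - conv w0 \<zeta> x = (LINT y|lborel. (w y - w0 y) * \<zeta> (x - y))"
      unfolding conv_def using i by (simp add: left_diff_distrib)
    then have "\<bar>conv w \<zeta> x - conv w0 \<zeta> x\<bar> \<le> (LINT y|lborel. \<bar>(w y - w0 y) * \<zeta> (x - y)\<bar>)"
      using integral_abs_bound[of lborel "\<lambda>y. (w y - w0 y) * \<zeta> (x - y)"] by simp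
    also have "\<dots> \<le> (LINT y|lborel. 4 * CE * L' * (indicator B y * eta (2 * t n) (x - y)))"
    proof (rule integral_mono)
      have "integrable lborel (\<lambda>y. w y * \<zeta> (x - y) - w0 y * \<zeta> (x - y))" using i by simp
      then show "integrable lborel (\<lambda>y. \<bar>(w y - w0 y) * \<zeta> (x - y)\<bar>)" by (simp add: left_diff_distrib)
      show "integrable lborel (\<lambda>y. 4 * CE * L' * (indicator B y * eta (2 * t n) (x - y)))"
        using conv_eta_integrable[OF Bi, of "2 * t n" x] t(1)[of n] by (intro integrable_mult_right) auto
      fix y
      have z: "\<bar>\<zeta> (x - y)\<bar> \<le> CE / t n * eta (2 * t n) (x - y)" using \<zeta> CE(2)[OF t(1), of n "x - y"] CE(3)[OF t(1), of n "x - y"] by auto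
      have "\<bar>(w y - w0 y) * \<zeta> (x - y)\<bar> \<le> (indicator B y * (L' * dist x y)) * (CE / t n * eta (2 * t n) (x - y))"
        unfolding abs_mult using L' by (intro mult_mono df[OF x] z) auto
      also have "\<dots> \<le> 4 * CE * L' * (indicator B y * eta (2 * t n) (x - y))"
      proof (cases "eta (2 * t n) (x - y) = 0")
        case False
        then have "dist x y \<le> 4 * t n" using eta_supp[of "2 * t n" "x - y"] t(1)[of n] by (simp add: dist_norm)
        then have "(indicator B y * L' * (CE / t n) * eta (2 * t n) (x - y)) * dist x y \<le> (indicator B y * L' * (CE / t n) * eta (2 * t n) (x - y)) * (4 * t n)"
          using L' CE(1) t(1)[of n] eta_nonneg by (intro mult_left_mono) auto
        then show ?thesis using t(1)[of n] by (simp add: mult_ac)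
      qed simp
      finally show "\<bar>(w y - w0 y) * \<zeta> (x - y)\<bar> \<le> 4 * CE * L' * (indicator B y * eta (2 * t n) (x - y))" .
    qed
    also have "\<dots> = 4 * CE * L' * conv (indicator B) (eta (2 * t n)) x" by (simp add: conv_def)
    finally show ?thesis .
  qed
  \<comment> \<open>a common subsequence along which all mollifications converge almost everywhere\<close>
  obtain \<sigma>1 where \<sigma>1: "strict_mono \<sigma>1" "AE x in lborel. x \<in> W \<longrightarrow> (\<lambda>n. conv h1 (eta (t (\<sigma>1 n))) x) \<longlonglongrightarrow> h1 x"
    using mollify_AE_subseq[OF hi(1) Wb Ws t(1) tl] by (elim exE conjE) (rule that)
  have tl1: "(\<lambda>n. t (\<sigma>1 n)) \<longlonglongrightarrow> 0" using LIMSEQ_subseq_LIMSEQ[OF tl \<sigma>1(1)] by (simp add: comp_def)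
  obtain \<sigma>2 where \<sigma>2: "strict_mono \<sigma>2" "AE x in lborel. x \<in> W \<longrightarrow> (\<lambda>n. conv h2 (eta (t (\<sigma>1 (\<sigma>2 n)))) x) \<longlonglongrightarrow> h2 x"
    using mollify_AE_subseq[OF hi(2) Wb Ws t(1) tl1] by (elim exE conjE) (rule that)
  have tl2: "(\<lambda>n. 2 * t (\<sigma>1 (\<sigma>2 n))) \<longlonglongrightarrow> 0"
    using tendsto_mult[OF tendsto_const[of 2] LIMSEQ_subseq_LIMSEQ[OF tl1 \<sigma>2(1)]] by (simp add: comp_def)
  have t2: "2 * t (\<sigma>1 (\<sigma>2 n)) > 0" for n using t(1) by simp
  obtain \<sigma>3 where \<sigma>3: "strict_mono \<sigma>3" "AE x in lborel. x \<in> W \<longrightarrow> (\<lambda>n. conv (indicator B) (eta (2 * t (\<sigma>1 (\<sigma>2 (\<sigma>3 n))))) x) \<longlonglongrightarrow> indicator B x"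
    using mollify_AE_subseq[OF Bi Wb Ws t2 tl2] by (elim exE conjE) (rule that)
  define \<sigma> where "\<sigma> n = \<sigma>1 (\<sigma>2 (\<sigma>3 n))" for n
  have lim: "AE x in lborel. x \<in> G \<longrightarrow> (\<lambda>n. partial_x (wt (\<sigma> n)) x) \<longlonglongrightarrow> h1 x \<and> (\<lambda>n. partial_y (wt (\<sigma> n)) x) \<longlonglongrightarrow> h2 x"
    using \<sigma>1(2) \<sigma>2(2) \<sigma>3(2)
  proof eventually_elim
    case (elim x)
    show ?case
    proof
      assume x: "x \<in> G"
      then have xW: "x \<in> W" using G by auto
      have l1: "(\<lambda>n. conv h1 (eta (t (\<sigma> n))) x) \<longlonglongrightarrow> h1 x"
        using LIMSEQ_subseq_LIMSEQ[OF LIMSEQ_subseq_LIMSEQ[OF elim(1)[rule_format, OF xW] \<sigma>2(1)] \<sigma>3(1)] by (simp add: comp_def \<sigma>_def)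
      have l2: "(\<lambda>n. conv h2 (eta (t (\<sigma> n))) x) \<longlonglongrightarrow> h2 x"
        using LIMSEQ_subseq_LIMSEQ[OF elim(2)[rule_format, OF xW] \<sigma>3(1)] by (simp add: comp_def \<sigma>_def)
      have "(\<lambda>n. conv (indicator B) (eta (2 * t (\<sigma> n))) x) \<longlonglongrightarrow> indicator B x" using elim(3) xW by (simp add: \<sigma>_def)
      then have "(\<lambda>n. 4 * CE * L' * conv (indicator B) (eta (2 * t (\<sigma> n))) x) \<longlonglongrightarrow> 4 * CE * L' * indicator B x" by (intro tendsto_intros)
      then have l3: "(\<lambda>n. 4 * CE * L' * conv (indicator B) (eta (2 * t (\<sigma> n))) x) \<longlonglongrightarrow> 0" using x by (simp add: B_def)
      have d1: "(\<lambda>n. partial_x (wt (\<sigma> n)) x - conv h1 (eta (t (\<sigma> n))) x) \<longlonglongrightarrow> 0"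
        by (rule Lim_null_comparison[OF always_eventually l3])
          (use close[OF x] in \<open>simp add: has_grad_partial[OF wtg] flip: w0t\<close>)
      have d2: "(\<lambda>n. partial_y (wt (\<sigma> n)) x - conv h2 (eta (t (\<sigma> n))) x) \<longlonglongrightarrow> 0"
        by (rule Lim_null_comparison[OF always_eventually l3])
          (use close[OF x] in \<open>simp add: has_grad_partial[OF wtg] flip: w0t\<close>)
      show "(\<lambda>n. partial_x (wt (\<sigma> n)) x) \<longlonglongrightarrow> h1 x \<and> (\<lambda>n. partial_y (wt (\<sigma> n)) x) \<longlonglongrightarrow> h2 x"
        using tendsto_add[OF d1 l1] tendsto_add[OF d2 l2] by simp
    qed
  qed
  have [measurable]: "q \<in> borel_measurable borel" "r \<in> borel_measurable borel" "h1 \<in> borel_measurable borel" "h2 \<in> borel_measurable borel"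
    using q r h1m h2m by auto
  have [measurable]: "partial_x (wt n) \<in> borel_measurable borel" "partial_y (wt n) \<in> borel_measurable borel" for n
    using test_measurable[OF wtp(1)] test_measurable[OF wtp(2)] by auto
  have ind: "integrable lborel (\<lambda>x. indicator A x * f x)" if "A \<in> sets borel" "integrable lborel f" for A and f :: "real \<times> real \<Rightarrow> real"
    using integrable_mult_indicator[of A lborel f] that by simp
  define Q where "Q n x = q x * partial_x (wt n) x + r x * partial_y (wt n) x" for n x
  have Qi: "integrable lborel (Q n)" for n
    unfolding Q_def by (intro Bochner_Integration.integrable_add test_times_integrable[OF q wtp(1)] test_times_integrable[OF r wtp(2)])
  have Qb: "\<bar>Q n x\<bar> \<le> Lw * (\<bar>q x\<bar> + \<bar>r x\<bar>)" for n x
  proof -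
    have "\<bar>Q n x\<bar> \<le> \<bar>q x\<bar> * \<bar>partial_x (wt n) x\<bar> + \<bar>r x\<bar> * \<bar>partial_y (wt n) x\<bar>" unfolding Q_def by (metis abs_mult abs_triangle_ineq)
    also have "\<dots> \<le> \<bar>q x\<bar> * Lw + \<bar>r x\<bar> * Lw" by (intro add_mono mult_left_mono wtL) auto
    finally show ?thesis by (simp add: algebra_simps)
  qed
  have qri: "integrable lborel (\<lambda>x. \<bar>q x\<bar> + \<bar>r x\<bar>)" using q r by simp
  define R1 where "R1 = \<epsilon> * sqrt ((s\<^sup>2 + 2 * Lw\<^sup>2) * measure lborel U)"
  define R2 where "R2 = Lw * (LINT x|lborel. indicator B x * (\<bar>q x\<bar> + \<bar>r x\<bar>))"
  have onG: "\<bar>LINT x|lborel. indicator G x * Q n x\<bar> \<le> R1 + R2" for n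
  proof -
    have "Q n x = indicator G x * Q n x + indicator B x * Q n x" for x
      using G(2) test_zero_outside[OF wtp(1), of x n] test_zero_outside[OF wtp(2), of x n] by (auto simp: Q_def B_def indicator_def)
    then have "(LINT x|lborel. Q n x) = (LINT x|lborel. indicator G x * Q n x + indicator B x * Q n x)" by (rule Bochner_Integration.integral_cong[OF refl])
    also have "\<dots> = (LINT x|lborel. indicator G x * Q n x) + (LINT x|lborel. indicator B x * Q n x)"
      by (rule Bochner_Integration.integral_add) (intro ind Gm Bs Qi)+
    finally have eq: "(LINT x|lborel. indicator G x * Q n x) = (LINT x|lborel. Q n x) - (LINT x|lborel. indicator B x * Q n x)" by simp
    have "\<bar>LINT x|lborel. indicator B x * Q n x\<bar> \<le> (LINT x|lborel. \<bar>indicator B x * Q n x\<bar>)" by (rule integral_abs_bound)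
    also have "\<dots> \<le> (LINT x|lborel. Lw * (indicator B x * (\<bar>q x\<bar> + \<bar>r x\<bar>)))"
      by (intro integral_mono integrable_abs ind Bs Qi integrable_mult_right qri) (use Qb in \<open>auto simp: indicator_def\<close>)
    also have "\<dots> = R2" by (simp add: R2_def)
    finally have "\<bar>LINT x|lborel. indicator B x * Q n x\<bar> \<le> R2" .
    moreover have "\<bar>LINT x|lborel. Q n x\<bar> \<le> R1" using Twt[of n] by (simp add: Q_def[abs_def] R1_def)
    ultimately show ?thesis unfolding eq by linarith
  qed
  have "(\<lambda>n. LINT x|lborel. indicator G x * Q (\<sigma> n) x) \<longlonglongrightarrow> (LINT x|lborel. indicator G x * (q x * h1 x + r x * h2 x))"
  proof (rule integral_dominated_convergence[where w="\<lambda>x. Lw * (\<bar>q x\<bar> + \<bar>r x\<bar>)"])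
    show "(\<lambda>x. indicator G x * (q x * h1 x + r x * h2 x)) \<in> borel_measurable lborel" by measurable
    show "(\<lambda>x. indicator G x * Q (\<sigma> n) x) \<in> borel_measurable lborel" for n unfolding Q_def by measurable
    show "integrable lborel (\<lambda>x. Lw * (\<bar>q x\<bar> + \<bar>r x\<bar>))" using qri by simp
    show "AE x in lborel. (\<lambda>n. indicator G x * Q (\<sigma> n) x) \<longlonglongrightarrow> indicator G x * (q x * h1 x + r x * h2 x)"
      using lim by eventually_elim (auto simp: Q_def indicator_def intro!: tendsto_intros)
    show "AE x in lborel. norm (indicator G x * Q (\<sigma> n) x) \<le> Lw * (\<bar>q x\<bar> + \<bar>r x\<bar>)" for n
      using Qb Lw by (intro AE_I2) (auto simp: indicator_def)
  qed
  then have "(\<lambda>n. \<bar>LINT x|lborel. indicator G x * Q (\<sigma> n) x\<bar>) \<longlonglongrightarrow> \<bar>LINT x|lborel. indicator G x * (q x * h1 x + r x * h2 x)\<bar>" by (rule tendsto_rabs)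
  then have main: "\<bar>LINT x|lborel. indicator G x * (q x * h1 x + r x * h2 x)\<bar> \<le> R1 + R2"
    by (rule tendsto_upperbound) (use onG in auto)
  \<comment> \<open>the part of the gradient of \<open>w0\<close> that comes from the cutoff\<close>
  define E where "E x = (\<psi> x - m) * (q x * partial_x \<omega> x + r x * partial_y \<omega> x)" for x
  have Eb: "\<bar>indicator G x * E x\<bar> \<le> s * C * (indicator W x * (\<bar>q x\<bar> + \<bar>r x\<bar>))" for x
  proof (cases "x \<in> G")
    case True
    have "\<bar>q x * partial_x \<omega> x + r x * partial_y \<omega> x\<bar> \<le> \<bar>q x\<bar> * \<bar>partial_x \<omega> x\<bar> + \<bar>r x\<bar> * \<bar>partial_y \<omega> x\<bar>" by (metis abs_mult abs_triangle_ineq)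
    also have "\<dots> \<le> \<bar>q x\<bar> * C + \<bar>r x\<bar> * C" by (intro add_mono mult_left_mono \<omega>) auto
    finally have "\<bar>E x\<bar> \<le> s * (\<bar>q x\<bar> * C + \<bar>r x\<bar> * C)" unfolding E_def abs_mult using s True by (intro mult_mono) auto
    then show ?thesis using True G by (auto simp: algebra_simps)
  qed (use s C in auto)
  have Em: "E \<in> borel_measurable borel" unfolding E_def[abs_def]
    using \<psi>c test_measurable[OF test_partial(1)[OF \<omega>(1)]] test_measurable[OF test_partial(2)[OF \<omega>(1)]]
    by (intro borel_measurable_times borel_measurable_diff borel_measurable_add) (auto intro: borel_measurable_continuous_onI)
  have Ei: "integrable lborel (\<lambda>x. indicator G x * E x)"
  proof (rule Bochner_Integration.integrable_bound[where f="\<lambda>x. s * C * (indicator W x * (\<bar>q x\<bar> + \<bar>r x\<bar>))"])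
    show "integrable lborel (\<lambda>x. s * C * (indicator W x * (\<bar>q x\<bar> + \<bar>r x\<bar>)))" by (intro integrable_mult_right ind Ws qri)
    show "(\<lambda>x. indicator G x * E x) \<in> borel_measurable lborel" using Em by simp
    show "AE x in lborel. norm (indicator G x * E x) \<le> norm (s * C * (indicator W x * (\<bar>q x\<bar> + \<bar>r x\<bar>)))"
      using Eb by (intro AE_I2) (simp add: order_trans[OF _ abs_ge_self])
  qed
  have Hb: "integrable lborel (\<lambda>x. indicator G x * (q x * h1 x + r x * h2 x))"
  proof (rule Bochner_Integration.integrable_bound[where f="\<lambda>x. D * (\<bar>q x\<bar> + \<bar>r x\<bar>)"])
    show "integrable lborel (\<lambda>x. D * (\<bar>q x\<bar> + \<bar>r x\<bar>))" using qri by simp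
    have "\<bar>q x * h1 x + r x * h2 x\<bar> \<le> D * (\<bar>q x\<bar> + \<bar>r x\<bar>)" for x
    proof -
      have "\<bar>q x * h1 x + r x * h2 x\<bar> \<le> \<bar>q x\<bar> * \<bar>h1 x\<bar> + \<bar>r x\<bar> * \<bar>h2 x\<bar>" by (metis abs_mult abs_triangle_ineq)
      also have "\<dots> \<le> \<bar>q x\<bar> * D + \<bar>r x\<bar> * D" by (intro add_mono mult_left_mono D) auto
      finally show ?thesis by (simp add: algebra_simps)
    qed
    moreover have "D \<ge> 0" using D(1)[of 0] by linarith
    ultimately show "AE x in lborel. norm (indicator G x * (q x * h1 x + r x * h2 x)) \<le> norm (D * (\<bar>q x\<bar> + \<bar>r x\<bar>))"
      by (intro AE_I2) (auto simp: indicator_def)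
  qed measurable
  have "(LINT x|lborel. indicator G x * (\<omega> x * (q x * g1 x + r x * g2 x)))
    = (LINT x|lborel. indicator G x * (q x * h1 x + r x * h2 x) - indicator G x * E x)"
    by (intro Bochner_Integration.integral_cong refl) (simp add: h1_def h2_def E_def algebra_simps)
  also have "\<dots> = (LINT x|lborel. indicator G x * (q x * h1 x + r x * h2 x)) - (LINT x|lborel. indicator G x * E x)"
    by (rule Bochner_Integration.integral_diff[OF Hb Ei])
  finally have eq: "(LINT x|lborel. indicator G x * (\<omega> x * (q x * g1 x + r x * g2 x)))
    = (LINT x|lborel. indicator G x * (q x * h1 x + r x * h2 x)) - (LINT x|lborel. indicator G x * E x)" .
  have "\<bar>LINT x|lborel. indicator G x * E x\<bar> \<le> (LINT x|lborel. \<bar>indicator G x * E x\<bar>)" by (rule integral_abs_bound)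
  also have "\<dots> \<le> (LINT x|lborel. s * C * (indicator W x * (\<bar>q x\<bar> + \<bar>r x\<bar>)))"
    by (intro integral_mono Eb integrable_abs Ei integrable_mult_right ind Ws qri)
  also have "\<dots> = s * C * (LINT x|lborel. indicator W x * (\<bar>q x\<bar> + \<bar>r x\<bar>))" by simp
  finally show ?thesis unfolding eq using main by (simp add: R1_def R2_def B_def)
qed

section \<open>The determinant near a point\<close>

lemma measure_le_integral:
  assumes A: "A \<in> sets borel" "A \<subseteq> B" and f: "integrable lborel f" "\<And>x. 0 \<le> f x" and c: "c > 0" "\<And>x. x \<in> A \<Longrightarrow> c \<le> f x"
  shows "emeasure lborel A < \<infinity>" "measure lborel A \<le> (LINT x|lborel. f x) / c"
proof -
  have "ennreal c * emeasure lborel A = (\<integral>\<^sup>+x. ennreal c * indicator A x \<partial>lborel)" using A by (simp add: nn_integral_cmult_indicator)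
  also have "\<dots> \<le> (\<integral>\<^sup>+x. ennreal (f x) \<partial>lborel)"
    using c f by (intro nn_integral_mono) (auto simp: indicator_def intro: ennreal_leI)
  also have "\<dots> = ennreal (LINT x|lborel. f x)" by (rule nn_integral_eq_integral) (use f in auto)
  finally have *: "ennreal c * emeasure lborel A \<le> ennreal (LINT x|lborel. f x)" .
  show fin: "emeasure lborel A < \<infinity>"
  proof (rule ccontr)
    assume "\<not> emeasure lborel A < \<infinity>"
    then have "emeasure lborel A = top" using less_top[of "emeasure lborel A"] by auto
    with * c show False by (simp add: ennreal_mult_top top_unique)
  qed
  have I0: "0 \<le> (LINT x|lborel. f x)" using f by (intro integral_nonneg_AE) auto
  have "ennreal (c * measure lborel A) \<le> ennreal (LINT x|lborel. f x)"
    using * fin c by (simp add: emeasure_eq_ennreal_measure ennreal_mult less_top)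
  then have "c * measure lborel A \<le> (LINT x|lborel. f x)" using I0 by (simp add: ennreal_le_iff)
  then show "measure lborel A \<le> (LINT x|lborel. f x) / c" using c by (simp add: field_simps)
qed

text \<open>On the good set the identity \<open>q g1 + r g2 = (p r - q\<^sup>2) + q (g1 + q) + r (g2
  - p)\<close> turns the truncation estimate into a bound for the integral of the determinant,
  except where the error of the stream function exceeds \<open>\<sigma>\<close>, a set of measure at
  most \<open>\<omega> / \<sigma>\<close>. Since the determinant is nonnegative, the inequality of
  Markov bounds the measure of the set where it exceeds \<open>lam\<close>. The good set is where
  the averages of \<open>\<bar>g1\<bar> + \<bar>g2\<bar>\<close> are at most \<open>2 * c +
  1\<close>; the factor two is there because \<open>\<bar>p\<bar> + \<bar>q\<bar> \<le> 2 *
  M\<close>.\<close>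

lemma determinant_local_estimate:
  fixes p q r M :: "real \<times> real \<Rightarrow> real" and \<rho> c :: real
  assumes U: "open U" "bounded U" and \<rho>: "\<rho> > 0" and sub: "ball x0 (6 * \<rho>) \<subseteq> U"
    and int: "integrable lborel p" "integrable lborel q" "integrable lborel r" "integrable lborel M"
    and bd: "\<And>x. \<bar>p x\<bar> \<le> M x" "\<And>x. \<bar>q x\<bar> \<le> M x" "\<And>x. \<bar>r x\<bar> \<le> M x"
    and D: "\<And>x. 0 \<le> p x * r x - (q x)\<^sup>2" and c: "c \<ge> 0"
    and m1: "(LINT x|lborel. indicator (ball x0 (6 * \<rho>)) x * max 0 (M x - c)) \<le> m1"
    and g: "has_grad \<psi> g1 g2" "continuous_on UNIV g1" "continuous_on UNIV g2"
    and \<omega>: "(LINT x|lborel. indicator (ball x0 (6 * \<rho>)) x * (\<bar>g1 x + q x\<bar> + \<bar>g2 x - p x\<bar>)) \<le> \<omega>"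
    and div: "\<And>\<phi>. \<phi> \<in> test_functions U \<Longrightarrow> \<bar>LINT z|lborel. q z * partial_x \<phi> z + r z * partial_y \<phi> z\<bar> \<le> \<epsilon> * test_norm \<phi>"
    and \<epsilon>: "\<epsilon> \<ge> 0"
    and k: "k \<in> test_functions (ball x0 (2 * \<rho>))" "\<And>x. 0 \<le> k x" "\<And>x. k x \<le> 1" "\<And>x. \<bar>partial_x k x\<bar> \<le> C" "\<And>x. \<bar>partial_y k x\<bar> \<le> C"
      "\<And>x. x \<in> ball x0 \<rho> \<Longrightarrow> k x = 1"
    and osc: "\<And>x y. x \<in> ball x0 (2 * \<rho>) \<Longrightarrow> y \<in> ball x0 (2 * \<rho>) \<Longrightarrow> avg_bounded (2 * c + 1) (ball x0 (6 * \<rho>)) (\<lambda>z. \<bar>g1 z\<bar> + \<bar>g2 z\<bar>) x \<Longrightarrow>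
      avg_bounded (2 * c + 1) (ball x0 (6 * \<rho>)) (\<lambda>z. \<bar>g1 z\<bar> + \<bar>g2 z\<bar>) y \<Longrightarrow> \<bar>\<psi> x - \<psi> y\<bar> \<le> s"
    and s: "s \<ge> 0" "s * C \<le> 1/2" and \<sigma>: "\<sigma> > 0" and lam: "lam > 0"
  defines "K \<equiv> 2 * c + 1" and "I \<equiv> (LINT x|lborel. M x)"
  shows "measure lborel {x \<in> ball x0 \<rho>. lam < p x * r x - (q x)\<^sup>2} \<le> 25 * (2 * m1 + \<omega>) + \<omega> / \<sigma>
    + (\<epsilon> * sqrt ((s\<^sup>2 + 2 * (5 * K)\<^sup>2) * measure lborel U) + 5 * K * (2 * (c * (25 * (2 * m1 + \<omega>)) + m1)) + s * C * (2 * I)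
      + 2 * \<sigma> * I + 2 * K * (c * (\<omega> / \<sigma>) + m1)) / lam"
proof -
  define B6 where "B6 = ball x0 (6 * \<rho>)"
  define W where "W = ball x0 (2 * \<rho>)"
  define a where "a z = \<bar>g1 z\<bar> + \<bar>g2 z\<bar>" for z
  define er where "er z = \<bar>g1 z + q z\<bar> + \<bar>g2 z - p z\<bar>" for z
  define Mc where "Mc z = max 0 (M z - c)" for z
  define Dt where "Dt z = p z * r z - (q z)\<^sup>2" for z
  have WB: "W \<subseteq> B6" "W \<subseteq> U" using \<rho> sub by (auto simp: W_def B6_def subset_iff)
  have [measurable]: "B6 \<in> sets borel" "W \<in> sets borel" by (simp_all add: B6_def W_def)
  have [measurable]: "p \<in> borel_measurable borel" "q \<in> borel_measurable borel" "r \<in> borel_measurable borel" "M \<in> borel_measurable borel" using int by auto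
  have [measurable]: "g1 \<in> borel_measurable borel" "g2 \<in> borel_measurable borel" "\<psi> \<in> borel_measurable borel" "k \<in> borel_measurable borel"
    using g has_grad_cont[OF g(1)] test_measurable[OF k(1)] by (auto intro: borel_measurable_continuous_onI)
  have [measurable]: "a \<in> borel_measurable borel" "er \<in> borel_measurable borel" "Mc \<in> borel_measurable borel" "Dt \<in> borel_measurable borel"
    unfolding a_def[abs_def] er_def[abs_def] Mc_def[abs_def] Dt_def[abs_def] by measurable
  have ac: "continuous_on UNIV a" unfolding a_def[abs_def] using g by (intro continuous_intros)
  have M0: "M x \<ge> 0" for x using bd(1)[of x] by linarith
  have I: "I \<ge> 0" unfolding I_def using M0 by (intro integral_nonneg_AE) auto
  have C: "C \<ge> 0" using k(4)[of 0] by linarith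
  have K: "K \<ge> 1" using c by (simp add: K_def)
  have ind: "integrable lborel (\<lambda>x. indicator A x * f x)" if "A \<in> sets borel" "integrable lborel f" for A and f :: "real \<times> real \<Rightarrow> real"
    using integrable_mult_indicator[of A lborel f] that by simp
  have gi: "integrable lborel (\<lambda>x. indicator B6 x * g1 x)" "integrable lborel (\<lambda>x. indicator B6 x * g2 x)" "integrable lborel (\<lambda>x. indicator B6 x * a x)"
    unfolding B6_def by (intro integrable_indicator_ball g ac)+
  have eri: "integrable lborel (\<lambda>x. indicator B6 x * er x)"
  proof -
    have "integrable lborel (\<lambda>x. \<bar>indicator B6 x * g1 x + indicator B6 x * q x\<bar> + \<bar>indicator B6 x * g2 x - indicator B6 x * p x\<bar>)"
      using gi int ind[of B6] by simp
    moreover have "(\<lambda>x. \<bar>indicator B6 x * g1 x + indicator B6 x * q x\<bar> + \<bar>indicator B6 x * g2 x - indicator B6 x * p x\<bar>) = (\<lambda>x. indicator B6 x * er x)"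
      by (auto simp: er_def indicator_def fun_eq_iff)
    ultimately show ?thesis by simp
  qed
  have Mci: "integrable lborel (\<lambda>x. indicator B6 x * Mc x)"
  proof (rule Bochner_Integration.integrable_bound[OF int(4)])
    show "AE x in lborel. norm (indicator B6 x * Mc x) \<le> norm (M x)" using M0 c by (intro AE_I2) (auto simp: Mc_def indicator_def)
  qed measurable
  have m1': "(LINT x|lborel. indicator B6 x * Mc x) \<le> m1" using m1 by (simp add: B6_def Mc_def)
  have \<omega>': "(LINT x|lborel. indicator B6 x * er x) \<le> \<omega>" using \<omega> by (simp add: B6_def er_def)
  have m10: "m1 \<ge> 0" by (rule order_trans[OF _ m1'], rule integral_nonneg_AE) (auto simp: Mc_def)
  have \<omega>0: "\<omega> \<ge> 0" by (rule order_trans[OF _ \<omega>'], rule integral_nonneg_AE) (auto simp: er_def)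
  \<comment> \<open>the excess whose maximal function singles out the bad points\<close>
  define e where "e z = indicator B6 z * max 0 (a z - 2 * c)" for z
  have ei: "integrable lborel e"
  proof (rule Bochner_Integration.integrable_bound[OF gi(3)])
    show "e \<in> borel_measurable lborel" unfolding e_def[abs_def] by measurable
    show "AE x in lborel. norm (e x) \<le> norm (indicator B6 x * a x)" using c by (intro AE_I2) (auto simp: e_def indicator_def a_def)
  qed
  have eI: "(LINT x|lborel. e x) \<le> 2 * m1 + \<omega>"
  proof -
    have "(LINT x|lborel. e x) \<le> (LINT x|lborel. 2 * (indicator B6 x * Mc x) + indicator B6 x * er x)"
    proof (rule integral_mono[OF ei])
      show "integrable lborel (\<lambda>x. 2 * (indicator B6 x * Mc x) + indicator B6 x * er x)" using Mci eri by simp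
      fix x
      have "a x \<le> 2 * M x + er x" using bd(1,2)[of x] by (simp add: a_def er_def)
      then show "e x \<le> 2 * (indicator B6 x * Mc x) + indicator B6 x * er x"
        by (auto simp: e_def Mc_def er_def indicator_def max_def)
    qed
    also have "\<dots> = 2 * (LINT x|lborel. indicator B6 x * Mc x) + (LINT x|lborel. indicator B6 x * er x)" using Mci eri by simp
    finally show ?thesis using m1' \<omega>' by linarith
  qed
  define Bad where "Bad = maximal_superlevel 1 e"
  have Bad[measurable]: "Bad \<in> sets borel" unfolding Bad_def using open_maximal_superlevel by (rule borel_open)
  have "emeasure lborel Bad \<le> ennreal (25 / 1 * (LINT x|lborel. e x))"
    unfolding Bad_def by (rule maximal_weak_type[OF ei]) (auto simp: e_def)
  also have "\<dots> \<le> ennreal (25 * (2 * m1 + \<omega>))" using eI by (intro ennreal_leI) simp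
  finally have Badle: "emeasure lborel Bad \<le> ennreal (25 * (2 * m1 + \<omega>))" .
  have Badm: "emeasure lborel Bad < \<infinity>" "measure lborel Bad \<le> 25 * (2 * m1 + \<omega>)"
  proof -
    show fin: "emeasure lborel Bad < \<infinity>" using Badle by (rule le_less_trans) simp
    then have "emeasure lborel Bad = ennreal (measure lborel Bad)" by (intro emeasure_eq_ennreal_measure) auto
    then have "ennreal (measure lborel Bad) \<le> ennreal (25 * (2 * m1 + \<omega>))" using Badle by (simp only:)
    then show "measure lborel Bad \<le> 25 * (2 * m1 + \<omega>)"
      by (subst (asm) ennreal_le_iff) (use m10 \<omega>0 in auto)
  qed
  define G where "G = W - Bad"
  have G[measurable]: "G \<in> sets borel" by (simp add: G_def)
  have ab: "avg_bounded K B6 a x" if "x \<in> G" for x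
    using avg_bounded_outside_superlevel[OF ac, of B6 "2 * c" x] ei that unfolding G_def Bad_def e_def[abs_def] K_def by simp
  have aK: "a x \<le> K" if "x \<in> G" for x
    using avg_bounded_value[OF ac _ _ ab[OF that]] that WB by (auto simp: B6_def G_def)
  have Lip: "\<bar>\<psi> x - \<psi> y\<bar> \<le> (4 * K) * dist x y" if x: "x \<in> G" and y: "y \<in> G" for x y
  proof (rule avg_bounded_Lipschitz[OF g])
    show "avg_bounded K B6 (\<lambda>y. \<bar>g1 y\<bar> + \<bar>g2 y\<bar>) x" "avg_bounded K B6 (\<lambda>y. \<bar>g1 y\<bar> + \<bar>g2 y\<bar>) y"
      using ab[OF x] ab[OF y] by (simp_all add: a_def[abs_def])
    have xW: "dist x0 x < 2 * \<rho>" "dist x0 y < 2 * \<rho>" using x y by (auto simp: G_def W_def)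
    show "ball ((1/2) *\<^sub>R (x + y)) (dist x y) \<subseteq> B6"
    proof
      fix z assume z: "z \<in> ball ((1/2) *\<^sub>R (x + y)) (dist x y)"
      have "(1/2) *\<^sub>R x0 + (1/2) *\<^sub>R x0 = x0" by (simp flip: scaleR_add_left)
      then have "x0 - (1/2) *\<^sub>R (x + y) = (1/2) *\<^sub>R (x0 - x) + (1/2) *\<^sub>R (x0 - y)" by (simp add: algebra_simps)
      then have "dist x0 ((1/2) *\<^sub>R (x + y)) \<le> (1/2) * dist x0 x + (1/2) * dist x0 y"
        using norm_triangle_ineq[of "(1/2) *\<^sub>R (x0 - x)" "(1/2) *\<^sub>R (x0 - y)"] by (simp add: dist_norm)
      moreover have "dist x y \<le> dist x0 x + dist x0 y" using dist_triangle[of x y x0] by (simp add: dist_commute)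
      moreover have "dist x0 z \<le> dist x0 ((1/2) *\<^sub>R (x + y)) + dist ((1/2) *\<^sub>R (x + y)) z" by (rule dist_triangle)
      ultimately show "z \<in> B6" using z xW by (simp add: B6_def)
    qed
  qed (use K in simp)
  obtain m where m: "\<And>x. x \<in> G \<Longrightarrow> \<bar>\<psi> x - m\<bar> \<le> s"
  proof (cases "G = {}")
    case False
    then obtain x1 where x1: "x1 \<in> G" by auto
    show ?thesis
    proof (rule that[of "\<psi> x1"])
      fix x assume x: "x \<in> G"
      show "\<bar>\<psi> x - \<psi> x1\<bar> \<le> s"
        using ab[OF x] ab[OF x1] x x1 unfolding K_def B6_def a_def[abs_def] by (intro osc) (auto simp: G_def W_def)
    qed
  qed (use that in auto)
  have k1: "\<bar>k x\<bar> \<le> 1" for x using k(2,3)[of x] by simp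
  have main: "\<bar>LINT x|lborel. indicator G x * (k x * (q x * g1 x + r x * g2 x))\<bar>
    \<le> \<epsilon> * sqrt ((s\<^sup>2 + 2 * (4 * K + 2 * s * C)\<^sup>2) * measure lborel U) + (4 * K + 2 * s * C) * (LINT x|lborel. indicator (W - G) x * (\<bar>q x\<bar> + \<bar>r x\<bar>))
      + s * C * (LINT x|lborel. indicator W x * (\<bar>q x\<bar> + \<bar>r x\<bar>))"
  proof (rule Lipschitz_truncation_estimate[OF U _ WB(2) g G _ _ Lip s(1) m int(2,3) div \<epsilon> k(1)[folded W_def] k1 k(4,5)])
    show "open W" "G \<subseteq> W" "0 \<le> 4 * K" using K by (auto simp: W_def G_def)
  qed
  have lw: "4 * K + 2 * s * C \<le> 5 * K" "0 \<le> 4 * K + 2 * s * C" using s K C by auto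
  have Mint: "(LINT x|lborel. indicator A x * M x) \<le> c * measure lborel A + m1" if A: "A \<in> sets borel" "A \<subseteq> B6" for A
  proof -
    have Af: "emeasure lborel A < \<infinity>" using emeasure_bounded_finite[of A] A by (auto simp: B6_def intro: bounded_subset)
    have "(LINT x|lborel. indicator A x * M x) \<le> (LINT x|lborel. c * indicator A x + indicator B6 x * Mc x)"
    proof (rule integral_mono[OF ind[OF A(1) int(4)]])
      show "integrable lborel (\<lambda>x. c * indicator A x + indicator B6 x * Mc x)" using Mci A Af by (auto intro!: integrable_real_indicator)
      show "indicator A x * M x \<le> c * indicator A x + indicator B6 x * Mc x" for x using A by (auto simp: indicator_def Mc_def)
    qed
    also have "\<dots> = c * measure lborel A + (LINT x|lborel. indicator B6 x * Mc x)" using Mci A Af by simp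
    finally show ?thesis using m1' by linarith
  qed
  have qr2: "(LINT x|lborel. indicator A x * (\<bar>q x\<bar> + \<bar>r x\<bar>)) \<le> 2 * (LINT x|lborel. indicator A x * M x)" if A: "A \<in> sets borel" for A
  proof -
    have "(LINT x|lborel. indicator A x * (\<bar>q x\<bar> + \<bar>r x\<bar>)) \<le> (LINT x|lborel. 2 * (indicator A x * M x))"
    proof (rule integral_mono)
      show "integrable lborel (\<lambda>x. indicator A x * (\<bar>q x\<bar> + \<bar>r x\<bar>))" by (rule ind[OF A]) (use int in simp)
      show "integrable lborel (\<lambda>x. 2 * (indicator A x * M x))" using ind[OF A int(4)] by simp
      show "indicator A x * (\<bar>q x\<bar> + \<bar>r x\<bar>) \<le> 2 * (indicator A x * M x)" for x using bd(2,3)[of x] by (auto simp: indicator_def)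
    qed
    then show ?thesis by simp
  qed
  have t1: "(LINT x|lborel. indicator (W - G) x * (\<bar>q x\<bar> + \<bar>r x\<bar>)) \<le> 2 * (c * (25 * (2 * m1 + \<omega>)) + m1)"
  proof -
    have "measure lborel (W - G) \<le> measure lborel Bad" using Badm by (intro measure_mono_fmeasurable) (auto simp: G_def fmeasurable_def)
    then have "c * measure lborel (W - G) \<le> c * (25 * (2 * m1 + \<omega>))" using Badm(2) c by (intro mult_left_mono) auto
    then show ?thesis using qr2[of "W - G"] Mint[of "W - G"] WB by force
  qed
  have t2: "(LINT x|lborel. indicator W x * (\<bar>q x\<bar> + \<bar>r x\<bar>)) \<le> 2 * I"
  proof -
    have "(LINT x|lborel. indicator W x * M x) \<le> I" unfolding I_def
      by (rule integral_mono[OF ind int(4)]) (use int M0 in \<open>auto simp: indicator_def\<close>)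
    then show ?thesis using qr2[of W] by simp
  qed
  have t10: "0 \<le> (LINT x|lborel. indicator (W - G) x * (\<bar>q x\<bar> + \<bar>r x\<bar>))" by (intro integral_nonneg_AE) auto
  define R where "R = \<epsilon> * sqrt ((s\<^sup>2 + 2 * (5 * K)\<^sup>2) * measure lborel U) + 5 * K * (2 * (c * (25 * (2 * m1 + \<omega>)) + m1)) + s * C * (2 * I)"
  have mainR: "\<bar>LINT x|lborel. indicator G x * (k x * (q x * g1 x + r x * g2 x))\<bar> \<le> R"
    unfolding R_def
  proof (intro order_trans[OF main] add_mono mult_mono mult_left_mono t1 t2 \<epsilon> real_sqrt_le_mono mult_right_mono lw power_mono order_refl)
  qed (use t10 s C K lw in auto)
  \<comment> \<open>on \<open>G1\<close> the stream function is accurate, and \<open>G2\<close> is small by the inequality of Markov\<close>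
  define G1 where "G1 = {x \<in> G. er x \<le> \<sigma>}"
  define G2 where "G2 = {x \<in> G. \<sigma> < er x}"
  have G12[measurable]: "G1 \<in> sets borel" "G2 \<in> sets borel" unfolding G1_def G2_def by measurable
  have GB: "G1 \<subseteq> B6" "G2 \<subseteq> B6" "G1 \<subseteq> W" "G2 \<subseteq> W" using WB by (auto simp: G1_def G2_def G_def)
  have G2m: "measure lborel G2 \<le> \<omega> / \<sigma>"
  proof -
    have "measure lborel G2 \<le> (LINT x|lborel. indicator B6 x * er x) / \<sigma>"
      by (rule measure_le_integral(2)[OF G12(2) GB(2) eri _ \<sigma>]) (use GB in \<open>auto simp: G2_def er_def subset_iff\<close>)
    also have "\<dots> \<le> \<omega> / \<sigma>" using \<omega>' \<sigma> by (intro divide_right_mono) auto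
    finally show ?thesis .
  qed
  have Dle: "indicator G1 x * (k x * Dt x) \<le> indicator G x * (k x * (q x * g1 x + r x * g2 x)) + \<sigma> * (indicator G1 x * (2 * M x)) + K * (indicator G2 x * (2 * M x))" for x
  proof -
    have e: "q x * g1 x + r x * g2 x = Dt x + (q x * (g1 x + q x) + r x * (g2 x - p x))" by (simp add: Dt_def algebra_simps power2_eq_square)
    have e1: "\<bar>q x * (g1 x + q x) + r x * (g2 x - p x)\<bar> \<le> M x * er x"
    proof -
      have "\<bar>q x * (g1 x + q x) + r x * (g2 x - p x)\<bar> \<le> \<bar>q x\<bar> * \<bar>g1 x + q x\<bar> + \<bar>r x\<bar> * \<bar>g2 x - p x\<bar>" by (metis abs_mult abs_triangle_ineq)
      also have "\<dots> \<le> M x * \<bar>g1 x + q x\<bar> + M x * \<bar>g2 x - p x\<bar>" by (intro add_mono mult_right_mono bd) auto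
      finally show ?thesis by (simp add: er_def algebra_simps)
    qed
    have e2: "\<bar>q x * g1 x + r x * g2 x\<bar> \<le> M x * a x"
    proof -
      have "\<bar>q x * g1 x + r x * g2 x\<bar> \<le> \<bar>q x\<bar> * \<bar>g1 x\<bar> + \<bar>r x\<bar> * \<bar>g2 x\<bar>" by (metis abs_mult abs_triangle_ineq)
      also have "\<dots> \<le> M x * \<bar>g1 x\<bar> + M x * \<bar>g2 x\<bar>" by (intro add_mono mult_right_mono bd) auto
      finally show ?thesis by (simp add: a_def algebra_simps)
    qed
    consider "x \<in> G1" | "x \<in> G2" | "x \<notin> G" unfolding G1_def G2_def using le_less_linear[of "er x" \<sigma>] by blast
    then show ?thesis
    proof cases
      case 1
      then have x: "x \<in> G" "x \<notin> G2" "er x \<le> \<sigma>" by (auto simp: G1_def G2_def)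
      have "M x * er x \<le> M x * \<sigma>" using x M0 by (intro mult_left_mono) auto
      then have "Dt x \<le> (q x * g1 x + r x * g2 x) + \<sigma> * M x" using e e1 by (simp add: mult.commute)
      then have "k x * Dt x \<le> k x * ((q x * g1 x + r x * g2 x) + \<sigma> * M x)" using k(2) by (intro mult_left_mono)
      also have "\<dots> = k x * (q x * g1 x + r x * g2 x) + k x * (\<sigma> * M x)" by (simp add: distrib_left)
      also have "k x * (\<sigma> * M x) \<le> 1 * (\<sigma> * M x)" using k(3) \<sigma> M0 by (intro mult_right_mono) auto
      also have "1 * (\<sigma> * M x) \<le> \<sigma> * (2 * M x)" using \<sigma> M0[of x] by simp
      finally show ?thesis using 1 x by simp
    next
      case 2
      then have x: "x \<in> G" "x \<notin> G1" by (auto simp: G1_def G2_def)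
      have "\<bar>k x * (q x * g1 x + r x * g2 x)\<bar> \<le> 1 * (M x * K)"
        unfolding abs_mult[of "k x"] using k1 order_trans[OF e2 mult_left_mono[OF aK[OF x(1)] M0]] by (intro mult_mono) auto
      moreover have "0 \<le> M x * K" using M0[of x] K by simp
      ultimately have "0 \<le> k x * (q x * g1 x + r x * g2 x) + K * (2 * M x)" by (simp add: abs_le_iff algebra_simps)
      then show ?thesis using 2 x by simp
    next
      case 3
      then show ?thesis by (simp add: G1_def G2_def)
    qed
  qed
  have rhs_i: "integrable lborel (\<lambda>x. indicator G x * (k x * (q x * g1 x + r x * g2 x)))"
  proof (rule Bochner_Integration.integrable_bound[where f="\<lambda>x. K * M x"])
    show "integrable lborel (\<lambda>x. K * M x)" using int by simp
    show "AE x in lborel. norm (indicator G x * (k x * (q x * g1 x + r x * g2 x))) \<le> norm (K * M x)"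
    proof (rule AE_I2)
      fix x
      have "\<bar>q x * g1 x + r x * g2 x\<bar> \<le> M x * a x"
      proof -
        have "\<bar>q x * g1 x + r x * g2 x\<bar> \<le> \<bar>q x\<bar> * \<bar>g1 x\<bar> + \<bar>r x\<bar> * \<bar>g2 x\<bar>" by (metis abs_mult abs_triangle_ineq)
        also have "\<dots> \<le> M x * \<bar>g1 x\<bar> + M x * \<bar>g2 x\<bar>" by (intro add_mono mult_right_mono bd) auto
        finally show ?thesis by (simp add: a_def algebra_simps)
      qed
      then have "\<bar>k x\<bar> * \<bar>q x * g1 x + r x * g2 x\<bar> \<le> 1 * (M x * K)" if "x \<in> G"
        using k1 order_trans[OF _ mult_left_mono[OF aK[OF that] M0]] by (intro mult_mono) auto
      then show "norm (indicator G x * (k x * (q x * g1 x + r x * g2 x))) \<le> norm (K * M x)"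
        using M0[of x] K by (auto simp: indicator_def abs_mult mult.commute)
    qed
  qed measurable
  have M1i: "integrable lborel (\<lambda>x. indicator A x * (2 * M x))" if "A \<in> sets borel" for A using ind[OF that] int by simp
  have sum_i: "integrable lborel (\<lambda>x. indicator G x * (k x * (q x * g1 x + r x * g2 x)) + \<sigma> * (indicator G1 x * (2 * M x)) + K * (indicator G2 x * (2 * M x)))"
    using rhs_i M1i[OF G12(1)] M1i[OF G12(2)] by (intro Bochner_Integration.integrable_add integrable_mult_right)
  have kD0: "0 \<le> indicator G1 x * (k x * Dt x)" for x using k(2)[of x] D[of x] by (simp add: Dt_def)
  have kDi: "integrable lborel (\<lambda>x. indicator G1 x * (k x * Dt x))"
  proof (rule Bochner_Integration.integrable_bound[OF sum_i])
    show "AE x in lborel. norm (indicator G1 x * (k x * Dt x)) \<le> norm (indicator G x * (k x * (q x * g1 x + r x * g2 x)) + \<sigma> * (indicator G1 x * (2 * M x)) + K * (indicator G2 x * (2 * M x)))"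
    proof (rule AE_I2)
      fix x show "norm (indicator G1 x * (k x * Dt x)) \<le> norm (indicator G x * (k x * (q x * g1 x + r x * g2 x)) + \<sigma> * (indicator G1 x * (2 * M x)) + K * (indicator G2 x * (2 * M x)))"
        using Dle[of x] kD0[of x] unfolding real_norm_def by linarith
    qed
  qed measurable
  have kD: "(LINT x|lborel. indicator G1 x * (k x * Dt x)) \<le> R + 2 * \<sigma> * I + 2 * K * (c * (\<omega> / \<sigma>) + m1)"
  proof -
    have "(LINT x|lborel. indicator G1 x * (k x * Dt x)) \<le> (LINT x|lborel. indicator G x * (k x * (q x * g1 x + r x * g2 x)) + \<sigma> * (indicator G1 x * (2 * M x)) + K * (indicator G2 x * (2 * M x)))"
      by (rule integral_mono[OF kDi sum_i Dle])
    also have "\<dots> = (LINT x|lborel. indicator G x * (k x * (q x * g1 x + r x * g2 x))) + \<sigma> * (LINT x|lborel. indicator G1 x * (2 * M x)) + K * (LINT x|lborel. indicator G2 x * (2 * M x))"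
      using rhs_i M1i[OF G12(1)] M1i[OF G12(2)] by simp
    also have "\<dots> \<le> R + \<sigma> * (2 * I) + K * (2 * (c * (\<omega> / \<sigma>) + m1))"
    proof (intro add_mono mult_left_mono)
      show "(LINT x|lborel. indicator G x * (k x * (q x * g1 x + r x * g2 x))) \<le> R" using mainR by linarith
      have "(LINT x|lborel. indicator G1 x * (2 * M x)) \<le> (LINT x|lborel. 2 * M x)"
        by (rule integral_mono[OF M1i[OF G12(1)]]) (use int M0 in \<open>auto simp: indicator_def\<close>)
      then show "(LINT x|lborel. indicator G1 x * (2 * M x)) \<le> 2 * I" by (simp add: I_def)
      have "(LINT x|lborel. indicator G2 x * (2 * M x)) = 2 * (LINT x|lborel. indicator G2 x * M x)"
        by (subst integral_mult_right_zero[symmetric]) (intro Bochner_Integration.integral_cong refl, simp)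
      also have "\<dots> \<le> 2 * (c * (\<omega> / \<sigma>) + m1)" using Mint[OF G12(2) GB(2)] mult_left_mono[OF G2m c] by simp
      finally show "(LINT x|lborel. indicator G2 x * (2 * M x)) \<le> 2 * (c * (\<omega> / \<sigma>) + m1)" .
    qed (use \<sigma> K in auto)
    finally show ?thesis by (simp add: mult_ac)
  qed
  define S where "S = {x \<in> ball x0 \<rho>. lam < Dt x}"
  have Sm[measurable]: "S \<in> sets borel" unfolding S_def by measurable
  have S1m: "measure lborel (S \<inter> G1) \<le> (R + 2 * \<sigma> * I + 2 * K * (c * (\<omega> / \<sigma>) + m1)) / lam"
  proof -
    have "measure lborel (S \<inter> G1) \<le> (LINT x|lborel. indicator G1 x * (k x * Dt x)) / lam"
    proof (rule measure_le_integral(2)[OF _ _ kDi kD0 lam])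
      show "lam \<le> indicator G1 x * (k x * Dt x)" if "x \<in> S \<inter> G1" for x using that k(6)[of x] by (auto simp: S_def)
    qed (auto intro: subset_UNIV)
    also have "\<dots> \<le> (R + 2 * \<sigma> * I + 2 * K * (c * (\<omega> / \<sigma>) + m1)) / lam" using kD lam by (intro divide_right_mono) auto
    finally show ?thesis .
  qed
  have fin: "A \<in> fmeasurable lborel" if "A \<in> sets borel" "A \<subseteq> W" for A
    using emeasure_bounded_finite[of A] that by (auto simp: W_def fmeasurable_def intro: bounded_subset)
  have "S \<subseteq> Bad \<union> G2 \<union> (S \<inter> G1)" using \<rho> by (auto simp: S_def G_def G1_def G2_def W_def)
  then have "measure lborel S \<le> measure lborel (Bad \<union> G2 \<union> (S \<inter> G1))"
    using Badm(1) fin[OF G12(2) GB(4)] fin[of "S \<inter> G1"] GB(3)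
    by (intro measure_mono_fmeasurable fmeasurable.Un) (auto simp: fmeasurable_def)
  also have "\<dots> \<le> measure lborel (Bad \<union> G2) + measure lborel (S \<inter> G1)" by (rule measure_Un_le) auto
  also have "measure lborel (Bad \<union> G2) \<le> measure lborel Bad + measure lborel G2" by (rule measure_Un_le) auto
  finally have "measure lborel S \<le> 25 * (2 * m1 + \<omega>) + \<omega> / \<sigma> + (R + 2 * \<sigma> * I + 2 * K * (c * (\<omega> / \<sigma>) + m1)) / lam"
    using Badm(2) G2m S1m by linarith
  then show ?thesis by (simp add: S_def Dt_def R_def)
qed

lemma norm_prod_le_abs: "norm v \<le> \<bar>fst v\<bar> + \<bar>snd v\<bar>" for v :: "real \<times> real"
  using norm_Pair_le[of "fst v" "snd v"] by simp

text \<open>Division by \<open>A + 1\<close> rather than \<open>A\<close> covers the case \<open>A =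
  0\<close>.\<close>

lemma small_multiple:
  fixes A z :: real
  assumes "A \<ge> 0" "z > 0" shows "z / (A + 1) > 0" "A * (z / (A + 1)) \<le> z" "\<And>x. 0 \<le> x \<Longrightarrow> x \<le> z / (A + 1) \<Longrightarrow> A * x \<le> z"
proof -
  show 1: "z / (A + 1) > 0" using assms by simp
  have "A * (z / (A + 1)) = z * (A / (A + 1))" by simp
  also have "\<dots> \<le> z * 1" using assms by (intro mult_left_mono) auto
  finally show 2: "A * (z / (A + 1)) \<le> z" by simp
  show "A * x \<le> z" if "0 \<le> x" "x \<le> z / (A + 1)" for x
    using mult_left_mono[OF that(2) assms(1)] 2 by linarith
qed

lemma cutoff_exists:
  assumes \<rho>: "\<rho> > 0"
  obtains k C where "k \<in> test_functions (ball x0 (2 * \<rho>))" "\<And>x. 0 \<le> k x" "\<And>x. k x \<le> 1"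
    "\<And>x. \<bar>partial_x k x\<bar> \<le> C" "\<And>x. \<bar>partial_y k x\<bar> \<le> C" "\<And>x. x \<in> ball x0 \<rho> \<Longrightarrow> k x = 1"
proof -
  define t where "t = \<rho> / 8"
  have t: "t > 0" using \<rho> by (simp add: t_def)
  define S where "S = cball x0 (3 * \<rho> / 2)"
  have Si: "integrable lborel (indicator S :: _ \<Rightarrow> real)"
    using emeasure_bounded_finite[of S] by (intro integrable_real_indicator) (auto simp: S_def)
  define k where "k = conv (indicator S) (eta t)"
  have kt: "k \<in> test_functions (ball x0 (2 * \<rho>))" unfolding k_def
  proof (rule conv_test[OF Si eta_test[OF t], of S])
    show "norm p \<le> 2 * t" if "eta t p \<noteq> 0" for p by (rule eta_supp[OF t that])
    show "x \<in> ball x0 (2 * \<rho>)" if "y \<in> S" "dist x y \<le> 2 * t" for x y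
      using that dist_triangle[of x0 x y] \<rho> by (simp add: S_def t_def dist_commute)
  qed (auto simp: S_def)
  have i: "integrable lborel (\<lambda>y. indicator S y * eta t (x - y))" for x by (rule conv_eta_integrable[OF Si t])
  obtain C1 where C1: "\<And>x. \<bar>partial_x k x\<bar> \<le> C1" using test_bounded[OF test_partial(1)[OF kt]] by metis
  obtain C2 where C2: "\<And>x. \<bar>partial_y k x\<bar> \<le> C2" using test_bounded[OF test_partial(2)[OF kt]] by metis
  show ?thesis
  proof (rule that[OF kt, of "max C1 C2"])
    fix x
    show "0 \<le> k x" unfolding k_def conv_def by (intro integral_nonneg_AE AE_I2) (simp add: eta_nonneg)
    have "k x \<le> (LINT y|lborel. eta t (x - y))" unfolding k_def conv_def
      by (intro integral_mono i eta_shift_integral(4)[OF t]) (auto simp: indicator_def eta_nonneg)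
    then show "k x \<le> 1" using eta_shift_integral(3)[OF t, of x] by simp
    show "\<bar>partial_x k x\<bar> \<le> max C1 C2" "\<bar>partial_y k x\<bar> \<le> max C1 C2" using C1[of x] C2[of x] by auto
  next
    fix x assume x: "x \<in> ball x0 \<rho>"
    have e: "indicator S y * eta t (x - y) = eta t (x - y)" for y
    proof (cases "eta t (x - y) = 0")
      case False
      then have "dist x y \<le> 2 * t" using eta_supp[OF t False] by (simp add: dist_norm)
      then have "y \<in> S" using x dist_triangle[of x0 y x] \<rho> by (simp add: S_def t_def)
      then show ?thesis by simp
    qed simp
    show "k x = 1" unfolding k_def conv_def e by (rule eta_shift_integral(3)[OF t])
  qed
qed

text \<open>The parameters of \<open>determinant_local_estimate\<close> are fixed one after the
  other: the oscillation \<open>s\<close>, the mollification scale \<open>t\<close>, the size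
  \<open>m\<close> of the mollified gradient, the threshold \<open>\<sigma>\<close>, the error
  \<open>\<omega>\<close> of the stream function, and last the divergences. In the limit only the
  terms with \<open>m1\<close> remain.\<close>

lemma determinant_local_limit:
  fixes p q r :: "nat \<Rightarrow> real \<times> real \<Rightarrow> real" and M :: "real \<times> real \<Rightarrow> real" and \<rho> c :: real
  assumes U: "open U" "bounded U"
    and int: "\<And>j. integrable lborel (p j)" "\<And>j. integrable lborel (q j)" "\<And>j. integrable lborel (r j)" "integrable lborel M"
    and bd: "\<And>j x. \<bar>p j x\<bar> \<le> M x" "\<And>j x. \<bar>q j x\<bar> \<le> M x" "\<And>j x. \<bar>r j x\<bar> \<le> M x"
    and D: "\<And>j x. 0 \<le> p j x * r j x - (q j x)\<^sup>2"
    and div1: "\<And>e. e > 0 \<Longrightarrow> \<exists>N. \<forall>j\<ge>N. \<forall>\<phi>\<in>test_functions U. \<bar>LINT z|lborel. p j z * partial_x \<phi> z + q j z * partial_y \<phi> z\<bar> \<le> e * test_norm \<phi>"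
    and div2: "\<And>e. e > 0 \<Longrightarrow> \<exists>N. \<forall>j\<ge>N. \<forall>\<phi>\<in>test_functions U. \<bar>LINT z|lborel. q j z * partial_x \<phi> z + r j z * partial_y \<phi> z\<bar> \<le> e * test_norm \<phi>"
    and weak: "\<And>N e. e > 0 \<Longrightarrow> \<exists>J. \<forall>j\<ge>J. \<forall>x\<in>U. \<bar>conv (p j) (eta (inverse (real (Suc N)))) x\<bar> \<le> e \<and> \<bar>conv (q j) (eta (inverse (real (Suc N)))) x\<bar> \<le> e"
    and \<rho>: "\<rho> > 0" "cball x0 (14 * \<rho>) \<subseteq> U" and c: "c \<ge> 0"
    and m1: "(LINT x|lborel. indicator (ball x0 (6 * \<rho>)) x * max 0 (M x - c)) \<le> m1"
    and lam: "lam > 0" and zet: "zet > 0"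
  defines "K \<equiv> 2 * c + 1"
  shows "\<exists>J. \<forall>j\<ge>J. measure lborel {x \<in> ball x0 \<rho>. lam < p j x * r j x - (q j x)\<^sup>2}
    \<le> (50 + (10 * K * (50 * c + 1) + 2 * K) / lam) * m1 + zet"
proof -
  define I where "I = (LINT x|lborel. M x)"
  have M0: "M x \<ge> 0" for x using bd(1)[of 0 x] by linarith
  have I: "I \<ge> 0" unfolding I_def using M0 by (intro integral_nonneg_AE) auto
  have K: "K \<ge> 1" using c by (simp add: K_def)
  obtain k C where k: "k \<in> test_functions (ball x0 (2 * \<rho>))" "\<And>x. 0 \<le> k x" "\<And>x. k x \<le> 1"
    "\<And>x. \<bar>partial_x k x\<bar> \<le> C" "\<And>x. \<bar>partial_y k x\<bar> \<le> C" "\<And>x. x \<in> ball x0 \<rho> \<Longrightarrow> k x = 1"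
    by (rule cutoff_exists[OF \<rho>(1)]) (rule that)
  have C: "C \<ge> 0" using k(4)[of 0] by linarith
  have B6U: "ball x0 (6 * \<rho>) \<subseteq> U" "ball x0 (2 * \<rho>) \<subseteq> U" using \<rho> by (auto simp: subset_iff)
  \<comment> \<open>the oscillation of \<open>\<psi>\<close> that can be afforded against the derivative of the cutoff\<close>
  define s where "s = min (1 / (2 * (C + 1))) (zet * lam / 5 / (2 * C * I + 1))"
  have s: "s > 0" "s * C \<le> 1/2" "2 * C * I * s \<le> zet * lam / 5"
  proof -
    have 1: "zet * lam / 5 > 0" using zet lam by simp
    show s0: "s > 0" using C I 1 by (simp add: s_def add_nonneg_pos)
    have "s * C \<le> 1 / (2 * (C + 1)) * C" using C by (intro mult_right_mono) (auto simp: s_def)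
    also have "\<dots> \<le> 1/2" using C by (simp add: field_simps)
    finally show "s * C \<le> 1/2" .
    show "2 * C * I * s \<le> zet * lam / 5"
      by (rule small_multiple(3)[OF _ 1]) (use C I s0 in \<open>auto simp: s_def\<close>)
  qed
  obtain C0 where C0: "C0 > 0" "\<And>s p. s > 0 \<Longrightarrow> eta s p \<le> C0 / s\<^sup>2" using eta_sup_bound by metis
  define Cm where "Cm = 108 * pi * C0"
  have Cm: "Cm > 0" using C0 by (simp add: Cm_def)
  have "min \<rho> (s / 2 / (Cm * K + 1)) > 0" using \<rho> s Cm K by (simp add: add_nonneg_pos)
  from reals_Archimedean[OF this] obtain N where N: "inverse (real (Suc N)) < min \<rho> (s / 2 / (Cm * K + 1))" by blast
  define t where "t = inverse (real (Suc N))"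
  have t: "t > 0" "t \<le> \<rho>" "Cm * t * K \<le> s / 2"
  proof -
    show t0: "t > 0" "t \<le> \<rho>" using N by (auto simp: t_def)
    have "Cm * K * t \<le> s / 2" by (rule small_multiple(3)) (use Cm K s N t0 in \<open>auto simp: t_def\<close>)
    then show "Cm * t * K \<le> s / 2" by (simp add: mult_ac)
  qed
  \<comment> \<open>half of \<open>s\<close> is spent on the gradient bound of \<open>mean_oscillation\<close>, half on the mollification error\<close>
  define m where "m = s / (16 * \<rho>)"
  have m: "m > 0" "8 * \<rho> * m = s / 2" using s \<rho> by (auto simp: m_def)
  define \<sigma> where "\<sigma> = zet * lam / 5 / (2 * I + 1)"
  have \<sigma>: "\<sigma> > 0" "2 * I * \<sigma> \<le> zet * lam / 5"
    unfolding \<sigma>_def using small_multiple(1,2)[of "2 * I" "zet * lam / 5"] I zet lam by auto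
  define A1 where "A1 = 25 + 1 / \<sigma> + (250 * K * c + 2 * K * c / \<sigma>) / lam"
  have A1: "A1 \<ge> 0" unfolding A1_def using \<sigma> K c lam by (intro add_nonneg_nonneg divide_nonneg_nonneg mult_nonneg_nonneg) auto
  define A2 where "A2 = C0 / t\<^sup>2"
  have A2: "A2 \<ge> 0" using C0 by (simp add: A2_def)
  define \<omega> where "\<omega> = min (zet / 5 / (A1 + 1)) (m / 2 / (A2 + 1))"
  have \<omega>: "\<omega> > 0" "A1 * \<omega> \<le> zet / 5" "A2 * \<omega> \<le> m / 2"
  proof -
    show w: "\<omega> > 0" using A1 A2 zet m by (simp add: \<omega>_def add_nonneg_pos)
    show "A1 * \<omega> \<le> zet / 5" by (rule small_multiple(3)[OF A1]) (use zet w in \<open>auto simp: \<omega>_def\<close>)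
    show "A2 * \<omega> \<le> m / 2" by (rule small_multiple(3)[OF A2]) (use m w in \<open>auto simp: \<omega>_def\<close>)
  qed
  define S where "S = sqrt ((s\<^sup>2 + 2 * (5 * K)\<^sup>2) * measure lborel U)"
  have S: "S \<ge> 0" by (simp add: S_def)
  define \<epsilon> where "\<epsilon> = zet * lam / 5 / (S + 1)"
  have \<epsilon>: "\<epsilon> > 0" "S * \<epsilon> \<le> zet * lam / 5"
    unfolding \<epsilon>_def using small_multiple(1,2)[OF S, of "zet * lam / 5"] zet lam by auto
  define A3 where "A3 = (measure lborel U + 4) * (2 + 14 * \<rho>)"
  have A3: "A3 \<ge> 0" using \<rho> by (simp add: A3_def)
  define \<epsilon>1 where "\<epsilon>1 = \<omega> / 2 / (A3 + 1)"
  have \<epsilon>1: "\<epsilon>1 > 0" "A3 * \<epsilon>1 \<le> \<omega> / 2" unfolding \<epsilon>1_def using small_multiple(1,2)[OF A3, of "\<omega> / 2"] \<omega> by auto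
  obtain J1 where J1: "\<And>j \<phi>. j \<ge> J1 \<Longrightarrow> \<phi> \<in> test_functions U \<Longrightarrow> \<bar>LINT z|lborel. p j z * partial_x \<phi> z + q j z * partial_y \<phi> z\<bar> \<le> \<epsilon>1 * test_norm \<phi>"
    using div1[OF \<epsilon>1(1)] by blast
  obtain J2 where J2: "\<And>j \<phi>. j \<ge> J2 \<Longrightarrow> \<phi> \<in> test_functions U \<Longrightarrow> \<bar>LINT z|lborel. q j z * partial_x \<phi> z + r j z * partial_y \<phi> z\<bar> \<le> \<epsilon> * test_norm \<phi>"
    using div2[OF \<epsilon>(1)] by blast
  have "m / 2 > 0" using m by simp
  from weak[OF this, of N, folded t_def] obtain J3 where J3: "\<forall>j\<ge>J3. \<forall>x\<in>U. \<bar>conv (p j) (eta t) x\<bar> \<le> m / 2 \<and> \<bar>conv (q j) (eta t) x\<bar> \<le> m / 2" ..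
  show ?thesis
  proof (intro exI[of _ "max J1 (max J2 J3)"] allI impI)
    fix j assume "max J1 (max J2 J3) \<le> j"
    then have j: "J1 \<le> j" "J2 \<le> j" "J3 \<le> j" by auto
    obtain a b where x0: "x0 = (a, b)" by (cases x0)
    \<comment> \<open>a box between the ball of radius \<open>6 * \<rho>\<close> and the ball of radius \<open>14 * \<rho>\<close>\<close>
    define Y where "Y = cbox (a - 7 * \<rho>, b - 7 * \<rho>) (a + 7 * \<rho>, b + 7 * \<rho>)"
    have YU: "Y \<subseteq> U"
    proof
      fix z assume "z \<in> Y"
      then have "\<bar>fst x0 - fst z\<bar> \<le> 7 * \<rho>" "\<bar>snd x0 - snd z\<bar> \<le> 7 * \<rho>"
        by (cases z; auto simp: Y_def x0 abs_le_iff)+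
      then have "dist x0 z \<le> 14 * \<rho>" using norm_prod_le_abs[of "x0 - z"] by (simp add: dist_norm)
      then have "z \<in> cball x0 (14 * \<rho>)" by simp
      then show "z \<in> U" using \<rho>(2) by blast
    qed
    have BY: "ball x0 (6 * \<rho>) \<subseteq> Y"
    proof
      fix z assume "z \<in> ball x0 (6 * \<rho>)"
      then have "norm (x0 - z) < 6 * \<rho>" by (simp add: dist_norm)
      then have "\<bar>fst x0 - fst z\<bar> < 6 * \<rho>" "\<bar>snd x0 - snd z\<bar> < 6 * \<rho>"
        using abs_fst_le[of "x0 - z"] abs_snd_le[of "x0 - z"] by simp_all
      then show "z \<in> Y" using \<rho>(1) by (cases z) (auto simp: Y_def x0 abs_less_iff)
    qed
    have "\<exists>\<psi> g1 g2. has_grad \<psi> g1 g2 \<and> continuous_on UNIV g1 \<and> continuous_on UNIV g2 \<and>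
      (LINT z|lborel. indicator Y z * (\<bar>g1 z + q j z\<bar> + \<bar>g2 z - p j z\<bar>)) \<le> \<epsilon>1 * (measure lborel U + 4) * (2 + ((a + 7 * \<rho>) - (a - 7 * \<rho>))) + \<omega> / 2"
      unfolding Y_def by (rule approx_stream_function[OF U int(1,2) \<epsilon>1(1)]) (use \<omega> J1[OF j(1)] \<rho>(1) YU in \<open>auto simp: Y_def\<close>)
    then obtain \<psi> g1 g2 where g: "has_grad \<psi> g1 g2" "continuous_on UNIV g1" "continuous_on UNIV g2"
      and er: "(LINT z|lborel. indicator Y z * (\<bar>g1 z + q j z\<bar> + \<bar>g2 z - p j z\<bar>)) \<le> \<epsilon>1 * (measure lborel U + 4) * (2 + ((a + 7 * \<rho>) - (a - 7 * \<rho>))) + \<omega> / 2"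
      by blast
    have erY: "(LINT z|lborel. indicator Y z * (\<bar>g1 z + q j z\<bar> + \<bar>g2 z - p j z\<bar>)) \<le> \<omega>"
      using er \<epsilon>1(2) by (simp add: A3_def mult_ac)
    have [measurable]: "Y \<in> sets borel" by (simp add: Y_def)
    have ic: "integrable lborel (\<lambda>z. indicator Y z * f z)" if "continuous_on UNIV f" for f :: "real \<times> real \<Rightarrow> real"
    proof -
      have "integrable lborel (\<lambda>z. indicator Y z *\<^sub>R f z)" unfolding Y_def
        by (rule borel_integrable_compact) (use that in \<open>auto intro: continuous_on_subset\<close>)
      then show ?thesis by simp
    qed
    have ii: "integrable lborel (\<lambda>z. indicator Y z * f z)" if "integrable lborel f" for f :: "real \<times> real \<Rightarrow> real"
      using integrable_mult_indicator[of Y lborel f] that by simp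
    have eri: "integrable lborel (\<lambda>z. indicator Y z * (\<bar>g1 z + q j z\<bar> + \<bar>g2 z - p j z\<bar>))"
    proof -
      have "integrable lborel (\<lambda>z. \<bar>indicator Y z * g1 z + indicator Y z * q j z\<bar> + \<bar>indicator Y z * g2 z - indicator Y z * p j z\<bar>)"
        using ic[OF g(2)] ic[OF g(3)] ii[OF int(1)] ii[OF int(2)] by simp
      moreover have "(\<lambda>z. \<bar>indicator Y z * g1 z + indicator Y z * q j z\<bar> + \<bar>indicator Y z * g2 z - indicator Y z * p j z\<bar>)
        = (\<lambda>z. indicator Y z * (\<bar>g1 z + q j z\<bar> + \<bar>g2 z - p j z\<bar>))" by (auto simp: indicator_def fun_eq_iff)
      ultimately show ?thesis by simp
    qed
    have erB: "(LINT z|lborel. indicator (ball x0 (6 * \<rho>)) z * (\<bar>g1 z + q j z\<bar> + \<bar>g2 z - p j z\<bar>)) \<le> \<omega>"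
    proof (rule order_trans[OF integral_mono' erY])
      show "indicator (ball x0 (6 * \<rho>)) z * (\<bar>g1 z + q j z\<bar> + \<bar>g2 z - p j z\<bar>) \<le> indicator Y z * (\<bar>g1 z + q j z\<bar> + \<bar>g2 z - p j z\<bar>)" for z
        using BY by (auto simp: indicator_def)
    qed (auto intro: eri)
    have avg: "\<bar>LINT y|lborel. g y * eta t (x - y)\<bar> \<le> m"
      if x: "x \<in> ball x0 (2 * \<rho>)" and gc: "continuous_on UNIV g" and fi: "integrable lborel f"
        and cf: "\<bar>conv f (eta t) x\<bar> \<le> m / 2" and le: "\<And>z. \<bar>g z - f z\<bar> \<le> \<bar>g1 z + q j z\<bar> + \<bar>g2 z - p j z\<bar>" for x g f
    proof -
      have inY: "y \<in> Y" if "eta t (x - y) \<noteq> 0" for y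
      proof -
        have "dist x y \<le> 2 * t" using eta_supp[OF t(1) that] by (simp add: dist_norm)
        then have "y \<in> ball x0 (6 * \<rho>)" using x t(2) dist_triangle[of x0 y x] \<rho> by simp
        then show ?thesis using BY by blast
      qed
      have i2: "integrable lborel (\<lambda>y. f y * eta t (x - y))" by (rule conv_eta_integrable[OF fi t(1)])
      have i1: "integrable lborel (\<lambda>y. g y * eta t (x - y))"
      proof -
        have "integrable lborel (\<lambda>y. (indicator Y y * g y) * eta t (x - y))" by (rule conv_eta_integrable[OF ic[OF gc] t(1)])
        moreover have "(indicator Y y * g y) * eta t (x - y) = g y * eta t (x - y)" for y using inY[of y] by (cases "eta t (x - y) = 0") auto
        ultimately show ?thesis by simp
      qed
      have "(LINT y|lborel. g y * eta t (x - y)) - conv f (eta t) x = (LINT y|lborel. g y * eta t (x - y) - f y * eta t (x - y))"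
        using i1 i2 by (simp add: conv_def)
      then have "\<bar>(LINT y|lborel. g y * eta t (x - y)) - conv f (eta t) x\<bar> \<le> (LINT y|lborel. \<bar>g y * eta t (x - y) - f y * eta t (x - y)\<bar>)"
        using integral_abs_bound[of lborel "\<lambda>y. g y * eta t (x - y) - f y * eta t (x - y)"] by simp
      also have "\<dots> \<le> (LINT y|lborel. A2 * (indicator Y y * (\<bar>g1 y + q j y\<bar> + \<bar>g2 y - p j y\<bar>)))"
      proof (rule integral_mono)
        show "integrable lborel (\<lambda>y. \<bar>g y * eta t (x - y) - f y * eta t (x - y)\<bar>)" using i1 i2 by simp
        show "integrable lborel (\<lambda>y. A2 * (indicator Y y * (\<bar>g1 y + q j y\<bar> + \<bar>g2 y - p j y\<bar>)))" using eri by simp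
        fix y
        show "\<bar>g y * eta t (x - y) - f y * eta t (x - y)\<bar> \<le> A2 * (indicator Y y * (\<bar>g1 y + q j y\<bar> + \<bar>g2 y - p j y\<bar>))"
        proof (cases "eta t (x - y) = 0")
          case False
          have "\<bar>g y * eta t (x - y) - f y * eta t (x - y)\<bar> = eta t (x - y) * \<bar>g y - f y\<bar>"
            using eta_nonneg[of t "x - y"] by (simp add: abs_mult flip: left_diff_distrib)
          also have "\<dots> \<le> A2 * (\<bar>g1 y + q j y\<bar> + \<bar>g2 y - p j y\<bar>)"
            unfolding A2_def using C0 by (intro mult_mono C0(2) t le) auto
          finally show ?thesis using inY[OF False] by simp
        qed (use A2 in simp)
      qed
      also have "\<dots> = A2 * (LINT y|lborel. indicator Y y * (\<bar>g1 y + q j y\<bar> + \<bar>g2 y - p j y\<bar>))" by simp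
      also have "\<dots> \<le> A2 * \<omega>" using erY A2 by (intro mult_left_mono)
      also have "\<dots> \<le> m / 2" by (rule \<omega>)
      finally show ?thesis using cf by linarith
    qed
    have "measure lborel {x \<in> ball x0 \<rho>. lam < p j x * r j x - (q j x)\<^sup>2} \<le> 25 * (2 * m1 + \<omega>) + \<omega> / \<sigma>
      + (\<epsilon> * sqrt ((s\<^sup>2 + 2 * (5 * (2 * c + 1))\<^sup>2) * measure lborel U) + 5 * (2 * c + 1) * (2 * (c * (25 * (2 * m1 + \<omega>)) + m1)) + s * C * (2 * (LINT x|lborel. M x))
      + 2 * \<sigma> * (LINT x|lborel. M x) + 2 * (2 * c + 1) * (c * (\<omega> / \<sigma>) + m1)) / lam"
    proof (rule determinant_local_estimate[OF U \<rho>(1) B6U(1) int(1,2,3,4) bd D c m1 g erB J2[OF j(2)] less_imp_le[OF \<epsilon>(1)] k _ less_imp_le[OF s(1)] s(2) \<sigma>(1) lam])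
      fix x y assume x: "x \<in> ball x0 (2 * \<rho>)" and y: "y \<in> ball x0 (2 * \<rho>)"
        and ax: "avg_bounded (2 * c + 1) (ball x0 (6 * \<rho>)) (\<lambda>z. \<bar>g1 z\<bar> + \<bar>g2 z\<bar>) x"
        and ay: "avg_bounded (2 * c + 1) (ball x0 (6 * \<rho>)) (\<lambda>z. \<bar>g1 z\<bar> + \<bar>g2 z\<bar>) y"
      have "\<bar>\<psi> x - \<psi> y\<bar> \<le> 8 * \<rho> * m + Cm * t * (2 * c + 1)"
      unfolding Cm_def
      proof (rule mean_oscillation[OF C0 g _ t(1,2) x y ax ay])
        show "0 \<le> 2 * c + 1" using c by simp
        fix z assume z: "z \<in> ball x0 (2 * \<rho>)"
        then have zU: "z \<in> U" using B6U(2) by blast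
        have cc: "\<bar>conv (p j) (eta t) z\<bar> \<le> m / 2" "\<bar>conv (q j) (eta t) z\<bar> \<le> m / 2" using J3 j(3) zU by blast+
        have cq: "\<bar>conv (\<lambda>y. - q j y) (eta t) z\<bar> \<le> m / 2" using cc(2) by (simp add: conv_def)
        show "\<bar>LINT y|lborel. g1 y * eta t (z - y)\<bar> \<le> m" by (rule avg[OF z g(2) _ cq]) (use int(2) in auto)
        show "\<bar>LINT y|lborel. g2 y * eta t (z - y)\<bar> \<le> m" by (rule avg[OF z g(3) int(1) cc(1)]) auto
      qed
      then show "\<bar>\<psi> x - \<psi> y\<bar> \<le> s" using m(2) t(3) unfolding K_def by linarith
    qed
    also have "\<dots> = (50 + (10 * K * (50 * c + 1) + 2 * K) / lam) * m1 + A1 * \<omega> + (S * \<epsilon>) / lam + (2 * C * I * s) / lam + (2 * I * \<sigma>) / lam"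
      unfolding A1_def S_def K_def[symmetric] I_def[symmetric] using lam \<sigma>(1) by (simp add: field_simps)
    also have "\<dots> \<le> (50 + (10 * K * (50 * c + 1) + 2 * K) / lam) * m1 + zet / 5 + zet / 5 + zet / 5 + zet / 5"
      using \<omega>(2) \<epsilon>(2) s(3) \<sigma>(2) lam by (intro add_mono order_refl) (simp_all add: field_simps)
    also have "\<dots> \<le> (50 + (10 * K * (50 * c + 1) + 2 * K) / lam) * m1 + zet" using zet by simp
    finally show "measure lborel {x \<in> ball x0 \<rho>. lam < p j x * r j x - (q j x)\<^sup>2}
      \<le> (50 + (10 * K * (50 * c + 1) + 2 * K) / lam) * m1 + zet" .
  qed
qed

section \<open>The determinant on compact sets\<close>

text \<open>Approximate \<open>M\<close> in \<open>L\<^sup>1\<close> by a continuous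
  \<open>M0\<close>. Away from a set of small measure, both \<open>\<bar>M - M0\<bar>\<close> and
  its averages over balls are small, so on small balls the excess of \<open>M\<close> over
  \<open>c\<close> is a small multiple \<open>m1\<close> of the area of the ball. The Vitali
  covering lemma gives finitely many such balls of equal radius whose areas add up to at most a
  constant, and the sum of the local bounds is small.\<close>

lemma determinant_small_in_measure:
  fixes p q r :: "nat \<Rightarrow> real \<times> real \<Rightarrow> real" and M :: "real \<times> real \<Rightarrow> real"
  assumes U: "open U" "bounded U"
    and int: "\<And>j. integrable lborel (p j)" "\<And>j. integrable lborel (q j)" "\<And>j. integrable lborel (r j)" "integrable lborel M"
    and bd: "\<And>j x. \<bar>p j x\<bar> \<le> M x" "\<And>j x. \<bar>q j x\<bar> \<le> M x" "\<And>j x. \<bar>r j x\<bar> \<le> M x"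
    and D: "\<And>j x. 0 \<le> p j x * r j x - (q j x)\<^sup>2"
    and div1: "\<And>e. e > 0 \<Longrightarrow> \<exists>N. \<forall>j\<ge>N. \<forall>\<phi>\<in>test_functions U. \<bar>LINT z|lborel. p j z * partial_x \<phi> z + q j z * partial_y \<phi> z\<bar> \<le> e * test_norm \<phi>"
    and div2: "\<And>e. e > 0 \<Longrightarrow> \<exists>N. \<forall>j\<ge>N. \<forall>\<phi>\<in>test_functions U. \<bar>LINT z|lborel. q j z * partial_x \<phi> z + r j z * partial_y \<phi> z\<bar> \<le> e * test_norm \<phi>"
    and weak: "\<And>N e. e > 0 \<Longrightarrow> \<exists>J. \<forall>j\<ge>J. \<forall>x\<in>U. \<bar>conv (p j) (eta (inverse (real (Suc N)))) x\<bar> \<le> e \<and> \<bar>conv (q j) (eta (inverse (real (Suc N)))) x\<bar> \<le> e"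
    and K: "compact K" "K \<subseteq> U" and R: "R \<ge> 0" and lam: "lam > 0" and zet: "zet > 0"
  shows "\<exists>J. \<forall>j\<ge>J. measure lborel {x \<in> K. M x \<le> R \<and> lam < p j x * r j x - (q j x)\<^sup>2} \<le> zet"
proof -
  \<comment> \<open>one unit for the oscillation of \<open>M0\<close> on a ball and one for its error at the centre\<close>
  define c where "c = R + 2"
  define Kc where "Kc = 2 * c + 1"
  define Cc where "Cc = 50 + (10 * Kc * (50 * c + 1) + 2 * Kc) / lam"
  have c: "c \<ge> 0" using R by (simp add: c_def)
  have Cc: "Cc \<ge> 0" unfolding Cc_def Kc_def using c lam by (intro add_nonneg_nonneg divide_nonneg_nonneg mult_nonneg_nonneg) auto
  define V where "V = measure lborel U"
  have V: "V \<ge> 0" by (simp add: V_def)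
  have Vfin: "emeasure lborel U = ennreal V" unfolding V_def
    using emeasure_bounded_finite[OF U(2)] by (intro emeasure_eq_ennreal_measure) auto
  define A where "A = Cc * 36 * 36 * V"
  have A: "A \<ge> 0" using Cc V by (simp add: A_def)
  define e1 where "e1 = min 1 (zet / 4 / (A + 1))"
  have e1: "e1 > 0" "e1 \<le> 1" "A * e1 \<le> zet / 4"
  proof -
    show e: "e1 > 0" "e1 \<le> 1" using A zet by (auto simp: e1_def)
    show "A * e1 \<le> zet / 4" by (rule small_multiple(3)[OF A]) (use zet e in \<open>auto simp: e1_def\<close>)
  qed
  define A' where "A' = 25 / e1 + 1"
  have A': "A' \<ge> 0" using e1 by (simp add: A'_def)
  define \<delta> where "\<delta> = zet / 4 / (A' + 1)"
  have \<delta>: "\<delta> > 0" "A' * \<delta> \<le> zet / 4" unfolding \<delta>_def using small_multiple(1,2)[OF A', of "zet / 4"] zet by auto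
  obtain M0 where M0: "continuous_on UNIV M0" "integrable lborel M0" "(LINT x|lborel. \<bar>M x - M0 x\<bar>) < \<delta>"
    using L1_approx_continuous[OF int(4) \<delta>(1)] by blast
  define d where "d y = \<bar>M y - M0 y\<bar>" for y
  have di: "integrable lborel d" unfolding d_def[abs_def] using int M0 by simp
  have dI: "(LINT y|lborel. d y) \<le> \<delta>" using M0(3) by (simp add: d_def)
  have d0: "d y \<ge> 0" for y by (simp add: d_def)
  have [measurable]: "d \<in> borel_measurable borel" "M \<in> borel_measurable borel" using di int by auto
  have [measurable]: "p j \<in> borel_measurable borel" "q j \<in> borel_measurable borel" "r j \<in> borel_measurable borel" for j
    using int by auto
  define X where "X = maximal_superlevel e1 d"
  have Xs[measurable]: "X \<in> sets borel" unfolding X_def using open_maximal_superlevel by (rule borel_open)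
  have dI0: "0 \<le> (LINT y|lborel. d y)" by (intro integral_nonneg_AE) (simp add: d0)
  have Xle: "emeasure lborel X \<le> ennreal (25 / e1 * \<delta>)"
    unfolding X_def by (rule order_trans[OF maximal_weak_type[OF di d0 e1(1)]], intro ennreal_leI mult_left_mono dI) (use e1 in simp)
  have Xf: "X \<in> fmeasurable lborel" "measure lborel X \<le> 25 / e1 * \<delta>"
  proof -
    have fin: "emeasure lborel X < \<infinity>" using Xle by (rule le_less_trans) simp
    then show "X \<in> fmeasurable lborel" by (auto simp: fmeasurable_def)
    have "emeasure lborel X = ennreal (measure lborel X)" using fin by (intro emeasure_eq_ennreal_measure) auto
    then have "ennreal (measure lborel X) \<le> ennreal (25 / e1 * \<delta>)" using Xle by (simp only:)
    then show "measure lborel X \<le> 25 / e1 * \<delta>" by (subst (asm) ennreal_le_iff) (use e1 \<delta> in auto)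
  qed
  define X2 where "X2 = {y. 1 < d y}"
  have X2s[measurable]: "X2 \<in> sets borel" unfolding X2_def by measurable
  have "1 \<le> d y" if "y \<in> X2" for y using that by (simp add: X2_def)
  note X2b = measure_le_integral[OF X2s subset_UNIV di d0 zero_less_one this]
  have X2f: "X2 \<in> fmeasurable lborel" "measure lborel X2 \<le> \<delta>" using dI X2b by (auto simp: fmeasurable_def)
  obtain r0 where r0: "r0 > 0" "\<And>x. x \<in> K \<Longrightarrow> cball x r0 \<subseteq> U" using compact_in_open_thickening[OF K(1) U(1) K(2)] by metis
  obtain B where "\<forall>x\<in>U. norm x \<le> B" using U(2) bounded_iff by blast
  then have B: "U \<subseteq> cball 0 B" by (intro subsetI) simp
  have "uniformly_continuous_on (cball 0 B) M0"
    using M0(1) by (intro compact_uniformly_continuous) (auto intro: continuous_on_subset)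
  then obtain d1 where d1: "d1 > 0" "\<And>x y. x \<in> cball 0 B \<Longrightarrow> y \<in> cball 0 B \<Longrightarrow> dist y x < d1 \<Longrightarrow> dist (M0 y) (M0 x) < 1"
    unfolding uniformly_continuous_on_def by (metis zero_less_one)
  define \<rho> where "\<rho> = min (r0 / 14) (d1 / 7)"
  have \<rho>: "\<rho> > 0" "14 * \<rho> \<le> r0" "7 * \<rho> \<le> d1" using r0 d1 by (auto simp: \<rho>_def)
  \<comment> \<open>balls about these points satisfy the hypotheses of the local estimate\<close>
  define S where "S = {x \<in> K. M x \<le> R} - X - X2"
  have rho6: "0 < \<rho> / 6" using \<rho> by simp
  have cov0: "S \<subseteq> (\<Union>i\<in>S. cball i (\<rho> / 6))" by (rule subsetI, rule UN_I, assumption) (use \<rho> in simp)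
  obtain C where C: "countable C" "C \<subseteq> S" "pairwise (\<lambda>i j. disjnt (cball i (\<rho> / 6)) (cball j (\<rho> / 6))) C"
    "S \<subseteq> (\<Union>i\<in>C. cball i (5 * (\<rho> / 6)))"
    by (rule Vitali_covering_lemma_cballs[OF cov0 conjI[OF rho6 order_refl]]) (rule that)
  have SU: "cball x (14 * \<rho>) \<subseteq> U" if "x \<in> S" for x
    using order_trans[OF subset_cball[OF \<rho>(2)] r0(2)[of x]] that by (simp add: S_def)
  \<comment> \<open>disjoint balls of equal radius inside \<open>U\<close>: their number is bounded\<close>
  have card: "real (card F) * (pi * \<rho>\<^sup>2) \<le> 36 * V" if F: "F \<subseteq> C" "finite F" for F
  proof -
    have "ennreal (real (card F) * (pi * (\<rho> / 6)\<^sup>2)) = (\<Sum>i\<in>F. emeasure lborel (cball i (\<rho> / 6)))"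
      using \<rho> by (simp add: emeasure_cball2 ennreal_mult' ennreal_of_nat_eq_real_of_nat)
    also have "\<dots> = emeasure lborel (\<Union>i\<in>F. cball i (\<rho> / 6))"
    proof (rule sum_emeasure)
      show "disjoint_family_on (\<lambda>i. cball i (\<rho> / 6)) F"
        unfolding disjoint_family_on_def using C(3) F unfolding pairwise_def disjnt_def by blast
    qed (use F in auto)
    also have "\<dots> \<le> emeasure lborel U"
    proof (rule emeasure_mono)
      show "(\<Union>i\<in>F. cball i (\<rho> / 6)) \<subseteq> U"
      proof
        fix y assume "y \<in> (\<Union>i\<in>F. cball i (\<rho> / 6))"
        then obtain i where i: "i \<in> F" "y \<in> cball i (\<rho> / 6)" by blast
        then have "y \<in> cball i (14 * \<rho>)" using \<rho>(1) by auto
        then show "y \<in> U" using SU[of i] i F C by blast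
      qed
    qed (use U in auto)
    also have "\<dots> = ennreal V" by (rule Vfin)
    finally have "real (card F) * (pi * (\<rho> / 6)\<^sup>2) \<le> V" using V by (simp add: ennreal_le_iff)
    then show ?thesis by (simp add: power_divide field_simps)
  qed
  have finC: "finite C"
  proof -
    define n where "n = nat \<lceil>36 * V / (pi * \<rho>\<^sup>2)\<rceil>"
    have "card F \<le> n" if "F \<subseteq> C" "finite F" for F
    proof -
      have "real (card F) \<le> 36 * V / (pi * \<rho>\<^sup>2)" using card[OF that] \<rho>(1) by (simp add: pos_le_divide_eq)
      then show ?thesis unfolding n_def by linarith
    qed
    then show ?thesis using finite_if_finite_subsets_card_bdd[of C n] by blast
  qed
  define m1 where "m1 = e1 * (pi * (6 * \<rho>)\<^sup>2)"
  define z' where "z' = zet / 4 / (real (card C) + 1)"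
  have z': "z' > 0" "real (card C) * z' \<le> zet / 4" unfolding z'_def using small_multiple(1,2)[of "real (card C)" "zet / 4"] zet by auto
  have loc: "\<forall>\<^sub>F j in sequentially. measure lborel {y \<in> ball x \<rho>. lam < p j y * r j y - (q j y)\<^sup>2} \<le> Cc * m1 + z'" if x: "x \<in> C" for x
  proof -
    have xS: "x \<in> S" using x C by auto
    have xx: "M x \<le> R" "x \<notin> X" "d x \<le> 1" "x \<in> K" using xS by (auto simp: S_def X2_def)
    have "(LINT y|lborel. indicator (ball x (6 * \<rho>)) y * max 0 (M y - c)) \<le> (LINT y|lborel. indicator (ball x (6 * \<rho>)) y * d y)"
    proof (rule integral_mono')
      show "integrable lborel (\<lambda>y. indicator (ball x (6 * \<rho>)) y * d y)"
        using integrable_mult_indicator[of "ball x (6 * \<rho>)" lborel d] di by simp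
      fix y
      show "indicator (ball x (6 * \<rho>)) y * max 0 (M y - c) \<le> indicator (ball x (6 * \<rho>)) y * d y"
      proof (cases "y \<in> ball x (6 * \<rho>)")
        case True
        then have "y \<in> cball x (14 * \<rho>)" using \<rho> by simp
        then have yU: "y \<in> cball 0 B" using SU[OF xS] B by blast
        have xU: "x \<in> cball 0 B" using xx K B by blast
        have "dist y x < d1" using True \<rho> by (simp add: dist_commute)
        from d1(2)[OF xU yU this] have "M0 y \<le> M0 x + 1" by (simp add: dist_real_def)
        moreover have "M y \<le> M0 y + d y" "M0 x \<le> M x + d x" by (auto simp: d_def)
        ultimately have "M y - c \<le> d y" using xx by (simp add: c_def)
        then show ?thesis using True d0[of y] by simp
      qed simp
      show "0 \<le> indicator (ball x (6 * \<rho>)) y * d y" using d0[of y] by simp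
    qed
    also have "\<dots> \<le> m1"
    proof (rule ccontr)
      assume "\<not> ?thesis"
      then have lt: "e1 * measure lborel (ball x (6 * \<rho>)) < (LINT y|lborel. indicator (ball x (6 * \<rho>)) y * d y)"
        using \<rho>(1) measure_ball2[of "6 * \<rho>" x] by (simp add: m1_def)
      have "x \<in> maximal_superlevel e1 d" unfolding maximal_superlevel_def using \<rho>(1) lt by (intro UN_I[of "(x, 6 * \<rho>)"]) auto
      then show False using xx by (simp add: X_def)
    qed
    finally have m1: "(LINT y|lborel. indicator (ball x (6 * \<rho>)) y * max 0 (M y - c)) \<le> m1" .
    have "\<exists>J. \<forall>j\<ge>J. measure lborel {y \<in> ball x \<rho>. lam < p j y * r j y - (q j y)\<^sup>2} \<le> Cc * m1 + z'"
      unfolding Cc_def Kc_def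
      by (rule determinant_local_limit[OF U int bd D div1 div2 weak \<rho>(1) SU[OF xS] c m1 lam z'(1)])
    then show ?thesis by (simp add: eventually_sequentially)
  qed
  have "\<forall>\<^sub>F j in sequentially. \<forall>x\<in>C. measure lborel {y \<in> ball x \<rho>. lam < p j y * r j y - (q j y)\<^sup>2} \<le> Cc * m1 + z'"
    by (rule eventually_ball_finite[OF finC]) (use loc in blast)
  then obtain J where J: "\<And>j x. j \<ge> J \<Longrightarrow> x \<in> C \<Longrightarrow> measure lborel {y \<in> ball x \<rho>. lam < p j y * r j y - (q j y)\<^sup>2} \<le> Cc * m1 + z'"
    by (auto simp: eventually_sequentially)
  show ?thesis
  proof (intro exI[of _ J] allI impI)
    fix j assume j: "J \<le> j"
    define T where "T x = {y \<in> ball x \<rho>. lam < p j y * r j y - (q j y)\<^sup>2}" for x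
    have Ts: "T x \<in> sets lborel" for x unfolding T_def by measurable
    have Tf: "T x \<in> fmeasurable lborel" for x
    proof -
      have "bounded (T x)" by (rule bounded_subset[OF bounded_ball[of x \<rho>]]) (simp add: T_def subset_iff)
      then show ?thesis using emeasure_bounded_finite[of "T x"] Ts[of x] by (simp add: fmeasurable_def)
    qed
    have sub: "{x \<in> K. M x \<le> R \<and> lam < p j x * r j x - (q j x)\<^sup>2} \<subseteq> (X \<union> X2) \<union> (\<Union>x\<in>C. T x)"
    proof
      fix y assume y: "y \<in> {x \<in> K. M x \<le> R \<and> lam < p j x * r j x - (q j x)\<^sup>2}"
      show "y \<in> (X \<union> X2) \<union> (\<Union>x\<in>C. T x)"
      proof (cases "y \<in> X \<union> X2")
        case False
        then have "y \<in> S" using y by (auto simp: S_def)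
        then obtain i where i: "i \<in> C" "y \<in> cball i (5 * (\<rho> / 6))" using C(4) by blast
        then have "y \<in> T i" using y \<rho>(1) by (simp add: T_def)
        then show ?thesis using i by blast
      qed blast
    qed
    have Ks: "K \<in> sets borel" using K by (simp add: borel_compact)
    have Um: "(\<Union>x\<in>C. T x) \<in> fmeasurable lborel" using finC Tf by (intro fmeasurable.finite_UN) auto
    have "measure lborel {x \<in> K. M x \<le> R \<and> lam < p j x * r j x - (q j x)\<^sup>2} \<le> measure lborel ((X \<union> X2) \<union> (\<Union>x\<in>C. T x))"
    proof (rule measure_mono_fmeasurable[OF sub])
      have "{x \<in> K. M x \<le> R \<and> lam < p j x * r j x - (q j x)\<^sup>2} = K \<inter> {x. M x \<le> R \<and> lam < p j x * r j x - (q j x)\<^sup>2}" by blast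
      also have "\<dots> \<in> sets lborel" using Ks by measurable
      finally show "{x \<in> K. M x \<le> R \<and> lam < p j x * r j x - (q j x)\<^sup>2} \<in> sets lborel" .
      show "(X \<union> X2) \<union> (\<Union>x\<in>C. T x) \<in> fmeasurable lborel" using Xf X2f Um by (intro fmeasurable.Un)
    qed
    also have "\<dots> \<le> measure lborel (X \<union> X2) + measure lborel (\<Union>x\<in>C. T x)"
      by (rule measure_Un_le) (use Xs X2s Um in auto)
    also have "\<dots> \<le> (measure lborel X + measure lborel X2) + (\<Sum>x\<in>C. measure lborel (T x))"
      by (intro add_mono measure_Un_le measure_UNION_le finC Ts) auto
    also have "\<dots> \<le> (25 / e1 * \<delta> + \<delta>) + (\<Sum>x\<in>C. Cc * m1 + z')"
      using Xf X2f J[OF j] by (intro add_mono sum_mono) (auto simp: T_def)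
    also have "\<dots> = A' * \<delta> + (real (card C) * (Cc * m1) + real (card C) * z')" by (simp add: A'_def algebra_simps)
    also have "\<dots> \<le> zet / 4 + (zet / 4 + zet / 4)"
    proof (intro add_mono \<delta>(2) z'(2))
      have "real (card C) * (Cc * m1) = (36 * Cc * e1) * (real (card C) * (pi * \<rho>\<^sup>2))" by (simp add: m1_def power_mult_distrib)
      also have "\<dots> \<le> (36 * Cc * e1) * (36 * V)" using Cc e1 by (intro mult_left_mono card finC) auto
      also have "\<dots> = A * e1" by (simp add: A_def)
      finally show "real (card C) * (Cc * m1) \<le> zet / 4" using e1(3) by linarith
    qed
    also have "\<dots> \<le> zet" using zet by simp
    finally show "measure lborel {x \<in> K. M x \<le> R \<and> lam < p j x * r j x - (q j x)\<^sup>2} \<le> zet" .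
  qed
qed

text \<open>If the double sequence had bad pairs \<open>(n, m)\<close> arbitrarily far out, the
  differences along these pairs would contradict the result for single sequences.\<close>

lemma determinant_cauchy_in_measure:
  fixes P Q R :: "nat \<Rightarrow> real \<times> real \<Rightarrow> real" and M :: "real \<times> real \<Rightarrow> real"
  assumes U: "open U" "bounded U"
    and int: "\<And>n. integrable lborel (P n)" "\<And>n. integrable lborel (Q n)" "\<And>n. integrable lborel (R n)" "integrable lborel M"
    and bd: "\<And>n m x. \<bar>P n x - P m x\<bar> \<le> M x" "\<And>n m x. \<bar>Q n x - Q m x\<bar> \<le> M x" "\<And>n m x. \<bar>R n x - R m x\<bar> \<le> M x"
    and D: "\<And>n m x. 0 \<le> (P n x - P m x) * (R n x - R m x) - (Q n x - Q m x)\<^sup>2"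
    and div1: "\<And>e. e > 0 \<Longrightarrow> \<exists>N. \<forall>n\<ge>N. \<forall>m\<ge>N. \<forall>\<phi>\<in>test_functions U.
      \<bar>LINT z|lborel. (P n z - P m z) * partial_x \<phi> z + (Q n z - Q m z) * partial_y \<phi> z\<bar> \<le> e * test_norm \<phi>"
    and div2: "\<And>e. e > 0 \<Longrightarrow> \<exists>N. \<forall>n\<ge>N. \<forall>m\<ge>N. \<forall>\<phi>\<in>test_functions U.
      \<bar>LINT z|lborel. (Q n z - Q m z) * partial_x \<phi> z + (R n z - R m z) * partial_y \<phi> z\<bar> \<le> e * test_norm \<phi>"
    and weak: "\<And>N e. e > 0 \<Longrightarrow> \<exists>J. \<forall>n\<ge>J. \<forall>m\<ge>J. \<forall>x\<in>U.
      \<bar>conv (P n) (eta (inverse (real (Suc N)))) x - conv (P m) (eta (inverse (real (Suc N)))) x\<bar> \<le> e \<and>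
      \<bar>conv (Q n) (eta (inverse (real (Suc N)))) x - conv (Q m) (eta (inverse (real (Suc N)))) x\<bar> \<le> e"
    and K: "compact K" "K \<subseteq> U" and c: "c \<ge> 0" and lam: "lam > 0" and zet: "zet > 0"
  shows "\<exists>J. \<forall>n\<ge>J. \<forall>m\<ge>J. measure lborel {x \<in> K. M x \<le> c \<and> lam < (P n x - P m x) * (R n x - R m x) - (Q n x - Q m x)\<^sup>2} \<le> zet"
proof (rule ccontr)
  define G where "G n m = measure lborel {x \<in> K. M x \<le> c \<and> lam < (P n x - P m x) * (R n x - R m x) - (Q n x - Q m x)\<^sup>2}" for n m
  assume "\<not> ?thesis"
  then have "\<forall>J. \<exists>n m. J \<le> n \<and> J \<le> m \<and> \<not> G n m \<le> zet" unfolding G_def by blast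
  then obtain n m where nm: "\<And>j. j \<le> n j" "\<And>j. j \<le> m j" "\<And>j. \<not> G (n j) (m j) \<le> zet" by metis
  have ge: "J \<le> n j" "J \<le> m j" if "J \<le> j" for J j using nm(1,2)[of j] that by linarith+
  have "\<exists>J. \<forall>j\<ge>J. measure lborel {x \<in> K. M x \<le> c \<and> lam < (P (n j) x - P (m j) x) * (R (n j) x - R (m j) x) - (Q (n j) x - Q (m j) x)\<^sup>2} \<le> zet"
  proof (rule determinant_small_in_measure[OF U _ _ _ int(4) bd D _ _ _ K c lam zet])
    show "integrable lborel (\<lambda>x. P (n j) x - P (m j) x)" "integrable lborel (\<lambda>x. Q (n j) x - Q (m j) x)" "integrable lborel (\<lambda>x. R (n j) x - R (m j) x)" for j
      using int by auto
    fix e :: real assume e: "e > 0"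
    show "\<exists>N. \<forall>j\<ge>N. \<forall>\<phi>\<in>test_functions U. \<bar>LINT z|lborel. (P (n j) z - P (m j) z) * partial_x \<phi> z + (Q (n j) z - Q (m j) z) * partial_y \<phi> z\<bar> \<le> e * test_norm \<phi>"
      using div1[OF e] ge by blast
    show "\<exists>N. \<forall>j\<ge>N. \<forall>\<phi>\<in>test_functions U. \<bar>LINT z|lborel. (Q (n j) z - Q (m j) z) * partial_x \<phi> z + (R (n j) z - R (m j) z) * partial_y \<phi> z\<bar> \<le> e * test_norm \<phi>"
      using div2[OF e] ge by blast
    fix N
    have s: "inverse (real (Suc N)) > 0" by simp
    show "\<exists>J. \<forall>j\<ge>J. \<forall>x\<in>U. \<bar>conv (\<lambda>x. P (n j) x - P (m j) x) (eta (inverse (real (Suc N)))) x\<bar> \<le> e \<and>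
      \<bar>conv (\<lambda>x. Q (n j) x - Q (m j) x) (eta (inverse (real (Suc N)))) x\<bar> \<le> e"
      unfolding conv_diff[OF int(1) int(1) s] conv_diff[OF int(2) int(2) s] using weak[OF e, of N] ge by blast
  qed
  then show False using nm(3) unfolding G_def[symmetric] by blast
qed

text \<open>Adapts diagonal sequences to properties that depend only on the tail of a
  sequence.\<close>

lemma diagonal_subseq:
  fixes P :: "nat \<Rightarrow> (nat \<Rightarrow> nat) \<Rightarrow> bool"
  assumes ex: "\<And>n (s :: nat \<Rightarrow> nat). strict_mono s \<Longrightarrow> \<exists>r. strict_mono r \<and> P n (s \<circ> r)"
    and stable: "\<And>n (r :: nat \<Rightarrow> nat) s. strict_mono r \<Longrightarrow> P n s \<Longrightarrow> P n (s \<circ> r)"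
    and tail: "\<And>n s k. P n (s \<circ> (+) k) \<Longrightarrow> P n s"
  shows "\<exists>r. strict_mono r \<and> (\<forall>n. P n r)"
proof -
  interpret subseqs P by unfold_locales (rule ex)
  show ?thesis
  proof (intro exI[of _ diagseq] conjI allI subseq_diagseq)
    fix n
    have "P n (diagseq \<circ> (+) (Suc n))" by (rule diagseq_holds) (rule stable)
    then show "P n diagseq" by (rule tail)
  qed
qed

section \<open>Measurability of composed primitives\<close>

text \<open>Approximate \<open>v\<close> by functions with countably many values; the fractions in
  \<open>z\<close> are capped at one only to stay in the interval.\<close>

lemma caratheodory_measurable:
  fixes h :: "'a \<Rightarrow> real \<Rightarrow> real"
  assumes ab: "a < b" and h: "\<And>u. u \<in> {a..b} \<Longrightarrow> (\<lambda>p. h p u) \<in> borel_measurable M"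
    and c: "\<And>p. p \<in> space M \<Longrightarrow> continuous_on {a..b} (h p)"
    and v: "v \<in> borel_measurable M" "\<And>p. p \<in> space M \<Longrightarrow> v p \<in> {a..b}"
  shows "(\<lambda>p. h p (v p)) \<in> borel_measurable M"
proof (rule borel_measurable_LIMSEQ_real)
  define g where "g n p = nat \<lfloor>real (Suc n) * ((v p - a) / (b - a))\<rfloor>" for n p
  define z where "z n i = a + (b - a) * min 1 (real i / real (Suc n))" for n i
  have z: "z n i \<in> {a..b}" for n i
  proof -
    have "0 \<le> min 1 (real i / real (Suc n))" "min 1 (real i / real (Suc n)) \<le> 1" by auto
    then have "(b - a) * 0 \<le> (b - a) * min 1 (real i / real (Suc n))" "(b - a) * min 1 (real i / real (Suc n)) \<le> (b - a) * 1"
      using ab by (intro mult_left_mono; simp)+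
    then show ?thesis by (simp add: z_def)
  qed
  show "(\<lambda>p. h p (z n (g n p))) \<in> borel_measurable M" for n
  proof (rule measurable_compose_countable[where f="\<lambda>i p. h p (z n i)"])
    show "(\<lambda>p. h p (z n i)) \<in> borel_measurable M" for i by (rule h[OF z])
    show "g n \<in> measurable M (count_space UNIV)" unfolding g_def using v(1) by measurable
  qed
  fix p assume p: "p \<in> space M"
  define x where "x = (v p - a) / (b - a)"
  have x: "0 \<le> x" "x \<le> 1" "v p = a + (b - a) * x" using v(2)[OF p] ab by (auto simp: x_def field_simps)
  have "(\<lambda>n. real (g n p) / real (Suc n)) \<longlonglongrightarrow> x"
  proof (rule real_tendsto_sandwich)
    show "\<forall>\<^sub>F n in sequentially. x - inverse (real (Suc n)) \<le> real (g n p) / real (Suc n)"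
    proof (intro always_eventually allI)
      fix n
      have "real (Suc n) * x - 1 \<le> real (g n p)" unfolding g_def x_def[symmetric] using x by linarith
      then have "(real (Suc n) * x - 1) / real (Suc n) \<le> real (g n p) / real (Suc n)" by (intro divide_right_mono) auto
      moreover have "(real (Suc n) * x - 1) / real (Suc n) = x - inverse (real (Suc n))"
        by (simp add: diff_divide_distrib inverse_eq_divide del: of_nat_Suc)
      ultimately show "x - inverse (real (Suc n)) \<le> real (g n p) / real (Suc n)" by simp
    qed
    show "\<forall>\<^sub>F n in sequentially. real (g n p) / real (Suc n) \<le> x"
    proof (intro always_eventually allI)
      fix n
      have "0 \<le> real (Suc n) * x" using x by (intro mult_nonneg_nonneg) auto
      then have "real (g n p) \<le> real (Suc n) * x" unfolding g_def x_def[symmetric] by linarith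
      then have "real (g n p) / real (Suc n) \<le> real (Suc n) * x / real (Suc n)" by (intro divide_right_mono) auto
      then show "real (g n p) / real (Suc n) \<le> x" by (simp del: of_nat_Suc)
    qed
    show "(\<lambda>n. x - inverse (real (Suc n))) \<longlonglongrightarrow> x" using tendsto_diff[OF tendsto_const LIMSEQ_inverse_real_of_nat, of x] by simp
  qed simp
  then have "(\<lambda>n. z n (g n p)) \<longlonglongrightarrow> a + (b - a) * min 1 x" unfolding z_def by (intro tendsto_intros)
  then have "(\<lambda>n. z n (g n p)) \<longlonglongrightarrow> v p" using x by simp
  then show "(\<lambda>n. h p (z n (g n p))) \<longlonglongrightarrow> h p (v p)"
    using continuous_on_tendsto_compose[OF c[OF p], of "\<lambda>n. z n (g n p)" "v p" sequentially] z v(2)[OF p] by simp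
qed

lemma Ck2_deriv:
  assumes "Ck_Icc 2 a b h"
  shows "\<And>u. u \<in> {a..b} \<Longrightarrow> (h has_vector_derivative deriv_Icc a b h u) (at u within {a..b})"
    "continuous_on {a..b} (deriv_Icc a b h)"
proof -
  have d: "h differentiable_on {a..b}" "deriv_Icc a b h differentiable_on {a..b}"
    using assms by (auto simp: numeral_2_eq_2)
  show "(h has_vector_derivative deriv_Icc a b h u) (at u within {a..b})" if "u \<in> {a..b}" for u
    using d(1) that unfolding deriv_Icc_def differentiable_on_def by (meson vector_derivative_works)
  show "continuous_on {a..b} (deriv_Icc a b h)" by (rule differentiable_imp_continuous_on[OF d(2)])
qed

text \<open>A limit of difference quotients, taken towards the end point \<open>e\<close> of the
  interval that is different from \<open>u\<close>.\<close>

lemma deriv_Icc_measurable: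
  fixes f :: "real \<Rightarrow> real \<Rightarrow> real" and k :: "'a \<Rightarrow> real"
  assumes ab: "a < b" and f: "\<And>\<kappa>. \<kappa> \<in> {\<alpha>..\<beta>} \<Longrightarrow> Ck_Icc 2 a b (f \<kappa>)"
    and fk: "\<And>u. u \<in> {a..b} \<Longrightarrow> Ck_Icc 1 \<alpha> \<beta> (\<lambda>\<kappa>. f \<kappa> u)"
    and k: "k \<in> borel_measurable M" "\<And>p. k p \<in> {\<alpha>..\<beta>}" and u: "u \<in> {a..b}"
  shows "(\<lambda>p. deriv_Icc a b (f (k p)) u) \<in> borel_measurable M"
proof -
  have fm: "(\<lambda>p. f (k p) t) \<in> borel_measurable M" if t: "t \<in> {a..b}" for t
  proof -
    have c: "continuous_on {\<alpha>..\<beta>} (\<lambda>\<kappa>. f \<kappa> t)" using fk[OF t] by (auto intro: differentiable_imp_continuous_on)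
    have "continuous_on UNIV (\<lambda>x. f (max \<alpha> (min \<beta> x)) t)"
    proof (rule continuous_on_compose2[OF c])
      have "\<alpha> \<le> \<beta>" using k(2)[of undefined] by simp
      then show "(\<lambda>x. max \<alpha> (min \<beta> x)) ` UNIV \<subseteq> {\<alpha>..\<beta>}" by auto
    qed (intro continuous_intros)
    then have "(\<lambda>x. f (max \<alpha> (min \<beta> x)) t) \<in> borel_measurable borel" by (rule borel_measurable_continuous_onI)
    from measurable_compose[OF k(1) this] show ?thesis using k(2) by simp
  qed
  define e where "e = (if u < b then b else a)"
  define s where "s n = u + (e - u) * inverse (real (Suc n))" for n
  have eu: "e \<noteq> u" "e \<in> {a..b}" using u ab by (auto simp: e_def)
  have s1: "s n \<in> {a..b}" for n
  proof -
    define i where "i = inverse (real (Suc n))"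
    have i: "0 \<le> i" "i \<le> 1" by (auto simp: i_def inverse_le_1_iff)
    have "s n = (1 - i) * u + i * e" unfolding s_def i_def[symmetric] by (simp add: algebra_simps)
    moreover have "(1 - i) * a + i * a \<le> (1 - i) * u + i * e" "(1 - i) * u + i * e \<le> (1 - i) * b + i * b"
      using i u eu by (intro add_mono mult_left_mono; simp)+
    ultimately show ?thesis by (simp add: algebra_simps)
  qed
  have s2: "s n \<noteq> u" for n using eu by (simp add: s_def)
  have "(\<lambda>n. u + (e - u) * inverse (real (Suc n))) \<longlonglongrightarrow> u + (e - u) * 0"
    by (intro tendsto_intros LIMSEQ_inverse_real_of_nat)
  then have s3: "s \<longlonglongrightarrow> u" by (simp add: s_def[abs_def])
  show ?thesis
  proof (rule borel_measurable_LIMSEQ_real)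
    show "(\<lambda>p. (f (k p) (s n) - f (k p) u) / (s n - u)) \<in> borel_measurable M" for n
      using fm[OF s1] fm[OF u] by simp
    fix p
    have "(f (k p) has_real_derivative deriv_Icc a b (f (k p)) u) (at u within {a..b})"
      using Ck2_deriv(1)[OF f[OF k(2)] u] by (simp add: has_real_derivative_iff_has_vector_derivative)
    then have "((\<lambda>y. (f (k p) y - f (k p) u) / (y - u)) \<longlongrightarrow> deriv_Icc a b (f (k p)) u) (at u within {a..b})"
      by (simp add: has_field_derivative_iff)
    moreover have "filterlim s (at u within {a..b}) sequentially"
      using s1 s2 s3 by (auto simp: filterlim_at)
    ultimately show "(\<lambda>n. (f (k p) (s n) - f (k p) u) / (s n - u)) \<longlonglongrightarrow> deriv_Icc a b (f (k p)) u"
      by (rule filterlim_compose)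
  qed
qed

lemma primitive_measurable:
  fixes F G :: "real \<times> real \<Rightarrow> real \<Rightarrow> real"
  assumes ab: "a < b"
    and F: "\<And>u. u \<in> {a..b} \<Longrightarrow> (\<lambda>p. F p u) \<in> borel_measurable borel" "\<And>p. continuous_on {a..b} (F p)"
    and G: "\<And>u. u \<in> {a..b} \<Longrightarrow> (\<lambda>p. G p u) \<in> borel_measurable borel" "\<And>p. continuous_on {a..b} (G p)"
    and v: "v \<in> borel_measurable borel" "\<And>p. v p \<in> {a..b}"
  shows "(\<lambda>p. integral {a..v p} (\<lambda>s. F p s * G p s)) \<in> borel_measurable borel"
proof (rule caratheodory_measurable[where h="\<lambda>p u. integral {a..u} (\<lambda>s. F p s * G p s)" and v=v, OF ab _ _ v])
  show "continuous_on {a..b} (\<lambda>u. integral {a..u} (\<lambda>s. F p s * G p s))" for p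
    by (rule indefinite_integral_continuous_1) (intro integrable_continuous_interval continuous_intros F G)
  fix u assume u: "u \<in> {a..b}"
  define cl where "cl s = max a (min b s)" for s :: real
  have cl: "cl s \<in> {a..b}" for s using ab by (auto simp: cl_def)
  have clm: "cl \<in> borel_measurable borel" unfolding cl_def[abs_def] by measurable
  have jm: "(\<lambda>x. H (fst x) (cl (snd x))) \<in> borel_measurable (borel \<Otimes>\<^sub>M lborel)"
    if H: "\<And>u. u \<in> {a..b} \<Longrightarrow> (\<lambda>p. H p u) \<in> borel_measurable borel" "\<And>p. continuous_on {a..b} (H p)" for H :: "real \<times> real \<Rightarrow> real \<Rightarrow> real"
  proof (rule caratheodory_measurable[where h="\<lambda>x. H (fst x)" and v="\<lambda>x. cl (snd x)", OF ab])
    show "(\<lambda>x. H (fst x) u) \<in> borel_measurable (borel \<Otimes>\<^sub>M lborel)" if "u \<in> {a..b}" for u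
      by (rule measurable_compose[OF measurable_fst H(1)[OF that]])
    show "continuous_on {a..b} (H (fst x))" for x by (rule H(2))
    show "(\<lambda>x. cl (snd x)) \<in> borel_measurable (borel \<Otimes>\<^sub>M lborel)" by (rule measurable_compose[OF measurable_snd]) (use clm in simp)
    show "cl (snd x) \<in> {a..b}" for x by (rule cl)
  qed
  have "(\<lambda>p. LINT s|lborel. indicator {a..u} s * (F p (cl s) * G p (cl s))) \<in> borel_measurable borel"
  proof (rule lborel.borel_measurable_lebesgue_integral)
    have "(\<lambda>x. indicator {a..u} (snd x) * (F (fst x) (cl (snd x)) * G (fst x) (cl (snd x)))) \<in> borel_measurable (borel \<Otimes>\<^sub>M lborel)"
      by (intro borel_measurable_times jm F G) measurable
    then show "(\<lambda>(p, s). indicator {a..u} s * (F p (cl s) * G p (cl s))) \<in> borel_measurable (borel \<Otimes>\<^sub>M lborel)"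
      by (simp add: split_beta')
  qed
  moreover have "(LINT s|lborel. indicator {a..u} s * (F p (cl s) * G p (cl s))) = integral {a..u} (\<lambda>s. F p s * G p s)" for p
  proof -
    have c: "continuous_on {a..u} (\<lambda>s. F p s * G p s)"
      by (intro continuous_intros continuous_on_subset[OF F(2)] continuous_on_subset[OF G(2)]) (use u in auto)
    have "set_integrable lborel {a..u} (\<lambda>s. F p s * G p s)" unfolding set_integrable_def
      by (rule borel_integrable_compact[OF _ c]) simp
    from set_borel_integral_eq_integral(2)[OF this]
    have "integral {a..u} (\<lambda>s. F p s * G p s) = (LINT s|lborel. indicator {a..u} s * (F p s * G p s))"
      unfolding set_lebesgue_integral_def real_scaleR_def by (rule sym)
    also have "\<dots> = (LINT s|lborel. indicator {a..u} s * (F p (cl s) * G p (cl s)))"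
      by (intro Bochner_Integration.integral_cong refl) (use u in \<open>auto simp: indicator_def cl_def\<close>)
    finally show ?thesis by simp
  qed
  ultimately show "(\<lambda>p. integral {a..u} (\<lambda>s. F p s * G p s)) \<in> borel_measurable borel" by simp
qed

section \<open>The Cauchy--Schwarz gap\<close>

text \<open>The determinant formed with the increments of the three primitives between
  \<open>w\<close> and \<open>u\<close>.\<close>

definition gap :: "real \<Rightarrow> (real \<Rightarrow> real) \<Rightarrow> (real \<Rightarrow> real) \<Rightarrow> real \<Rightarrow> real \<Rightarrow> real" where
  "gap a \<phi> \<psi> u w =
    (integral {a..u} (\<lambda>s. \<phi> s * \<phi> s) - integral {a..w} (\<lambda>s. \<phi> s * \<phi> s)) *
    (integral {a..u} (\<lambda>s. \<psi> s * \<psi> s) - integral {a..w} (\<lambda>s. \<psi> s * \<psi> s)) -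
    (integral {a..u} (\<lambda>s. \<phi> s * \<psi> s) - integral {a..w} (\<lambda>s. \<phi> s * \<psi> s))\<^sup>2"

lemma gap_commute: "gap a \<phi> \<psi> u w = gap a \<phi> \<psi> w u"
  unfolding gap_def by (simp add: power2_commute[of "integral {a..u} _"] algebra_simps)

lemma integral_initial_diff:
  assumes f: "continuous_on {a..b} f" and "a \<le> w" "w \<le> u" "u \<le> b"
  shows "integral {a..u} f - integral {a..w} f = integral {w..u} (f :: real \<Rightarrow> real)"
proof -
  have "f integrable_on {a..u}" by (intro integrable_continuous_interval continuous_on_subset[OF f]) (use assms in auto)
  from Henstock_Kurzweil_Integration.integral_combine[OF assms(2,3) this] show ?thesis by simp
qed

lemma quadratic_form:
  fixes \<phi> \<psi> :: "real \<Rightarrow> real"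
  assumes c: "continuous_on {a..b} \<phi>" "continuous_on {a..b} \<psi>" and w: "a \<le> w" "w \<le> u" "u \<le> b"
  shows "x\<^sup>2 * integral {w..u} (\<lambda>s. \<phi> s * \<phi> s) + 2 * x * y * integral {w..u} (\<lambda>s. \<phi> s * \<psi> s) + y\<^sup>2 * integral {w..u} (\<lambda>s. \<psi> s * \<psi> s)
    = integral {w..u} (\<lambda>s. (x * \<phi> s + y * \<psi> s)\<^sup>2)"
proof -
  have c': "continuous_on {w..u} \<phi>" "continuous_on {w..u} \<psi>" using w by (auto intro: continuous_on_subset[OF c(1)] continuous_on_subset[OF c(2)])
  have h: "((\<lambda>s. f s * g s) has_integral integral {w..u} (\<lambda>s. f s * g s)) {w..u}"
    if "continuous_on {w..u} f" "continuous_on {w..u} g" for f g :: "real \<Rightarrow> real"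
    by (intro integrable_integral integrable_continuous_interval continuous_intros that)
  have "((\<lambda>s. x\<^sup>2 * (\<phi> s * \<phi> s) + 2 * x * y * (\<phi> s * \<psi> s) + y\<^sup>2 * (\<psi> s * \<psi> s)) has_integral
    x\<^sup>2 * integral {w..u} (\<lambda>s. \<phi> s * \<phi> s) + 2 * x * y * integral {w..u} (\<lambda>s. \<phi> s * \<psi> s) + y\<^sup>2 * integral {w..u} (\<lambda>s. \<psi> s * \<psi> s)) {w..u}"
    by (intro has_integral_add has_integral_mult_right h c')
  moreover have "x\<^sup>2 * (\<phi> s * \<phi> s) + 2 * x * y * (\<phi> s * \<psi> s) + y\<^sup>2 * (\<psi> s * \<psi> s) = (x * \<phi> s + y * \<psi> s)\<^sup>2" for s
    by (simp add: power2_eq_square algebra_simps)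
  ultimately show ?thesis by (simp add: integral_unique)
qed

text \<open>A nonnegative quadratic form has nonnegative determinant, and if the determinant
  vanishes then the form has a nontrivial zero.\<close>

lemma quadratic_nonneg:
  fixes P Q R :: real
  assumes "\<And>x y. 0 \<le> x\<^sup>2 * P + 2 * x * y * Q + y\<^sup>2 * R"
  shows "0 \<le> P * R - Q\<^sup>2" "P * R - Q\<^sup>2 = 0 \<Longrightarrow> \<exists>x y. (x \<noteq> 0 \<or> y \<noteq> 0) \<and> x\<^sup>2 * P + 2 * x * y * Q + y\<^sup>2 * R = 0"
proof -
  have R: "0 \<le> R" using assms[of 0 1] by simp
  have e: "R\<^sup>2 * P + 2 * R * (- Q) * Q + (- Q)\<^sup>2 * R = R * (P * R - Q\<^sup>2)" by (simp add: power2_eq_square algebra_simps)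
  show "0 \<le> P * R - Q\<^sup>2"
  proof (cases "R = 0")
    case True
    have "Q = 0"
    proof (rule ccontr)
      assume Q: "Q \<noteq> 0"
      have "0 \<le> P + 2 * (- (P + 1) / (2 * Q)) * Q" using assms[of 1 "- (P + 1) / (2 * Q)"] True by simp
      then show False using Q by (simp add: field_simps)
    qed
    then show ?thesis using True by simp
  next
    case False
    then show ?thesis using assms[of R "- Q"] R unfolding e by (simp add: zero_le_mult_iff)
  qed
  show "\<exists>x y. (x \<noteq> 0 \<or> y \<noteq> 0) \<and> x\<^sup>2 * P + 2 * x * y * Q + y\<^sup>2 * R = 0" if "P * R - Q\<^sup>2 = 0"
  proof (cases "R = 0")
    case True
    then show ?thesis by (intro exI[of _ 0] exI[of _ 1]) simp
  next
    case False
    then show ?thesis using e that by (intro exI[of _ R] exI[of _ "- Q"]) simp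
  qed
qed

text \<open>The integral of \<open>(x * \<phi> + y * \<psi>)\<^sup>2\<close> is a nonnegative
  quadratic form in \<open>(x, y)\<close> with determinant \<open>gap\<close>. A zero of the form is
  a combination with vanishing integral of its square, which therefore vanishes identically by
  continuity.\<close>

lemma gap_ordered:
  fixes \<phi> \<psi> :: "real \<Rightarrow> real"
  assumes c: "continuous_on {a..b} \<phi>" "continuous_on {a..b} \<psi>" and w: "a \<le> w" "w \<le> u" "u \<le> b"
  shows "0 \<le> gap a \<phi> \<psi> u w" "gap a \<phi> \<psi> u w = 0 \<Longrightarrow> w < u \<Longrightarrow> \<exists>x y. (x \<noteq> 0 \<or> y \<noteq> 0) \<and> (\<forall>s\<in>{w..u}. x * \<phi> s + y * \<psi> s = 0)"
proof -
  define P where "P = integral {w..u} (\<lambda>s. \<phi> s * \<phi> s)"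
  define Q where "Q = integral {w..u} (\<lambda>s. \<phi> s * \<psi> s)"
  define R where "R = integral {w..u} (\<lambda>s. \<psi> s * \<psi> s)"
  have g: "gap a \<phi> \<psi> u w = P * R - Q\<^sup>2"
    unfolding gap_def P_def Q_def R_def by (subst (1 2 3) integral_initial_diff[OF _ w]) (intro continuous_intros c refl)+
  note q = quadratic_form[OF c w, folded P_def Q_def R_def]
  have cs: "continuous_on {w..u} (\<lambda>s. (x * \<phi> s + y * \<psi> s)\<^sup>2)" for x y
    by (intro continuous_intros continuous_on_subset[OF c(1)] continuous_on_subset[OF c(2)]) (use w in auto)
  have n: "0 \<le> x\<^sup>2 * P + 2 * x * y * Q + y\<^sup>2 * R" for x y
    unfolding q by (intro Henstock_Kurzweil_Integration.integral_nonneg integrable_continuous_interval cs) simp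
  show "0 \<le> gap a \<phi> \<psi> u w" unfolding g by (rule quadratic_nonneg(1)[OF n])
  assume "gap a \<phi> \<psi> u w = 0" and lt: "w < u"
  then obtain x y where xy: "x \<noteq> 0 \<or> y \<noteq> 0" "x\<^sup>2 * P + 2 * x * y * Q + y\<^sup>2 * R = 0" using quadratic_nonneg(2)[OF n] g by auto
  have z: "integral {w..u} (\<lambda>s. (x * \<phi> s + y * \<psi> s)\<^sup>2) = 0" using xy(2) unfolding q .
  have "\<forall>s\<in>{w..u}. x * \<phi> s + y * \<psi> s = 0"
  proof -
    have "((\<lambda>s. (x * \<phi> s + y * \<psi> s)\<^sup>2) has_integral 0) (cbox w u)"
      using integrable_integral[OF integrable_continuous_interval[OF cs, of x y]] z by simp
    then have "(x * \<phi> s + y * \<psi> s)\<^sup>2 = 0" if "s \<in> cbox w u" for s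
      by (rule has_integral_0_cbox_imp_0[rotated 2]) (use cs lt that in auto)
    then show ?thesis by simp
  qed
  then show "\<exists>x y. (x \<noteq> 0 \<or> y \<noteq> 0) \<and> (\<forall>s\<in>{w..u}. x * \<phi> s + y * \<psi> s = 0)" using xy by blast
qed

lemma integral_initial_diff_bound:
  fixes f h :: "real \<Rightarrow> real"
  assumes c: "continuous_on {a..b} f" "continuous_on {a..b} h"
    and le: "\<And>s. s \<in> {a..b} \<Longrightarrow> \<bar>f s\<bar> \<le> h s" and u: "u \<in> {a..b}" and w: "w \<in> {a..b}"
  shows "\<bar>integral {a..u} f - integral {a..w} f\<bar> \<le> integral {a..b} h"
proof -
  have *: "\<bar>integral {a..u} f - integral {a..w} f\<bar> \<le> integral {a..b} h" if w: "a \<le> w" "w \<le> u" "u \<le> b" for u w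
  proof -
    have sub: "{w..u} \<subseteq> {a..b}" using w by auto
    have "\<bar>integral {w..u} f\<bar> \<le> integral {w..u} h"
      using integral_norm_bound_integral[of f "{w..u}" h] integrable_continuous_interval[OF continuous_on_subset[OF c(1) sub]]
        integrable_continuous_interval[OF continuous_on_subset[OF c(2) sub]] le sub by (simp add: subset_iff)
    also have "\<dots> \<le> integral {a..b} h"
    proof -
      have i: "h integrable_on {w..u}" "h integrable_on {a..b}"
        by (rule integrable_continuous_interval[OF continuous_on_subset[OF c(2) sub]], rule integrable_continuous_interval[OF c(2)])
      have "0 \<le> h s" if "s \<in> {a..b}" for s using le[OF that] by linarith
      then show ?thesis using integral_subset_le[OF sub i] by blast
    qed
    finally show ?thesis using integral_initial_diff[OF c(1) w] by simp
  qed
  show ?thesis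
  proof (cases "w \<le> u")
    case True
    then show ?thesis using * u w by simp
  next
    case False
    then have "\<bar>integral {a..w} f - integral {a..u} f\<bar> \<le> integral {a..b} h" using *[of u w] u w by simp
    then show ?thesis by (simp add: abs_minus_commute)
  qed
qed

lemma gap_nonneg:
  assumes "continuous_on {a..b} \<phi>" "continuous_on {a..b} \<psi>" "u \<in> {a..b}" "w \<in> {a..b}"
  shows "0 \<le> gap a \<phi> \<psi> u w"
  using gap_ordered(1)[OF assms(1,2), of w u] gap_ordered(1)[OF assms(1,2), of u w] gap_commute[of a \<phi> \<psi> u w] assms(3,4)
  by (cases "w \<le> u") auto

text \<open>A combination of \<open>f\<^sub>u\<close> and \<open>g\<^sub>u\<close> that vanishes on
  an interval makes the same combination of \<open>f\<close> and \<open>g\<close> constant there,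
  hence affine; it also has a zero set of positive measure.\<close>

lemma gap_pos:
  fixes f g :: "real \<Rightarrow> real \<Rightarrow> real"
  assumes f: "Ck_Icc 2 a b (f \<kappa>)" and g: "Ck_Icc 2 a b (g \<mu>)"
    and nl: "nowhere_affine_pair \<alpha> \<beta> a b f g \<or> null_critical_pair \<alpha> \<beta> a b f g"
    and \<kappa>: "\<kappa> \<in> {\<alpha>..\<beta>}" and \<mu>: "\<mu> \<in> {\<alpha>..\<beta>}" and u: "u \<in> {a..b}" and w: "w \<in> {a..b}" and ne: "u \<noteq> w"
  shows "0 < gap a (deriv_Icc a b (f \<kappa>)) (deriv_Icc a b (g \<mu>)) u w"
proof -
  note c = Ck2_deriv(2)[OF f] Ck2_deriv(2)[OF g]
  have *: "gap a (deriv_Icc a b (f \<kappa>)) (deriv_Icc a b (g \<mu>)) u w \<noteq> 0" if w: "a \<le> w" "w < u" "u \<le> b" for u w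
  proof
    assume "gap a (deriv_Icc a b (f \<kappa>)) (deriv_Icc a b (g \<mu>)) u w = 0"
    then obtain x y where xy: "x \<noteq> 0 \<or> y \<noteq> 0" "\<And>s. s \<in> {w..u} \<Longrightarrow> x * deriv_Icc a b (f \<kappa>) s + y * deriv_Icc a b (g \<mu>) s = 0"
      using gap_ordered(2)[OF c w(1) less_imp_le[OF w(2)] w(3)] w(2) by blast
    define n where "n = norm (x, y)"
    have n: "n > 0" using xy(1) by (auto simp: n_def zero_prod_def)
    define \<xi> where "\<xi> = (x / n, y / n)"
    have "norm \<xi> = norm ((1 / n) *\<^sub>R (x, y))" by (simp add: \<xi>_def)
    also have "\<dots> = 1" unfolding norm_scaleR using n by (simp add: n_def)
    finally have \<xi>1: "norm \<xi> = 1" .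
    have z: "fst \<xi> * deriv_Icc a b (f \<kappa>) s + snd \<xi> * deriv_Icc a b (g \<mu>) s = 0" if "s \<in> {w..u}" for s
    proof -
      have "fst \<xi> * deriv_Icc a b (f \<kappa>) s + snd \<xi> * deriv_Icc a b (g \<mu>) s
        = (x * deriv_Icc a b (f \<kappa>) s + y * deriv_Icc a b (g \<mu>) s) / n"
        by (simp add: \<xi>_def add_divide_distrib)
      then show ?thesis using xy(2)[OF that] by simp
    qed
    from nl show False
    proof
      assume nap: "nowhere_affine_pair \<alpha> \<beta> a b f g"
      have sub: "{w..u} \<subseteq> {a..b}" using w by auto
      have "((\<lambda>s. fst \<xi> * f \<kappa> s + snd \<xi> * g \<mu> s) has_vector_derivative 0) (at s within {w..u})" if s: "s \<in> {w..u}" for s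
      proof -
        have "s \<in> {a..b}" using s sub by auto
        then have "(f \<kappa> has_vector_derivative deriv_Icc a b (f \<kappa>) s) (at s within {w..u})"
          "(g \<mu> has_vector_derivative deriv_Icc a b (g \<mu>) s) (at s within {w..u})"
          using has_vector_derivative_within_subset[OF Ck2_deriv(1)[OF f] sub] has_vector_derivative_within_subset[OF Ck2_deriv(1)[OF g] sub] by auto
        then have "((\<lambda>s. fst \<xi> * f \<kappa> s + snd \<xi> * g \<mu> s) has_vector_derivative
          fst \<xi> * deriv_Icc a b (f \<kappa>) s + snd \<xi> * deriv_Icc a b (g \<mu>) s) (at s within {w..u})"
          by (intro has_vector_derivative_add has_vector_derivative_mult_right)
        then show ?thesis using z[OF s] by simp
      qed
      then obtain q where q: "\<And>s. s \<in> {w..u} \<Longrightarrow> fst \<xi> * f \<kappa> s + snd \<xi> * g \<mu> s = q"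
        using has_vector_derivative_zero_constant[of "{w..u}" "\<lambda>s. fst \<xi> * f \<kappa> s + snd \<xi> * g \<mu> s"] by auto
      have "\<forall>s\<in>{w..u}. fst \<xi> * f \<kappa> s + snd \<xi> * g \<mu> s = 0 * s + q" using q by simp
      then show False using nap \<xi>1 \<kappa> \<mu> w unfolding nowhere_affine_pair_def by blast
    next
      assume "null_critical_pair \<alpha> \<beta> a b f g"
      then have Z: "{s \<in> {a..b}. fst \<xi> * deriv_Icc a b (f \<kappa>) s + snd \<xi> * deriv_Icc a b (g \<mu>) s = 0} \<in> null_sets lebesgue"
        (is "?Z \<in> _") using \<xi>1 \<kappa> \<mu> unfolding null_critical_pair_def by blast
      have "{w..u} \<subseteq> ?Z" using w z by auto
      from emeasure_mono[OF this null_setsD2[OF Z]] have "emeasure lebesgue {w..u} = 0" unfolding null_setsD1[OF Z] by simp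
      then show False using w by simp
    qed
  qed
  have "gap a (deriv_Icc a b (f \<kappa>)) (deriv_Icc a b (g \<mu>)) u w \<noteq> 0"
  proof (cases "w < u")
    case True
    then show ?thesis using * u w by simp
  next
    case False
    then have "gap a (deriv_Icc a b (f \<kappa>)) (deriv_Icc a b (g \<mu>)) w u \<noteq> 0" using *[of u w] ne u w by simp
    then show ?thesis by (simp add: gap_commute[of _ _ _ u w])
  qed
  then show ?thesis using gap_nonneg[OF c u w] by simp
qed

lemma gap_continuous:
  assumes "continuous_on {a..b} \<phi>" "continuous_on {a..b} \<psi>"
  shows "continuous_on ({a..b} \<times> {a..b}) (\<lambda>z. gap a \<phi> \<psi> (fst z) (snd z))"
proof -
  have i: "continuous_on ({a..b} \<times> {a..b}) (\<lambda>z. integral {a..p z} (\<lambda>s. f s * g s))"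
    if "continuous_on {a..b} f" "continuous_on {a..b} g" "continuous_on ({a..b} \<times> {a..b}) p" "p ` ({a..b} \<times> {a..b}) \<subseteq> {a..b}"
    for f g :: "real \<Rightarrow> real" and p :: "real \<times> real \<Rightarrow> real"
    by (rule continuous_on_compose2[OF indefinite_integral_continuous_1 that(3,4)])
      (intro integrable_continuous_interval continuous_intros that)
  show ?thesis unfolding gap_def
    by (intro continuous_intros i assms) auto
qed

section \<open>From convergence in measure to convergence almost everywhere\<close>

text \<open>A continuous function that is positive off the diagonal of a compact square controls the distance to the
  diagonal.\<close>

lemma off_diagonal_small:
  fixes D :: "real \<Rightarrow> real \<Rightarrow> real"
  assumes c: "continuous_on ({a..b} \<times> {a..b}) (\<lambda>z. D (fst z) (snd z))"
    and pos: "\<And>u w. u \<in> {a..b} \<Longrightarrow> w \<in> {a..b} \<Longrightarrow> u \<noteq> w \<Longrightarrow> 0 < D u w" and d: "d > 0"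
  shows "\<exists>e>0. \<forall>u\<in>{a..b}. \<forall>w\<in>{a..b}. D u w \<le> e \<longrightarrow> \<bar>u - w\<bar> \<le> d"
proof -
  define S where "S = ({a..b} \<times> {a..b}) \<inter> {z. d \<le> \<bar>fst z - snd z\<bar>}"
  have S: "compact S" unfolding S_def
    by (intro compact_Int_closed compact_Times closed_Collect_le continuous_intros) simp_all
  have cS: "continuous_on S (\<lambda>z. D (fst z) (snd z))" by (rule continuous_on_subset[OF c]) (auto simp: S_def)
  show ?thesis
  proof (cases "S = {}")
    case True
    then have "\<bar>u - w\<bar> \<le> d" if "u \<in> {a..b}" "w \<in> {a..b}" for u w
      using that by (force simp: S_def)
    then show ?thesis by (intro exI[of _ 1]) auto
  next
    case False
    obtain z where z: "z \<in> S" "\<And>y. y \<in> S \<Longrightarrow> D (fst z) (snd z) \<le> D (fst y) (snd y)"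
      using continuous_attains_inf[OF S False cS] by blast
    define e where "e = D (fst z) (snd z)"
    have e: "e > 0" unfolding e_def using z(1) d by (intro pos) (auto simp: S_def)
    have "\<bar>u - w\<bar> \<le> d" if "u \<in> {a..b}" "w \<in> {a..b}" "D u w \<le> e / 2" for u w
    proof (rule ccontr)
      assume "\<not> ?thesis"
      then have "(u, w) \<in> S" using that by (auto simp: S_def)
      then show False using z(2)[of "(u, w)"] that(3) e by (simp add: e_def)
    qed
    then show ?thesis using e by (intro exI[of _ "e / 2"]) auto
  qed
qed

text \<open>Boundedness supplies the finiteness of the measures.\<close>

lemma borel_cantelli_geometric:
  fixes B :: "nat \<Rightarrow> 'a::euclidean_space set"
  assumes m: "\<And>n. B n \<in> sets borel" and K: "compact K" "\<And>n. B n \<subseteq> K" and le: "\<And>n. measure lborel (B n) \<le> (1/2) ^ n"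
  shows "AE x in lborel. \<forall>\<^sub>F n in sequentially. x \<notin> B n"
proof -
  have "AE x in lborel. \<forall>\<^sub>F n in sequentially. x \<in> space lborel - B n"
  proof (rule borel_cantelli_AE1)
    show "B n \<in> sets lborel" for n using m by simp
    show "emeasure lborel (B n) < \<infinity>" for n
      by (rule emeasure_bounded_finite) (rule bounded_subset[OF compact_imp_bounded[OF K(1)] K(2)])
    show "summable (\<lambda>n. measure lborel (B n))"
      by (rule summable_comparison_test'[where g="\<lambda>n. (1/2) ^ n" and N=0]) (use le in auto)
  qed
  then show ?thesis by simp
qed

text \<open>The usual fast subsequence: consecutive differences are eventually at most \<open>(1/2)
  ^ n\<close>, so the telescoping series converges.\<close>

lemma cauchy_in_measure_AE_subseq:
  fixes v :: "nat \<Rightarrow> 'a::euclidean_space \<Rightarrow> real"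
  assumes K: "compact K" and v: "\<And>n. v n \<in> borel_measurable borel"
    and cau: "\<And>d z. d > 0 \<Longrightarrow> z > 0 \<Longrightarrow> \<exists>J. \<forall>n\<ge>J. \<forall>m\<ge>J. measure lborel {x \<in> K. d < \<bar>v n x - v m x\<bar>} \<le> z"
  shows "\<exists>r. strict_mono r \<and> (AE x in lborel. x \<in> K \<longrightarrow> convergent (\<lambda>n. v (r n) x))"
proof -
  have [measurable]: "K \<in> sets borel" using K by (simp add: borel_compact)
  note [measurable] = v
  have "\<exists>J. \<forall>n\<ge>J. \<forall>m\<ge>J. measure lborel {x \<in> K. (1/2) ^ k < \<bar>v n x - v m x\<bar>} \<le> (1/2) ^ k" for k :: nat
    by (intro cau) simp_all
  then obtain J where J: "\<And>k n m. J k \<le> n \<Longrightarrow> J k \<le> m \<Longrightarrow> measure lborel {x \<in> K. (1/2) ^ k < \<bar>v n x - v m x\<bar>} \<le> (1/2) ^ k"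
    by metis
  define r where "r k = (\<Sum>i\<le>k. J i) + k" for k
  have r: "strict_mono r" unfolding strict_mono_Suc_iff by (simp add: r_def)
  have rJ: "J k \<le> r k" for k unfolding r_def by (rule trans_le_add1, rule member_le_sum) auto
  have rJ': "J k \<le> r (Suc k)" for k using rJ[of k] strict_monoD[OF r, of k "Suc k"] by simp
  define B where "B k = {x \<in> K. (1/2) ^ k < \<bar>v (r (Suc k)) x - v (r k) x\<bar>}" for k
  have "AE x in lborel. \<forall>\<^sub>F n in sequentially. x \<notin> B n"
  proof (rule borel_cantelli_geometric[OF _ K])
    show "B n \<in> sets borel" for n unfolding B_def by measurable
    show "B n \<subseteq> K" for n by (auto simp: B_def)
    show "measure lborel (B n) \<le> (1/2) ^ n" for n unfolding B_def by (rule J[OF rJ' rJ])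
  qed
  then have "AE x in lborel. x \<in> K \<longrightarrow> convergent (\<lambda>n. v (r n) x)"
  proof (rule AE_mp, intro AE_I2 impI)
    fix x assume ev: "\<forall>\<^sub>F n in sequentially. x \<notin> B n" and x: "x \<in> K"
    have "\<forall>\<^sub>F n in sequentially. norm (v (r (Suc n)) x - v (r n) x) \<le> (1/2) ^ n"
      using ev by eventually_elim (use x in \<open>simp add: B_def not_less\<close>)
    then have "summable (\<lambda>n. v (r (Suc n)) x - v (r n) x)"
      by (rule summable_comparison_test_ev) (simp add: summable_geometric)
    then have "convergent (\<lambda>n. \<Sum>k<n. v (r (Suc k)) x - v (r k) x)" by (simp add: summable_iff_convergent)
    then have "convergent (\<lambda>n. v (r n) x - v (r 0) x)" by (simp add: sum_lessThan_telescope[of "\<lambda>n. v (r n) x"])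
    then obtain L where "(\<lambda>n. v (r n) x - v (r 0) x) \<longlonglongrightarrow> L" by (auto simp: convergent_def)
    from tendsto_add[OF this tendsto_const[of "v (r 0) x"]] show "convergent (\<lambda>n. v (r n) x)" by (auto simp: convergent_def)
  qed
  then show ?thesis using r by blast
qed

text \<open>If \<open>v\<close> were not Cauchy in measure, there would be pairs of indices along
  which \<open>\<bar>v n - v m\<bar>\<close> exceeds \<open>d\<close> on sets of measure more than
  \<open>z\<close>, and by Borel--Cantelli they could be chosen such that \<open>D\<close> tends to
  zero almost everywhere. At each such point \<open>off_diagonal_small\<close> forces the
  differences below \<open>d\<close>, and dominated convergence gives the contradiction.\<close>

lemma gap_in_measure_AE_subseq:
  fixes v :: "nat \<Rightarrow> 'a::euclidean_space \<Rightarrow> real" and D :: "'a \<Rightarrow> real \<Rightarrow> real \<Rightarrow> real"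
  assumes K: "compact K" and v: "\<And>n. v n \<in> borel_measurable borel" "\<And>n x. v n x \<in> {a..b}"
    and M: "(M :: 'a \<Rightarrow> real) \<in> borel_measurable borel"
    and Dm: "\<And>n m. (\<lambda>x. D x (v n x) (v m x)) \<in> borel_measurable borel"
    and c: "\<And>x. x \<in> K \<Longrightarrow> continuous_on ({a..b} \<times> {a..b}) (\<lambda>z. D x (fst z) (snd z))"
    and pos: "\<And>x u w. x \<in> K \<Longrightarrow> u \<in> {a..b} \<Longrightarrow> w \<in> {a..b} \<Longrightarrow> u \<noteq> w \<Longrightarrow> 0 < D x u w"
    and small: "\<And>c l z. c \<ge> 0 \<Longrightarrow> l > 0 \<Longrightarrow> z > 0 \<Longrightarrow>
      \<exists>J. \<forall>n\<ge>J. \<forall>m\<ge>J. measure lborel {x \<in> K. M x \<le> c \<and> l < D x (v n x) (v m x)} \<le> z"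
  shows "\<exists>r. strict_mono r \<and> (AE x in lborel. x \<in> K \<longrightarrow> convergent (\<lambda>n. v (r n) x))"
proof (rule cauchy_in_measure_AE_subseq[OF K v(1)])
  have [measurable]: "K \<in> sets borel" using K by (simp add: borel_compact)
  note [measurable] = v(1) M Dm
  fix d z :: real assume d: "d > 0" and z: "z > 0"
  show "\<exists>J. \<forall>n\<ge>J. \<forall>m\<ge>J. measure lborel {x \<in> K. d < \<bar>v n x - v m x\<bar>} \<le> z"
  proof (rule ccontr)
    assume "\<not> ?thesis"
    then have "\<forall>J. \<exists>n m. J \<le> n \<and> J \<le> m \<and> z < measure lborel {x \<in> K. d < \<bar>v n x - v m x\<bar>}"
      by (meson not_le)
    then obtain n m where nm: "\<And>J. J \<le> n J" "\<And>J. J \<le> m J" "\<And>J. z < measure lborel {x \<in> K. d < \<bar>v (n J) x - v (m J) x\<bar>}"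
      by metis
    have "\<forall>k::nat. \<exists>J. \<forall>n\<ge>J. \<forall>m\<ge>J. measure lborel {x \<in> K. M x \<le> real k \<and> inverse (real (Suc k)) < D x (v n x) (v m x)} \<le> (1/2) ^ k"
    proof
      fix k :: nat
      have k: "0 \<le> real k" "0 < inverse (real (Suc k))" "0 < (1/2 :: real) ^ k" by simp_all
      show "\<exists>J. \<forall>n\<ge>J. \<forall>m\<ge>J. measure lborel {x \<in> K. M x \<le> real k \<and> inverse (real (Suc k)) < D x (v n x) (v m x)} \<le> (1/2) ^ k"
        by (rule small[OF k])
    qed
    from choice[OF this] obtain J where J: "\<And>k n m. J k \<le> n \<Longrightarrow> J k \<le> m \<Longrightarrow>
        measure lborel {x \<in> K. M x \<le> real k \<and> inverse (real (Suc k)) < D x (v n x) (v m x)} \<le> (1/2) ^ k"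
      by blast
    define n' where "n' k = n (J k)" for k
    define m' where "m' k = m (J k)" for k
    define B where "B k = {x \<in> K. M x \<le> real k \<and> inverse (real (Suc k)) < D x (v (n' k) x) (v (m' k) x)}" for k
    have ae: "AE x in lborel. \<forall>\<^sub>F k in sequentially. x \<notin> B k"
    proof (rule borel_cantelli_geometric[OF _ K])
      show "B k \<in> sets borel" for k unfolding B_def by measurable
      show "B k \<subseteq> K" for k by (auto simp: B_def)
      show "measure lborel (B k) \<le> (1/2) ^ k" for k unfolding B_def n'_def m'_def by (rule J[OF nm(1,2)])
    qed
    define A where "A k = {x \<in> K. d < \<bar>v (n' k) x - v (m' k) x\<bar>}" for k
    have Am[measurable]: "A k \<in> sets borel" for k unfolding A_def by measurable
    have "(\<lambda>k. LINT x|lborel. indicator (A k) x) \<longlonglongrightarrow> (LINT x::'a|lborel. (0::real))"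
    proof (rule integral_dominated_convergence[where w="indicator K"])
      show "integrable lborel (indicator K :: 'a \<Rightarrow> real)"
        using emeasure_bounded_finite[OF compact_imp_bounded[OF K]] by (intro integrable_real_indicator) auto
      show "AE x in lborel. (\<lambda>k. indicator (A k) x) \<longlonglongrightarrow> (0::real)"
        using ae
      proof (rule AE_mp, intro AE_I2 impI)
        fix x assume ev: "\<forall>\<^sub>F k in sequentially. x \<notin> B k"
        show "(\<lambda>k. indicator (A k) x) \<longlonglongrightarrow> (0::real)"
        proof (cases "x \<in> K")
          case True
          obtain e where e: "e > 0" "\<forall>u\<in>{a..b}. \<forall>w\<in>{a..b}. D x u w \<le> e \<longrightarrow> \<bar>u - w\<bar> \<le> d"
            using off_diagonal_small[OF c[OF True] pos[OF True] d] by blast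
          have "\<forall>\<^sub>F k in sequentially. inverse (real (Suc k)) < e"
            by (rule order_tendstoD(2)[OF LIMSEQ_inverse_real_of_nat e(1)])
          moreover have "\<forall>\<^sub>F k in sequentially. M x \<le> real k"
            using filterlim_real_sequentially by (simp add: filterlim_at_top)
          ultimately have "\<forall>\<^sub>F k in sequentially. indicator (A k) x = (0::real)"
            using ev
          proof eventually_elim
            case (elim k)
            then have "D x (v (n' k) x) (v (m' k) x) \<le> e" using True by (auto simp: B_def)
            then have "\<bar>v (n' k) x - v (m' k) x\<bar> \<le> d" using e(2) v(2) by blast
            then show ?case by (simp add: A_def)
          qed
          then show ?thesis by (rule tendsto_eventually)
        next
          case False
          then show ?thesis by (simp add: A_def)
        qed
      qed
      show "AE x in lborel. norm (indicator (A k) x :: real) \<le> indicator K x" for k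
        by (intro AE_I2) (simp add: A_def indicator_def)
    qed measurable
    then have "(\<lambda>k. measure lborel (A k)) \<longlonglongrightarrow> 0" by simp
    from order_tendstoD(2)[OF this z] obtain k where "measure lborel (A k) < z"
      by (auto dest: eventually_happens)
    moreover have "z < measure lborel (A k)" unfolding A_def n'_def m'_def by (rule nm(3))
    ultimately show False by simp
  qed
qed

text \<open>Domination by \<open>M\<close> makes the mollifications uniformly bounded and uniformly
  Lipschitz, so the theorem of Arzela and Ascoli applies.\<close>

section \<open>Uniform convergence of mollifications\<close>

lemma mollified_subseq:
  fixes P :: "nat \<Rightarrow> real \<times> real \<Rightarrow> real" and M :: "real \<times> real \<Rightarrow> real"
  assumes U: "bounded U" and P: "\<And>n. integrable lborel (P n)" and M: "integrable lborel M" and bd: "\<And>n x. \<bar>P n x\<bar> \<le> M x"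
    and t: "t > 0"
  shows "\<exists>r::nat \<Rightarrow> nat. strict_mono r \<and> (\<forall>e>0. \<exists>J. \<forall>n\<ge>J. \<forall>m\<ge>J. \<forall>x\<in>U. \<bar>conv (P (r n)) (eta t) x - conv (P (r m)) (eta t) x\<bar> \<le> e)"
proof -
  define I where "I = (LINT y|lborel. M y)"
  obtain C where C: "C > 0" "\<And>p. \<bar>eta t p\<bar> \<le> C" by (rule eta_bounded[OF t]) (rule that)
  note et = eta_test[OF t]
  obtain C1 where C1: "C1 > 0" "\<And>p. \<bar>partial_x (eta t) p\<bar> \<le> C1" by (rule test_bounded[OF test_partial(1)[OF et]]) (rule that)
  obtain C2 where C2: "C2 > 0" "\<And>p. \<bar>partial_y (eta t) p\<bar> \<le> C2" by (rule test_bounded[OF test_partial(2)[OF et]]) (rule that)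
  define L where "L = 2 * (C1 + C2)"
  have L0: "L \<ge> 0" using C1(1) C2(1) by (simp add: L_def)
  have L: "\<bar>eta t x - eta t y\<bar> \<le> L * norm (x - y)" for x y
    unfolding L_def
  proof (rule grad_bound_Lipschitz[of UNIV])
    show "\<bar>partial_x (eta t) p\<bar> \<le> C1 + C2" "\<bar>partial_y (eta t) p\<bar> \<le> C1 + C2" for p
      using C1(1) C2(1) C1(2)[of p] C2(2)[of p] by linarith+
  qed (use has_gradD[OF test_grad[OF et]] in auto)
  have dom: "\<bar>LINT y|lborel. P n y * w y\<bar> \<le> I * B"
    if i: "integrable lborel (\<lambda>y. P n y * w y)" and w: "\<And>y. \<bar>w y\<bar> \<le> B" for n w B
  proof -
    have "\<bar>LINT y|lborel. P n y * w y\<bar> \<le> (LINT y|lborel. \<bar>P n y * w y\<bar>)"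
      using integral_abs_bound[of lborel "\<lambda>y. P n y * w y"] by simp
    also have "\<dots> \<le> (LINT y|lborel. M y * B)"
    proof (rule integral_mono)
      show "integrable lborel (\<lambda>y. \<bar>P n y * w y\<bar>)" using i by simp
      show "integrable lborel (\<lambda>y. M y * B)" using M by simp
      fix y show "\<bar>P n y * w y\<bar> \<le> M y * B"
        unfolding abs_mult by (intro mult_mono bd w) (use bd[of n y] in auto)
    qed
    also have "\<dots> = I * B" by (simp add: I_def)
    finally show ?thesis .
  qed
  have I0: "I \<ge> 0" unfolding I_def by (intro integral_nonneg_AE AE_I2) (rule order_trans[OF abs_ge_zero bd])
  have lip: "\<bar>conv (P n) (eta t) x - conv (P n) (eta t) y\<bar> \<le> I * (L * norm (x - y))" for n x y
  proof -
    note i = conv_eta_integrable[OF P[of n] t, of x] conv_eta_integrable[OF P[of n] t, of y]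
    have "conv (P n) (eta t) x - conv (P n) (eta t) y = (LINT z|lborel. P n z * (eta t (x - z) - eta t (y - z)))"
      unfolding conv_def using i by (simp add: right_diff_distrib)
    moreover have "integrable lborel (\<lambda>z. P n z * (eta t (x - z) - eta t (y - z)))"
      using Bochner_Integration.integrable_diff[OF i] by (simp add: right_diff_distrib)
    moreover have "\<bar>eta t (x - z) - eta t (y - z)\<bar> \<le> L * norm (x - y)" for z using L[of "x - z" "y - z"] by simp
    ultimately show ?thesis using dom by presburger
  qed
  obtain g r where r: "strict_mono (r :: nat \<Rightarrow> nat)"
    and g: "\<And>e. 0 < e \<Longrightarrow> \<exists>N. \<forall>n x. n \<ge> N \<and> x \<in> closure U \<longrightarrow> norm (conv (P (r n)) (eta t) x - g x) < e"
  proof (rule Arzela_Ascoli[where \<F>="\<lambda>n. conv (P n) (eta t)" and S="closure U" and M="I * C"])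
    show "compact (closure U)" using U by (simp add: compact_closure)
    show "norm (conv (P n) (eta t) x) \<le> I * C" for n x
      unfolding real_norm_def conv_def by (rule dom[OF conv_eta_integrable[OF P t]]) (rule C(2))
    fix x e assume "x \<in> closure U" and e: "(0::real) < e"
    define d where "d = e / (I * L + 1)"
    have d: "d > 0" using e I0 L0 by (simp add: d_def add_nonneg_pos)
    have "norm (conv (P n) (eta t) x - conv (P n) (eta t) y) < e" if "norm (x - y) < d" for n y
    proof -
      have "I * L * norm (x - y) \<le> I * L * d" using that I0 L0 by (intro mult_left_mono) auto
      also have "\<dots> < (I * L + 1) * d" using d by (simp add: distrib_right)
      also have "\<dots> = e" using I0 L0 by (simp add: d_def add_nonneg_pos less_imp_neq[symmetric])
      finally show ?thesis using lip[of n x y] by (simp add: mult.assoc)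
    qed
    then show "\<exists>d>0. \<forall>n y. y \<in> closure U \<and> norm (x - y) < d \<longrightarrow> norm (conv (P n) (eta t) x - conv (P n) (eta t) y) < e"
      using d by blast
  qed (rule that)
  have "\<exists>J. \<forall>n\<ge>J. \<forall>m\<ge>J. \<forall>x\<in>U. \<bar>conv (P (r n)) (eta t) x - conv (P (r m)) (eta t) x\<bar> \<le> e" if e: "e > 0" for e
  proof -
    obtain J where J: "\<And>n x. n \<ge> J \<Longrightarrow> x \<in> closure U \<Longrightarrow> norm (conv (P (r n)) (eta t) x - g x) < e / 2" using g[of "e / 2"] e by auto
    have "\<bar>conv (P (r n)) (eta t) x - conv (P (r m)) (eta t) x\<bar> \<le> e" if "n \<ge> J" "m \<ge> J" "x \<in> U" for n m x
    proof -
      have x: "x \<in> closure U" using that(3) closure_subset by blast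
      from J[OF that(1) x] J[OF that(2) x] show ?thesis unfolding real_norm_def by linarith
    qed
    then show ?thesis by blast
  qed
  then show ?thesis using r by blast
qed

lemma all_mollified_subseq:
  fixes P :: "nat \<Rightarrow> real \<times> real \<Rightarrow> real" and M :: "real \<times> real \<Rightarrow> real"
  assumes U: "bounded U" and P: "\<And>n. integrable lborel (P n)" and M: "integrable lborel M" and bd: "\<And>n x. \<bar>P n x\<bar> \<le> M x"
  shows "\<exists>r::nat \<Rightarrow> nat. strict_mono r \<and> (\<forall>N. \<forall>e>0. \<exists>J. \<forall>n\<ge>J. \<forall>m\<ge>J. \<forall>x\<in>U.
    \<bar>conv (P (r n)) (eta (inverse (real (Suc N)))) x - conv (P (r m)) (eta (inverse (real (Suc N)))) x\<bar> \<le> e)"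
proof -
  define W where "W N s \<longleftrightarrow> (\<forall>e>0. \<exists>J. \<forall>n\<ge>J. \<forall>m\<ge>J. \<forall>x\<in>U.
    \<bar>conv (P (s n)) (eta (inverse (real (Suc N)))) x - conv (P (s m)) (eta (inverse (real (Suc N)))) x\<bar> \<le> e)"
    for N and s :: "nat \<Rightarrow> nat"
  have "\<exists>r. strict_mono r \<and> (\<forall>N. W N r)"
  proof (rule diagonal_subseq)
    fix n :: nat and s :: "nat \<Rightarrow> nat"
    show "\<exists>r. strict_mono r \<and> W n (s \<circ> r)"
      unfolding W_def comp_def
      by (rule mollified_subseq[where P="\<lambda>n. P (s n)", OF U P M bd]) simp
  next
    fix n and r s :: "nat \<Rightarrow> nat" assume r: "strict_mono r" and W: "W n s"
    show "W n (s \<circ> r)" unfolding W_def comp_def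
    proof (intro allI impI)
      fix e :: real assume "e > 0"
      then obtain J where J: "\<forall>i\<ge>J. \<forall>m\<ge>J. \<forall>x\<in>U. \<bar>conv (P (s i)) (eta (inverse (real (Suc n)))) x - conv (P (s m)) (eta (inverse (real (Suc n)))) x\<bar> \<le> e"
        using W unfolding W_def by blast
      have "J \<le> r i" if "J \<le> i" for i using seq_suble[OF r, of i] that by simp
      then show "\<exists>J. \<forall>i\<ge>J. \<forall>m\<ge>J. \<forall>x\<in>U. \<bar>conv (P (s (r i))) (eta (inverse (real (Suc n)))) x - conv (P (s (r m))) (eta (inverse (real (Suc n)))) x\<bar> \<le> e"
        using J by blast
    qed
  next
    fix n and s :: "nat \<Rightarrow> nat" and k assume W: "W n (s \<circ> (+) k)"
    show "W n s" unfolding W_def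
    proof (intro allI impI)
      fix e :: real assume "e > 0"
      then obtain J where J: "\<forall>i\<ge>J. \<forall>m\<ge>J. \<forall>x\<in>U. \<bar>conv (P (s (k + i))) (eta (inverse (real (Suc n)))) x - conv (P (s (k + m))) (eta (inverse (real (Suc n)))) x\<bar> \<le> e"
        using W unfolding W_def comp_def by blast
      have "J \<le> i - k \<and> k + (i - k) = i" if "J + k \<le> i" for i using that by simp
      then show "\<exists>J. \<forall>i\<ge>J. \<forall>m\<ge>J. \<forall>x\<in>U. \<bar>conv (P (s i)) (eta (inverse (real (Suc n)))) x - conv (P (s m)) (eta (inverse (real (Suc n)))) x\<bar> \<le> e"
        using J by (metis (no_types, opaque_lifting))
    qed
  qed
  then obtain r where r: "strict_mono r" "\<And>N. W N r" by blast
  show ?thesis by (intro exI[of _ r] conjI r(1) allI impI) (rule r(2)[unfolded W_def, rule_format])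
qed

text \<open>Here the pieces meet: the differences of \<open>P\<close>, \<open>Q\<close>,
  \<open>R\<close> have the gap as determinant and are dominated by \<open>M\<close>. Everything is
  cut off outside \<open>U\<close>, so that all functions are integrable over the plane.\<close>

section \<open>The conclusion on compact sets\<close>

lemma local_AE_subseq:
  fixes k l :: "real \<times> real \<Rightarrow> real" and f g :: "real \<Rightarrow> real \<Rightarrow> real" and v :: "nat \<Rightarrow> real \<times> real \<Rightarrow> real"
  assumes ab: "a < b"
    and k: "k \<in> borel_measurable borel" "\<And>p. k p \<in> {\<alpha>..\<beta>}" and l: "l \<in> borel_measurable borel" "\<And>p. l p \<in> {\<alpha>..\<beta>}"
    and v: "\<And>n. v n \<in> borel_measurable borel" "\<And>n p. v n p \<in> {a..b}"
    and f: "\<And>\<kappa>. \<kappa> \<in> {\<alpha>..\<beta>} \<Longrightarrow> Ck_Icc 2 a b (f \<kappa>)" "\<And>u. u \<in> {a..b} \<Longrightarrow> Ck_Icc 1 \<alpha> \<beta> (\<lambda>\<kappa>. f \<kappa> u)"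
    and g: "\<And>\<kappa>. \<kappa> \<in> {\<alpha>..\<beta>} \<Longrightarrow> Ck_Icc 2 a b (g \<kappa>)" "\<And>u. u \<in> {a..b} \<Longrightarrow> Ck_Icc 1 \<alpha> \<beta> (\<lambda>\<kappa>. g \<kappa> u)"
    and nl: "nowhere_affine_pair \<alpha> \<beta> a b f g \<or> null_critical_pair \<alpha> \<beta> a b f g"
    and U: "open U" "bounded U" and K: "compact K" "K \<subseteq> U"
    and int: "integrable lborel (\<lambda>p. indicator U p * (prim_sq a b f (k p) b + prim_sq a b g (l p) b))"
    and div1: "\<And>e. e > 0 \<Longrightarrow> \<exists>N. \<forall>n\<ge>N. \<forall>m\<ge>N. \<forall>\<phi>\<in>test_functions U.
      \<bar>distr_div U (\<lambda>p. prim_sq a b f (k p) (v n p)) (\<lambda>p. prim_mix a b f g (k p) (l p) (v n p)) \<phi>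
        - distr_div U (\<lambda>p. prim_sq a b f (k p) (v m p)) (\<lambda>p. prim_mix a b f g (k p) (l p) (v m p)) \<phi>\<bar> \<le> e * test_norm \<phi>"
    and div2: "\<And>e. e > 0 \<Longrightarrow> \<exists>N. \<forall>n\<ge>N. \<forall>m\<ge>N. \<forall>\<phi>\<in>test_functions U.
      \<bar>distr_div U (\<lambda>p. prim_mix a b f g (k p) (l p) (v n p)) (\<lambda>p. prim_sq a b g (l p) (v n p)) \<phi>
        - distr_div U (\<lambda>p. prim_mix a b f g (k p) (l p) (v m p)) (\<lambda>p. prim_sq a b g (l p) (v m p)) \<phi>\<bar> \<le> e * test_norm \<phi>"
  shows "\<exists>r. strict_mono r \<and> (AE x in lborel. x \<in> K \<longrightarrow> convergent (\<lambda>n. v (r n) x))"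
proof -
  define F where "F p = deriv_Icc a b (f (k p))" for p
  define G where "G p = deriv_Icc a b (g (l p))" for p
  have Fm: "(\<lambda>p. F p u) \<in> borel_measurable borel" if "u \<in> {a..b}" for u
    unfolding F_def by (rule deriv_Icc_measurable[OF ab f k that])
  have Gm: "(\<lambda>p. G p u) \<in> borel_measurable borel" if "u \<in> {a..b}" for u
    unfolding G_def by (rule deriv_Icc_measurable[OF ab g l that])
  have Fc: "continuous_on {a..b} (F p)" for p unfolding F_def by (rule Ck2_deriv(2)[OF f(1)[OF k(2)]])
  have Gc: "continuous_on {a..b} (G p)" for p unfolding G_def by (rule Ck2_deriv(2)[OF g(1)[OF l(2)]])
  have eqs: "prim_sq a b f (k p) u = integral {a..u} (\<lambda>s. F p s * F p s)" "prim_sq a b g (l p) u = integral {a..u} (\<lambda>s. G p s * G p s)"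
    "prim_mix a b f g (k p) (l p) u = integral {a..u} (\<lambda>s. F p s * G p s)" for p u
    by (simp_all add: prim_sq_def prim_mix_def F_def G_def power2_eq_square)
  define M where "M p = indicator U p * integral {a..b} (\<lambda>s. F p s * F p s + G p s * G p s)" for p
  define P where "P n p = indicator U p * integral {a..v n p} (\<lambda>s. F p s * F p s)" for n p
  define Q where "Q n p = indicator U p * integral {a..v n p} (\<lambda>s. F p s * G p s)" for n p
  define R where "R n p = indicator U p * integral {a..v n p} (\<lambda>s. G p s * G p s)" for n p
  have bb: "integral {a..b} (\<lambda>s. F p s * F p s + G p s * G p s) = prim_sq a b f (k p) b + prim_sq a b g (l p) b" for p
    unfolding eqs by (intro Henstock_Kurzweil_Integration.integral_add integrable_continuous_interval continuous_intros Fc Gc)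
  have Mi: "integrable lborel M" using int by (simp add: M_def[abs_def] bb)
  have [measurable]: "U \<in> sets borel" using U by simp
  have meas: "P n \<in> borel_measurable borel" "Q n \<in> borel_measurable borel" "R n \<in> borel_measurable borel" for n
    unfolding P_def Q_def R_def using primitive_measurable[OF ab Fm Fc Fm Fc v] primitive_measurable[OF ab Fm Fc Gm Gc v]
      primitive_measurable[OF ab Gm Gc Gm Gc v] by measurable
  have ch: "continuous_on {a..b} (\<lambda>s. F p s * F p s + G p s * G p s)" for p by (intro continuous_intros Fc Gc)
  have am: "\<bar>x * y\<bar> \<le> x * x + y * y" for x y :: real
  proof -
    have "2 * (\<bar>x\<bar> * \<bar>y\<bar>) \<le> x * x + y * y"
      using sum_squares_bound[of "\<bar>x\<bar>" "\<bar>y\<bar>"] by (simp add: power2_eq_square mult.assoc)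
    moreover have "0 \<le> \<bar>x\<bar> * \<bar>y\<bar>" by simp
    ultimately show ?thesis unfolding abs_mult by linarith
  qed
  have dom: "\<bar>integral {a..u} (\<lambda>s. F p s * F p s) - integral {a..w} (\<lambda>s. F p s * F p s)\<bar> \<le> integral {a..b} (\<lambda>s. F p s * F p s + G p s * G p s)"
    "\<bar>integral {a..u} (\<lambda>s. F p s * G p s) - integral {a..w} (\<lambda>s. F p s * G p s)\<bar> \<le> integral {a..b} (\<lambda>s. F p s * F p s + G p s * G p s)"
    "\<bar>integral {a..u} (\<lambda>s. G p s * G p s) - integral {a..w} (\<lambda>s. G p s * G p s)\<bar> \<le> integral {a..b} (\<lambda>s. F p s * F p s + G p s * G p s)"
    if "u \<in> {a..b}" "w \<in> {a..b}" for p u w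
    by (rule integral_initial_diff_bound[OF _ ch _ that], intro continuous_intros Fc Gc, simp add: am)+
  have bd: "\<bar>P n x - P m x\<bar> \<le> M x" "\<bar>Q n x - Q m x\<bar> \<le> M x" "\<bar>R n x - R m x\<bar> \<le> M x" for n m x
    unfolding P_def Q_def R_def M_def using dom[OF v(2)[of n x] v(2)[of m x], of x] by (simp_all add: indicator_def)
  have a0: "a \<in> {a..b}" using ab by simp
  have bd0: "\<bar>P n x\<bar> \<le> M x" "\<bar>Q n x\<bar> \<le> M x" "\<bar>R n x\<bar> \<le> M x" for n x
    unfolding P_def Q_def R_def M_def using dom[OF v(2)[of n x] a0, of x] by (simp_all add: indicator_def)
  have int: "integrable lborel (P n)" "integrable lborel (Q n)" "integrable lborel (R n)" for n
  proof -
    have "integrable lborel h" if h: "h \<in> borel_measurable borel" "\<And>x. \<bar>h x\<bar> \<le> M x" for h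
      by (rule Bochner_Integration.integrable_bound[OF Mi]) (use h in \<open>auto intro!: AE_I2 intro: order_trans[OF _ abs_ge_self]\<close>)
    then show "integrable lborel (P n)" "integrable lborel (Q n)" "integrable lborel (R n)" using meas bd0 by blast+
  qed
  have gp: "(P n x - P m x) * (R n x - R m x) - (Q n x - Q m x)\<^sup>2 = indicator U x * gap a (F x) (G x) (v n x) (v m x)" for n m x
    by (simp add: P_def Q_def R_def gap_def indicator_def)
  have dist: "\<bar>distr_div U A B \<phi> - distr_div U A' B' \<phi>\<bar>
      = \<bar>LINT z|lborel. (indicator U z * A z - indicator U z * A' z) * partial_x \<phi> z + (indicator U z * B z - indicator U z * B' z) * partial_y \<phi> z\<bar>"
    if \<phi>: "\<phi> \<in> test_functions U" and m: "A \<in> borel_measurable borel" "A' \<in> borel_measurable borel" "B \<in> borel_measurable borel" "B' \<in> borel_measurable borel"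
      and i: "integrable lborel (\<lambda>z. indicator U z * A z)" "integrable lborel (\<lambda>z. indicator U z * A' z)"
        "integrable lborel (\<lambda>z. indicator U z * B z)" "integrable lborel (\<lambda>z. indicator U z * B' z)"
    for \<phi> A A' B B'
  proof -
    have e: "distr_partial U d h \<phi> = - (LINT z|lborel. indicator U z * h z * partial d \<phi> z)"
      if "h \<in> borel_measurable borel" "partial d \<phi> \<in> test_functions U" for h d
      unfolding distr_partial_def using LINT_lebesgue_on_open[OF U(1), of "\<lambda>z. h z * partial d \<phi> z"] that(1) test_measurable[OF that(2)]
      by (simp add: mult.assoc)
    note t = test_partial[OF \<phi>]
    have j: "integrable lborel (\<lambda>z. indicator U z * h z * \<psi> z)"
      if "integrable lborel (\<lambda>z. indicator U z * h z)" "\<psi> \<in> test_functions U" for h \<psi>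
      by (rule test_times_integrable[OF that])
    show ?thesis unfolding distr_div_def e[OF m(1) t(1)] e[OF m(2) t(1)] e[OF m(3) t(2)] e[OF m(4) t(2)]
      using j[OF i(1) t(1)] j[OF i(2) t(1)] j[OF i(3) t(2)] j[OF i(4) t(2)]
      by (simp add: left_diff_distrib)
  qed
  define dP where "dP n = distr_div U (\<lambda>p. prim_sq a b f (k p) (v n p)) (\<lambda>p. prim_mix a b f g (k p) (l p) (v n p))" for n
  define dR where "dR n = distr_div U (\<lambda>p. prim_mix a b f g (k p) (l p) (v n p)) (\<lambda>p. prim_sq a b g (l p) (v n p))" for n
  note pm = primitive_measurable[OF ab Fm Fc Fm Fc v] primitive_measurable[OF ab Fm Fc Gm Gc v] primitive_measurable[OF ab Gm Gc Gm Gc v]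
  have ints: "integrable lborel (\<lambda>z. indicator U z * integral {a..v n z} (\<lambda>s. F z s * F z s))"
    "integrable lborel (\<lambda>z. indicator U z * integral {a..v n z} (\<lambda>s. F z s * G z s))"
    "integrable lborel (\<lambda>z. indicator U z * integral {a..v n z} (\<lambda>s. G z s * G z s))" for n
    using int[of n] by (simp_all add: P_def[abs_def] Q_def[abs_def] R_def[abs_def])
  have dP: "\<bar>dP n \<phi> - dP m \<phi>\<bar> = \<bar>LINT z|lborel. (P n z - P m z) * partial_x \<phi> z + (Q n z - Q m z) * partial_y \<phi> z\<bar>"
    if "\<phi> \<in> test_functions U" for n m \<phi>
    unfolding dP_def eqs P_def Q_def by (rule dist[OF that pm(1) pm(1) pm(2) pm(2) ints(1) ints(1) ints(2) ints(2)]; assumption)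
  have dR: "\<bar>dR n \<phi> - dR m \<phi>\<bar> = \<bar>LINT z|lborel. (Q n z - Q m z) * partial_x \<phi> z + (R n z - R m z) * partial_y \<phi> z\<bar>"
    if "\<phi> \<in> test_functions U" for n m \<phi>
    unfolding dR_def eqs R_def Q_def by (rule dist[OF that pm(2) pm(2) pm(3) pm(3) ints(2) ints(2) ints(3) ints(3)]; assumption)
  \<comment> \<open>one subsequence for the mollifications of \<open>P\<close>, and a further one for those of \<open>Q\<close>\<close>
  obtain r1 where r1: "strict_mono (r1 :: nat \<Rightarrow> nat)" and w1: "\<And>N e. e > 0 \<Longrightarrow> \<exists>J. \<forall>n\<ge>J. \<forall>m\<ge>J. \<forall>x\<in>U.
    \<bar>conv (P (r1 n)) (eta (inverse (real (Suc N)))) x - conv (P (r1 m)) (eta (inverse (real (Suc N)))) x\<bar> \<le> e"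
    using all_mollified_subseq[where P=P, OF U(2) int(1) Mi bd0(1)] by (elim exE conjE) (rule that, assumption, blast)
  obtain r2 where r2: "strict_mono (r2 :: nat \<Rightarrow> nat)" and w2: "\<And>N e. e > 0 \<Longrightarrow> \<exists>J. \<forall>n\<ge>J. \<forall>m\<ge>J. \<forall>x\<in>U.
    \<bar>conv (Q (r1 (r2 n))) (eta (inverse (real (Suc N)))) x - conv (Q (r1 (r2 m))) (eta (inverse (real (Suc N)))) x\<bar> \<le> e"
    using all_mollified_subseq[where P="\<lambda>n. Q (r1 n)", OF U(2) int(2) Mi bd0(2)] by (elim exE conjE) (rule that, assumption, blast)
  define r where "r n = r1 (r2 n)" for n
  have r: "strict_mono r" using strict_mono_o[OF r1 r2] by (simp add: r_def[abs_def] comp_def)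
  have rge: "n \<le> r n" for n by (rule seq_suble[OF r])
  have "\<exists>s. strict_mono s \<and> (AE x in lborel. x \<in> K \<longrightarrow> convergent (\<lambda>n. v (r (s n)) x))"
  proof (rule gap_in_measure_AE_subseq[where v="\<lambda>n. v (r n)" and D="\<lambda>x. gap a (F x) (G x)" and M=M and a=a and b=b, OF K(1) v(1) v(2)])
    show "M \<in> borel_measurable borel" using Mi by auto
    show "(\<lambda>x. gap a (F x) (G x) (v (r n) x) (v (r m) x)) \<in> borel_measurable borel" for n m
      unfolding gap_def using primitive_measurable[OF ab Fm Fc Fm Fc v] primitive_measurable[OF ab Fm Fc Gm Gc v]
      primitive_measurable[OF ab Gm Gc Gm Gc v] by measurable
    show "continuous_on ({a..b} \<times> {a..b}) (\<lambda>z. gap a (F x) (G x) (fst z) (snd z))" for x by (rule gap_continuous[OF Fc Gc])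
    show "0 < gap a (F x) (G x) u w" if "u \<in> {a..b}" "w \<in> {a..b}" "u \<noteq> w" for x u w
      unfolding F_def G_def by (rule gap_pos[where f=f and g=g, OF f(1)[OF k(2)] g(1)[OF l(2)] nl k(2) l(2) that])
    fix c lam zet :: real assume c: "0 \<le> c" and lam: "0 < lam" and zet: "0 < zet"
    have "\<exists>J. \<forall>n\<ge>J. \<forall>m\<ge>J. measure lborel {x \<in> K. M x \<le> c \<and> lam < (P (r n) x - P (r m) x) * (R (r n) x - R (r m) x) - (Q (r n) x - Q (r m) x)\<^sup>2} \<le> zet"
    proof (rule determinant_cauchy_in_measure[where P="\<lambda>n. P (r n)" and Q="\<lambda>n. Q (r n)" and R="\<lambda>n. R (r n)", OF U int Mi bd _ _ _ _ K c lam zet])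
      show "0 \<le> (P (r n) x - P (r m) x) * (R (r n) x - R (r m) x) - (Q (r n) x - Q (r m) x)\<^sup>2" for n m x
        unfolding gp using gap_nonneg[OF Fc Gc v(2) v(2)] by simp
      fix e :: real assume e: "e > 0"
      obtain N where N: "\<And>n m \<phi>. n \<ge> N \<Longrightarrow> m \<ge> N \<Longrightarrow> \<phi> \<in> test_functions U \<Longrightarrow> \<bar>dP n \<phi> - dP m \<phi>\<bar> \<le> e * test_norm \<phi>"
        using div1[OF e] unfolding dP_def by blast
      show "\<exists>N. \<forall>n\<ge>N. \<forall>m\<ge>N. \<forall>\<phi>\<in>test_functions U.
        \<bar>LINT z|lborel. (P (r n) z - P (r m) z) * partial_x \<phi> z + (Q (r n) z - Q (r m) z) * partial_y \<phi> z\<bar> \<le> e * test_norm \<phi>"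
      proof (intro exI[of _ N] allI impI ballI)
        fix n m \<phi> assume "N \<le> n" "N \<le> m" and \<phi>: "\<phi> \<in> test_functions U"
        then have "N \<le> r n" "N \<le> r m" using rge le_trans by blast+
        from N[OF this \<phi>]
        show "\<bar>LINT z|lborel. (P (r n) z - P (r m) z) * partial_x \<phi> z + (Q (r n) z - Q (r m) z) * partial_y \<phi> z\<bar> \<le> e * test_norm \<phi>"
          unfolding dP[OF \<phi>] .
      qed
      obtain N where N: "\<And>n m \<phi>. n \<ge> N \<Longrightarrow> m \<ge> N \<Longrightarrow> \<phi> \<in> test_functions U \<Longrightarrow> \<bar>dR n \<phi> - dR m \<phi>\<bar> \<le> e * test_norm \<phi>"
        using div2[OF e] unfolding dR_def by blast
      show "\<exists>N. \<forall>n\<ge>N. \<forall>m\<ge>N. \<forall>\<phi>\<in>test_functions U.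
        \<bar>LINT z|lborel. (Q (r n) z - Q (r m) z) * partial_x \<phi> z + (R (r n) z - R (r m) z) * partial_y \<phi> z\<bar> \<le> e * test_norm \<phi>"
      proof (intro exI[of _ N] allI impI ballI)
        fix n m \<phi> assume "N \<le> n" "N \<le> m" and \<phi>: "\<phi> \<in> test_functions U"
        then have "N \<le> r n" "N \<le> r m" using rge le_trans by blast+
        from N[OF this \<phi>]
        show "\<bar>LINT z|lborel. (Q (r n) z - Q (r m) z) * partial_x \<phi> z + (R (r n) z - R (r m) z) * partial_y \<phi> z\<bar> \<le> e * test_norm \<phi>"
          unfolding dR[OF \<phi>] .
      qed
      fix N :: nat
      define cP where "cP n = conv (P (r n)) (eta (inverse (real (Suc N))))" for n
      define cQ where "cQ n = conv (Q (r n)) (eta (inverse (real (Suc N))))" for n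
      obtain J1 where J1: "\<And>n m x. n \<ge> J1 \<Longrightarrow> m \<ge> J1 \<Longrightarrow> x \<in> U \<Longrightarrow>
        \<bar>conv (P (r1 n)) (eta (inverse (real (Suc N)))) x - conv (P (r1 m)) (eta (inverse (real (Suc N)))) x\<bar> \<le> e"
        using w1[OF e, of N] by blast
      obtain J2 where J2: "\<And>n m x. n \<ge> J2 \<Longrightarrow> m \<ge> J2 \<Longrightarrow> x \<in> U \<Longrightarrow> \<bar>cQ n x - cQ m x\<bar> \<le> e"
        using w2[OF e, of N] unfolding cQ_def r_def by blast
      have J1': "\<bar>cP n x - cP m x\<bar> \<le> e" if "n \<ge> J1" "m \<ge> J1" "x \<in> U" for n m x
        unfolding cP_def r_def by (rule J1[OF order_trans[OF that(1) seq_suble[OF r2]] order_trans[OF that(2) seq_suble[OF r2]] that(3)])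
      have "\<exists>J. \<forall>n\<ge>J. \<forall>m\<ge>J. \<forall>x\<in>U. \<bar>cP n x - cP m x\<bar> \<le> e \<and> \<bar>cQ n x - cQ m x\<bar> \<le> e"
        by (intro exI[of _ "max J1 J2"]) (use J1' J2 in simp)
      then show "\<exists>J. \<forall>n\<ge>J. \<forall>m\<ge>J. \<forall>x\<in>U.
        \<bar>conv (P (r n)) (eta (inverse (real (Suc N)))) x - conv (P (r m)) (eta (inverse (real (Suc N)))) x\<bar> \<le> e \<and>
        \<bar>conv (Q (r n)) (eta (inverse (real (Suc N)))) x - conv (Q (r m)) (eta (inverse (real (Suc N)))) x\<bar> \<le> e"
        unfolding cP_def cQ_def .
    qed
    moreover have "{x \<in> K. M x \<le> c \<and> lam < (P (r n) x - P (r m) x) * (R (r n) x - R (r m) x) - (Q (r n) x - Q (r m) x)\<^sup>2}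
      = {x \<in> K. M x \<le> c \<and> lam < gap a (F x) (G x) (v (r n) x) (v (r m) x)}" for n m
      unfolding gp by (rule Collect_cong, rule conj_cong[OF refl]) (use K(2) in \<open>simp add: subset_iff indicator_def split: if_splits; blast\<close>)
    ultimately show "\<exists>J. \<forall>n\<ge>J. \<forall>m\<ge>J. measure lborel {x \<in> K. M x \<le> c \<and> lam < gap a (F x) (G x) (v (r n) x) (v (r m) x)} \<le> zet"
      by simp
  qed
  then obtain s where s: "strict_mono (s :: nat \<Rightarrow> nat)" "AE x in lborel. x \<in> K \<longrightarrow> convergent (\<lambda>n. v (r (s n)) x)" by blast
  show ?thesis
    by (intro exI[of _ "\<lambda>n. r (s n)"] conjI s(2)) (use strict_mono_o[OF r s(1)] in \<open>simp add: comp_def\<close>)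
qed

lemma prim_mix_measurable:
  fixes k l v :: "real \<times> real \<Rightarrow> real" and f g :: "real \<Rightarrow> real \<Rightarrow> real"
  assumes ab: "a < b"
    and k: "k \<in> borel_measurable borel" "\<And>p. k p \<in> {\<alpha>..\<beta>}" and l: "l \<in> borel_measurable borel" "\<And>p. l p \<in> {\<alpha>..\<beta>}"
    and v: "v \<in> borel_measurable borel" "\<And>p. v p \<in> {a..b}"
    and f: "\<And>\<kappa>. \<kappa> \<in> {\<alpha>..\<beta>} \<Longrightarrow> Ck_Icc 2 a b (f \<kappa>)" "\<And>u. u \<in> {a..b} \<Longrightarrow> Ck_Icc 1 \<alpha> \<beta> (\<lambda>\<kappa>. f \<kappa> u)"
    and g: "\<And>\<kappa>. \<kappa> \<in> {\<alpha>..\<beta>} \<Longrightarrow> Ck_Icc 2 a b (g \<kappa>)" "\<And>u. u \<in> {a..b} \<Longrightarrow> Ck_Icc 1 \<alpha> \<beta> (\<lambda>\<kappa>. g \<kappa> u)"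
  shows "(\<lambda>p. prim_mix a b f g (k p) (l p) (v p)) \<in> borel_measurable borel"
  unfolding prim_mix_def
  by (rule primitive_measurable[OF ab _ _ _ _ v])
    (use deriv_Icc_measurable[OF ab f k] deriv_Icc_measurable[OF ab g l] Ck2_deriv(2)[OF f(1)[OF k(2)]] Ck2_deriv(2)[OF g(1)[OF l(2)]] in blast)+

lemma prim_sq_eq_prim_mix: "prim_sq a b f \<kappa> u = prim_mix a b f f \<kappa> \<kappa> u"
  by (simp add: prim_sq_def prim_mix_def power2_eq_square)

text \<open>Clamping to the interval changes the function only on a null set and gives bounds that
  hold everywhere.\<close>

lemma borel_version:
  assumes h: "h \<in> borel_measurable lebesgue" and \<alpha>: "\<alpha> \<le> \<beta>"
  shows "\<exists>h'\<in>borel_measurable borel. (\<forall>p. h' p \<in> {\<alpha>..\<beta>}) \<and> (AE p in lborel. \<alpha> \<le> h p \<and> h p \<le> \<beta> \<longrightarrow> h' p = (h p :: real))"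
proof -
  obtain g where g: "g \<in> borel_measurable lborel" "AE x in lborel. h x = g x" using completion_ex_borel_measurable_real[OF h] by blast
  show ?thesis
  proof (intro bexI conjI allI)
    show "max \<alpha> (min \<beta> (g p)) \<in> {\<alpha>..\<beta>}" for p using \<alpha> by simp
    show "AE p in lborel. \<alpha> \<le> h p \<and> h p \<le> \<beta> \<longrightarrow> max \<alpha> (min \<beta> (g p)) = h p" using g(2) by eventually_elim auto
    show "(\<lambda>p. max \<alpha> (min \<beta> (g p))) \<in> borel_measurable borel" using g(1) by measurable
  qed
qed

text \<open>A test function on \<open>U\<close> sees only the values on \<open>U\<close>, and these
  only up to null sets.\<close>

lemma distr_partial_restrict:
  assumes \<Omega>: "open \<Omega>" and U: "open U" "U \<subseteq> \<Omega>" and \<phi>: "partial e \<phi> \<in> test_functions U" and A: "A \<in> borel_measurable borel"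
    and eq: "AE p in lborel. p \<in> \<Omega> \<longrightarrow> A p = A0 p"
  shows "distr_partial \<Omega> e A0 \<phi> = distr_partial U e A \<phi>"
proof -
  note [measurable] = A test_measurable[OF \<phi>]
  have \<Omega>l: "\<Omega> \<in> sets lebesgue" using \<Omega> by (intro sets_completionI_sets) simp
  have ae: "AE p in lebesgue. (if p \<in> \<Omega> then A p * partial e \<phi> p else 0) = (if p \<in> \<Omega> then A0 p * partial e \<phi> p else 0)"
    using AE_completion[OF eq] by eventually_elim auto
  have m: "(\<lambda>p. A p * partial e \<phi> p) \<in> borel_measurable (lebesgue_on \<Omega>)"
    by (intro measurable_restrict_space1 measurable_completion) measurable
  have m0: "(\<lambda>p. A0 p * partial e \<phi> p) \<in> borel_measurable (lebesgue_on \<Omega>)"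
    using borel_measurable_AE[OF borel_measurable_if_I[OF m \<Omega>l] ae] unfolding borel_measurable_if[OF \<Omega>l] .
  have "(LINT p|lebesgue_on \<Omega>. A0 p * partial e \<phi> p) = (LINT p|lebesgue_on \<Omega>. A p * partial e \<phi> p)"
  proof (rule integral_cong_AE[OF m0 m])
    have "AE p in lebesgue. p \<in> \<Omega> \<longrightarrow> A0 p * partial e \<phi> p = A p * partial e \<phi> p"
      using AE_completion[OF eq] by eventually_elim auto
    then show "AE p in lebesgue_on \<Omega>. A0 p * partial e \<phi> p = A p * partial e \<phi> p"
      using \<Omega>l by (subst AE_restrict_space_iff) auto
  qed
  also have "\<dots> = (LINT p|lborel. A p * partial e \<phi> p)"
    by (rule LINT_lebesgue_on_test[OF \<Omega>]) (measurable, use test_zero_outside[OF \<phi>] U(2) in auto)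
  also have "\<dots> = (LINT p|lebesgue_on U. A p * partial e \<phi> p)"
    by (rule sym, rule LINT_lebesgue_on_test[OF U(1)]) (measurable, use test_zero_outside[OF \<phi>] in auto)
  finally show ?thesis by (simp add: distr_partial_def)
qed

lemma compact_open_neighbourhood:
  fixes K :: "(real \<times> real) set"
  assumes "compact K" "open \<Omega>" "K \<subseteq> \<Omega>"
  obtains U where "open U" "bounded U" "K \<subseteq> U" "compact (closure U)" "closure U \<subseteq> \<Omega>"
proof -
  obtain r where r: "r > 0" "\<And>x. x \<in> K \<Longrightarrow> cball x r \<subseteq> \<Omega>" using compact_in_open_thickening[OF assms] by metis
  define C where "C = {x + y |x y. x \<in> K \<and> y \<in> cball 0 r}"
  have C: "compact C" unfolding C_def by (rule compact_sums[OF assms(1)]) simp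
  define U where "U = (\<Union>x\<in>K. ball x r)"
  have UC: "U \<subseteq> C"
  proof
    fix z assume "z \<in> U"
    then obtain x where "x \<in> K" "z \<in> ball x r" by (auto simp only: U_def)
    then have "z = x + (z - x) \<and> x \<in> K \<and> z - x \<in> cball 0 r" by (simp add: dist_norm norm_minus_commute)
    then show "z \<in> C" unfolding C_def by blast
  qed
  have C\<Omega>: "C \<subseteq> \<Omega>"
  proof
    fix z assume "z \<in> C"
    then obtain x y where z: "z = x + y" "x \<in> K" "y \<in> cball 0 r" unfolding C_def by blast
    then have "z \<in> cball x r" by (simp add: dist_norm)
    then show "z \<in> \<Omega>" using r(2)[OF z(2)] by blast
  qed
  have cl: "closure U \<subseteq> C" using UC C by (simp add: closure_minimal compact_imp_closed)
  show ?thesis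
  proof (rule that[of U])
    show "open U" unfolding U_def by blast
    show "bounded U" using UC C compact_imp_bounded bounded_subset by blast
    show "K \<subseteq> U" unfolding U_def using r(1) by (intro subsetI UN_I) auto
    show "closure U \<subseteq> \<Omega>" using cl C\<Omega> by blast
    show "compact (closure U)" using \<open>bounded U\<close> by (simp add: compact_closure)
  qed
qed

section \<open>Strong compactness\<close>

theorem lemma3p2:
  fixes \<Omega> :: "(real \<times> real) set"
    and \<alpha> \<beta> a b :: real
    and k l :: "real \<times> real \<Rightarrow> real"
    and f g :: "real \<Rightarrow> real \<Rightarrow> real"
    and \<rho> :: "nat \<Rightarrow> real"
    and v :: "real \<Rightarrow> real \<times> real \<Rightarrow> real"
  assumes "open \<Omega>" and "\<alpha> < \<beta>" and "a < b"
    and "k \<in> Linfty lebesgue \<inter> BV_plane" and "l \<in> Linfty lebesgue \<inter> BV_plane"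
    and "AE p in lebesgue. \<alpha> \<le> k p \<and> k p \<le> \<beta>" and "AE p in lebesgue. \<alpha> \<le> l p \<and> l p \<le> \<beta>"
    and "\<forall>\<kappa>\<in>{\<alpha>..\<beta>}. Ck_Icc 2 a b (f \<kappa>)" and "\<forall>\<mu>\<in>{\<alpha>..\<beta>}. Ck_Icc 2 a b (g \<mu>)"
    and "\<forall>u\<in>{a..b}. Ck_Icc 1 \<alpha> \<beta> (\<lambda>\<kappa>. f \<kappa> u)" and "\<forall>u\<in>{a..b}. Ck_Icc 1 \<alpha> \<beta> (\<lambda>\<mu>. g \<mu> u)"
    and "nowhere_affine_pair \<alpha> \<beta> a b f g \<or> null_critical_pair \<alpha> \<beta> a b f g"
    and "\<forall>\<kappa>\<in>{\<alpha>..\<beta>}. f \<kappa> a = 0 \<and> f \<kappa> b = 0" and "\<forall>\<mu>\<in>{\<alpha>..\<beta>}. g \<mu> a = 0 \<and> g \<mu> b = 0"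
    (* implicit in the original: the sequences below are distributions on \<Omega> *)
    and "loc_integrable \<Omega> (\<lambda>p. prim_sq a b f (k p) b)"
    and "loc_integrable \<Omega> (\<lambda>p. prim_sq a b g (l p) b)"
    and "\<forall>n. \<rho> n > 0" and "\<rho> \<longlonglongrightarrow> 0"
    and "\<forall>n. v (\<rho> n) \<in> borel_measurable (lebesgue_on \<Omega>)"
    and "\<forall>n. AE p in lebesgue_on \<Omega>. a \<le> v (\<rho> n) p \<and> v (\<rho> n) p \<le> b"
    and "precompact_W_minus12_loc \<Omega> (range (\<lambda>n. distr_div \<Omega>
           (\<lambda>p. prim_sq a b f (k p) (v (\<rho> n) p))
           (\<lambda>p. prim_mix a b f g (k p) (l p) (v (\<rho> n) p))))"
    and "precompact_W_minus12_loc \<Omega> (range (\<lambda>n. distr_div \<Omega>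
           (\<lambda>p. prim_mix a b f g (k p) (l p) (v (\<rho> n) p))
           (\<lambda>p. prim_sq a b g (l p) (v (\<rho> n) p))))"
  shows "\<exists>r w. strict_mono (r :: nat \<Rightarrow> nat) \<and> w \<in> Linfty (lebesgue_on \<Omega>) \<and>
    (AE p in lebesgue_on \<Omega>. (\<lambda>n. v (\<rho> (r n)) p) \<longlonglongrightarrow> w p) \<and>
    (AE p in lebesgue_on \<Omega>. a \<le> w p \<and> w p \<le> b)"
proof -
  note \<Omega> = assms(1) and ab = assms(3)
  have f: "\<And>\<kappa>. \<kappa> \<in> {\<alpha>..\<beta>} \<Longrightarrow> Ck_Icc 2 a b (f \<kappa>)" "\<And>u. u \<in> {a..b} \<Longrightarrow> Ck_Icc 1 \<alpha> \<beta> (\<lambda>\<kappa>. f \<kappa> u)"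
    using assms(8,10) by blast+
  have g: "\<And>\<kappa>. \<kappa> \<in> {\<alpha>..\<beta>} \<Longrightarrow> Ck_Icc 2 a b (g \<kappa>)" "\<And>u. u \<in> {a..b} \<Longrightarrow> Ck_Icc 1 \<alpha> \<beta> (\<lambda>\<kappa>. g \<kappa> u)"
    using assms(9,11) by blast+
  have \<Omega>l: "\<Omega> \<in> sets lebesgue" using \<Omega> by (intro sets_completionI_sets) simp
  have kl: "k \<in> borel_measurable lebesgue" "l \<in> borel_measurable lebesgue" using assms(4,5) by (auto simp: Linfty_def)
  \<comment> \<open>Borel representatives with values in the prescribed intervals everywhere\<close>
  obtain k' where k': "k' \<in> borel_measurable borel" "\<And>p. k' p \<in> {\<alpha>..\<beta>}" "AE p in lborel. \<alpha> \<le> k p \<and> k p \<le> \<beta> \<longrightarrow> k' p = k p"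
    using borel_version[OF kl(1) less_imp_le[OF assms(2)]] by blast
  obtain l' where l': "l' \<in> borel_measurable borel" "\<And>p. l' p \<in> {\<alpha>..\<beta>}" "AE p in lborel. \<alpha> \<le> l p \<and> l p \<le> \<beta> \<longrightarrow> l' p = l p"
    using borel_version[OF kl(2) less_imp_le[OF assms(2)]] by blast
  have ke: "AE p in lborel. k' p = k p" using k'(3) assms(6) unfolding AE_completion_iff by eventually_elim blast
  have le: "AE p in lborel. l' p = l p" using l'(3) assms(7) unfolding AE_completion_iff by eventually_elim blast
  have "\<exists>v'\<in>borel_measurable borel. (\<forall>p. v' p \<in> {a..b}) \<and> (AE p in lborel. p \<in> \<Omega> \<longrightarrow> v' p = v (\<rho> n) p)" for n
  proof -
    have vm: "v (\<rho> n) \<in> borel_measurable (lebesgue_on \<Omega>)" using assms(19) by blast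
    obtain v' where v': "v' \<in> borel_measurable borel" "\<And>p. v' p \<in> {a..b}"
      "AE p in lborel. a \<le> (if p \<in> \<Omega> then v (\<rho> n) p else 0) \<and> (if p \<in> \<Omega> then v (\<rho> n) p else 0) \<le> b \<longrightarrow> v' p = (if p \<in> \<Omega> then v (\<rho> n) p else 0)"
      using borel_version[OF borel_measurable_if_I[OF vm \<Omega>l] less_imp_le[OF ab]] by blast
    have "AE p in lebesgue_on \<Omega>. a \<le> v (\<rho> n) p \<and> v (\<rho> n) p \<le> b" using assms(20) by blast
    then have "AE p in lebesgue. p \<in> \<Omega> \<longrightarrow> a \<le> v (\<rho> n) p \<and> v (\<rho> n) p \<le> b" using \<Omega>l by (subst (asm) AE_restrict_space_iff) auto
    then have "AE p in lborel. p \<in> \<Omega> \<longrightarrow> v' p = v (\<rho> n) p"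
      using v'(3) unfolding AE_completion_iff by eventually_elim auto
    then show ?thesis using v'(1,2) by blast
  qed
  then have "\<forall>n. \<exists>v'. v' \<in> borel_measurable borel \<and> (\<forall>p. v' p \<in> {a..b}) \<and> (AE p in lborel. p \<in> \<Omega> \<longrightarrow> v' p = v (\<rho> n) p)" by blast
  from choice[OF this] obtain v' where v'0: "\<forall>n. v' n \<in> borel_measurable borel \<and> (\<forall>p. v' n p \<in> {a..b}) \<and> (AE p in lborel. p \<in> \<Omega> \<longrightarrow> v' n p = v (\<rho> n) p)" by blast
  have v': "v' n \<in> borel_measurable borel" "v' n p \<in> {a..b}" "AE p in lborel. p \<in> \<Omega> \<longrightarrow> v' n p = v (\<rho> n) p" for n p
    using v'0 by blast+
  define Fn Gn Hn where "Fn n p = prim_sq a b f (k' p) (v' n p)" and "Gn n p = prim_sq a b g (l' p) (v' n p)"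
    and "Hn n p = prim_mix a b f g (k' p) (l' p) (v' n p)" for n p
  have Fm: "Fn n \<in> borel_measurable borel" for n
    unfolding Fn_def[abs_def] prim_sq_eq_prim_mix by (rule prim_mix_measurable[OF ab k'(1,2) k'(1,2) v'(1,2) f f])
  have Gm: "Gn n \<in> borel_measurable borel" for n
    unfolding Gn_def[abs_def] prim_sq_eq_prim_mix by (rule prim_mix_measurable[OF ab l'(1,2) l'(1,2) v'(1,2) g g])
  have Hm: "Hn n \<in> borel_measurable borel" for n
    unfolding Hn_def[abs_def] by (rule prim_mix_measurable[OF ab k'(1,2) l'(1,2) v'(1,2) f g])
  have Fe: "AE p in lborel. p \<in> \<Omega> \<longrightarrow> Fn n p = prim_sq a b f (k p) (v (\<rho> n) p)" for n
    using ke v'(3)[of n] by eventually_elim (simp add: Fn_def)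
  have Ge: "AE p in lborel. p \<in> \<Omega> \<longrightarrow> Gn n p = prim_sq a b g (l p) (v (\<rho> n) p)" for n
    using le v'(3)[of n] by eventually_elim (simp add: Gn_def)
  have He: "AE p in lborel. p \<in> \<Omega> \<longrightarrow> Hn n p = prim_mix a b f g (k p) (l p) (v (\<rho> n) p)" for n
    using ke le v'(3)[of n] by eventually_elim (simp add: Hn_def)
  define T1 where "T1 n = distr_div \<Omega> (\<lambda>p. prim_sq a b f (k p) (v (\<rho> n) p)) (\<lambda>p. prim_mix a b f g (k p) (l p) (v (\<rho> n) p))" for n
  define T2 where "T2 n = distr_div \<Omega> (\<lambda>p. prim_mix a b f g (k p) (l p) (v (\<rho> n) p)) (\<lambda>p. prim_sq a b g (l p) (v (\<rho> n) p))" for n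
  have pc: "precompact_W_minus12_loc \<Omega> (range T1)" "precompact_W_minus12_loc \<Omega> (range T2)"
    using assms(21,22) unfolding T1_def T2_def by blast+
  define M where "M p = prim_sq a b f (k' p) b + prim_sq a b g (l' p) b" for p
  have bb: "b \<in> {a..b}" using ab by simp
  have Mm: "M \<in> borel_measurable borel"
    unfolding M_def[abs_def] prim_sq_eq_prim_mix
    by (intro borel_measurable_add prim_mix_measurable[OF ab k'(1,2) k'(1,2) _ _ f f] prim_mix_measurable[OF ab l'(1,2) l'(1,2) _ _ g g]) (use ab in auto)
  have compact_case: "\<exists>r. strict_mono r \<and> (AE x in lborel. x \<in> K \<longrightarrow> convergent (\<lambda>n. v' (s (r n)) x))"
    if K: "compact K" "K \<subseteq> \<Omega>" for K and s :: "nat \<Rightarrow> nat"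
  proof -
    obtain U where U: "open U" "bounded U" "K \<subseteq> U" "compact (closure U)" "closure U \<subseteq> \<Omega>"
      by (rule compact_open_neighbourhood[OF K(1) \<Omega> K(2)]) (rule that)
    have U\<Omega>: "U \<subseteq> \<Omega>" using U(5) closure_subset by blast
    have T1: "T1 n \<phi> = distr_div U (Fn n) (Hn n) \<phi>" if "\<phi> \<in> test_functions U" for n \<phi>
      unfolding T1_def distr_div_def
      using distr_partial_restrict[OF \<Omega> U(1) U\<Omega> test_partial(1)[OF that] Fm Fe] distr_partial_restrict[OF \<Omega> U(1) U\<Omega> test_partial(2)[OF that] Hm He]
      by simp
    have T2: "T2 n \<phi> = distr_div U (Hn n) (Gn n) \<phi>" if "\<phi> \<in> test_functions U" for n \<phi>
      unfolding T2_def distr_div_def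
      using distr_partial_restrict[OF \<Omega> U(1) U\<Omega> test_partial(1)[OF that] Hm He] distr_partial_restrict[OF \<Omega> U(1) U\<Omega> test_partial(2)[OF that] Gm Ge]
      by simp
    have int: "integrable lborel (\<lambda>p. indicator U p * M p)"
    proof -
      have "set_integrable lebesgue (closure U) (\<lambda>p. prim_sq a b f (k p) b)" "set_integrable lebesgue (closure U) (\<lambda>p. prim_sq a b g (l p) b)"
        using assms(15,16) U(4,5) unfolding loc_integrable_def by blast+
      then have "set_integrable lebesgue (closure U) (\<lambda>p. prim_sq a b f (k p) b + prim_sq a b g (l p) b)" by (rule set_integral_add)
      then have "integrable lebesgue (\<lambda>p. indicator (closure U) p * (prim_sq a b f (k p) b + prim_sq a b g (l p) b))"
        by (simp add: set_integrable_def)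
      moreover have "AE p in lebesgue. indicator (closure U) p * (prim_sq a b f (k p) b + prim_sq a b g (l p) b) = indicator (closure U) p * M p"
        using AE_completion[OF ke] AE_completion[OF le] by eventually_elim (simp add: M_def)
      moreover have cm: "(\<lambda>p. indicator (closure U) p * M p) \<in> borel_measurable lborel" using Mm by measurable
      ultimately have "integrable lebesgue (\<lambda>p. indicator (closure U) p * M p)"
        using integrable_cong_AE_imp[OF _ measurable_completion[OF cm]] by blast
      then have "integrable lborel (\<lambda>p. indicator (closure U) p * M p)" using integrable_completion[OF cm] by blast
      from integrable_mult_indicator[OF _ this, of U] have "integrable lborel (\<lambda>p. indicator U p * (indicator (closure U) p * M p))"
        using U(1) by simp
      moreover have "indicator U p * (indicator (closure U) p * M p) = indicator U p * M p" for p
        using subsetD[OF closure_subset, of p U] by (simp add: indicator_def)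
      ultimately show ?thesis by simp
    qed
    \<comment> \<open>compactness for the first sequence of divergences, then for the second\<close>
    obtain r1 where r1: "strict_mono (r1 :: nat \<Rightarrow> nat)" and c1: "\<forall>e>0. \<exists>N. \<forall>n\<ge>N. \<forall>m\<ge>N. \<forall>\<phi>\<in>test_functions U.
      \<bar>T1 (s (r1 n)) \<phi> - T1 (s (r1 m)) \<phi>\<bar> \<le> e * test_norm \<phi>"
      using precompact_subseq[OF pc(1) U(1,2,5), of s] by (elim exE conjE) (rule that)
    obtain r2 where r2: "strict_mono (r2 :: nat \<Rightarrow> nat)" and c2: "\<forall>e>0. \<exists>N. \<forall>n\<ge>N. \<forall>m\<ge>N. \<forall>\<phi>\<in>test_functions U.
      \<bar>T2 (s (r1 (r2 n))) \<phi> - T2 (s (r1 (r2 m))) \<phi>\<bar> \<le> e * test_norm \<phi>"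
      using precompact_subseq[OF pc(2) U(1,2,5), of "\<lambda>n. s (r1 n)"] by (elim exE conjE) (rule that)
    define t where "t n = r1 (r2 n)" for n
    have t: "strict_mono t" using strict_mono_o[OF r1 r2] by (simp add: t_def[abs_def] comp_def)
    have "\<exists>r. strict_mono r \<and> (AE x in lborel. x \<in> K \<longrightarrow> convergent (\<lambda>n. v' (s (t (r n))) x))"
    proof (rule local_AE_subseq[where v="\<lambda>n. v' (s (t n))" and k=k' and l=l' and f=f and g=g and U=U,
          OF ab k'(1,2) l'(1,2) v'(1,2) f g assms(12) U(1,2) K(1) U(3) int[unfolded M_def]])
      fix e :: real assume e: "0 < e"
      obtain N where N: "\<And>n m \<phi>. n \<ge> N \<Longrightarrow> m \<ge> N \<Longrightarrow> \<phi> \<in> test_functions U \<Longrightarrow> \<bar>T1 (s (r1 n)) \<phi> - T1 (s (r1 m)) \<phi>\<bar> \<le> e * test_norm \<phi>"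
        using c1 e by blast
      have "\<exists>N. \<forall>n\<ge>N. \<forall>m\<ge>N. \<forall>\<phi>\<in>test_functions U.
        \<bar>distr_div U (Fn (s (t n))) (Hn (s (t n))) \<phi> - distr_div U (Fn (s (t m))) (Hn (s (t m))) \<phi>\<bar> \<le> e * test_norm \<phi>"
      proof (intro exI[of _ N] allI impI ballI)
        fix n m \<phi> assume "N \<le> n" "N \<le> m" and \<phi>: "\<phi> \<in> test_functions U"
        then have "N \<le> r2 n" "N \<le> r2 m" using seq_suble[OF r2] le_trans by blast+
        from N[OF this \<phi>]
        show "\<bar>distr_div U (Fn (s (t n))) (Hn (s (t n))) \<phi> - distr_div U (Fn (s (t m))) (Hn (s (t m))) \<phi>\<bar> \<le> e * test_norm \<phi>"
          unfolding T1[OF \<phi>] t_def .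
      qed
      then show "\<exists>N. \<forall>n\<ge>N. \<forall>m\<ge>N. \<forall>\<phi>\<in>test_functions U.
        \<bar>distr_div U (\<lambda>p. prim_sq a b f (k' p) (v' (s (t n)) p)) (\<lambda>p. prim_mix a b f g (k' p) (l' p) (v' (s (t n)) p)) \<phi>
        - distr_div U (\<lambda>p. prim_sq a b f (k' p) (v' (s (t m)) p)) (\<lambda>p. prim_mix a b f g (k' p) (l' p) (v' (s (t m)) p)) \<phi>\<bar> \<le> e * test_norm \<phi>"
        unfolding Fn_def[abs_def] Hn_def[abs_def] .
      obtain N where N: "\<And>n m \<phi>. n \<ge> N \<Longrightarrow> m \<ge> N \<Longrightarrow> \<phi> \<in> test_functions U \<Longrightarrow> \<bar>T2 (s (t n)) \<phi> - T2 (s (t m)) \<phi>\<bar> \<le> e * test_norm \<phi>"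
        using c2 e unfolding t_def by blast
      have "\<exists>N. \<forall>n\<ge>N. \<forall>m\<ge>N. \<forall>\<phi>\<in>test_functions U.
        \<bar>distr_div U (Hn (s (t n))) (Gn (s (t n))) \<phi> - distr_div U (Hn (s (t m))) (Gn (s (t m))) \<phi>\<bar> \<le> e * test_norm \<phi>"
      proof (intro exI[of _ N] allI impI ballI)
        fix n m \<phi> assume nm: "N \<le> n" "N \<le> m" and \<phi>: "\<phi> \<in> test_functions U"
        from N[OF nm \<phi>]
        show "\<bar>distr_div U (Hn (s (t n))) (Gn (s (t n))) \<phi> - distr_div U (Hn (s (t m))) (Gn (s (t m))) \<phi>\<bar> \<le> e * test_norm \<phi>"
          unfolding T2[OF \<phi>] .
      qed
      then show "\<exists>N. \<forall>n\<ge>N. \<forall>m\<ge>N. \<forall>\<phi>\<in>test_functions U.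
        \<bar>distr_div U (\<lambda>p. prim_mix a b f g (k' p) (l' p) (v' (s (t n)) p)) (\<lambda>p. prim_sq a b g (l' p) (v' (s (t n)) p)) \<phi>
        - distr_div U (\<lambda>p. prim_mix a b f g (k' p) (l' p) (v' (s (t m)) p)) (\<lambda>p. prim_sq a b g (l' p) (v' (s (t m)) p)) \<phi>\<bar> \<le> e * test_norm \<phi>"
        unfolding Gn_def[abs_def] Hn_def[abs_def] .
    qed
    then obtain r where r: "strict_mono (r :: nat \<Rightarrow> nat)" "AE x in lborel. x \<in> K \<longrightarrow> convergent (\<lambda>n. v' (s (t (r n))) x)" by blast
    show ?thesis
      by (intro exI[of _ "\<lambda>n. t (r n)"] conjI r(2)) (use strict_mono_o[OF t r(1)] in \<open>simp add: comp_def\<close>)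
  qed
  obtain \<D> where \<D>: "countable \<D>" "\<D> \<subseteq> Pow \<Omega>" "\<And>X. X \<in> \<D> \<Longrightarrow> \<exists>c d. X = cbox c d" "\<Union>\<D> = \<Omega>"
    by (rule open_countable_Union_open_cbox[OF \<Omega>]) (rule that)
  \<comment> \<open>the empty set is added because \<open>\<Omega>\<close> may be empty, and an enumeration needs an element\<close>
  define K where "K = from_nat_into (insert {} \<D>)"
  have rK: "range K = insert {} \<D>" unfolding K_def by (rule range_from_nat_into) (use \<D>(1) in auto)
  have K: "compact (K n)" "K n \<subseteq> \<Omega>" for n
  proof -
    have "K n \<in> insert {} \<D>" using rK by blast
    then show "compact (K n)" "K n \<subseteq> \<Omega>" using \<D>(2,3) by force+
  qed
  have "\<exists>r. strict_mono r \<and> (\<forall>n. AE x in lborel. x \<in> K n \<longrightarrow> convergent (\<lambda>i. v' (r i) x))"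
  proof (rule diagonal_subseq[where P="\<lambda>n r. AE x in lborel. x \<in> K n \<longrightarrow> convergent (\<lambda>i. v' (r i) x)"])
    show "\<exists>r. strict_mono r \<and> (AE x in lborel. x \<in> K n \<longrightarrow> convergent (\<lambda>i. v' ((s \<circ> r) i) x))" for n and s :: "nat \<Rightarrow> nat"
      unfolding comp_def by (rule compact_case[OF K])
    show "AE x in lborel. x \<in> K n \<longrightarrow> convergent (\<lambda>i. v' ((s \<circ> r) i) x)"
      if "strict_mono r" "AE x in lborel. x \<in> K n \<longrightarrow> convergent (\<lambda>i. v' (s i) x)" for n and r s :: "nat \<Rightarrow> nat"
      using that(2)
    proof eventually_elim
      case (elim x)
      then show ?case using convergent_subseq_convergent[OF _ that(1), of "\<lambda>i. v' (s i) x"] by (simp add: comp_def)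
    qed
    show "AE x in lborel. x \<in> K n \<longrightarrow> convergent (\<lambda>i. v' (s i) x)"
      if "AE x in lborel. x \<in> K n \<longrightarrow> convergent (\<lambda>i. v' ((s \<circ> (+) j) i) x)" for n j and s :: "nat \<Rightarrow> nat"
      using that
    proof eventually_elim
      case (elim x)
      then show ?case using convergent_ignore_initial_segment[of "\<lambda>i. v' (s i) x" j] by (simp add: comp_def add.commute)
    qed
  qed
  then obtain r where r: "strict_mono (r :: nat \<Rightarrow> nat)" and rc: "\<And>n. AE x in lborel. x \<in> K n \<longrightarrow> convergent (\<lambda>i. v' (r i) x)" by blast
  have conv: "AE x in lborel. x \<in> \<Omega> \<longrightarrow> convergent (\<lambda>i. v' (r i) x)"
  proof -
    have "AE x in lborel. \<forall>n. x \<in> K n \<longrightarrow> convergent (\<lambda>i. v' (r i) x)" using rc unfolding AE_all_countable by blast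
    then show ?thesis
    proof eventually_elim
      case (elim x)
      show ?case
      proof
        assume "x \<in> \<Omega>"
        then have "x \<in> \<Union>(range K)" using \<D>(4) rK by auto
        then show "convergent (\<lambda>i. v' (r i) x)" using elim by blast
      qed
    qed
  qed
  define w where "w x = lim (\<lambda>i. v' (r i) x)" for x
  have wm: "w \<in> borel_measurable lborel" unfolding w_def[abs_def] using v'(1) by measurable
  have lim: "AE x in lebesgue_on \<Omega>. (\<lambda>i. v (\<rho> (r i)) x) \<longlonglongrightarrow> w x \<and> a \<le> w x \<and> w x \<le> b"
  proof -
    have "AE x in lborel. \<forall>n. x \<in> \<Omega> \<longrightarrow> v' n x = v (\<rho> n) x" using v'(3) unfolding AE_all_countable by blast
    with conv have "AE x in lborel. x \<in> \<Omega> \<longrightarrow> (\<lambda>i. v (\<rho> (r i)) x) \<longlonglongrightarrow> w x \<and> a \<le> w x \<and> w x \<le> b"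
    proof eventually_elim
      case (elim x)
      show ?case
      proof
        assume x: "x \<in> \<Omega>"
        have l: "(\<lambda>i. v' (r i) x) \<longlonglongrightarrow> w x" using elim(1) x by (simp add: w_def convergent_LIMSEQ_iff)
        have "w x \<in> {a..b}"
          by (rule closed_sequentially[OF closed_atLeastAtMost _ l]) (rule v'(2))
        then show "(\<lambda>i. v (\<rho> (r i)) x) \<longlonglongrightarrow> w x \<and> a \<le> w x \<and> w x \<le> b" using l elim(2) x by simp
      qed
    qed
    then show ?thesis using \<Omega>l by (subst AE_restrict_space_iff) (auto intro: AE_completion)
  qed
  have "w \<in> Linfty (lebesgue_on \<Omega>)" unfolding Linfty_def
  proof (intro CollectI conjI exI)
    show "w \<in> borel_measurable (lebesgue_on \<Omega>)" by (intro measurable_restrict_space1 measurable_completion wm)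
    show "AE x in lebesgue_on \<Omega>. \<bar>w x\<bar> \<le> \<bar>a\<bar> + \<bar>b\<bar>" using lim by eventually_elim auto
  qed
  moreover have "AE p in lebesgue_on \<Omega>. (\<lambda>n. v (\<rho> (r n)) p) \<longlonglongrightarrow> w p" using lim by eventually_elim blast
  moreover have "AE p in lebesgue_on \<Omega>. a \<le> w p \<and> w p \<le> b" using lim by eventually_elim blast
  ultimately show ?thesis using r by blast
qed

end
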